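(* For each $\sigma\in[0,\infty)$ there exists a determinantal point process $Z_\sigma=\{(x_j,y_j)\}$ on $\mathbb{R}^2$ with correlation kernel $$M_{\sigma}(\zeta_1,\zeta_2)=-\frac{1}{4\pi^{5/2}}\int_{\gamma_1}\int_{\gamma_2}\frac{e^{-\frac{1}{2}(\sigma v-\eta_2)^2+\frac{i}{3}v^3+i\xi_2v-\frac{1}{2}(\sigma u+\eta_1)^2+\frac{i}{3}u^3+i\xi_1u}}{i(u+v)}\,du\,dv,$$ where $\zeta_j=(\xi_j,\eta_j)\in\mathbb{R}^2$ and $\gamma_j$ is the contour $\mathbb{R}\ni t\mapsto t+i\delta_j$, independently of the choice of $\delta_1,\delta_2>0$. For $\sigma>1$ define the rescaled point process $$\tilde Z_\sigma=\left\{\left(\frac{x_j-c_\sigma}{a_\sigma},\frac{y_j}{b_\sigma}\right)\right\},$$ where $$a_\sigma=\frac{\sigma}{\sqrt{6\log\sigma}},\qquad b_\sigma=\frac{\sigma^{3/2}}{(6\log\sigma)^{1/4}},\qquad c_\sigma=a_\sigma\left(3\log\sigma-\frac54\log(6\log\sigma)-\log(2\pi)\right).$$ Then: (1) $Z_0=Z_A$, and $\tilde Z_\sigma$ converges weakly in $\mathcal{N}(\mathbb{R}^2)$ to $Z_P$ as $\sigma\to\infty$. (2) For any fixed $\sigma\in[0,\infty)$, $Z_\sigma$ has a last particle almost surely, with distribution function $$F_\sigma(t)=\mathbb{P}\left[\left|Z_\sigma\cap\left((t,\infty)\times\mathbb{R}\right)\right|=0\right]=\det(I-M_\sigma)_{L^2((t,\infty)\times\mathbb{R})}=\sum_{r=0}^\infty\frac{(-1)^r}{r!}\int_{((t,\infty)\times\mathbb{R})^r}\det\left(M_\sigma(\zeta_j,\zeta_k)\right)_{j,k=1}^r\,d^r\xi\,d^r\eta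 .$$ (3) For every $t\in\mathbb{R}$, $F_\sigma(c_\sigma+a_\sigma t)\to F_G(t)$ as $\sigma\to\infty$.
   Context: Point processes. $\mathcal{N}(\mathbb{R}^2)$ is the set of boundedly finite simple counting measures on $\mathbb{R}^2$, identified with locally finite sets of distinct points, with the smallest $\sigma$-algebra making $\mu\mapsto\mu(A)$ measurable for all Borel sets $A$. A point process is a random element of $\mathcal{N}(\mathbb{R}^2)$. With respect to Lebesgue measure, $\rho_n$ is an $n$-point correlation function of a point process $X$ if $\mathbb{E}\big[\sum\varphi(x_{k_1},\dots,x_{k_n})\big]=\int\varphi\,\rho_n$ for every bounded measurable $\varphi$ on $(\mathbb{R}^2)^n$ (tests for which the expressions make sense, e.g. nonnegative or of bounded support), the sum being over all ordered $n$-tuples of distinct points of $X$. $X$ is determinantal with correlation kernel $K$ if for every $n\ge1$ it has $n$-point correlation function $\det(K(\zeta_i,\zeta_j))_{i,j=1}^n$. Weak convergence in $\mathcal{N}(\mathbb{R}^2)$ of point processes to $X$ is convergence of the finite dimensional distributions: for any bounded disjoint Borel sets $A_1,\dots,A_k$ and integers $m_i$, the probability that exactly $m_i$ points lie in $A_i$ for all $i$ converges to the corresponding probability for $X$. A determinantal point process $Z$ on $\mathbb{R}^2$ is said to have a last (rightmost) particle almost surely if there is $t\in\mathbb{R}$ with $\mathbb{E}[|Z\cap((t,\infty)\times\mathbb{R})|]<\infty$. Its last particle distribution function is then $F(t)=\mathbb{P}[|Z\cap((t,\infty)\times\mathbb{R})|=0]$. Limit objects. $F_G(x)=e^{-e^{-x}}$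 is the Gumbel distribution function. $Z_P$ is the Poisson process on $\mathbb{R}^2$ with intensity $\pi^{-1/2}e^{-\xi-\eta^2}$ at $(\xi,\eta)$. The Airy kernel is $K_A(\xi_1,\xi_2)=\frac{\mathrm{Ai}(\xi_1)\mathrm{Ai}'(\xi_2)-\mathrm{Ai}'(\xi_1)\mathrm{Ai}(\xi_2)}{\xi_1-\xi_2}$ for $\xi_1\ne\xi_2$, extended by continuity to $\xi_1=\xi_2$, where $\mathrm{Ai}$ is the Airy function. $Z_A$ is the determinantal point process on $\mathbb{R}^2$ with correlation kernel $M_A(\zeta_1,\zeta_2)=\pi^{-1/2}e^{-\frac12(\eta_1^2+\eta_2^2)}K_A(\xi_1,\xi_2)$, $\zeta_j=(\xi_j,\eta_j)$. $\det(I-M)_{L^2(\cdot)}$ denotes the Fredholm determinant of the integral operator with kernel $M$. *)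

theory Defs
  imports "HOL-Probability.Probability" "Jordan_Normal_Form.Determinant"
begin

(* HOL-Analysis and Jordan_Normal_Form both provide a determinant; the size-indexed one
   of Jordan_Normal_Form is used throughout. *)
hide_const (open) Determinants.det

type_synonym plane = "real \<times> real"
type_synonym kernel = "plane \<Rightarrow> plane \<Rightarrow> complex"

text \<open>A boundedly finite simple counting measure is identified with its support, a locally
  finite set. Counts are extended-valued because unbounded sets may contain infinitely many
  points.\<close>

definition configs :: "plane set set" where
  "configs = {S. \<forall>A. bounded A \<longrightarrow> finite (S \<inter> A)}"

definition npts :: "plane set \<Rightarrow> plane set \<Rightarrow> ennreal" where
  "npts A S = emeasure (count_space UNIV) (S \<inter> A)"

definition config_space :: "plane set measure" where
  "config_space =
     sigma configs {{S \<in> configs. npts A S \<in> B} | A B. A \<in> sets borel \<and> B \<in> sets borel}"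

definition point_process :: "'a measure \<Rightarrow> ('a \<Rightarrow> plane set) \<Rightarrow> bool" where
  "point_process P X \<longleftrightarrow> prob_space P \<and> X \<in> measurable P config_space"

definition distinct_tuples :: "nat \<Rightarrow> plane set \<Rightarrow> (nat \<Rightarrow> plane) set" where
  "distinct_tuples n S = {x \<in> {..<n} \<rightarrow>\<^sub>E S. inj_on x {..<n}}"

abbreviation lborel_pow :: "nat \<Rightarrow> (nat \<Rightarrow> plane) measure" where
  "lborel_pow n \<equiv> (\<Pi>\<^sub>M i\<in>{..<n}. lborel)"

text \<open>Tests are the bounded measurable functions of bounded support, for which the sum over
  tuples is finite; the identity for nonnegative tests follows by monotone convergence. The
  function \<open>\<rho>\<close> may be complex-valued because it will be a determinant of a complex Hermitian
  kernel.\<close>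

definition correlation_function ::
    "'a measure \<Rightarrow> ('a \<Rightarrow> plane set) \<Rightarrow> nat \<Rightarrow> ((nat \<Rightarrow> plane) \<Rightarrow> complex) \<Rightarrow> bool" where
  "correlation_function P X n \<rho> \<longleftrightarrow>
     \<rho> \<in> borel_measurable (lborel_pow n) \<and>
     (\<forall>\<phi> :: (nat \<Rightarrow> plane) \<Rightarrow> real.
        \<phi> \<in> borel_measurable (lborel_pow n) \<longrightarrow>
        (\<exists>B. \<forall>x \<in> space (lborel_pow n). \<bar>\<phi> x\<bar> \<le> B) \<longrightarrow>
        (\<exists>R. \<forall>x \<in> space (lborel_pow n). \<phi> x \<noteq> 0 \<longrightarrow> (\<forall>i<n. norm (x i) \<le> R)) \<longrightarrow>
          integrable P (\<lambda>\<omega>. \<Sum>\<^sub>\<infinity>x\<in>distinct_tuples n (X \<omega>). \<phi> x) \<and>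
          integrable (lborel_pow n) (\<lambda>x. of_real (\<phi> x) * \<rho> x) \<and>
          of_real (LINT \<omega>|P. (\<Sum>\<^sub>\<infinity>x\<in>distinct_tuples n (X \<omega>). \<phi> x)) =
            (LINT x|lborel_pow n. of_real (\<phi> x) * \<rho> x))"

definition kernel_det :: "kernel \<Rightarrow> nat \<Rightarrow> (nat \<Rightarrow> plane) \<Rightarrow> complex" where
  "kernel_det K n x = det (mat n n (\<lambda>(i, j). K (x i) (x j)))"

definition determinantal :: "'a measure \<Rightarrow> ('a \<Rightarrow> plane set) \<Rightarrow> kernel \<Rightarrow> bool" where
  "determinantal P X K \<longleftrightarrow>
     point_process P X \<and> (\<forall>n\<ge>1. correlation_function P X n (kernel_det K n))"

text \<open>Equality of point processes means equality of their laws on the configuration space.\<close>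

definition same_law ::
    "'a measure \<Rightarrow> ('a \<Rightarrow> plane set) \<Rightarrow> 'b measure \<Rightarrow> ('b \<Rightarrow> plane set) \<Rightarrow> bool" where
  "same_law P X Q Y \<longleftrightarrow> distr P config_space X = distr Q config_space Y"

definition counts_prob ::
    "'a measure \<Rightarrow> ('a \<Rightarrow> plane set) \<Rightarrow> nat \<Rightarrow> (nat \<Rightarrow> plane set) \<Rightarrow> (nat \<Rightarrow> nat) \<Rightarrow> real" where
  "counts_prob P X k A m = measure P {\<omega> \<in> space P. \<forall>i<k. npts (A i) (X \<omega>) = of_nat (m i)}"

definition bounded_disjoint_borel :: "nat \<Rightarrow> (nat \<Rightarrow> plane set) \<Rightarrow> bool" where
  "bounded_disjoint_borel k A \<longleftrightarrow>
     (\<forall>i<k. A i \<in> sets borel \<and> bounded (A i)) \<and> disjoint_family_on A {..<k}"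

definition converges_weakly ::
    "('i \<Rightarrow> 'a measure) \<Rightarrow> ('i \<Rightarrow> 'a \<Rightarrow> plane set) \<Rightarrow> 'i filter \<Rightarrow>
     'b measure \<Rightarrow> ('b \<Rightarrow> plane set) \<Rightarrow> bool" where
  "converges_weakly P X F Q Y \<longleftrightarrow>
     (\<forall>k A m. bounded_disjoint_borel k A \<longrightarrow>
        ((\<lambda>s. counts_prob (P s) (X s) k A m) \<longlongrightarrow> counts_prob Q Y k A m) F)"

text \<open>The Poisson process with intensity \<open>f\<close>: counts in disjoint bounded Borel sets are
  independent and Poisson distributed with the integral of \<open>f\<close> as parameter.\<close>

definition poisson_process ::
    "'a measure \<Rightarrow> ('a \<Rightarrow> plane set) \<Rightarrow> (plane \<Rightarrow> real) \<Rightarrow> bool" where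
  "poisson_process P X f \<longleftrightarrow>
     point_process P X \<and>
     (\<forall>k A m. bounded_disjoint_borel k A \<longrightarrow>
        counts_prob P X k A m =
          (\<Prod>i<k. exp (- (LINT z:A i|lborel. f z)) * (LINT z:A i|lborel. f z) ^ m i / fact (m i)))"

definition right_of :: "real \<Rightarrow> plane set" where
  "right_of t = {t<..} \<times> UNIV"

definition has_last_particle :: "'a measure \<Rightarrow> ('a \<Rightarrow> plane set) \<Rightarrow> bool" where
  "has_last_particle P X \<longleftrightarrow> (\<exists>t. (\<integral>\<^sup>+\<omega>. npts (right_of t) (X \<omega>) \<partial>P) < \<infinity>)"

definition last_particle_cdf :: "'a measure \<Rightarrow> ('a \<Rightarrow> plane set) \<Rightarrow> real \<Rightarrow> real" where
  "last_particle_cdf P X t = measure P {\<omega> \<in> space P. npts (right_of t) (X \<omega>) = 0}"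

definition fredholm_term :: "plane set \<Rightarrow> kernel \<Rightarrow> nat \<Rightarrow> complex" where
  "fredholm_term A K r =
     (-1) ^ r / fact r * (LINT z:({..<r} \<rightarrow>\<^sub>E A)|lborel_pow r. kernel_det K r z)"

text \<open>The Fredholm determinant of the integral operator on \<open>A\<close> with kernel \<open>K\<close>, defined
  (as Fredholm did) by its series.\<close>

definition fredholm_det :: "plane set \<Rightarrow> kernel \<Rightarrow> complex" where
  "fredholm_det A K = (\<Sum>r. fredholm_term A K r)"

definition M_integrand :: "real \<Rightarrow> plane \<Rightarrow> plane \<Rightarrow> complex \<Rightarrow> complex \<Rightarrow> complex" where
  "M_integrand \<sigma> = (\<lambda>(\<xi>\<^sub>1, \<eta>\<^sub>1) (\<xi>\<^sub>2, \<eta>\<^sub>2) u v.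
     exp (- (1/2) * (of_real \<sigma> * v - of_real \<eta>\<^sub>2)^2 + \<i>/3 * v^3 + \<i> * of_real \<xi>\<^sub>2 * v
          - (1/2) * (of_real \<sigma> * u + of_real \<eta>\<^sub>1)^2 + \<i>/3 * u^3 + \<i> * of_real \<xi>\<^sub>1 * u)
     / (\<i> * (u + v)))"

definition line :: "real \<Rightarrow> real \<Rightarrow> complex" where
  "line d t = of_real t + \<i> * of_real d"

text \<open>On each contour the parametrization has derivative 1. The outer integral (in \<open>v\<close>) runs
  over the line at height \<open>d\<^sub>1\<close>, the inner one (in \<open>u\<close>) over the line at height \<open>d\<^sub>2\<close>.\<close>

definition M_kernel :: "real \<Rightarrow> real \<Rightarrow> real \<Rightarrow> kernel" where
  "M_kernel d\<^sub>1 d\<^sub>2 \<sigma> \<zeta>\<^sub>1 \<zeta>\<^sub>2 =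
     - of_real (1 / (4 * pi powr (5/2))) *
       (LBINT s. LBINT t. M_integrand \<sigma> \<zeta>\<^sub>1 \<zeta>\<^sub>2 (line d\<^sub>2 t) (line d\<^sub>1 s))"

definition a_scale :: "real \<Rightarrow> real" where
  "a_scale \<sigma> = \<sigma> / sqrt (6 * ln \<sigma>)"

definition b_scale :: "real \<Rightarrow> real" where
  "b_scale \<sigma> = \<sigma> powr (3/2) / (6 * ln \<sigma>) powr (1/4)"

definition c_shift :: "real \<Rightarrow> real" where
  "c_shift \<sigma> = a_scale \<sigma> * (3 * ln \<sigma> - 5/4 * ln (6 * ln \<sigma>) - ln (2 * pi))"

definition rescale :: "real \<Rightarrow> plane set \<Rightarrow> plane set" where
  "rescale \<sigma> S = (\<lambda>(x, y). ((x - c_shift \<sigma>) / a_scale \<sigma>, y / b_scale \<sigma>)) ` S"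

definition gumbel_cdf :: "real \<Rightarrow> real" where
  "gumbel_cdf x = exp (- exp (- x))"

definition poisson_intensity :: "plane \<Rightarrow> real" where
  "poisson_intensity = (\<lambda>(\<xi>, \<eta>). pi powr (-1/2) * exp (- \<xi> - \<eta>^2))"

text \<open>The Airy function on the real line, as the usual improper (conditionally convergent)
  integral.\<close>

definition Airy :: "real \<Rightarrow> real" where
  "Airy x = 1 / pi * Lim at_top (\<lambda>T. integral {0..T} (\<lambda>t. cos (t^3 / 3 + x * t)))"

definition Airy_quotient :: "plane \<Rightarrow> real" where
  "Airy_quotient = (\<lambda>(x, y). (Airy x * deriv Airy y - deriv Airy x * Airy y) / (x - y))"

definition Airy_kernel :: "real \<Rightarrow> real \<Rightarrow> real" where
  "Airy_kernel x y =
     (if x \<noteq> y then Airy_quotient (x, y)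
      else Lim (at (x, y) within {p. fst p \<noteq> snd p}) Airy_quotient)"

definition M_Airy :: kernel where
  "M_Airy = (\<lambda>(\<xi>\<^sub>1, \<eta>\<^sub>1) (\<xi>\<^sub>2, \<eta>\<^sub>2).
     of_real (pi powr (-1/2) * exp (- (1/2) * (\<eta>\<^sub>1^2 + \<eta>\<^sub>2^2)) * Airy_kernel \<xi>\<^sub>1 \<xi>\<^sub>2))"

end

theory Submission
  imports Defs "HOL-Complex_Analysis.Complex_Analysis" "HOL-Real_Asymp.Real_Asymp"
begin

text \<open>Writing 1/(i(u+v)) as a half-line integral turns the double contour integral into a Gram kernel,
  the integral over l > 0 of A(x+l, -y) A(x'+l, y') for a one-dimensional contour integral A, which
  does not depend on the height of the contour. Plancherel shows that this kernel is a limit of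
  projections of finite rank, so its Janossy densities on bounded windows are nonnegative; they are
  consistent, and a Markov chain over growing windows glues them to a point process. Expectations
  of products over the points are Fredholm series, bounded by Hadamard's inequality; this gives
  uniqueness in law, the void probabilities and, by dominated convergence, both limit theorems,
  once the rescaled kernel is known to converge. With the contour at height c/s^2 the rescaled
  amplitudes converge; the diagonal gives the Poisson intensity, while off the diagonal a rapidly
  rotating phase kills the kernel. For s = 0 the kernel is the Airy kernel by Christoffel-Darboux.\<close>

text \<open>Positivity of the Janossy densities is the obstacle that shapes the construction: it
  does not follow from positive semidefiniteness of the kernel but expresses that the operator is at
  most the identity. For a projection of rank N it becomes visible. Exactly N points occur, so a
  term with fewer points can be completed by integrating out the missing ones, and the alternating
  series collapses to the integral of one nonnegative function. The algebra around it is a single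
  identity, the expansion of a Fredholm series with fixed points whose weight is a sum u + w. Weight
  -1 on a window gives its Janossy density; adding the weight of a shell gives consistency, adding
  the whole window gives back the correlation function.

  The height c/s^2 minimises s^2 d^2/2 - c d, the leading part of the exponent that bounds the
  amplitude at abscissa c on the contour at height d. The minimum -c^2/(2 s^2) is what the
  logarithms in \<open>c_shift\<close> balance against the powers in the scaling factors.\<close>

hide_const (open) Determinants.det

abbreviation (input) "bmeas == borel_measurable"
abbreviation (input) "ind == indicator"
abbreviation (input) "nni == nn_integral"
abbreviation (input) "hbi == has_bochner_integral"
abbreviation (input) "cor == complex_of_real"
abbreviation (input) "pint == poisson_intensity"
notation (input) tendsto (infixr "--->" 55)
abbreviation (input) limseq (infixr "---->" 55) where "X ----> L == X \<longlonglongrightarrow> L"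
lemmas hbi_iff = has_bochner_integral_iff
lemmas hbi_mult = has_bochner_integral_mult_right
lemmas integrable_le = Bochner_Integration.integrable_bound
lemmas integral_eq = Bochner_Integration.integral_cong

(* HOL-Algebra's inv is in scope as well and makes the usual notation for inverse functions ambiguous. *)
abbreviation (input) pinv :: "('a => 'a) => 'a => 'a" where
 "pinv p \<equiv> inv_into UNIV p"

section \<open>Kernel determinants as sums over permutations\<close>

lemma permutes_lessThan:
 fixes n :: nat assumes "p permutes {..<n}" "i < n" shows "p i < n" using permutes_in_image[OF assms(1), of i] assms(2) by simp

lemma det_leibniz:
 "kernel_det K n x = (\<Sum>p | p permutes {..<n}. of_int (sign p) * (PROD i<n. K (x i) (x (p i))))"
proof -
 have "kernel_det K n x = (\<Sum>p | p permutes {0..<n}. signof p * (PROD i=0..<n. mat n n (%(i, j). K (x i) (x j)) $$ (i, p i)))"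
  unfolding kernel_det_def by (subst det_def') auto
 also have "... = (\<Sum>p | p permutes {..<n}. of_int (sign p) * (PROD i<n. K (x i) (x (p i))))" unfolding atLeast0LessThan
  by (intro sum.cong refl arg_cong2[where f="(*)"] prod.cong) (auto simp: permutes_lessThan sign_def)
 finally show ?thesis .
qed

lemma kernel_det_cong: assumes "!!i. i < n ==> x i = y i" shows "kernel_det K n x = kernel_det K n y"
 unfolding kernel_det_def using assms by (intro arg_cong[where f=det] eq_matI) auto

lemma kernel_det_0 [simp]: "kernel_det K 0 x = 1" by (simp add: det_leibniz)

text \<open>Relabelling rows and columns simultaneously conjugates the permutation in the Leibniz
  sum, and conjugation preserves the sign.\<close>

lemma kernel_det_permute: assumes q: "q permutes {..<n}" shows "kernel_det K n (x \<circ> q) = kernel_det K n x"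
proof -
 let ?B = "%p. pinv q \<circ> p \<circ> q"
 let ?A = "%p. pinv q \<circ> p \<circ> q"
 let ?S = "{p. p permutes {..<n}}"
 have bij: "bij_betw ?B ?S ?S"
 proof (rule bij_betw_byWitness[where f' = "%p. q \<circ> p \<circ> pinv q"])
  have qq: "q \<circ> pinv q = id" "pinv q \<circ> q = id" using q by (simp_all add: permutes_inv_o)
  show "ALL p:?S. q \<circ> (?A p) \<circ> pinv q = p" "ALL p:?S. pinv q \<circ> (q \<circ> p \<circ> pinv q) \<circ> q = p"
   using qq by (metis comp_assoc comp_id id_comp)+
  show "?B ` ?S \<subseteq> ?S" "(%p. q \<circ> p \<circ> pinv q) ` ?S \<subseteq> ?S" using q by (auto intro!: permutes_compose permutes_inv)
 qed
 have "kernel_det K n x = (SUM p:?S. of_int (sign p) * (PROD i<n. K (x i) (x (p i))))" by (rule det_leibniz)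
 also have "... = (SUM p:?S. of_int (sign p) * (PROD i<n. K (x (q i)) (x (p (q i)))))"
  using q by (intro sum.cong refl arg_cong2[where f="(*)"]) (rule prod.permute[OF q, unfolded comp_def])
 also have "... = (SUM p:?S. of_int (sign (?A p)) * (PROD i<n. K (x (q i)) (x (q ((?A p) i)))))"
 proof (intro sum.cong refl arg_cong2[where f="(*)"] prod.cong)
  fix p assume p: "p : ?S"
  have "permutation p" "permutation q" "permutation (pinv q)" using p q by (auto simp: permutation_permutes intro: permutes_inv)
  then show "of_int (sign p) = (of_int (sign (?A p)) :: complex)"
   by (simp add: sign_compose permutation_compose sign_inverse sign_idempotent mult.assoc mult.left_commute)
  show "K (x (q i)) (x (p (q i))) = K (x (q i)) (x (q ((?A p) i)))" for i using q by (simp add: permutes_inverses)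
 qed
 also have "... = (SUM p:?S. of_int (sign p) * (PROD i<n. K (x (q i)) (x (q (p i)))))" by (rule sum.reindex_bij_betw[OF bij])
 also have "... = kernel_det K n (x \<circ> q)" by (simp add: det_leibniz)
 finally show ?thesis by simp
qed

lemma measurable_kernel_det: assumes K: "(%(a, b). K a b) : bmeas (borel \<Otimes>\<^sub>M borel)"
  and X: "!!i. i < n ==> (%w. X w i) : M \<rightarrow>\<^sub>M borel"
 shows "(%w. kernel_det K n (X w)) : bmeas M"
proof -
 have *: "(%w. K (X w i) (X w j)) : bmeas M" if "i < n" "j < n" for i j
  using measurable_compose[OF measurable_Pair[OF X[OF that(1)] X[OF that(2)]] K] by simp
 show ?thesis unfolding det_leibniz by (intro borel_measurable_sum borel_measurable_times borel_measurable_const borel_measurable_prod *)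
   (auto simp: permutes_lessThan)
qed

text \<open>Leibniz expansion, sorted by what the permutation does to the last index: it is fixed, or it
  is spliced into a permutation of the other indices just before \<open>b\<close>.\<close>

lemma kernel_det_Suc:
 "kernel_det K (Suc n) x = K (x n) (x n) * kernel_det K n x - (SUM b<n. \<Sum>q | q permutes {..<n}. of_int (sign q) *
    (PROD i:{..<n} - {pinv q b}. K (x i) (x (q i))) * (K (x (pinv q b)) (x n) * K (x n) (x b)))"
proof -
 let ?B = "%b q. Transposition.transpose n b \<circ> q"
 let ?A = "%q b. PROD i:{..<n} - {pinv q b}. K (x i) (x (q i))"
 let ?S = "{p. p permutes {..<n}}"
 let ?f = "%p. of_int (sign p) * (PROD i<Suc n. K (x i) (x (p i))) :: complex"
 have "kernel_det K (Suc n) x = sum ?f {p. p permutes insert n {..<n}}" by (simp add: det_leibniz lessThan_Suc)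
 also have "... = (SUM b:insert n {..<n}. SUM q:?S. ?f (?B b q))" by (rule sum_over_permutations_insert) auto
 also have "... = (SUM q:?S. ?f q) + (SUM b<n. SUM q:?S. ?f (?B b q))" by simp
 also have "(SUM q:?S. ?f q) = K (x n) (x n) * kernel_det K n x" unfolding det_leibniz sum_distrib_left
  by (intro sum.cong refl) (auto simp: permutes_not_in algebra_simps)
 also have "(SUM b<n. SUM q:?S. ?f (?B b q)) = (SUM b<n. SUM q:?S. - (of_int (sign q) *
    (?A q b) * (K (x (pinv q b)) (x n) * K (x n) (x b))))"
 proof (intro sum.cong refl)
  fix b q assume b: "b : {..<n}" and q: "q : ?S"
  let ?t = "Transposition.transpose n b \<circ> q"
  have qn: "q n = n" using q by (auto simp: permutes_not_in)
  have iq: "q (pinv q b) = b" using q by (simp add: permutes_inverses)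
  have c: "pinv q b : {..<n}" using q b permutes_inv[of q "{..<n}"] permutes_in_image by fastforce
  have "permutation q" using q by (auto simp: permutation_permutes)
  then have s: "sign ?t = - sign q" using b by (subst sign_compose) (auto simp: permutation_swap_id sign_swap_id)
  have "(PROD i<Suc n. K (x i) (x (?t i))) = (PROD i<n. K (x i) (x (?t i))) * K (x n) (x b)" using qn by simp
  also have "(PROD i<n. K (x i) (x (?t i))) = K (x (pinv q b)) (x (?t (pinv q b))) * (PROD i:{..<n} - {pinv q b}. K (x i) (x (?t i)))"
   using c by (subst prod.remove[of _ "pinv q b"]) auto
  also have "(PROD i:{..<n} - {pinv q b}. K (x i) (x (?t i))) = (?A q b)"
  proof (intro prod.cong refl)
   fix i assume i: "i : {..<n} - {pinv q b}"
   then have "q i ~= b" using q by (metis DiffD2 mem_Collect_eq permutes_inverses(2) singletonI)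
   moreover have "q i ~= n" using i q qn by (metis DiffD1 lessThan_iff less_irrefl mem_Collect_eq permutes_inverses(2))
   ultimately show "K (x i) (x (?t i)) = K (x i) (x (q i))" by simp
  qed
  finally show "?f ?t = - (of_int (sign q) * (?A q b) * (K (x (pinv q b)) (x n) * K (x n) (x b)))" unfolding s by (simp add: iq algebra_simps)
 qed
 finally show ?thesis by (simp add: sum_negf)
qed

text \<open>Dyson's integration rule for a reproducing kernel of trace N. If the last index is
  fixed, integrating it yields the trace; if it is spliced in before one of the n other indices, the
  reproducing property removes it again and each of the n places contributes the smaller determinant
  with a minus sign.\<close>

lemma integral_kernel_det_Suc: assumes rep: "!!a b. hbi M (%z. K a z * K z b) (K a b)"
  and tr: "hbi M (%z. K z z) N"
 shows "hbi M (%z. kernel_det K (Suc n) (x(n := z))) ((N - of_nat n) * kernel_det K n x)"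
proof -
 let ?A = "%q b. PROD i:{..<n} - {pinv q b}. K (x i) (x (q i))"
 let ?S = "{p. p permutes {..<n}}"
 have 1: "kernel_det K (Suc n) (x(n := z)) = K z z * kernel_det K n x - (SUM b<n. SUM q:?S. of_int (sign q) *
    (?A q b) * (K (x (pinv q b)) z * K z (x b)))" for z
 proof -
  have inv: "pinv q b ~= n" if "q permutes {..<n}" "b < n" for q b using permutes_lessThan[OF permutes_inv[OF that(1)] that(2)] by simp
  have im: "q i ~= n" if "q permutes {..<n}" "i < n" for q i using permutes_lessThan[OF that] by simp
  have cong: "kernel_det K n (x(n := z)) = kernel_det K n x" by (rule kernel_det_cong) auto
  show ?thesis unfolding kernel_det_Suc cong by (intro arg_cong2[where f=minus] sum.cong refl arg_cong2[where f="(*)"] prod.cong) (use inv im in auto)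
 qed
 have "hbi M (%z. K z z * kernel_det K n x - (SUM b<n. SUM q:?S. of_int (sign q) *
    (?A q b) * (K (x (pinv q b)) z * K z (x b)))) (N * kernel_det K n x - (SUM b<n. SUM q:?S. of_int (sign q) *
    (?A q b) * K (x (pinv q b)) (x b)))" by (intro has_bochner_integral_diff has_bochner_integral_sum has_bochner_integral_mult_left
    hbi_mult rep tr)
 \<comment> \<open>Since q sends \<open>pinv q b\<close> to b, the factor left by the integration is
   exactly the one missing from the product. The summand therefore no longer depends on b.\<close>
 also have "(SUM b<n. SUM q:?S. of_int (sign q) * (?A q b) * K (x (pinv q b)) (x b)) =
   (SUM b<n. SUM q:?S. of_int (sign q) * (PROD i<n. K (x i) (x (q i))))"
 proof (intro sum.cong refl)
  fix b q assume b: "b : {..<n}" and q: "q : ?S"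
  have iq: "q (pinv q b) = b" using q by (simp add: permutes_inverses)
  have c: "pinv q b : {..<n}" using q b permutes_inv[of q "{..<n}"] permutes_in_image by fastforce
  show "of_int (sign q) * (?A q b) * K (x (pinv q b)) (x b) = of_int (sign q) * (PROD i<n. K (x i) (x (q i)))"
   using c iq by (subst (2) prod.remove[of _ "pinv q b"]) auto
 qed
 also have "... = of_nat n * kernel_det K n x" by (simp add: det_leibniz)
 finally show ?thesis unfolding 1 by (simp add: algebra_simps)
qed

section \<open>Positive semidefinite kernels and Hadamard's inequality\<close>

definition psd_kernel :: "kernel => bool" where
 "psd_kernel K \<longleftrightarrow> (ALL a b. K b a = cnj (K a b)) &
  (ALL (n::nat) x c. 0 <= Re (SUM i<n. SUM j<n. cnj (c i) * c j * K (x i) (x j)))"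

lemma psd_kernelD: assumes "psd_kernel K" shows "K b a = cnj (K a b)" "0 <= Re (SUM i<(n::nat). SUM j<n. cnj (c i) * c j * K (x i) (x j))"
 using assms unfolding psd_kernel_def by blast+

lemma psd_diag: assumes "psd_kernel K" shows "Im (K a a) = 0" "0 <= Re (K a a)"
proof -
 have "K a a = cnj (K a a)" by (rule psd_kernelD[OF assms])
 then show "Im (K a a) = 0" by (metis cnj.simps(2) equal_neg_zero)
 show "0 <= Re (K a a)" using psd_kernelD(2)[OF assms, where n = 1 and c = "%_. 1" and x = "%_. a"] by simp
qed

text \<open>Otherwise the quadratic form on the two points a and b would be affine and nonconstant
  in the weight given to a, and so take negative values.\<close>

lemma psd_kernel_0: assumes K: "psd_kernel K" and 0: "K a a = 0" shows "K a b = 0"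
proof (rule ccontr)
 assume nz: "K a b ~= 0"
 \<comment> \<open>With coefficients \<open>- r * K a b\<close> at a and 1 at b the form is
   \<open>K b b\<close> minus 2 r times the squared modulus of \<open>K a b\<close>; this r makes it
   equal to -1.\<close>
 define r where "r = (Re (K b b) + 1) / (2 * (cmod (K a b))^2)"
 define c where "c = (%i::nat. if i = 0 then - of_real r * K a b else 1)"
 define x where "x = (%i::nat. if i = 0 then a else b)"
 have ba: "K b a = cnj (K a b)" by (rule psd_kernelD[OF K])
 have "(SUM i<(2::nat). SUM j<2. cnj (c i) * c j * K (x i) (x j)) = K b b - 2 * of_real r * (K a b * cnj (K a b))"
  by (simp add: numeral_2_eq_2 c_def x_def 0 ba algebra_simps)
 also have "Re ... = Re (K b b) - 2 * r * (cmod (K a b))^2" by (simp add: complex_mult_cnj cmod_power2)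
 also have "... = -1" using nz by (simp add: r_def field_simps)
 finally show False using psd_kernelD(2)[OF K, of c x 2] by simp
qed

definition schur :: "plane => kernel => kernel" where
 "schur z K a b = K a b - K a z * K z b / K z z"

text \<open>The form of the Schur complement is the minimum of the form of K over the coefficient
  attached to the additional point z. The minimiser is \<open>- s / K z z\<close>, which is the last
  entry of the extended vector \<open>c'\<close>.\<close>

lemma psd_schur: assumes K: "psd_kernel K" and nz: "K z z ~= 0" shows "psd_kernel (schur z K)" unfolding psd_kernel_def
proof (intro conjI allI)
 have her: "K b a = cnj (K a b)" for a b by (rule psd_kernelD[OF K])
 have zz: "cnj (K z z) = K z z" using her by metis
 show "schur z K b a = cnj (schur z K a b)" for a b by (simp add: schur_def her[symmetric] mult.commute)
 fix n :: nat and x :: "nat => plane" and c :: "nat => complex"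
 define s where "s = (SUM j<n. c j * K z (x j))"
 have cs: "cnj s = (SUM i<n. cnj (c i) * K (x i) z)" unfolding s_def by (simp add: her[symmetric])
 define c' where "c' = (%i. if i < n then c i else - s / K z z)"
 define x' where "x' = (%i. if i < n then x i else z)"
 have c'n: "c' n = - s / K z z" and x'n: "x' n = z" by (auto simp: c'_def x'_def)
 have e1: "(SUM i<n. SUM j<n. cnj (c' i) * c' j * K (x' i) (x' j)) = (SUM i<n. SUM j<n. cnj (c i) * c j * K (x i) (x j))"
  by (intro sum.cong refl) (auto simp: c'_def x'_def)
 have e2: "(SUM j<n. cnj (c' n) * c' j * K (x' n) (x' j)) = cnj (c' n) * s"
  unfolding s_def sum_distrib_left by (intro sum.cong refl) (auto simp: c'_def x'_def)
 have e3: "(SUM i<n. cnj (c' i) * c' n * K (x' i) (x' n)) = c' n * cnj s"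
  unfolding cs sum_distrib_left by (intro sum.cong refl) (auto simp: c'_def x'_def)
 have "(SUM i<Suc n. SUM j<Suc n. cnj (c' i) * c' j * K (x' i) (x' j)) =
  (SUM i<n. SUM j<n. cnj (c i) * c j * K (x i) (x j)) + c' n * cnj s + cnj (c' n) * s + cnj (c' n) * c' n * K z z"
  unfolding sum.lessThan_Suc sum.distrib e1 e2 e3 by (simp add: x'n)
 also have "... = (SUM i<n. SUM j<n. cnj (c i) * c j * K (x i) (x j)) - cnj s * s / K z z"
  unfolding c'n using nz by (simp add: zz field_simps)
 also have "... = (SUM i<n. SUM j<n. cnj (c i) * c j * schur z K (x i) (x j))"
 proof -
  have "cnj s * s / K z z = (SUM i<n. SUM j<n. cnj (c i) * c j * (K (x i) z * K z (x j) / K z z))"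
   unfolding cs unfolding s_def sum_product sum_divide_distrib by (intro sum.cong refl) (simp add: field_simps)
  then show ?thesis by (simp add: schur_def sum_subtractf[symmetric] right_diff_distrib)
 qed
 finally show "0 <= Re (SUM i<n. SUM j<n. cnj (c i) * c j * schur z K (x i) (x j))" using psd_kernelD(2)[OF K, of c' x' "Suc n"] by simp
qed

text \<open>The matrix factors into a unit upper triangular block matrix and a lower triangular one
  whose diagonal blocks are the Schur complement and the single entry at the last point.\<close>

lemma kernel_det_schur: assumes nz: "K (x n) (x n) ~= 0" shows "kernel_det K (Suc n) x = K (x n) (x n) * kernel_det (schur (x n) K) n x"
proof -
 define z where "z = x n"
 define M where "M = mat n n (%(i, j). schur z K (x i) (x j))"
 define u where "u = mat n 1 (%(i, j::nat). K (x i) z / K z z)"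
 define w where "w = mat 1 n (%(i::nat, j). K z (x j))"
 define k where "k = mat 1 1 (%(i::nat, j::nat). K z z)"
 let ?U = "four_block_mat (1\<^sub>m n) u (0\<^sub>m 1 n) (1\<^sub>m 1)"
 let ?L = "four_block_mat M (0\<^sub>m n 1) w k"
 have c: "M : carrier_mat n n" "u : carrier_mat n 1" "w : carrier_mat 1 n" "k : carrier_mat 1 1"
  by (auto simp: M_def u_def w_def k_def)
 have "?U * ?L = four_block_mat (1\<^sub>m n * M + u * w) (1\<^sub>m n * 0\<^sub>m n 1 + u * k)
  (0\<^sub>m 1 n * M + 1\<^sub>m 1 * w) (0\<^sub>m 1 n * 0\<^sub>m n 1 + 1\<^sub>m 1 * k)"
  using c by (intro mult_four_block_mat[of _ n n _ 1 _ 1 _ _ n _ 1]) auto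
 also have "... = mat (Suc n) (Suc n) (%(i, j). K (x i) (x j))" using nz by (intro eq_matI)
   (auto simp: M_def u_def w_def k_def schur_def scalar_prod_def z_def less_Suc_eq not_less)
 finally have "kernel_det K (Suc n) x = det (?U * ?L)" by (simp add: kernel_det_def)
 also have "... = det ?U * det ?L" using c by (intro det_mult[of _ "n + 1"]) auto
 also have "det ?U = 1" using c by (subst det_four_block_mat_lower_left_zero[of _ n _ 1]) auto
 also have "det ?L = det M * det k" using c by (subst det_four_block_mat_upper_right_zero[of _ n _ 1]) auto
 also have "det k = K z z" by (subst det_single) (auto simp: k_def)
 also have "det M = kernel_det (schur z K) n x" by (simp add: M_def kernel_det_def)
 finally show ?thesis by (simp add: z_def)
qed

text \<open>Splitting off the last point leaves the determinant of the Schur complement, which is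
  again positive semidefinite and has a smaller diagonal, so induction applies. If the diagonal
  entry at that point vanishes, its whole row does and the determinant is 0.\<close>

lemma psd_kernel_det_bounds: assumes "psd_kernel K" shows "Im (kernel_det K n x) = 0 & 0 <= Re (kernel_det K n x) &
  Re (kernel_det K n x) <= (PROD i<n. Re (K (x i) (x i)))" using assms
proof (induction n arbitrary: K)
 case 0
 then show ?case by simp
next
 case (Suc n)
 define z where "z = x n"
 have d: "Im (K a a) = 0" "0 <= Re (K a a)" for a using psd_diag[OF Suc.prems] by auto
 show ?case
 proof (cases "K z z = 0")
  case True
  have "kernel_det K (Suc n) x = 0" unfolding det_leibniz z_def[symmetric]
   using psd_kernel_0[OF Suc.prems True] z_def by (intro sum.neutral ballI) auto
  then show ?thesis using d by (simp add: prod_nonneg)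
 next
  case False
  have S: "psd_kernel (schur z K)" by (rule psd_schur[OF Suc.prems False])
  note IH = Suc.IH[OF S]
  have e: "kernel_det K (Suc n) x = of_real (Re (K z z)) * kernel_det (schur z K) n x"
   using kernel_det_schur[of K x n] False d[of z] by (simp add: z_def complex_eq_iff)
  have "Re (schur z K a a) <= Re (K a a)" for a
  proof -
   have "K a z * K z a = of_real ((cmod (K a z))^2)" using psd_kernelD(1)[OF Suc.prems, of z a] by (metis complex_norm_square)
   moreover have "K z z = of_real (Re (K z z))" using d[of z] by (simp add: complex_eq_iff)
   ultimately have "Re (schur z K a a) = Re (K a a) - (cmod (K a z))^2 / Re (K z z)"
    unfolding schur_def by (metis Re_complex_of_real minus_complex.sel(1) of_real_divide)
   then show ?thesis using d(2)[of z] by simp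
  qed
  then have "(PROD i<n. Re (schur z K (x i) (x i))) <= (PROD i<n. Re (K (x i) (x i)))"
   using psd_diag[OF S] by (intro prod_mono) auto
  with IH have "Re (kernel_det (schur z K) n x) <= (PROD i<n. Re (K (x i) (x i)))" by linarith
  then show ?thesis using IH d(2)[of z] unfolding e by (auto simp: z_def[symmetric] mult.commute[of _ "Re (K z z)"] intro!: mult_left_mono)
 qed
qed

definition rho :: "kernel => nat => (nat => plane) => real" where
 "rho K n x = Re (kernel_det K n x)"

lemma psd_rho: assumes "psd_kernel K" shows "kernel_det K n x = of_real (rho K n x)" "0 <= rho K n x"
  "rho K n x <= (PROD i<n. Re (K (x i) (x i)))" using psd_kernel_det_bounds[OF assms, of n x] by (auto simp: rho_def complex_eq_iff)

section \<open>Sums over tuples of distinct points\<close>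

text \<open>Every subset of size n is the range of n! injective tuples, on all of which the product
  takes the same value.\<close>

lemma sum_distinct_tuples:
 fixes g :: "plane => complex" assumes S: "finite S"
 shows "(SUM x:distinct_tuples n S. PROD i<n. g (x i)) = fact n * (\<Sum>T | T \<subseteq> S & card T = n. PROD t:T. g t)"
proof -
 let ?A = "%x T. \<Sum>x | x : distinct_tuples n S & x ` {..<n} = T. PROD i<n. g (x i)"
 let ?Ts = "{T. T \<subseteq> S & card T = n}"
 have fin: "finite (distinct_tuples n S)"
  unfolding distinct_tuples_def using S by (intro finite_subset[OF _ finite_PiE[of "{..<n}" "%_. S"]]) auto
 have "(SUM x:distinct_tuples n S. PROD i<n. g (x i)) =
  (SUM T:?Ts. \<Sum>x | x : distinct_tuples n S & x ` {..<n} = T. PROD i<n. g (x i))"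
 proof (rule sum.group[symmetric])
  show "(%x. x ` {..<n}) ` distinct_tuples n S \<subseteq> ?Ts" by (auto simp: distinct_tuples_def card_image PiE_iff)
 qed (use S fin in auto)
 also have "... = (SUM T:?Ts. fact n * (PROD t:T. g t))"
 proof (intro sum.cong refl)
  fix T assume T: "T : ?Ts"
  then have fT: "finite T" and cT: "card T = n" using S finite_subset by auto
  have "{x. x : distinct_tuples n S & x ` {..<n} = T} = {x : {..<n} \<rightarrow>\<^sub>E T. inj_on x {..<n}}"
  proof (rule subset_antisym; rule subsetI)
   fix x assume x: "x : {x : {..<n} \<rightarrow>\<^sub>E T. inj_on x {..<n}}"
   then have im: "x ` {..<n} \<subseteq> T" by (auto simp: PiE_iff)
   moreover have "card (x ` {..<n}) = n" using x by (simp add: card_image)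
   ultimately have "x ` {..<n} = T" using fT cT by (intro card_subset_eq) simp_all
   moreover have "ALL i:{..<n}. x i : S" using im T by blast
   then have "x : distinct_tuples n S" using x by (simp add: distinct_tuples_def PiE_iff)
   ultimately show "x : {x. x : distinct_tuples n S & x ` {..<n} = T}" by simp
  next
   fix x assume x: "x : {x. x : distinct_tuples n S & x ` {..<n} = T}"
   then have "ALL i:{..<n}. x i : T" by blast
   with x show "x : {x : {..<n} \<rightarrow>\<^sub>E T. inj_on x {..<n}}" by (simp add: distinct_tuples_def PiE_iff)
  qed
  moreover have "card {x : {..<n} \<rightarrow>\<^sub>E T. inj_on x {..<n}} = fact n"
   using card_inj_on_subset_funcset[of "{..<n}" T "{..<n}"] fT cT by (simp add: fact_prod_rev)
  moreover have "(PROD i<n. g (x i)) = (PROD t:T. g t)" if "x : distinct_tuples n S" "x ` {..<n} = T" for x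
   using prod.reindex[of x "{..<n}" g] that by (simp add: distinct_tuples_def)
  then have "(?A x T) = (\<Sum>x | x : distinct_tuples n S & x ` {..<n} = T. PROD t:T. g t)" by (intro sum.cong) auto
  ultimately show "(?A x T) = fact n * (PROD t:T. g t)" by simp
 qed
 finally show ?thesis by (simp add: sum_distrib_left)
qed

lemma finite_distinct_tuples: "finite S ==> finite (distinct_tuples n S)"
 unfolding distinct_tuples_def by (intro finite_subset[OF _ finite_PiE[of "{..<n}" "%_. S"]]) auto

lemma distinct_tuples_eq_empty: assumes "finite S" "card S < n" shows "distinct_tuples n S = {}"
proof -
 have False if "x : {..<n} \<rightarrow>\<^sub>E S" "inj_on x {..<n}" for x using card_inj[of x "{..<n}" S] that assms by (auto simp: PiE_iff)
 then show ?thesis by (auto simp: distinct_tuples_def)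
qed

text \<open>The pathwise origin of all Fredholm series below: taking expectations turns the n-th
  term into an integral against the n-point correlation function. For a fixed configuration the
  series is finite, as tuples longer than the number of points do not exist.\<close>

lemma prod_one_plus_sums:
 fixes g :: "plane => complex" assumes S: "finite S"
 shows "(%n. (SUM x:distinct_tuples n S. PROD i<n. g (x i)) / fact n) sums (PROD x:S. 1 + g x)"
proof -
 have "(PROD x:S. 1 + g x) = (PROD x:S. g x + 1)" by (simp add: add.commute)
 also have "... = (SUM T:Pow S. PROD t:T. g t)" using prod_add[OF S, of g "%_. 1"] by simp
 also have "... = (SUM n<=card S. \<Sum>T | T : Pow S & card T = n. PROD t:T. g t)"
  using S by (intro sum.group[symmetric]) (auto simp: card_mono)
 also have "... = (SUM n<=card S. (SUM x:distinct_tuples n S. PROD i<n. g (x i)) / fact n)"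
  by (intro sum.cong refl) (simp add: sum_distinct_tuples[OF S])
 also have "(%n. (SUM x:distinct_tuples n S. PROD i<n. g (x i)) / fact n) sums ..."
  by (rule sums_finite) (simp_all add: distinct_tuples_eq_empty[OF S])
 finally show ?thesis .
qed

lemma space_config_space: "space config_space = configs" unfolding config_space_def by (rule space_measure_of) auto

lemma infsum_distinct_tuples: assumes "finite (S Int A)" and "!!x i. i < n ==> x i ~: A ==> f x = 0"
 shows "(\<Sum>\<^sub>\<infinity>x\<in>distinct_tuples n S. f x) = (SUM x:distinct_tuples n (S Int A). f x :: real)"
proof -
 have "(\<Sum>\<^sub>\<infinity>x\<in>distinct_tuples n S. f x) = (\<Sum>\<^sub>\<infinity>x\<in>distinct_tuples n (S Int A). f x)"
  using assms(2) by (intro infsum_cong_neutral) (auto simp: distinct_tuples_def PiE_iff)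
 then show ?thesis using finite_distinct_tuples[OF assms(1)] by simp
qed

section \<open>Expectations of products over the points\<close>

text \<open>By Hadamard's inequality the integrand is dominated by a product of functions of single
  points. The n-th term of a Fredholm series is then at most the n-th power of one number, against
  which n! wins.\<close>

lemma integral_prod_kernel_det:
 fixes g :: "plane => complex" assumes psd: "psd_kernel K" and m: "kernel_det K n : bmeas (lborel_pow n)"
  and g[measurable]: "g : bmeas borel" and int: "integrable lborel (%z. norm (g z) * Re (K z z))"
 shows "integrable (lborel_pow n) (%x. (PROD i<n. g (x i)) * kernel_det K n x)"
  "norm (LINT x|lborel_pow n. (PROD i<n. g (x i)) * kernel_det K n x) <= (LINT z|lborel. norm (g z) * Re (K z z)) ^ n"
proof -
 let ?C = "%x. (PROD i<n. g (x i)) * kernel_det K n x"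
 let ?B = "LINT x|lborel_pow n. (PROD i<n. g (x i)) * kernel_det K n x"
 let ?A = "%x. PROD i<n. norm (g (x i)) * Re (K (x i) (x i))"
 interpret product_sigma_finite "%_::nat. lborel :: plane measure" ..
 have b: "norm ((PROD i<n. g (x i)) * kernel_det K n x) <= (?A x)" for x using psd_rho[OF psd, of n x]
  by (simp add: norm_mult prod.distrib prod_norm mult_left_mono prod_nonneg)
 have i: "integrable (lborel_pow n) (%x. PROD i<n. norm (g (x i)) * Re (K (x i) (x i)))" using int by (intro product_integrable_prod) auto
 note [measurable] = m
 show 1: "integrable (lborel_pow n) ?C"
 proof (rule integrable_le[OF i])
  show "?C : bmeas (lborel_pow n)" by measurable
  show "AE x in lborel_pow n. norm ((PROD i<n. g (x i)) * kernel_det K n x) <= norm (?A x)"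
   using b psd_diag(2)[OF psd] by (auto simp: prod_nonneg)
 qed
 have "norm ?B <= (LINT x|lborel_pow n. (?A x))" using 1 i b by (intro order_trans[OF integral_norm_bound] Bochner_Integration.integral_mono) auto
 also have "... = (PROD i<n. LINT z|lborel. norm (g z) * Re (K z z))" using int by (intro product_integral_prod) auto
 finally show "norm ?B <= (LINT z|lborel. norm (g z) * Re (K z z)) ^ n" by simp
qed

text \<open>Correlation functions are defined through real tests, so the complex product is treated
  by its real and imaginary parts. In \<open>main\<close> the map F is \<open>Re\<close> or
  \<open>Im\<close>; the bound by the modulus is what carries boundedness and support over to the
  test.\<close>

lemma correlation_tsum:
 fixes g :: "plane => complex" assumes D: "determinantal P X K" and A: "bounded A"
  and g[measurable]: "g : bmeas borel" and gb: "!!z. norm (g z) <= C" and g0: "!!z. z ~: A ==> g z = 0"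
 shows "hbi P (%b. SUM x:distinct_tuples n (X b Int A). PROD i<n. g (x i))
  (LINT x|lborel_pow n. (PROD i<n. g (x i)) * kernel_det K n x)"
proof (cases "n = 0")
 \<comment> \<open>The determinantal property speaks of n at least 1 only. For n = 0 there is
   exactly one tuple and both sides are 1.\<close>
 case True
 interpret prob_space P using D by (simp add: determinantal_def point_process_def)
 have dt: "distinct_tuples 0 S = {%_. undefined}" for S by (auto simp: distinct_tuples_def)
 interpret product_sigma_finite "%_::nat. lborel :: plane measure" ..
 interpret p0: prob_space "Pi\<^sub>M {} (%_::nat. lborel :: plane measure)" by (rule prob_spaceI) (simp add: PiM_empty)
 show ?thesis using True by (auto simp: dt hbi_iff prob_space p0.prob_space)
next
 case False
 have C: "0 <= C" using gb[of 0] norm_ge_zero order_trans by blast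
 have fin: "finite (X b Int A)" if "b : space P" for b using D that A measurable_space[of X P config_space b]
  by (auto simp: determinantal_def point_process_def space_config_space configs_def)
 have cf: "correlation_function P X n (kernel_det K n)" using D False by (auto simp: determinantal_def)
 obtain R where R: "!!z. z : A ==> norm z <= R" using A by (auto simp: bounded_iff)
 have main: "hbi P (%b. of_real (SUM x:distinct_tuples n (X b Int A). F (PROD i<n. g (x i))))
  (LINT x|lborel_pow n. of_real (F (PROD i<n. g (x i))) * kernel_det K n x :: complex)"
  "integrable (lborel_pow n) (%x. of_real (F (PROD i<n. g (x i))) * kernel_det K n x)"
  if F[measurable]: "F : bmeas borel" and F0: "!!w. \<bar>F w\<bar> <= norm w" for F :: "complex => real"
 proof -
  let ?f = "%x. F (PROD i<n. g (x i))"
  have F00: "F 0 = 0" using F0[of 0] by simp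
  have z: "?f x = 0" if "i < n" "x i ~: A" for x i
  proof -
   have "(PROD i<n. g (x i)) = 0" using that g0[of "x i"] by (intro prod_zero) auto
   then show ?thesis using F00 by (simp only:)
  qed
  have "?f : bmeas (lborel_pow n)" by measurable
  moreover have "EX B. ALL x:space (lborel_pow n). \<bar>?f x\<bar> <= B"
  proof (intro exI ballI)
   fix x
   have "\<bar>?f x\<bar> <= (PROD i<n. norm (g (x i)))" using F0[of "PROD i<n. g (x i)"] by (simp add: prod_norm)
   also have "... <= (PROD i<n. C)" using gb by (intro prod_mono) auto
   finally show "\<bar>?f x\<bar> <= C ^ n" by simp
  qed
  moreover have "EX R. ALL x:space (lborel_pow n). ?f x ~= 0 --> (ALL i<n. norm (x i) <= R)"
   using R z by (intro exI[of _ R]) blast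
  ultimately have *: "integrable P (%b. \<Sum>\<^sub>\<infinity>x\<in>distinct_tuples n (X b). ?f x)"
   "integrable (lborel_pow n) (%x. of_real (?f x) * kernel_det K n x)"
   "of_real (LINT b|P. (\<Sum>\<^sub>\<infinity>x\<in>distinct_tuples n (X b). ?f x)) = (LINT x|lborel_pow n. of_real (?f x) * kernel_det K n x)"
   using cf unfolding correlation_function_def by blast+
  have e: "(\<Sum>\<^sub>\<infinity>x\<in>distinct_tuples n (X b). ?f x) = (SUM x:distinct_tuples n (X b Int A). ?f x)"
   if "b : space P" for b using fin[OF that] z by (intro infsum_distinct_tuples)
  have "hbi P (%b. SUM x:distinct_tuples n (X b Int A). ?f x)
   (LINT b|P. (\<Sum>\<^sub>\<infinity>x\<in>distinct_tuples n (X b). ?f x))" using has_bochner_integral_integrable[OF *(1)] e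
   by (subst has_bochner_integral_cong[OF refl _ refl]) auto
  from has_bochner_integral_of_real[OF this, where 'a=complex] *(3)
  show "hbi P (%b. of_real (SUM x:distinct_tuples n (X b Int A). F (PROD i<n. g (x i))))
  (LINT x|lborel_pow n. of_real (F (PROD i<n. g (x i))) * kernel_det K n x :: complex)" by simp
  show "integrable (lborel_pow n) (%x. of_real (F (PROD i<n. g (x i))) * kernel_det K n x)" by fact
 qed
 note R = main[of Re] and I = main[of Im]
 have "hbi P (%b. of_real (SUM x:distinct_tuples n (X b Int A). Re (PROD i<n. g (x i))) +
   \<i> * of_real (SUM x:distinct_tuples n (X b Int A). Im (PROD i<n. g (x i))))
  ((LINT x|lborel_pow n. of_real (Re (PROD i<n. g (x i))) * kernel_det K n x) +
   \<i> * (LINT x|lborel_pow n. of_real (Im (PROD i<n. g (x i))) * kernel_det K n x))"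
  using R(1) I(1) by (intro has_bochner_integral_add hbi_mult) (auto simp: abs_Re_le_cmod abs_Im_le_cmod)
 also have "(%b. of_real (SUM x:distinct_tuples n (X b Int A). Re (PROD i<n. g (x i))) +
   \<i> * of_real (SUM x:distinct_tuples n (X b Int A). Im (PROD i<n. g (x i)))) =
   (%b. SUM x:distinct_tuples n (X b Int A). PROD i<n. g (x i))" by (simp add: complex_eq_iff fun_eq_iff)
 also have "(LINT x|lborel_pow n. of_real (Re (PROD i<n. g (x i))) * kernel_det K n x) +
   \<i> * (LINT x|lborel_pow n. of_real (Im (PROD i<n. g (x i))) * kernel_det K n x) =
  (LINT x|lborel_pow n. of_real (Re (PROD i<n. g (x i))) * kernel_det K n x + \<i> * (of_real (Im (PROD i<n. g (x i))) * kernel_det K n x))"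
  using R(2) I(2) by (subst Bochner_Integration.integral_add) (auto simp: abs_Re_le_cmod abs_Im_le_cmod)
 also have "... = (LINT x|lborel_pow n. (PROD i<n. g (x i)) * kernel_det K n x)"
 proof (rule integral_eq[OF refl])
  fix x :: "nat => plane"
  have "of_real (Re w) * d + \<i> * (of_real (Im w) * d) = w * d" for w d :: complex by (metis complex_eq distrib_right mult.assoc)
  then show "of_real (Re (PROD i<n. g (x i))) * kernel_det K n x + \<i> * (of_real (Im (PROD i<n. g (x i))) * kernel_det K n x) = (PROD i<n. g (x i)) * kernel_det K n x" .
 qed
 finally show ?thesis .
qed

text \<open>Expectation and series may be interchanged because the n-th tuple sum is dominated by
  the one for the modulus of g. The correlation identity evaluates the expectation of the latter,
  and Hadamard's inequality bounds it by the n-th power of B.\<close>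

lemma determinantal_functional:
 fixes g :: "plane => complex" assumes D: "determinantal P X K" and psd: "psd_kernel K"
  and A[measurable]: "A : sets borel" "bounded A" and int: "set_integrable lborel A (%z. Re (K z z))"
  and g[measurable]: "g : bmeas borel" and gb: "!!z. norm (g z) <= C" and g0: "!!z. z ~: A ==> g z = 0"
 shows "(%n. (LINT x|lborel_pow n. (PROD i<n. g (x i)) * kernel_det K n x) / fact n)
  sums (LINT w|P. (PROD x:X w Int A. 1 + g x))"
  "integrable P (%w. PROD x:X w Int A. 1 + g x)"
proof -
 let ?M = "%n. LINT x|lborel_pow n. (PROD i<n. g (x i)) * kernel_det K n x"
 let ?L = "%n. LINT x|lborel_pow n. (PROD i<n. of_real (norm (g (x i)))) * kernel_det K n x"
 let ?J = "LINT w|P. (PROD x:X w Int A. 1 + g x)"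
 let ?H = "%z. norm (g z) * Re (K z z)"
 let ?G = "%z. ind A z *\<^sub>R Re (K z z)"
 let ?F = "%z. of_real (norm (g z))"
 define e where "e = (%n h w. (SUM x:distinct_tuples n (X w Int A). PROD i<n. h (x i)) :: complex)"
 define B where "B = (LINT z|lborel. norm (g z) * Re (K z z))"
 have C: "0 <= C" using gb[of 0] norm_ge_zero order_trans by blast
 have fin: "finite (X w Int A)" if "w : space P" for w using D that A measurable_space[of X P config_space w]
  by (auto simp: determinantal_def point_process_def space_config_space configs_def)
 have m: "kernel_det K n : bmeas (lborel_pow n)" for n
 proof (cases "n = 0")
  case False
  then show ?thesis using D by (auto simp: determinantal_def correlation_function_def)
 next
  case True
  have "kernel_det K 0 = (%_. 1)" by (rule ext) simp
  then show ?thesis using True by simp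
 qed
 have intg: "integrable lborel ?H"
 proof (rule integrable_le)
  show "integrable lborel (%z. C * (?G z))" using int unfolding set_integrable_def by simp
  have "(%z. norm (g z) * (?G z)) : bmeas lborel" using int unfolding set_integrable_def by measurable
  also have "(%z. norm (g z) * (?G z)) = ?H" using g0 by (auto simp: fun_eq_iff indicator_def)
  finally show "?H : bmeas lborel" .
  show "AE z in lborel. norm (norm (g z) * Re (K z z)) <= norm (C * (?G z))"
   using gb g0 C psd_diag(2)[OF psd] by (auto simp: indicator_def abs_mult mult_right_mono)
 qed
 have E: "hbi P (e n g) (?M n)" for n unfolding e_def by (rule correlation_tsum[OF D A(2) g gb g0])
 have E': "hbi P (e n ?F) (?L n)" for n unfolding e_def using gb g0 by (intro correlation_tsum[OF D A(2), where C=C]) auto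
 have le: "(LINT w|P. norm (e n g w)) <= B ^ n" for n
 proof -
  have i: "integrable P (e n g)" "integrable P (e n ?F)" using E E' by (auto simp: hbi_iff)
  have "(LINT w|P. norm (e n g w)) <= (LINT w|P. Re (e n ?F w))"
  proof (rule integral_mono)
   show "integrable P (%w. norm (e n g w))" "integrable P (%w. Re (e n ?F w))" using i by auto
   show "norm (e n g w) <= Re (e n ?F w)" for w
    unfolding e_def by (rule order_trans[OF sum_norm_le[OF order_refl]]) (simp add: prod_norm of_real_prod[symmetric] del: of_real_prod)
  qed
  also have "... = Re (LINT w|P. e n ?F w)" using i by simp
  also have "... <= norm (?L n)" using E'[of n] by (simp add: hbi_iff complex_Re_le_cmod)
  also have "... <= B ^ n" using integral_prod_kernel_det(2)[OF psd m[of n], of "%z. of_real (norm (g z))"] intg by (simp add: B_def)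
  finally show ?thesis .
 qed
 let ?f = "%n w. e n g w / fact n"
 have f: "integrable P (?f n)" for n using E by (auto simp: hbi_iff)
 have s1: "AE w in P. summable (%n. norm (?f n w))"
 proof (rule AE_I2)
  fix w assume "w : space P"
  from fin[OF this] show "summable (%n. norm (?f n w))"
   by (intro summable_finite[of "{..card (X w Int A)}"]) (auto simp: e_def distinct_tuples_eq_empty not_le)
 qed
 have s2: "summable (%n. LINT w|P. norm (?f n w))"
 proof (rule summable_comparison_test')
  show "summable (%n. B ^ n / fact n)" using summable_exp_generic[of B] by (simp add: field_simps)
  show "norm (LINT w|P. norm (?f n w)) <= B ^ n / fact n" for n using le[of n] by (simp add: norm_divide divide_right_mono)
 qed
 have eq: "(\<Sum>n. ?f n w) = (PROD x:X w Int A. 1 + g x)" if "w : space P" for w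
  unfolding e_def using prod_one_plus_sums[OF fin[OF that], of g] by (simp add: sums_iff)
 have eqi: "(LINT w|P. (\<Sum>n. ?f n w)) = ?J" using eq by (intro integral_eq) auto
 show "(%n. (?M n) / fact n) sums ?J" using sums_integral[OF f s1 s2] E unfolding eqi by (simp add: hbi_iff)
 show "integrable P (%w. PROD x:X w Int A. 1 + g x)"
  using integrable_suminf[OF f s1 s2] eq by (subst Bochner_Integration.integrable_cong[OF refl, of _ _ "%w. \<Sum>n. ?f n w"]) auto
qed

section \<open>Recovering the law of counts from characteristic functions\<close>

definition circ :: "real measure" where
 "circ = uniform_measure lborel {0..2*pi}"

lemma sets_circ [measurable_cong]: "sets circ = sets borel" by (simp add: circ_def)

lemma prob_space_circ: "prob_space circ" unfolding circ_def by (rule prob_space_uniform_measure) auto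

lemma integral_circ: assumes [measurable]: "f : bmeas borel"
 shows "(LINT t|circ. f t :: complex) = (LINT t|lborel. ind {0..2*pi} t *\<^sub>R f t) / of_real (2 * pi)"
proof -
 let ?A = "%t. ennreal (ind {0..2*pi} t / (2 * pi))"
 have "circ = density lborel ?A" unfolding circ_def uniform_measure_def
  by (intro density_cong) (auto simp: indicator_def divide_ennreal[symmetric])
 then have "(LINT t|circ. f t) = (LINT t|density lborel ?A. f t)" by (rule arg_cong)
 also have "... = (LINT t|lborel. (ind {0..2*pi} t / (2 * pi)) *\<^sub>R f t)" by (rule integral_density) auto
 also have "... = (LINT t|lborel. (ind {0..2*pi} t *\<^sub>R f t) / of_real (2 * pi))"
  by (intro integral_eq) (auto simp: scaleR_conv_of_real)
 finally show ?thesis by simp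
qed

lemma integral_circle_exp:
 fixes k :: int shows "(LINT t|circ. exp (\<i> * of_real t * of_int k)) = (if k = 0 then 1 else 0)"
proof (cases "k = 0")
 case True
 interpret prob_space circ by (rule prob_space_circ)
 show ?thesis using True by (simp add: prob_space)
next
 case False
 let ?F = "%t. exp (\<i> * of_real t * of_int k) / (\<i> * of_int k)"
 have "(LINT t|lborel. ind {0..2*pi} t *\<^sub>R exp (\<i> * of_real t * of_int k)) = ?F (2*pi) - ?F 0"
 proof (rule integral_FTC_Icc)
  show "continuous_on {0..2*pi} (%t. exp (\<i> * of_real t * of_int k))" by (intro continuous_intros)
  show "(?F has_vector_derivative exp (\<i> * of_real t * of_int k)) (at t within {0..2*pi})" for t
   using False by (auto intro!: derivative_eq_intros has_vector_derivative_real_field simp: field_simps)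
 qed simp
 also have "... = 0"
 proof -
  have "exp (\<i> * of_real (2*pi) * of_int k) = (exp (2 * of_real pi * \<i>)) powi k" by (simp add: exp_power_int mult_ac)
  then show ?thesis by simp
 qed
 finally show ?thesis using False by (simp add: integral_circ)
qed

text \<open>Fourier inversion for integer variables: averaging exp(i t (N - m)) over the circle
  gives the indicator of N = m. Fubini moves the average inside the expectation.\<close>

lemma counts_inversion:
 fixes N :: "'i => 'a => nat"
 assumes "prob_space P" and I: "finite I" and N[measurable]: "!!i. i : I ==> N i : P \<rightarrow>\<^sub>M count_space UNIV"
 shows "of_real (measure P {w : space P. ALL i:I. N i w = m i}) =
  (LINT t|PiM I (%_. circ). (PROD i:I. exp (- \<i> * of_real (t i) * of_nat (m i))) *
   (LINT w|P. (PROD i:I. exp (\<i> * of_real (t i) * of_nat (N i w)))))"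
proof -
 let ?E = "%t. PROD i:I. exp (- \<i> * of_real (t i) * of_nat (m i))"
 let ?D = "%_. circ"
 let ?C = "%t. LINT w|P. (PROD i:I. exp (\<i> * of_real (t i) * of_nat (N i w)))"
 let ?A = "LINT w|P. ind {w : space P. ALL i:I. N i w = m i} w"
 interpret P: prob_space P by fact
 interpret c: prob_space circ by (rule prob_space_circ)
 interpret pr: product_sigma_finite "%_::'i. circ" ..
 interpret T: prob_space "PiM I ?D" by (intro prob_space_PiM prob_space_circ)
 interpret TP: pair_prob_space P "PiM I ?D" ..
 let ?T = "PiM I ?D"
 let ?f = "%w t. PROD i:I. exp (\<i> * of_real (t i) * of_int (int (N i w) - int (m i)))"
 have meas: "(%(w, t). ?f w t) : bmeas (P \<Otimes>\<^sub>M ?T)" unfolding case_prod_beta by measurable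
 have int: "integrable (P \<Otimes>\<^sub>M ?T) (%(w, t). ?f w t)"
  using meas by (intro TP.integrable_const_bound[where B=1]) (auto simp: prod_norm[symmetric])
 have 1: "(?E t) * (?C t) = (LINT w|P. ?f w t)" for t by (subst integral_mult_right_zero[symmetric])
   (simp add: prod.distrib[symmetric] exp_add[symmetric] algebra_simps)
 have 2: "(LINT t|?T. ?f w t) = ind {w : space P. ALL i:I. N i w = m i} w" if "w : space P" for w
 proof -
  have "(LINT t|?T. ?f w t) = (PROD i:I. LINT t|circ. exp (\<i> * of_real t * of_int (int (N i w) - int (m i))))"
   by (rule pr.product_integral_prod[OF I], rule c.integrable_const_bound[where B=1]) auto
  also have "... = (PROD i:I. if N i w = m i then 1 else 0)" by (intro prod.cong refl, subst integral_circle_exp) auto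
  also have "... = ind {w : space P. ALL i:I. N i w = m i} w" using I that by (auto simp: indicator_def prod_zero_iff)
  finally show ?thesis .
 qed
 have "(LINT t|?T. (?E t) * (?C t)) = (LINT t|?T. LINT w|P. ?f w t)" unfolding 1 ..
 also have "... = (LINT w|P. LINT t|?T. ?f w t)" by (rule TP.Fubini_integral[OF int])
 also have "... = ?A" using 2 by (intro integral_eq) auto
 also have "... = (LINT w|P. of_real (ind {w : space P. ALL i:I. N i w = m i} w))"
  by (intro integral_eq) (auto simp: indicator_def)
 also have "... = of_real ?A" by (rule integral_complex_of_real)
 also have "... = of_real (measure P {w : space P. ALL i:I. N i w = m i})" by (simp add: Int_absorb2 subset_eq)
 finally show ?thesis by simp
qed

text \<open>Characteristic functions are bounded by 1, so their pointwise convergence passes through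
  the inversion integral. The limit need not be known to come from a process.\<close>

lemma counts_limit:
 fixes N :: "nat => 'i => 'a => nat" assumes P: "!!s. prob_space (P s)" and I: "finite I"
  and N[measurable]: "!!s i. i : I ==> N s i : P s \<rightarrow>\<^sub>M count_space UNIV"
  and lim: "!!t. (%s. LINT b|P s. (PROD i:I. exp (\<i> * of_real (t i) * of_nat (N s i b)))) ----> \<Phi> t"
 shows "(%s. of_real (measure (P s) {b : space (P s). ALL i:I. N s i b = m i})) ---->
  (LINT t|PiM I (%_. circ). (PROD i:I. exp (- \<i> * of_real (t i) * of_nat (m i))) * \<Phi> t)"
proof -
 let ?A = "%t. PROD i:I. exp (- \<i> * of_real (t i) * of_nat (m i))"
 interpret P: prob_space "P s" for s by fact
 interpret T: prob_space "PiM I (%_. circ)" by (intro prob_space_PiM prob_space_circ)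
 let ?T = "PiM I (%_. circ)"
 let ?c = "%s t. LINT b|P s. (PROD i:I. exp (\<i> * of_real (t i) * of_nat (N s i b)))"
 have m[measurable]: "?c s : bmeas ?T" for s by measurable
 have [measurable]: "\<Phi> : bmeas ?T" by (rule borel_measurable_LIMSEQ_metric[OF m]) (rule lim)
 have le: "norm (?c s t) <= 1" for s t
 proof -
  have "norm (?c s t) <= (LINT b|P s. norm (PROD i:I. exp (\<i> * of_real (t i) * of_nat (N s i b))))" by (rule integral_norm_bound)
  also have "... = 1" by (simp add: prod_norm[symmetric] P.prob_space)
  finally show ?thesis .
 qed
 have eq: "of_real (measure (P s) {b : space (P s). ALL i:I. N s i b = m i}) = (LINT t|?T. (?A t) * ?c s t)" for s
  by (rule counts_inversion[OF P I]) (rule N)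
 show ?thesis unfolding eq
 proof (rule integral_dominated_convergence[where w = "%_. 1"])
  show "AE t in ?T. (%s. (?A t) * ?c s t) ----> (?A t) * \<Phi> t" by (intro AE_I2 tendsto_mult tendsto_const lim)
  show "AE t in ?T. norm ((?A t) * ?c s t) <= 1" for s using le by (intro AE_I2) (simp add: norm_mult prod_norm[symmetric])
 qed auto
qed

section \<open>Counting variables and uniqueness in law\<close>

lemma npts_eq_card: "finite (S Int A) ==> npts A S = of_nat (card (S Int A))"
 unfolding npts_def by (simp add: emeasure_count_space_finite)

lemma measurable_npts: assumes "A : sets borel" shows "npts A : bmeas config_space"
proof (rule measurableI)
 fix B :: "ennreal set" assume "B : sets borel"
 then have "{S : configs. npts A S : B} : sets config_space" unfolding config_space_def using assms by (subst sets_measure_of) auto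
 also have "{S : configs. npts A S : B} = npts A -` B Int space config_space" by (auto simp: space_config_space)
 finally show "npts A -` B Int space config_space : sets config_space" .
qed simp

lemma point_process_finite: assumes "point_process P X" "bounded A" "w : space P" shows "finite (X w Int A)"
 using assms measurable_space[of X P config_space w] by (auto simp: point_process_def space_config_space configs_def)

lemma measurable_card_points: assumes X: "point_process P X" and A: "A : sets borel" "bounded A"
 shows "(%w. card (X w Int A)) : P \<rightarrow>\<^sub>M count_space UNIV"
proof -
 have [measurable]: "(%w. npts A (X w)) : bmeas P"
  using X measurable_npts[OF A(1)] unfolding point_process_def by (blast intro: measurable_compose)
 have "(%w. nat \<lfloor>enn2real (npts A (X w))\<rfloor>) : P \<rightarrow>\<^sub>M count_space UNIV" by measurable
 also have "?this \<longleftrightarrow> ?thesis" by (intro measurable_cong)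
   (simp add: npts_eq_card[OF point_process_finite[OF X A(2)]] ennreal_of_nat_eq_real_of_nat)
 finally show ?thesis .
qed

text \<open>The function \<open>g\<close> is chosen so that 1 + g z is the product of the phases of
  the sets containing z; multiplied over the points this is the joint characteristic function of the
  counts. The sets may overlap, as they do in the events that determine the law.\<close>

lemma counts_functional:
 fixes A :: "'i => plane set" assumes D: "determinantal P X K" and psd: "psd_kernel K"
  and loc: "!!A. A : sets borel ==> bounded A ==> set_integrable lborel A (%z. Re (K z z))"
  and I: "finite I" and A: "!!i. i : I ==> A i : sets borel" "!!i. i : I ==> bounded (A i)"
 shows "(%n. (LINT x|lborel_pow n. (PROD j<n. (PROD i:I. exp (\<i> * of_real (t i) * of_bool (x j : A i))) - 1) * kernel_det K n x) / fact n)
  sums (LINT w|P. (PROD i:I. exp (\<i> * of_real (t i) * of_nat (card (X w Int A i)))))"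
proof -
 let ?C = "%z. PROD i:I. exp (\<i> * of_real (t i) * of_bool (z : A i))"
 let ?B = "%w. PROD i:I. exp (\<i> * of_real (t i) * of_nat (card (X w Int A i)))"
 define g :: "plane => complex" where "g = (%z. (?C z) - 1)"
 let ?A = "UN i:I. A i"
 have X: "point_process P X" using D by (simp add: determinantal_def)
 have A': "?A : sets borel" "bounded ?A" using I A by (auto intro: sets.finite_UN)
 have gm: "g : bmeas borel" unfolding g_def of_bool_def using A(1) by measurable
 have g0: "g z = 0" if "z ~: ?A" for z using that by (simp add: g_def)
 have gb: "norm (g z) <= 2" for z
 proof -
  have "norm (?C z) = 1" by (auto simp: prod_norm[symmetric] of_bool_def intro!: prod.neutral)
  then show ?thesis unfolding g_def by (intro order_trans[OF norm_triangle_ineq4]) simp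
 qed
 have "(PROD x:X w Int ?A. 1 + g x) = (?B w)" if w: "w : space P" for w
 proof -
  have fin: "finite (X w Int ?A)" by (rule point_process_finite[OF X A'(2) w])
  have "(PROD x:X w Int ?A. 1 + g x) = (PROD i:I. PROD x:X w Int ?A. exp (\<i> * of_real (t i) * of_bool (x : A i)))"
   unfolding g_def by (simp add: prod.swap[of _ "X w Int ?A"])
  also have "... = (?B w)"
  proof (intro prod.cong refl)
   fix i assume i: "i : I"
   have "(SUM x:X w Int ?A. of_bool (x : A i) :: complex) = of_nat (card ((X w Int ?A) Int {x. x : A i}))"
    using fin by (simp only: sum_of_bool_eq)
   also have "(X w Int ?A) Int {x. x : A i} = X w Int A i" using i by auto
   finally show "(PROD x:X w Int ?A. exp (\<i> * of_real (t i) * of_bool (x : A i))) = exp (\<i> * of_real (t i) * of_nat (card (X w Int A i)))"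
    by (simp add: exp_sum[OF fin, symmetric] sum_distrib_left[symmetric])
  qed
  finally show ?thesis .
 qed
 then have "(LINT w|P. (PROD x:X w Int ?A. 1 + g x)) = (LINT w|P. (?B w))" by (intro integral_eq) auto
 then show ?thesis using determinantal_functional(1)[OF D psd A' loc[OF A'] gm gb g0] by (simp add: g_def)
qed

lemma counts_unique:
 fixes A :: "'i => plane set" assumes D: "determinantal P X K" "determinantal Q Y K" and psd: "psd_kernel K"
  and loc: "!!A. A : sets borel ==> bounded A ==> set_integrable lborel A (%z. Re (K z z))"
  and I: "finite I" and A: "!!i. i : I ==> A i : sets borel" "!!i. i : I ==> bounded (A i)"
 shows "measure P {w : space P. ALL i:I. card (X w Int A i) = m i} =
  measure Q {w : space Q. ALL i:I. card (Y w Int A i) = m i}"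
proof -
 have pp: "point_process P X" "point_process Q Y" "prob_space P" "prob_space Q" using D by (auto simp: determinantal_def point_process_def)
 have "(LINT w|P. (PROD i:I. exp (\<i> * of_real (t i) * of_nat (card (X w Int A i))))) =
   (LINT w|Q. (PROD i:I. exp (\<i> * of_real (t i) * of_nat (card (Y w Int A i)))))" for t
  using counts_functional[OF D(1) psd loc I A, where t = t] counts_functional[OF D(2) psd loc I A, where t = t] by (rule sums_unique2)
 then have "cor (measure P {w : space P. ALL i:I. card (X w Int A i) = m i}) =
  of_real (measure Q {w : space Q. ALL i:I. card (Y w Int A i) = m i})" by (subst (1 2) counts_inversion[OF _ I])
   (auto intro!: measurable_card_points pp A)
 then show ?thesis by (simp only: of_real_eq_iff)
qed

lemma npts_SUP: "npts A S = (SUP n. npts (A Int cball 0 (real n)) S)"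
proof -
 let ?B = "\<Union>n. S Int (A Int cball 0 (real n))"
 have "(SUP n. emeasure (count_space UNIV) (S Int (A Int cball 0 (real n)))) = emeasure (count_space UNIV) ?B"
  by (intro SUP_emeasure_incseq) (auto simp: incseq_def)
 also have "?B = S Int A" using real_arch_simple by auto
 finally show ?thesis by (simp add: npts_def)
qed

text \<open>Events that fix finitely many counts in bounded Borel sets are closed under
  intersection, and they generate the configuration sigma-algebra because the count in an unbounded
  set is the supremum of its counts in balls.\<close>

lemma same_lawI: assumes X: "point_process P X" and Y: "point_process Q Y"
  and eq: "!!F. finite F ==> (!!p. p : F ==> fst p : sets borel & bounded (fst p)) ==>
   measure P {w : space P. ALL p:F. card (X w Int fst p) = snd p} =
   measure Q {w : space Q. ALL p:F. card (Y w Int fst p) = snd p}" shows "same_law P X Q Y"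
proof -
 define ev where "ev = (%F. {S : configs. ALL p:F. card (S Int fst p) = snd p})"
 define ok where "ok = (%F :: (plane set \<times> nat) set. finite F & (ALL p:F. fst p : sets borel & bounded (fst p)))"
 define E where "E = ev ` Collect ok"
 define G where "G = {{S : configs. npts A S : B} | A B. A : sets borel & B : sets borel}"
 interpret P: prob_space P using X by (simp add: point_process_def)
 interpret Q: prob_space Q using Y by (simp add: point_process_def)
 have X'[measurable]: "X : P \<rightarrow>\<^sub>M config_space" and Y'[measurable]: "Y : Q \<rightarrow>\<^sub>M config_space"
  using X Y by (auto simp: point_process_def)
 have Epow: "E \<subseteq> Pow configs" by (auto simp: E_def ev_def)
 have sc: "sets config_space = sigma_sets configs G" unfolding config_space_def G_def[symmetric] by (rule sets_measure_of) (auto simp: G_def)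
 have sE: "sets (sigma configs E) = sigma_sets configs E" by (rule sets_measure_of[OF Epow])
 have spE: "space (sigma configs E) = configs" by (rule space_measure_of[OF Epow])
 have bdd: "npts A : bmeas (sigma configs E)" if A: "A : sets borel" "bounded A" for A
 proof -
  have "(%S. card (S Int A)) : sigma configs E \<rightarrow>\<^sub>M count_space UNIV"
  proof (subst measurable_count_space_eq2_countable, intro conjI ballI)
   fix n :: nat
   have "ev {(A, n)} : E" using A by (auto simp: E_def ok_def)
   then show "(%S. card (S Int A)) -` {n} Int space (sigma configs E) : sets (sigma configs E)"
    unfolding sE spE ev_def by (auto simp: vimage_def Int_def conj_commute intro!: sigma_sets.Basic)
  qed auto
  then have "(%S. of_nat (card (S Int A)) :: ennreal) : bmeas (sigma configs E)" by measurable
  moreover have "npts A S = of_nat (card (S Int A))" if "S : space (sigma configs E)" for S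
   using that A unfolding spE by (intro npts_eq_card) (simp add: configs_def)
  ultimately show ?thesis by (subst measurable_cong) auto
 qed
 have "npts A : bmeas (sigma configs E)" if "A : sets borel" for A
 proof -
  have "(%S. SUP n. npts (A Int cball 0 (real n)) S) : bmeas (sigma configs E)"
   using that by (intro borel_measurable_SUP bdd) auto
  then show ?thesis by (simp add: npts_SUP[symmetric])
 qed
 then have "G \<subseteq> sigma_sets configs E" unfolding G_def using measurable_sets[of "npts _" "sigma configs E" borel]
  by (fastforce simp: sE spE vimage_def Int_def conj_commute)
 moreover have "E \<subseteq> sigma_sets configs G"
 proof
  fix e assume "e : E"
  then obtain F where F: "ok F" "e = ev F" by (auto simp: E_def)
  have "{S : space config_space. ALL p:F. npts (fst p) S = of_nat (snd p)} : sets config_space"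
   using F(1) by (intro sets.sets_Collect_finite_All borel_measurable_eq measurable_npts) (auto simp: ok_def)
  also have "{S : space config_space. ALL p:F. npts (fst p) S = of_nat (snd p)} = e" unfolding F(2) ev_def space_config_space
  proof (intro Collect_cong conj_cong refl ball_cong)
   fix S p assume "S : configs" "p : F"
   then have "npts (fst p) S = of_nat (card (S Int fst p))" using F(1) by (intro npts_eq_card) (simp add: configs_def ok_def)
   then show "npts (fst p) S = of_nat (snd p) \<longleftrightarrow> card (S Int fst p) = snd p" by simp
  qed
  finally show "e : sigma_sets configs G" unfolding sc .
 qed
 ultimately have sets_eq: "sets config_space = sigma_sets configs E" unfolding sc by (intro sigma_sets_eqI) auto
 have em: "emeasure (distr P config_space X) e = emeasure (distr Q config_space Y) e" if "e : E" for e
 proof -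
  from that obtain F where F: "ok F" "e = ev F" unfolding E_def by blast
  have es: "e : sets config_space" unfolding sets_eq using that by auto
  have x: "X -` e Int space P = {w : space P. ALL p:F. card (X w Int fst p) = snd p}"
   using measurable_space[OF X'] by (auto simp: F ev_def space_config_space)
  have y: "Y -` e Int space Q = {w : space Q. ALL p:F. card (Y w Int fst p) = snd p}"
   using measurable_space[OF Y'] by (auto simp: F ev_def space_config_space)
  show ?thesis using eq[of F] F(1) es by (simp add: emeasure_distr x y ok_def P.emeasure_eq_measure Q.emeasure_eq_measure)
 qed
 have "distr P config_space X = distr Q config_space Y"
 proof (rule measure_eqI_generator_eq[where E=E and \<Omega>=configs and A="%_. configs"])
  show "Int_stable E"
  proof (rule Int_stableI)
   \<comment> \<open>An index set consists of pairs of a region and a count, so the intersection of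
     two events belongs to the union of their index sets, even if both prescribe a count for the
     same region.\<close>
   fix a b assume "a : E" "b : E"
   then obtain F F' where F: "ok F" "ok F'" "a = ev F" "b = ev F'" by (auto simp: E_def)
   then have "a Int b = ev (F Un F')" "ok (F Un F')" by (auto simp: ev_def ok_def)
   then show "a Int b : E" by (auto simp: E_def)
  qed
  have "ev {} = configs" "ok {}" by (auto simp: ev_def ok_def)
  then show "range (%_. configs) \<subseteq> E" by (auto simp: E_def)
  interpret X: prob_space "distr P config_space X" by (rule P.prob_space_distr) simp
  show "emeasure (distr P config_space X) configs ~= \<infinity>" for i :: nat by simp
 qed (use Epow em sets_eq in auto)
 then show ?thesis by (simp add: same_law_def)
qed

theorem determinantal_same_law: assumes D: "determinantal P X K" "determinantal Q Y K" and psd: "psd_kernel K"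
  and loc: "!!A. A : sets borel ==> bounded A ==> set_integrable lborel A (%z. Re (K z z))"
 shows "same_law P X Q Y"
proof (rule same_lawI)
 show "point_process P X" "point_process Q Y" using D by (auto simp: determinantal_def)
qed (rule counts_unique[OF D psd loc], auto)

section \<open>Limits of Fredholm series\<close>

text \<open>Dominated convergence in each term and Tannery's theorem across the terms; Hadamard's
  inequality supplies a majorant of both that does not depend on k. The limits \<open>D n\<close>
  are arbitrary functions since in the Poisson limit they are products of intensities and not
  determinants of a kernel.\<close>

lemma functional_limit:
 fixes g :: "nat => plane => complex" assumes psd: "!!k. psd_kernel (K k)"
  and m: "!!k n. kernel_det (K k) n : bmeas (lborel_pow n)"
  and mD[measurable]: "!!n. D n : bmeas (lborel_pow n)"
  and g[measurable]: "!!k. g k : bmeas borel" "h : bmeas borel"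
  and le: "!!k z. norm (g k z) * Re (K k z z) <= w z" and w: "integrable lborel w"
  and gl: "!!z. (%k. g k z) ----> h z"
  and Dl: "!!n. AE x in lborel_pow n. (%k. kernel_det (K k) n x) ----> D n x"
 shows "summable (%n. (LINT x|lborel_pow n. (PROD i<n. h (x i)) * D n x) / fact n)"
  "(%k. \<Sum>n. (LINT x|lborel_pow n. (PROD i<n. g k (x i)) * kernel_det (K k) n x) / fact n) ---->
   (\<Sum>n. (LINT x|lborel_pow n. (PROD i<n. h (x i)) * D n x) / fact n)"
proof -
 let ?C = "%n. LINT x|lborel_pow n. (PROD i<n. h (x i)) * D n x"
 let ?B = "%n k x. (PROD i<n. g k (x i)) * kernel_det (K k) n x"
 let ?A = "%n k. LINT x|lborel_pow n. (PROD i<n. g k (x i)) * kernel_det (K k) n x"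
 interpret product_sigma_finite "%_::nat. lborel :: plane measure" ..
 note [measurable] = m
 define a where "a = (%n k. (?A n k) / fact n)"
 define b where "b = (%n. (?C n) / fact n)"
 have w0: "0 <= w z" for z using le[of 0 z] psd_diag(2)[OF psd, of 0 z] by (meson mult_nonneg_nonneg norm_ge_zero order_trans)
 have iw: "integrable (lborel_pow n) (%x. PROD i<n. w (x i))" for n using w by (intro product_integrable_prod) auto
 have iw2: "(LINT x|lborel_pow n. (PROD i<n. w (x i))) = (LINT z|lborel. w z) ^ n" for n using w by (subst product_integral_prod) auto
 have b1: "norm (?B n k x) <= (PROD i<n. w (x i))" for k n x
 proof -
  have "norm (?B n k x) <= (PROD i<n. norm (g k (x i)) * Re (K k (x i) (x i)))" using psd_rho[OF psd, of k n x]
   by (simp add: norm_mult prod.distrib prod_norm mult_left_mono prod_nonneg)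
  also have "... <= (PROD i<n. w (x i))" using le psd_diag(2)[OF psd] by (intro prod_mono) auto
  finally show ?thesis .
 qed
 have lim: "(%k. a n k) ----> b n" for n unfolding a_def b_def
 proof (intro tendsto_divide tendsto_const integral_dominated_convergence[where w="%x. PROD i<n. w (x i)"] iw)
  show "AE x in lborel_pow n. (%k. (PROD i<n. g k (x i)) * kernel_det (K k) n x) ----> (PROD i<n. h (x i)) * D n x"
   using Dl[of n] by eventually_elim (intro tendsto_mult tendsto_prod gl)
  show "AE x in lborel_pow n. norm (?B n k x) <= (PROD i<n. w (x i))" for k using b1 by auto
 qed auto
 have bd: "norm (a n k) <= (LINT z|lborel. w z) ^ n / fact n" for n k
 proof -
  have "norm (?A n k) <= (LINT x|lborel_pow n. norm (?B n k x))" by (rule integral_norm_bound)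
  also have "... <= (LINT x|lborel_pow n. (PROD i<n. w (x i)))" using b1 w0 by (intro integral_mono_AE' iw) (auto simp: prod_nonneg)
  finally show ?thesis unfolding a_def iw2 by (simp add: norm_divide divide_right_mono)
 qed
 have s: "summable (%n. (LINT z|lborel. w z) ^ n / fact n)" using summable_exp_generic[of "LINT z|lborel. w z"] by (simp add: field_simps)
 have T: "summable (%n. norm (b n)) & ((%k. suminf (%n. a n k)) ----> suminf b)"
 proof -
  have "\<forall>\<^sub>F (n, k) in sequentially \<times>\<^sub>F sequentially. norm (a n k) <= (LINT z|lborel. w z) ^ n / fact n"
   using bd by (intro always_eventually) auto
  from tannerys_theorem[where a=a and b=b, OF lim this s] show ?thesis by simp
 qed
 then show "summable (%n. (?C n) / fact n)" unfolding b_def by (auto intro: summable_norm_cancel)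
 show "(%k. \<Sum>n. (?A n k) / fact n) ----> (\<Sum>n. (?C n) / fact n)" using T by (simp add: a_def b_def)
qed

lemma emeasure_lborel_horizontal: "emeasure (lborel :: plane measure) {y. snd y = c} = 0"
proof -
 have "{y::plane. snd y = c} = (UNIV :: real set) \<times> {c}" by auto
 then have "emeasure (lborel :: plane measure) {y. snd y = c} = emeasure (lborel \<Otimes>\<^sub>M lborel) ((UNIV :: real set) \<times> {c})"
  by (simp add: lborel_prod)
 also have "... = 0" by (subst lborel.emeasure_pair_measure_Times) auto
 finally show ?thesis .
qed

text \<open>The rescaled kernel decays only between points with different second coordinates. Ties
  form a null set, so they are invisible in the Fredholm series.\<close>

lemma AE_snd_distinct:
 "AE x in lborel_pow n. ALL i<n. ALL j<n. i ~= j --> snd (x i) ~= snd (x j)"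
proof -
 interpret product_sigma_finite "%_::nat. lborel :: plane measure" ..
 have *: "AE x in lborel_pow n. snd (x i) ~= snd (x j)" if ij: "i < n" "j < n" "i ~= j" for i j
 proof -
  have ins: "{..<n} = insert i ({..<n} - {i})" using ij by auto
  have [measurable]: "(%x. x i) : lborel_pow n \<rightarrow>\<^sub>M borel" "(%x. x j) : lborel_pow n \<rightarrow>\<^sub>M borel"
   using ij by auto
   have [measurable]: "(%x. snd (x k)) : bmeas (lborel_pow n)" if "k < n" for k
   proof (rule measurable_compose[where f="%x. x k" and N=lborel and g=snd])
    show "(%x. x k) : lborel_pow n \<rightarrow>\<^sub>M lborel" using that by (intro measurable_component_singleton) auto
    show "(snd :: plane => real) : bmeas lborel" by (auto intro!: borel_measurable_continuous_onI continuous_intros)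
   qed
   have "{x : space (lborel_pow n). snd (x i) = snd (x j)} : sets (lborel_pow n)" using ij by (intro borel_measurable_eq) auto
   then have "(ind {x : space (lborel_pow n). snd (x i) = snd (x j)} :: _ => ennreal) : bmeas (lborel_pow n)"
    by measurable
   also have "?this \<longleftrightarrow> (ind {x. snd (x i) = snd (x j)} :: _ => ennreal) : bmeas (lborel_pow n)"
    by (intro measurable_cong) (auto simp: indicator_def)
   finally have mI: "(ind {x. snd (x i) = snd (x j)} :: _ => ennreal) : bmeas (lborel_pow n)" .
  have "(nni (lborel_pow n) (%x. ind {x. snd (x i) = snd (x j)} x)) =
   (nni (\<Pi>\<^sub>M i\<in>{..<n} - {i}. (lborel :: plane measure)) (%x. (nni lborel (%y. ind {x. snd (x i) = snd (x j)} (x(i := y))))))"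
  proof -
   from mI have "(ind {x. snd (x i) = snd (x j)} :: _ => ennreal) : bmeas (\<Pi>\<^sub>M i\<in>insert i ({..<n} - {i}). (lborel :: plane measure))"
    unfolding ins[symmetric] .
   moreover have "finite ({..<n} - {i})" "i ~: {..<n} - {i}" by auto
   ultimately show ?thesis using product_nn_integral_insert[of "{..<n} - {i}" i "ind {x. snd (x i) = snd (x j)}"]
    unfolding ins[symmetric] by simp
  qed
  also have "(%x::nat => plane. nni lborel (%y. ind {x. snd (x i) = snd (x j)} (x(i := y)))) = (%x. emeasure (lborel :: plane measure) {y. snd y = snd (x j)} :: ennreal)"
  proof
   fix x :: "nat => plane"
   have "(%y. ind {x. snd (x i) = snd (x j)} (x(i := y)) :: ennreal) = ind {y. snd y = snd (x j)}"
    using ij by (auto simp: fun_eq_iff indicator_def)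
   moreover have "{y::plane. snd y = snd (x j)} : sets lborel" by (auto intro!: borel_closed closed_Collect_eq continuous_intros)
   ultimately show "(nni lborel (%y. ind {x. snd (x i) = snd (x j)} (x(i := y)))) = emeasure (lborel :: plane measure) {y. snd y = snd (x j)}"
    by (simp only: nn_integral_indicator)
  qed
  finally have "(nni (lborel_pow n) (%x. ind {x. snd (x i) = snd (x j)} x)) = 0" by (simp add: emeasure_lborel_horizontal)
  then have "AE x in lborel_pow n. ind {x. snd (x i) = snd (x j)} x = (0::ennreal)" by (subst (asm) nn_integral_0_iff_AE[OF mI])
  then show ?thesis by eventually_elim (auto simp: indicator_def split: if_splits)
 qed
 have "AE x in lborel_pow n. ALL i:{..<n}. ALL j:{..<n} - {i}. snd (x i) ~= snd (x j)"
  by (intro AE_finite_allI) (auto intro!: *)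
 then show ?thesis by eventually_elim auto
qed

text \<open>Every permutation except the identity moves some index and so contains a factor that
  tends to 0.\<close>

lemma kernel_det_tendsto_prod: assumes diag: "!!i. i < n ==> (%k. K k (x i) (x i)) ----> l (x i)"
  and off: "!!i j. i < n ==> j < n ==> i ~= j ==> (%k. K k (x i) (x j)) ----> 0"
 shows "(%k. kernel_det (K k) n x) ----> (PROD i<n. l (x i))"
proof -
 let ?A = "%p. PROD i<n. if i = p i then l (x i) else 0"
 have *: "(%k. K k (x i) (x j)) ----> (if i = j then l (x i) else 0)" if "i < n" "j < n" for i j
  using diag off that by auto
 have "(%k. kernel_det (K k) n x) ----> (\<Sum>p | p permutes {..<n}. of_int (sign p) * (?A p))"
  unfolding det_leibniz by (intro tendsto_sum tendsto_mult tendsto_const tendsto_prod *) (auto simp: permutes_lessThan)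
 also have "(\<Sum>p | p permutes {..<n}. of_int (sign p) * (?A p)) = (SUM p:{id}. of_int (sign p) * (?A p))"
 proof (intro sum.mono_neutral_right ballI)
  fix p assume p: "p : {p. p permutes {..<n}} - {id}"
  then obtain i where "p i ~= i" by (auto simp: fun_eq_iff)
  moreover from this have "i : {..<n}" using p permutes_not_in by fastforce
  ultimately have "(?A p) = 0" by (intro prod_zero bexI[of _ i]) auto
  then show "of_int (sign p) * (?A p) = 0" by simp
 qed (auto intro: finite_permutations permutes_id)
 finally show ?thesis by (simp add: sign_id)
qed

section \<open>Affine changes of variables\<close>

context
 fixes a b c :: real assumes ab: "a > 0" "b > 0"
begin

definition stre :: "plane => plane" where
 "stre = (%(x, y). (c + a * x, b * y))"

lemma measurable_stre [measurable]: "stre : borel \<rightarrow>\<^sub>M borel"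
 unfolding stre_def case_prod_beta by (intro borel_measurable_continuous_onI continuous_intros)

lemma lborel_stre: "lborel = density (distr lborel borel stre) (%_. ennreal (a * b))"
proof -
 define f where "f = (%j::plane. if j = (1, 0) then a else b)"
 have B: "(Basis :: plane set) = {(1, 0), (0, 1)}" by (auto simp: Basis_prod_def)
 have "stre = (%x. (c, 0) + (SUM j:Basis. (f j * (x \<bullet> j)) *\<^sub>R j))" by (auto simp: B f_def stre_def fun_eq_iff)
 moreover have "(PROD j:Basis. \<bar>f j\<bar>) = a * b" using ab by (simp add: B f_def)
 moreover have "f j ~= 0" for j using ab by (simp add: f_def)
 ultimately show ?thesis using lborel_affine_euclidean[of f "(c, 0)"] by simp
qed

lemma emeasure_stre:
 "A : sets borel ==> ennreal (a * b) * emeasure lborel (stre -` A) = emeasure lborel A"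
 by (subst (2) lborel_stre) (simp add: emeasure_density_const emeasure_distr)

lemma lborel_pow_stre:
 "lborel_pow n = density (distr (lborel_pow n) (lborel_pow n) (%x. \<lambda>i\<in>{..<n}. stre (x i))) (%_. ennreal ((a * b) ^ n))"
proof -
 let ?B = "%x. \<lambda>i\<in>{..<n}. stre (x i)"
 interpret product_sigma_finite "%_::nat. lborel :: plane measure" ..
 have [measurable]: "?B : lborel_pow n \<rightarrow>\<^sub>M lborel_pow n" by (intro measurable_restrict) measurable
 show ?thesis
 proof (rule PiM_eqI[symmetric])
  fix A :: "nat => plane set" assume A: "!!i. i : {..<n} ==> A i : sets lborel"
  have [measurable]: "stre -` A i : sets borel" if "i < n" for i using measurable_sets[OF measurable_stre, of "A i"] A[of i] that by simp
  have pre: "?B -` Pi\<^sub>E {..<n} A Int space (lborel_pow n) = Pi\<^sub>E {..<n} (%i. stre -` A i)"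
   by (auto simp: space_PiM PiE_iff)
  have As: "Pi\<^sub>E {..<n} A : sets (lborel_pow n)" using A by (intro sets_PiM_I_finite) auto
  have "emeasure (density (distr (lborel_pow n) (lborel_pow n) ?B) (%_. ennreal ((a * b) ^ n))) (Pi\<^sub>E {..<n} A)
   = ennreal ((a * b) ^ n) * emeasure (lborel_pow n) (Pi\<^sub>E {..<n} (%i. stre -` A i))"
   using As by (simp add: emeasure_density_const emeasure_distr pre)
  also have "... = ennreal (a * b) ^ n * (PROD i<n. emeasure lborel (stre -` A i))"
   using ab by (subst emeasure_PiM) (auto simp: ennreal_power)
  also have "... = (PROD i<n. ennreal (a * b) * emeasure lborel (stre -` A i))" by (simp add: prod.distrib)
  also have "... = (PROD i<n. emeasure lborel (A i))" using A by (intro prod.cong refl emeasure_stre) auto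
  finally show "emeasure (density (distr (lborel_pow n) (lborel_pow n) ?B) (%_. ennreal ((a * b) ^ n))) (Pi\<^sub>E {..<n} A)
   = (PROD i<n. emeasure lborel (A i))" .
 qed auto
qed

text \<open>Putting the Jacobian into the kernel multiplies the n-point determinant by its n-th
  power, which is precisely the Jacobian of the substitution in all n points.\<close>

definition strk :: "kernel => kernel" where
 "strk K z w = of_real (a * b) * K (stre z) (stre w)"

lemma kernel_det_stre:
 "kernel_det (strk K) n z = of_real ((a * b) ^ n) * kernel_det K n (%i. stre (z i))"
 unfolding det_leibniz strk_def by (simp add: prod.distrib sum_distrib_left mult_ac power_mult_distrib)

lemma psd_strk: assumes "psd_kernel K" shows "psd_kernel (strk K)" unfolding psd_kernel_def
proof (intro conjI allI)
 show "strk K z w = cnj (strk K w z)" for z w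
  using psd_kernelD(1)[OF assms, of "stre z" "stre w"] by (simp add: strk_def)
 fix n :: nat and x d
 have "(SUM i<n. SUM j<n. cnj (d i) * d j * strk K (x i) (x j)) =
  of_real (a * b) * (SUM i<n. SUM j<n. cnj (d i) * d j * K (stre (x i)) (stre (x j)))"
  by (simp add: strk_def sum_distrib_left mult_ac)
 then show "0 <= Re (SUM i<n. SUM j<n. cnj (d i) * d j * strk K (x i) (x j))"
  using psd_kernelD(2)[OF assms, where c=d and x="%i. stre (x i)" and n=n] ab by (simp del: of_real_mult add: Re_complex_of_real)
qed

lemma integral_lborel_pow_stre:
 fixes g :: "plane => complex"
 assumes m: "kernel_det K n : bmeas (lborel_pow n)" and g[measurable]: "g : bmeas borel"
 shows "(LINT x|lborel_pow n. (PROD i<n. g (x i)) * kernel_det K n x) =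
  (LINT z|lborel_pow n. (PROD i<n. g (stre (z i))) * kernel_det (strk K) n z)"
proof -
 let ?A = "%x. \<lambda>i\<in>{..<n}. stre (x i)"
 note [measurable] = m
 have [measurable]: "?A : lborel_pow n \<rightarrow>\<^sub>M lborel_pow n" by (intro measurable_restrict) measurable
 have k: "kernel_det K n (\<lambda>i\<in>{..<n}. stre (x i)) = kernel_det K n (%i. stre (x i))" for x by (rule kernel_det_cong) auto
 have "(LINT x|lborel_pow n. (PROD i<n. g (x i)) * kernel_det K n x) =
  (LINT x|density (distr (lborel_pow n) (lborel_pow n) ?A) (%_. ennreal ((a * b) ^ n)). (PROD i<n. g (x i)) * kernel_det K n x)"
  by (subst lborel_pow_stre) (rule refl)
 also have "... = (LINT x|distr (lborel_pow n) (lborel_pow n) ?A. (a * b) ^ n *\<^sub>R ((PROD i<n. g (x i)) * kernel_det K n x))"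
  using ab by (intro integral_density) auto
 also have "... = (LINT z|lborel_pow n. (a * b) ^ n *\<^sub>R ((PROD i<n. g (stre (z i))) * kernel_det K n (%i. stre (z i))))"
  by (subst integral_distr) (simp_all add: k)
 also have "... = (LINT z|lborel_pow n. (PROD i<n. g (stre (z i))) * kernel_det (strk K) n z)"
  by (intro integral_eq refl) (simp add: kernel_det_stre scaleR_conv_of_real mult_ac)
 finally show ?thesis .
qed

lemma measurable_strk_det: assumes m[measurable]: "kernel_det K n : bmeas (lborel_pow n)"
 shows "kernel_det (strk K) n : bmeas (lborel_pow n)"
proof -
 let ?A = "%z. of_real ((a * b) ^ n) * kernel_det K n (\<lambda>i\<in>{..<n}. stre (z i))"
 have [measurable]: "(%x. \<lambda>i\<in>{..<n}. stre (x i)) : lborel_pow n \<rightarrow>\<^sub>M lborel_pow n"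
  by (intro measurable_restrict) measurable
 have "?A : bmeas (lborel_pow n)" by measurable
 also have "?A = kernel_det (strk K) n"
  by (intro ext) (simp only: kernel_det_stre, intro arg_cong2[where f="(*)"] refl kernel_det_cong, simp)
 finally show ?thesis .
qed

end

section \<open>Void probabilities and Fredholm determinants\<close>

lemma det_meas_det: assumes "determinantal P X K" shows "kernel_det K n : bmeas (lborel_pow n)"
proof (cases "n = 0")
 case False
 then show ?thesis using assms by (auto simp: determinantal_def correlation_function_def)
next
 case True
 have "kernel_det K 0 = (%_. 1)" by (rule ext) simp
 then show ?thesis using True by simp
qed

lemma indicator_prod_PiE: assumes "z : space (lborel_pow r)"
 shows "ind ({..<r} \<rightarrow>\<^sub>E A) z = (PROD i<r. ind A (z i) :: 'a :: comm_semiring_1)"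
 using assms by (auto simp: indicator_def space_PiM PiE_iff prod_zero_iff intro!: prod_zero)

lemma prod_indicator_PiE: assumes "z : space (lborel_pow r)"
 shows "(PROD i<r. ind A (z i) :: complex) = of_real (ind ({..<r} \<rightarrow>\<^sub>E A) z)"
proof -
 have "ind ({..<r} \<rightarrow>\<^sub>E A) z = (PROD i<r. ind A (z i) :: complex)" by (rule indicator_prod_PiE[OF assms])
 then show ?thesis by (metis indicator_def of_real_0 of_real_1 of_bool_def)
qed

lemma norm_indicator_mult: "norm (ind A z :: complex) * r = ind A z *\<^sub>R r" by (auto simp: indicator_def)

text \<open>Identifies the Fredholm determinant with the product functional at g equal to minus the
  indicator of A, for which a single point in A makes the product vanish.\<close>

lemma fredholm_term_eq:
 "fredholm_term A K r = (LINT z|lborel_pow r. (PROD i<r. - ind A (z i)) * kernel_det K r z) / fact r"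
proof -
 let ?B = "{..<r} \<rightarrow>\<^sub>E A"
 have e: "(PROD i<r. - ind A (z i)) * kernel_det K r z = (-1) ^ r * (ind ?B z *\<^sub>R kernel_det K r z)"
  if z: "z : space (lborel_pow r)" for z
 proof -
  have "(PROD i<r. - ind A (z i) :: complex) = (-1) ^ r * (PROD i<r. ind A (z i))" by (induction r) auto
  also have "(PROD i<r. ind A (z i) :: complex) = of_real (ind ?B z)" by (rule prod_indicator_PiE[OF z])
  finally show ?thesis by (simp add: scaleR_conv_of_real mult_ac)
 qed
 have "(LINT z|lborel_pow r. (PROD i<r. - ind A (z i)) * kernel_det K r z) =
  (LINT z|lborel_pow r. (-1) ^ r * (ind ?B z *\<^sub>R kernel_det K r z))" by (intro integral_eq refl e)
 also have "... = (-1) ^ r * (LINT z:?B|lborel_pow r. kernel_det K r z)" unfolding set_lebesgue_integral_def by (rule integral_mult_right_zero)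
 finally show ?thesis by (simp add: fredholm_term_def)
qed

context
 fixes P :: "'a measure" and X K A assumes D: "determinantal P X K" and psd: "psd_kernel K"
  and loc: "!!A. A : sets borel ==> bounded A ==> set_integrable lborel A (%z. Re (K z z))"
  and A[measurable]: "A : sets borel" and int: "set_integrable lborel A (%z. Re (K z z))"
begin

text \<open>For bounded sets the product of 1 + g over the points is the indicator of the event that
  the set is empty. A general A is exhausted by its intersections with balls: the events decrease,
  and the corresponding Fredholm series converge because the trace on A is finite.\<close>

lemma void_probability:
 "fredholm_term A K sums of_real (measure P {a : space P. npts A (X a) = 0})"
proof -
 have pp: "point_process P X" using D by (simp add: determinantal_def)
 interpret prob_space P using pp by (simp add: point_process_def)
 have X[measurable]: "X : P \<rightarrow>\<^sub>M config_space" using pp by (simp add: point_process_def)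
 define B where "B = (%n. A Int cball 0 (real n))"
 have B: "B n : sets borel" "bounded (B n)" for n by (auto simp: B_def)
 note [measurable] = B(1)
 have [measurable]: "npts C : bmeas config_space" if "C : sets borel" for C by (rule measurable_npts[OF that])
 have "(%n. measure P {a : space P. npts (B n) (X a) = 0}) ----> measure P (\<Inter>n. {a : space P. npts (B n) (X a) = 0})"
 proof (rule finite_Lim_measure_decseq)
  show "range (%n. {a : space P. npts (B n) (X a) = 0}) \<subseteq> sets P" using B(1) by auto
  show "decseq (%n. {a : space P. npts (B n) (X a) = 0})"
  proof (rule decseq_SucI, rule subsetI)
   fix n a assume *: "a : {a : space P. npts (B (Suc n)) (X a) = 0}"
   have "npts (B n) (X a) <= npts (B (Suc n)) (X a)" unfolding npts_def B_def by (intro emeasure_mono) auto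
   then show "a : {a : space P. npts (B n) (X a) = 0}" using * by auto
  qed
 qed
 also have "(\<Inter>n. {a : space P. npts (B n) (X a) = 0}) = {a : space P. npts A (X a) = 0}"
  by (subst npts_SUP[of A]) (auto simp: B_def SUP_eq_iff bot_ennreal[symmetric] simp del: bot_ennreal)
 finally have l1: "(%n. cor (measure P {a : space P. npts (B n) (X a) = 0})) ---->
   of_real (measure P {a : space P. npts A (X a) = 0})" by (rule tendsto_of_real)
 have eq: "(\<Sum>n. (LINT x|lborel_pow n. (PROD i<n. - ind (B k) (x i)) * kernel_det K n x) / fact n) =
  of_real (measure P {a : space P. npts (B k) (X a) = 0})" for k
 proof -
  have "(%n. (LINT x|lborel_pow n. (PROD i<n. - ind (B k) (x i)) * kernel_det K n x) / fact n)
   sums (LINT a|P. (PROD x:X a Int B k. 1 + - ind (B k) x))"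
   by (rule determinantal_functional[OF D psd B loc[OF B], where C=1]) (auto simp: indicator_def)
  moreover have "(PROD x:X a Int B k. 1 + - ind (B k) x :: complex) = of_real (ind {a : space P. npts (B k) (X a) = 0} a)"
   if w: "a : space P" for a
  proof -
   have fin: "finite (X a Int B k)" by (rule point_process_finite[OF pp B(2) w])
   show ?thesis
   proof (cases "X a Int B k = {}")
    case True
    then show ?thesis using w by (simp add: npts_def)
   next
    case False
    then have "(PROD x:X a Int B k. 1 + - ind (B k) x :: complex) = 0" using fin by (intro prod_zero) auto
    moreover have "npts (B k) (X a) ~= 0" using False fin by (simp add: npts_eq_card)
    ultimately show ?thesis by simp
   qed
  qed
  then have "(LINT a|P. (PROD x:X a Int B k. 1 + - ind (B k) x)) = (LINT a|P. cor (ind {a : space P. npts (B k) (X a) = 0} a))"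
   by (intro integral_eq) auto
  also have "... = of_real (LINT a|P. ind {a : space P. npts (B k) (X a) = 0} a)" by (rule integral_complex_of_real)
  also have "... = of_real (measure P {a : space P. npts (B k) (X a) = 0})" by (simp add: Int_absorb2 subset_eq)
  ultimately show ?thesis by (simp add: sums_iff)
 qed
 have gl: "(%k. - ind (B k) z :: complex) ----> - ind A z" for z
 proof (rule tendsto_eventually)
  obtain k0 where "norm z <= real k0" using real_arch_simple by blast
  then have "- ind (B k) z = (- ind A z :: complex)" if "k >= k0" for k using that by (auto simp: B_def indicator_def)
  then show "\<forall>\<^sub>F k in sequentially. - ind (B k) z = (- ind A z :: complex)" unfolding eventually_sequentially by blast
 qed
 \<comment> \<open>The kernel is constant here; only the test functions, minus the indicators of the
   growing bounded parts of A, vary with k.\<close>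
 note FL = functional_limit[of "%_. K" "kernel_det K" "%k z. - ind (B k) z" "%z. - ind A z"
   "%z. ind A z *\<^sub>R Re (K z z)", OF psd det_meas_det[OF D] det_meas_det[OF D]
   _ _ _ int[unfolded set_integrable_def] gl]
 have s: "summable (fredholm_term A K)" unfolding fredholm_term_eq using psd_diag(2)[OF psd] by (intro FL(1)) (auto simp: B_def indicator_def)
 have "(%k. \<Sum>n. (LINT x|lborel_pow n. (PROD i<n. - ind (B k) (x i)) * kernel_det K n x) / fact n) ----> (\<Sum>n. fredholm_term A K n)"
  unfolding fredholm_term_eq using psd_diag(2)[OF psd] by (intro FL(2)) (auto simp: B_def indicator_def)
 then have "(\<Sum>n. fredholm_term A K n) = of_real (measure P {a : space P. npts A (X a) = 0})" using l1 unfolding eq by (rule LIMSEQ_unique)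
 with s show ?thesis by (simp add: sums_iff)
qed

lemma set_integrable_kernel_det:
 "set_integrable (lborel_pow r) ({..<r} \<rightarrow>\<^sub>E A) (kernel_det K r)"
proof -
 have "integrable lborel (%z. norm (ind A z :: complex) * Re (K z z))"
  unfolding norm_indicator_mult by (rule int[unfolded set_integrable_def])
 then have "integrable (lborel_pow r) (%x. (PROD i<r. ind A (x i)) * kernel_det K r x)"
  by (intro integral_prod_kernel_det[OF psd det_meas_det[OF D]]) auto
 also have "?this \<longleftrightarrow> integrable (lborel_pow r) (%x. ind ({..<r} \<rightarrow>\<^sub>E A) x *\<^sub>R kernel_det K r x)"
  by (intro Bochner_Integration.integrable_cong refl) (simp only: prod_indicator_PiE scaleR_conv_of_real)
 finally show ?thesis unfolding set_integrable_def .
qed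

text \<open>On each bounded part of A the expected count is the integral of the first correlation
  function, hence at most the trace L on all of A. Monotone convergence removes the
  boundedness.\<close>

lemma nn_integral_npts:
 "(nni P (%a. npts A (X a))) < \<infinity>"
proof -
 let ?G = "%B n. nni P (%a. npts (B n) (X a))"
 let ?F = "%a B n. card (X a Int B n)"
 let ?E = "%B n. LINT x|lborel_pow 1. (PROD i<1. ind (B n) (x i)) * kernel_det K 1 x"
 have pp: "point_process P X" using D by (simp add: determinantal_def)
 interpret prob_space P using pp by (simp add: point_process_def)
 have X[measurable]: "X : P \<rightarrow>\<^sub>M config_space" using pp by (simp add: point_process_def)
 interpret product_sigma_finite "%_::nat. lborel :: plane measure" ..
 define B where "B = (%n. A Int cball 0 (real n))"
 have B: "B n : sets borel" "bounded (B n)" for n by (auto simp: B_def)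
 note [measurable] = B(1)
 have [measurable]: "npts C : bmeas config_space" if "C : sets borel" for C by (rule measurable_npts[OF that])
 define L where "L = (LINT z|lborel. ind A z *\<^sub>R Re (K z z))"
 have 1: "(?G B n) <= ennreal L" for n
 proof -
  have H: "hbi P (%a. SUM x:distinct_tuples 1 (X a Int B n). PROD i<1. ind (B n) (x i) :: complex)
   (?E B n)" by (rule correlation_tsum[OF D B(2), where C=1]) (auto simp: indicator_def)
  have c: "(SUM x:distinct_tuples 1 (X a Int B n). PROD i<1. ind (B n) (x i) :: complex) = of_real (real (?F a B n))"
   if w: "a : space P" for a
  proof -
   have fin: "finite (X a Int B n)" by (rule point_process_finite[OF pp B(2) w])
   have "{T. T \<subseteq> X a Int B n & card T = 1} = (%x. {x}) ` (X a Int B n)" by (auto simp: card_1_singleton_iff)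
   then show ?thesis using sum_distinct_tuples[OF fin, where n = 1 and g = "ind (B n)"] by (simp add: sum.reindex)
  qed
  have H2: "integrable P (%a. real (?F a B n))" "cor (LINT a|P. real (?F a B n)) = (?E B n)"
  proof -
   have "hbi P (%a. cor (real (?F a B n))) (?E B n)"
    using H c by (subst has_bochner_integral_cong[OF refl _ refl, symmetric]) auto
   then show "integrable P (%a. real (?F a B n))" "cor (LINT a|P. real (?F a B n)) = (?E B n)"
    unfolding hbi_iff integral_complex_of_real using complex_of_real_integrable_eq[of P "%a. real (?F a B n)"] by auto
  qed
  have iB: "integrable lborel (%z. norm (ind (B n) z :: complex) * Re (K z z))"
   using loc[OF B] unfolding set_integrable_def norm_indicator_mult .
  have "norm (?E B n) <= (LINT z|lborel. norm (ind (B n) z :: complex) * Re (K z z)) ^ 1"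
   using iB by (intro integral_prod_kernel_det(2)[OF psd det_meas_det[OF D]]) auto
  also have "... <= L" unfolding L_def power_one_right using psd_diag(2)[OF psd]
   by (intro integral_mono iB int[unfolded set_integrable_def]) (auto simp: indicator_def B_def)
  finally have "(LINT a|P. real (?F a B n)) <= L" unfolding H2(2)[symmetric] norm_of_real by (simp add: abs_le_iff)
  moreover have "(?G B n) = (nni P (%a. ennreal (real (?F a B n))))"
   by (intro nn_integral_cong) (simp add: npts_eq_card[OF point_process_finite[OF pp B(2)]] ennreal_of_nat_eq_real_of_nat)
  ultimately show ?thesis using H2(1) by (simp add: nn_integral_eq_integral ennreal_leI)
 qed
 have "(nni P (%a. npts A (X a))) = (nni P (%a. (SUP n. npts (B n) (X a))))" unfolding B_def by (simp add: npts_SUP[symmetric])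
 also have "... = (SUP n. nni P (%a. npts (B n) (X a)))"
 proof (rule nn_integral_monotone_convergence_SUP)
  show "incseq (%n a. npts (B n) (X a))" unfolding incseq_def le_fun_def npts_def B_def by (auto intro!: emeasure_mono)
 qed measurable
 also have "... <= ennreal L" using 1 by (intro SUP_least)
 finally show ?thesis by (rule le_less_trans) simp
qed

end

section \<open>Gaussian, exponential and Poisson integrals\<close>

lemma hbi_gauss:
 fixes a m :: real assumes "a > 0" shows "hbi lborel (%x. exp (- a * (x - m)^2)) (sqrt (pi / a))"
proof -
 define s where "s = 1 / sqrt (2 * a)"
 have s: "s > 0" "2 * s^2 = 1 / a" using assms by (auto simp: s_def power_divide)
 have e: "normal_density m s x = (1 / sqrt (pi / a)) * exp (- a * (x - m)^2)" for x
 proof -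
  have "2 * pi * s^2 = pi * (2 * s^2)" by simp
  then have "2 * pi * s^2 = pi / a" unfolding s(2) by simp
  moreover have "- ((x - m)^2) / (2 * s^2) = - a * (x - m)^2" unfolding s(2) by simp
  ultimately show ?thesis by (simp add: normal_density_def)
 qed
 have "hbi lborel (%x. sqrt (pi / a) * normal_density m s x) (sqrt (pi / a) * 1)"
  using s(1) by (intro hbi_mult) (simp add: hbi_iff)
 then show ?thesis using assms by (simp add: e)
qed

lemma has_bochner_integral_exp_tail:
 fixes k t :: real assumes k: "k > 0" shows "hbi lborel (%x. ind {t<..} x * exp (- k * x)) (exp (- k * t) / k)"
proof -
 let ?A = "nni lborel (%x. ennreal (exp (- k * x)) * ind {t..} x)"
 have "?A = ennreal (0 - (- exp (- k * t) / k))"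
 proof (rule nn_integral_FTC_atLeast)
  show "((%x. - exp (- k * x) / k) has_real_derivative exp (- k * x)) (at x)" for x
   using k by (auto intro!: derivative_eq_intros simp: field_simps)
  have "filterlim (%x. k * x) at_top at_top"
   using k by (intro filterlim_tendsto_pos_mult_at_top[OF tendsto_const]) (auto simp: filterlim_ident)
  then have "((%x. exp (- (k * x))) ---> 0) at_top"
   by (intro filterlim_compose[OF exp_at_bot]) (simp add: filterlim_uminus_at_top)
  then have "((%x. - exp (- (k * x)) / k) ---> - 0 / k) at_top"
   by (intro tendsto_divide tendsto_minus tendsto_const) (use k in auto)
  then show "((%x. - exp (- k * x) / k) ---> 0) at_top" by simp
 qed auto
 also have "?A = (nni lborel (%x. ennreal (ind {t<..} x * exp (- k * x))))"
 proof (rule nn_integral_cong_AE)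
  have "AE x in lborel. x ~= t" by (rule AE_lborel_singleton)
  then show "AE x in lborel. ennreal (exp (- k * x)) * ind {t..} x = ennreal (ind {t<..} x * exp (- k * x))"
   by eventually_elim (auto simp: indicator_def)
 qed
 finally show ?thesis using k by (intro has_bochner_integral_nn_integral) auto
qed

lemma has_bochner_integral_product:
 fixes f g :: "real => real" assumes f: "hbi lborel f A" and g: "hbi lborel g B"
 shows "hbi (lborel :: plane measure) (%z. f (fst z) * g (snd z)) (A * B)"
proof -
 let ?C = "lborel \<Otimes>\<^sub>M lborel"
 have i: "integrable lborel f" "integrable lborel g" and e: "integral\<^sup>L lborel f = A" "integral\<^sup>L lborel g = B"
  using assms by (auto simp: hbi_iff)
 have [measurable]: "f : bmeas borel" "g : bmeas borel" using i by auto
 have int: "integrable ?C (%z. f (fst z) * g (snd z))"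
 proof (rule lborel_pair.Fubini_integrable)
  show "(%z. f (fst z) * g (snd z)) : bmeas ?C" by measurable
  show "integrable lborel (%x. LINT y|lborel. norm (f (fst (x, y)) * g (snd (x, y))))" using i by (simp add: abs_mult)
  show "AE x in lborel. integrable lborel (%y. f (fst (x, y)) * g (snd (x, y)))" using i by simp
 qed
 have "(LINT z|?C. f (fst z) * g (snd z)) = (LINT x|lborel. LINT y|lborel. f x * g y)" using lborel_pair.integral_fst'[OF int] by simp
 also have "... = A * B" by (simp add: e)
 finally show ?thesis using int by (simp add: hbi_iff lborel_prod)
qed

text \<open>The factor pi^(-1/2) normalises the Gaussian in the second coordinate, which leaves the
  exponential tail in the first. This mass is the inner exponent of the Gumbel distribution.\<close>

lemma hbi_poisson:
 "hbi lborel (%z. ind (right_of t) z * pint z) (exp (- t))"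
proof -
 have "hbi (lborel :: plane measure)
  (%z. (ind {t<..} (fst z) * exp (- 1 * fst z)) * (pi powr (-1/2) * exp (- 1 * (snd z - 0)^2)))
  ((exp (- 1 * t) / 1) * (pi powr (-1/2) * sqrt (pi / 1)))"
  by (intro has_bochner_integral_product[where f="%x. ind {t<..} x * exp (- 1 * x)"
    and g="%y. pi powr (-1/2) * exp (- 1 * (y - 0)^2)"]
    has_bochner_integral_exp_tail hbi_mult hbi_gauss) auto
 moreover have "(ind {t<..} (fst z) * exp (- 1 * fst z)) * (pi powr (-1/2) * exp (- 1 * (snd z - 0)^2)) =
  ind (right_of t) z * pint z" for z
 proof (cases z)
  case (Pair x y)
  have "exp (- x - y^2) = exp (- x) * exp (- (y^2))" by (simp add: mult_exp_exp)
  moreover have "ind (right_of t) z = (ind {t<..} x :: real)" by (simp add: Pair right_of_def indicator_def)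
  ultimately show ?thesis by (simp only: Pair poisson_intensity_def prod.case fst_conv snd_conv mult_minus_left mult_1 diff_0_right)
    (simp only: mult_ac)
 qed
 moreover have "pi powr (-1/2) * sqrt (pi / 1) = 1" by (simp add: powr_half_sqrt[symmetric] powr_add[symmetric])
 ultimately show ?thesis by simp
qed

lemma right_of_borel [measurable]: "right_of t : sets borel" unfolding right_of_def by (intro borel_open open_Times) auto

text \<open>Inverts the characteristic function of a Poisson variable: the expanded exponential has
  the frequencies j - m with Poisson weights, and orthogonality keeps only j = m.\<close>

lemma circle_poisson:
 fixes L :: real shows "(LINT t|circ. exp (- \<i> * of_real t * of_nat m) * exp ((exp (\<i> * of_real t) - 1) * of_real L)) =
  of_real (exp (- L) * L ^ m / fact m)"
proof -
 let ?C = "%t. (exp (\<i> * of_real t) - 1) * of_real L"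
 let ?A = "%t. - \<i> * of_real t * of_nat m"
 interpret prob_space circ by (rule prob_space_circ)
 define f where "f = (%j t. of_real (exp (- L) * L ^ j / fact j) * exp (\<i> * of_real t * of_int (int j - int m)))"
 have nf: "norm (f j t) = exp (- L) * \<bar>L\<bar> ^ j / fact j" for j t unfolding f_def norm_mult norm_of_real by (simp add: abs_mult power_abs)
 have int: "integrable circ (f j)" for j
  by (rule integrable_const_bound[where B="exp (- L) * \<bar>L\<bar> ^ j / fact j"]) (auto simp: nf, auto simp: f_def)
 have s: "summable (%j. exp (- L) * \<bar>L\<bar> ^ j / fact j)"
  using summable_mult[OF summable_exp_generic[of "\<bar>L\<bar>"], of "exp (- L)"] by (simp add: field_simps)
 have sums: "(%j. f j t) sums (exp (?A t) * exp (?C t))" for t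
 proof -
  let ?w = "exp (\<i> * of_real t) * of_real L"
  have "(%j. (exp (?A t) * exp (- of_real L)) * (?w ^ j /\<^sub>R fact j)) sums ((exp (?A t) * exp (- of_real L)) * exp ?w)"
   by (intro sums_mult exp_converges)
  moreover have "(exp (?A t) * exp (- of_real L)) * (?w ^ j /\<^sub>R fact j) = f j t" for j
  proof -
   have "exp (\<i> * of_real t * of_int (int j - int m)) = exp (?A t) * exp (\<i> * of_real t) ^ j"
    by (simp add: exp_of_nat_mult[symmetric] exp_add[symmetric] algebra_simps)
   moreover have "exp (- cor L) = of_real (exp (- L))" using exp_of_real[of "- L", where 'a=complex] by simp
   ultimately show ?thesis by (simp add: f_def scaleR_conv_of_real power_mult_distrib field_simps)
  qed
  moreover have "(exp (?A t) * exp (- of_real L)) * exp ?w = exp (?A t) * exp (?C t)" by (simp add: exp_add[symmetric] algebra_simps)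
  ultimately show ?thesis by (simp only:)
 qed
 have "(%j. integral\<^sup>L circ (f j)) sums (LINT t|circ. (\<Sum>j. f j t))"
  using s by (intro sums_integral int) (auto simp: nf prob_space)
 also have "(%t. \<Sum>j. f j t) = (%t. exp (?A t) * exp (?C t))" using sums by (simp add: sums_iff)
 also have "(%j. integral\<^sup>L circ (f j)) = (%j. if j = m then of_real (exp (- L) * L ^ j / fact j) else 0)"
  unfolding f_def by (subst integral_mult_right_zero, subst integral_circle_exp) (auto simp: fun_eq_iff)
 finally show ?thesis using sums_single[of m "%j. of_real (exp (- L) * L ^ j / fact j)"] sums_unique2 by blast
qed

text \<open>Reduces limits in a real parameter to sequences, to which the series limit applies.
  Domination of the kernels holds only eventually; dropping an initial segment of the sequence makes
  it hold at every index.\<close>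

lemma tendsto_at_top_sequence:
 fixes f :: "real => 'a :: first_countable_topology" assumes Q: "eventually Q at_top"
  and lim: "!!X. filterlim X at_top sequentially ==> (!!k. Q (X k)) ==> (%k::nat. f (X k)) ----> y"
 shows "(f ---> y) at_top"
proof (rule tendsto_at_topI_sequentially)
 fix X :: "nat => real" assume X: "filterlim X at_top sequentially"
 then have "eventually (%k. Q (X k)) sequentially" using Q by (rule eventually_compose_filterlim[rotated])
 then obtain N where N: "!!k. k >= N ==> Q (X k)" by (auto simp: eventually_sequentially)
 have "(%k. f (X (k + N))) ----> y"
  by (rule lim[of "%k. X (k + N)"]) (use X N in \<open>auto intro: filterlim_compose[OF X filterlim_add_const_nat_at_top]\<close>)
 then show "(%k. f (X k)) ----> y" by (rule LIMSEQ_offset)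
qed

text \<open>With product correlation functions the Fredholm series is an exponential series, the
  generating functional of a Poisson process.\<close>

lemma prod_intensity_series:
 fixes g :: "plane => complex" assumes "integrable lborel (%z. g z * of_real (l z))"
 shows "(\<Sum>n. (LINT x|lborel_pow n. (PROD i<n. g (x i)) * (PROD i<n. of_real (l (x i)))) / fact n) = exp (LINT z|lborel. g z * of_real (l z))"
proof -
 let ?A = "LINT z|lborel. g z * of_real (l z)"
 interpret product_sigma_finite "%_::nat. lborel :: plane measure" ..
 have "(LINT x|lborel_pow n. (PROD i<n. g (x i)) * (PROD i<n. of_real (l (x i)))) = ?A ^ n" for n
  unfolding prod.distrib[symmetric] using assms by (subst product_integral_prod) auto
 moreover have "?A ^ n / fact n = ?A ^ n /\<^sub>R fact n" for n by (simp add: scaleR_conv_of_real field_simps)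
 ultimately show ?thesis by (simp add: exp_def)
qed

section \<open>The rescaled process: both limit theorems from kernel asymptotics\<close>

lemma scales_pos: assumes "s > 1" shows "a_scale s > 0" "b_scale s > 0" using assms by (auto simp: a_scale_def b_scale_def)

definition skern :: "(real => kernel) => real => kernel" where
 "skern K s = strk (a_scale s) (b_scale s) (c_shift s) (K s)"

definition unscale :: "real => plane => plane" where
 "unscale s = (%(x, y). ((x - c_shift s) / a_scale s, y / b_scale s))"

lemma measurable_unscale [measurable]: "unscale s : borel \<rightarrow>\<^sub>M borel"
 unfolding unscale_def case_prod_beta by (cases "a_scale s = 0"; cases "b_scale s = 0")
  (auto intro!: borel_measurable_continuous_onI continuous_intros)

lemma unscale_stre: assumes "s > 1" shows "unscale s (stre (a_scale s) (b_scale s) (c_shift s) z) = z"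
  "stre (a_scale s) (b_scale s) (c_shift s) (unscale s z) = z"
 using scales_pos[OF assms] by (auto simp: unscale_def stre_def[OF scales_pos[OF assms]] split: prod.split)

lemma card_rescale: assumes "s > 1" shows "npts A (rescale s S) = npts (unscale s -` A) S"
proof -
 have inj: "inj (unscale s)" using unscale_stre(2)[OF assms] by (metis injI)
 have "rescale s S Int A = unscale s ` (S Int unscale s -` A)" by (auto simp: rescale_def unscale_def[symmetric])
 moreover have "inj_on (unscale s) (S Int unscale s -` A)" using inj by (rule inj_on_subset) simp
 ultimately show ?thesis by (simp add: npts_def emeasure_count_space finite_image_iff card_image)
qed

lemma bounded_vimage_unscale: assumes "a > 1" "bounded A" shows "bounded (unscale a -` A)"
proof -
 note p = scales_pos[OF assms(1)]
 let ?s = "stre (a_scale a) (b_scale a) (c_shift a)"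
 obtain R where R: "!!z. z : A ==> norm z <= R" using assms(2) by (auto simp: bounded_iff)
 have "norm (?s z) <= (\<bar>c_shift a\<bar> + a_scale a * R) + b_scale a * R" if "z : A" for z
 proof -
  obtain x y where z: "z = (x, y)" by (cases z)
  have "\<bar>x\<bar> <= R" "\<bar>y\<bar> <= R" using R[OF that] norm_fst_le[of x y] norm_snd_le[of y x] by (auto simp: z)
  then have "\<bar>c_shift a + a_scale a * x\<bar> <= \<bar>c_shift a\<bar> + a_scale a * R" "\<bar>b_scale a * y\<bar> <= b_scale a * R"
   using p by (auto simp: abs_mult intro!: order_trans[OF abs_triangle_ineq] mult_left_mono)
  then show ?thesis using norm_Pair_le[of "c_shift a + a_scale a * x" "b_scale a * y"] by (simp add: z stre_def[OF p])
 qed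
 then have "bounded (?s ` A)" unfolding bounded_iff by blast
 moreover have "unscale a -` A \<subseteq> ?s ` A" using unscale_stre(2)[OF assms(1)] by (metis image_eqI subsetI vimageE)
 ultimately show ?thesis by (rule bounded_subset)
qed

text \<open>The hypothesis \<open>off\<close> is restricted to different second coordinates. For
  equal ones the phase does not rotate along the half-line, and the modulus of the rescaled kernel
  tends to a positive limit.\<close>

context
 fixes K :: "real => kernel" and P :: "real => 'a measure" and Z :: "real => 'a => plane set"
 assumes D: "!!\<sigma>. \<sigma> >= 0 ==> determinantal (P \<sigma>) (Z \<sigma>) (K \<sigma>)"
  and psd: "!!\<sigma>. \<sigma> >= 0 ==> psd_kernel (K \<sigma>)"
  and loc: "!!\<sigma> A. \<sigma> >= 0 ==> A : sets borel ==> bounded A ==> set_integrable lborel A (%z. Re (K \<sigma> z z))"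
  and right: "!!\<sigma> t. \<sigma> >= 0 ==> set_integrable lborel (right_of t) (%z. Re (K \<sigma> z z))"
  and diag: "!!z. ((%\<sigma>. skern K \<sigma> z z) ---> of_real (pint z)) at_top"
  and off: "!!z w. snd z ~= snd w ==> ((%\<sigma>. skern K \<sigma> z w) ---> 0) at_top"
  and dom: "!!t. EX w. set_integrable lborel (right_of t) w & eventually (%\<sigma>. ALL z:right_of t. Re (skern K \<sigma> z z) <= w z) at_top"
begin

text \<open>The change of variables moves the scaling from the test function into the kernel. Almost
  everywhere the determinants then converge to products of intensities, and the limiting series is
  an exponential.\<close>

lemma scaled_series_limit:
 fixes g :: "plane => complex" assumes g[measurable]: "g : bmeas borel" and gb: "!!z. norm (g z) <= 2"
  and g0: "!!z. z ~: right_of t ==> g z = 0" and w: "set_integrable lborel (right_of t) w"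
  and X: "filterlim X at_top sequentially"
  and Xw: "!!k. X k > 1" "!!k z. z : right_of t ==> Re (skern K (X k) z z) <= w z"
 shows "(%k. \<Sum>n. (LINT x|lborel_pow n. (PROD i<n. g (unscale (X k) (x i))) * kernel_det (K (X k)) n x) / fact n)
  ----> exp (LINT z|lborel. g z * of_real (pint z))"
proof -
 let ?B = "%z. ind (right_of t) z *\<^sub>R w z"
 let ?A = "%n k. LINT x|lborel_pow n. (PROD i<n. g (x i)) * kernel_det (skern K (X k)) n x"
 interpret product_sigma_finite "%_::nat. lborel :: plane measure" ..
 have X0: "X k >= 0" for k using Xw(1)[of k] by simp
 note p = scales_pos[OF Xw(1)]
 have psd': "psd_kernel (skern K (X k))" for k unfolding skern_def by (rule psd_strk[OF p psd[OF X0]])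
 have mK: "kernel_det (K (X k)) n : bmeas (lborel_pow n)" for k n by (rule det_meas_det[OF D[OF X0]])
 have m: "kernel_det (skern K (X k)) n : bmeas (lborel_pow n)" for k n
  unfolding skern_def by (rule measurable_strk_det[OF p mK])
 have eq: "(LINT x|lborel_pow n. (PROD i<n. g (unscale (X k) (x i))) * kernel_det (K (X k)) n x) = (?A n k)" for n k unfolding skern_def
  by (subst integral_lborel_pow_stre[where a="a_scale (X k)" and b="b_scale (X k)" and c="c_shift (X k)", OF p mK])
   (simp_all add: unscale_stre[OF Xw(1)])
 have [measurable]: "(%z. cor (pint z)) : bmeas borel" unfolding poisson_intensity_def case_prod_beta
  by (intro borel_measurable_continuous_onI continuous_intros)
 have ig: "integrable lborel (%z. g z * of_real (pint z))"
 proof (rule integrable_le)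
  show "integrable lborel (%z. 2 * (ind (right_of t) z * pint z))"
   using hbi_poisson[of t] by (auto simp: hbi_iff)
  have "pint z >= 0" for z by (simp add: poisson_intensity_def case_prod_beta)
  then show "AE z in lborel. norm (g z * of_real (pint z)) <= norm (2 * (ind (right_of t) z * pint z))"
   using gb g0 by (intro AE_I2) (auto simp: norm_mult indicator_def abs_mult mult_right_mono)
 qed simp
 have "(%k. \<Sum>n. (?A n k) / fact n) ---->
   (\<Sum>n. (LINT x|lborel_pow n. (PROD i<n. g (x i)) * (PROD i<n. of_real (pint (x i)))) / fact n)"
 proof (rule functional_limit(2)[where w="%z. 2 * (?B z)", OF psd' m])
  show "integrable lborel (%z. 2 * (?B z))" using w unfolding set_integrable_def by simp
  show "norm (g z) * Re (skern K (X k) z z) <= 2 * (?B z)" for k z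
  proof (cases "z : right_of t")
   case True
   then show ?thesis using gb[of z] Xw(2)[OF True, of k] psd_diag(2)[OF psd'[of k], of z] by (simp add: mult_mono)
  qed (simp add: g0)
  show "AE x in lborel_pow n. (%k. kernel_det (skern K (X k)) n x) ----> (PROD i<n. of_real (pint (x i)))" for n
   using AE_snd_distinct[of n]
  proof eventually_elim
   case (elim x)
   then show ?case
    by (intro kernel_det_tendsto_prod[where l="%z. of_real (pint z)"] filterlim_compose[OF diag X] filterlim_compose[OF off X]) auto
  qed
 qed auto
 then show ?thesis unfolding eq prod_intensity_series[OF ig] .
qed

text \<open>Weak convergence speaks of bounded sets only and cannot control a half plane. The void
  probability of the half plane is itself a Fredholm series, so the series limit applies directly;
  the exponent in the limit is minus the Poisson mass of the half plane.\<close>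

theorem rescaled_last_particle:
 "((%s. last_particle_cdf (P s) (Z s) (c_shift s + a_scale s * t)) ---> gumbel_cdf t) at_top"
proof -
 let ?A = "%z. ind (right_of t) z * pint z"
 obtain w where w: "set_integrable lborel (right_of t) w"
  "eventually (%s. ALL z:right_of t. Re (skern K s z z) <= w z) at_top" using dom by blast
 let ?F = "%s. last_particle_cdf (P s) (Z s) (c_shift s + a_scale s * t)"
 have "((%s. cor (?F s)) ---> of_real (gumbel_cdf t)) at_top"
 proof (rule tendsto_at_top_sequence)
  show "eventually (%s. s > 1 & (ALL z:right_of t. Re (skern K s z z) <= w z)) at_top"
   using w(2) eventually_gt_at_top[of 1] by eventually_elim auto
  fix X :: "nat => real"
  assume X: "filterlim X at_top sequentially" and Xw: "!!k. X k > 1 & (ALL z:right_of t. Re (skern K (X k) z z) <= w z)"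
  let ?g = "%z. - ind (right_of t) z :: complex"
  have lim: "(%k. \<Sum>n. (LINT x|lborel_pow n. (PROD i<n. ?g (unscale (X k) (x i))) * kernel_det (K (X k)) n x) / fact n)
  ----> exp (LINT z|lborel. ?g z * of_real (pint z))"
   by (rule scaled_series_limit[OF _ _ _ w(1) X]) (use Xw in \<open>auto simp: indicator_def\<close>)
  have "(\<Sum>n. (LINT x|lborel_pow n. (PROD i<n. ?g (unscale (X k) (x i))) * kernel_det (K (X k)) n x) / fact n) = of_real (?F (X k))" for k
  proof -
   have X1: "X k > 1" and X0: "X k >= 0" using Xw[of k] by auto
   have i: "ind (right_of t) (unscale (X k) z) = (ind (right_of (c_shift (X k) + a_scale (X k) * t)) z :: complex)" for z
    using scales_pos[OF X1] by (cases z) (auto simp: indicator_def right_of_def unscale_def field_simps)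
   show ?thesis unfolding i fredholm_term_eq[symmetric] last_particle_cdf_def
    using void_probability[OF D[OF X0] psd[OF X0] loc[OF X0] right_of_borel right[OF X0], of "c_shift (X k) + a_scale (X k) * t"]
    by (simp add: sums_iff)
  qed
  moreover have "(LINT z|lborel. ?g z * of_real (pint z)) = of_real (- exp (- t))"
  proof -
   have "(LINT z|lborel. ?g z * of_real (pint z)) = (LINT z|lborel. of_real (- (?A z)))"
    by (intro integral_eq) (auto simp: indicator_def)
   also have "... = of_real (LINT z|lborel. - (?A z))" by (rule integral_complex_of_real)
   also have "(LINT z|lborel. - (?A z)) = - exp (- t)" using hbi_poisson[of t] by (simp add: hbi_iff)
   finally show ?thesis .
  qed
  moreover have "exp (cor (- exp (- t))) = of_real (gumbel_cdf t)" by (simp add: gumbel_cdf_def exp_of_real[symmetric])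
  ultimately show "(%k. cor (?F (X k))) ----> of_real (gumbel_cdf t)" using lim by (simp only:)
 qed
 then show ?thesis by (simp add: tendsto_of_real_iff)
qed

text \<open>The characteristic functions of the counts converge to a product of Poisson ones.
  Inverting on the torus, an integral over a product, gives the product of Poisson
  probabilities.\<close>

theorem rescaled_poisson: assumes Q: "poisson_process Q Z\<^sub>P pint"
 shows "converges_weakly P (%s b. rescale s (Z s b)) at_top Q Z\<^sub>P" unfolding converges_weakly_def
proof (intro allI impI)
 let ?J = "%A i t. %z. ind (A i) z * (ind (right_of t) z * pint z)"
 let ?H = "%g a. LINT z|lborel. g a z * of_real (pint z)"
 let ?G = "%t m i. - \<i> * of_real t * of_nat (m i)"
 let ?F = "%a i. exp (\<i> * of_real (a i)) - 1"
 let ?E = "%t. exp (\<i> * of_real t) - 1"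
 let ?C = "%n m L. LINT t|PiM {..<n} (%_. circ). (PROD i:{..<n}. exp (- \<i> * of_real (t i) * of_nat (m i))) * (PROD i<n. exp ((exp (\<i> * of_real (t i)) - 1) * of_real (L i)))"
 fix n A m assume A: "bounded_disjoint_borel n A"
 then have Ab: "!!i. i < n ==> A i : sets borel" "!!i. i < n ==> bounded (A i)" and dis: "disjoint_family_on A {..<n}"
  by (auto simp: bounded_disjoint_borel_def)
 have "bounded (\<Union>i<n. A i)" using Ab by auto
 then obtain R where R: "!!z. z : (\<Union>i<n. A i) ==> norm z <= R" by (auto simp: bounded_iff)
 \<comment> \<open>All sets lie in one half plane, where a majorant for the diagonal is
   available.\<close>
 define t where "t = - R - 1"
 have sub: "z : right_of t" if "i < n" "z : A i" for z i
 proof -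
  have "norm z <= R" using that by (intro R) auto
  then have "\<bar>fst z\<bar> <= R" using norm_fst_le[of "fst z" "snd z"] by simp
  then show ?thesis by (cases z) (auto simp: right_of_def t_def)
 qed
 define L where "L = (%i. LINT z:A i|lborel. pint z)"
 have iL: "integrable lborel (%z. ind (A i) z * pint z)" if "i < n" for i
 proof -
  have "integrable lborel (?J A i t)"
   using hbi_poisson[of t] integrable_mult_indicator[of "A i" lborel "%z. ind (right_of t) z * pint z"] Ab that
   by (auto simp: hbi_iff)
  also have "(?J A i t) = (%z. ind (A i) z * pint z)" using sub[OF that] by (auto simp: indicator_def fun_eq_iff)
  finally show ?thesis .
 qed
 have tgt: "counts_prob Q Z\<^sub>P n A m = (PROD i<n. exp (- L i) * L i ^ m i / fact (m i))" using Q A unfolding poisson_process_def L_def by blast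
 obtain w where w: "set_integrable lborel (right_of t) w"
  "eventually (%s. ALL z:right_of t. Re (skern K s z z) <= w z) at_top" using dom by blast
 let ?c = "%s. counts_prob (P s) (%b. rescale s (Z s b)) n A m"
 have "((%s. cor (?c s)) ---> of_real (counts_prob Q Z\<^sub>P n A m)) at_top"
 proof (rule tendsto_at_top_sequence)
  show "eventually (%s. s > 1 & (ALL z:right_of t. Re (skern K s z z) <= w z)) at_top"
   using w(2) eventually_gt_at_top[of 1] by eventually_elim auto
  fix X :: "nat => real"
  assume X: "filterlim X at_top sequentially" and Xw: "!!k. X k > 1 & (ALL z:right_of t. Re (skern K (X k) z z) <= w z)"
  have X1: "X k > 1" and X0: "X k >= 0" for k using Xw[of k] by auto
  define B where "B = (%k i. unscale (X k) -` A i)"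
  have B: "B k i : sets borel" "bounded (B k i)" if "i < n" for k i
   using that measurable_sets[OF measurable_unscale, of "A i" "X k"] bounded_vimage_unscale[OF X1] Ab by (auto simp: B_def)
  have pp: "point_process (P (X k)) (Z (X k))" and ps: "prob_space (P (X k))" for k using D[OF X0] by (auto simp: determinantal_def point_process_def)
  define N where "N = (%k i b. card (Z (X k) b Int B k i))"
  define g where "g = (%a z. (PROD i<n. exp (\<i> * of_real (a i) * of_bool (z : A i))) - 1 :: complex)"
  have c: "?c (X k) = measure (P (X k)) {b : space (P (X k)). ALL i:{..<n}. N k i b = m i}" for k
  proof -
   have "npts (A i) (rescale (X k) (Z (X k) b)) = of_nat (N k i b)" if "b : space (P (X k))" "i < n" for i b
    unfolding card_rescale[OF X1] B_def[symmetric] N_def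
    using npts_eq_card[OF point_process_finite[OF pp B(2)[OF that(2)] that(1)]] by (simp add: B_def)
   then show ?thesis unfolding counts_prob_def by (intro arg_cong[where f="measure _"]) auto
  qed
  \<comment> \<open>By disjointness at most one phase differs from 1, so the product minus 1 is a
    sum over the sets. Its integral against the intensity splits accordingly, which makes the
    limiting counts independent.\<close>
  have g_eq: "g a z = (SUM i<n. (?F a i) * ind (A i) z)" for a z
  proof (cases "EX i<n. z : A i")
   case True
   then obtain i where i: "i < n" "z : A i" by blast
   have u: "z : A j \<longleftrightarrow> j = i" if "j < n" for j using disjoint_family_onD[OF dis, of i j] i that by blast
   have "(PROD j<n. exp (\<i> * of_real (a j) * of_bool (z : A j))) = (PROD j<n. if j = i then exp (\<i> * of_real (a i)) else 1)"
    by (intro prod.cong) (auto simp: u)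
   moreover have "(SUM j<n. (exp (\<i> * of_real (a j)) - 1) * ind (A j) z) = (SUM j<n. if j = i then exp (\<i> * of_real (a i)) - 1 else 0)"
    by (intro sum.cong) (auto simp: indicator_def u)
   ultimately show ?thesis using i by (simp add: g_def)
  qed (auto simp: g_def intro!: sum.neutral[symmetric])
  have [measurable]: "g a : bmeas borel" for a unfolding g_eq[abs_def] using Ab by measurable
  have lim: "(%k. LINT b|P (X k). (PROD i:{..<n}. exp (\<i> * of_real (a i) * of_nat (N k i b)))) ----> (PROD i<n. exp ((?F a i) * of_real (L i)))" for a
  proof -
   have gb: "norm (g a z) <= 2" for z
   proof -
    have "norm (PROD i<n. exp (\<i> * of_real (a i) * of_bool (z : A i))) = 1"
     by (auto simp: prod_norm[symmetric] of_bool_def intro!: prod.neutral)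
    then show ?thesis unfolding g_def by (intro order_trans[OF norm_triangle_ineq4]) simp
   qed
   have g0: "g a z = 0" if "z ~: right_of t" for z
   proof -
    have "z ~: A i" if "i < n" for i using sub[OF that] \<open>z ~: right_of t\<close> by blast
    then show ?thesis by (simp add: g_eq)
   qed
   have "(%k. \<Sum>l. (LINT x|lborel_pow l. (PROD i<l. g a (unscale (X k) (x i))) * kernel_det (K (X k)) l x) / fact l)
  ----> exp (?H g a)" by (rule scaled_series_limit[OF _ gb g0 w(1) X]) (use Xw in auto)
   moreover have "(\<Sum>l. (LINT x|lborel_pow l. (PROD i<l. g a (unscale (X k) (x i))) * kernel_det (K (X k)) l x) / fact l) =
    (LINT b|P (X k). (PROD i:{..<n}. exp (\<i> * of_real (a i) * of_nat (N k i b))))" for k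
    using counts_functional[OF D[OF X0] psd[OF X0] loc[OF X0], where I="{..<n}" and A="B k" and t=a] B by (simp add: sums_iff g_def B_def N_def)
   moreover have "(?H g a) = (SUM i<n. (?F a i) * of_real (L i))"
   proof -
    have "(?H g a) = (LINT z|lborel. (SUM i<n. (?F a i) * of_real (ind (A i) z * pint z)))"
    proof -
     have "(ind (A i) z :: complex) = of_real (ind (A i) z)" for i z by (simp add: indicator_def)
     then show ?thesis unfolding g_eq sum_distrib_right of_real_mult by (simp only: mult.assoc)
    qed
    also have "... = (SUM i<n. LINT z|lborel. (?F a i) * of_real (ind (A i) z * pint z))"
     using iL by (intro Bochner_Integration.integral_sum integrable_mult_right integrable_of_real) auto
    also have "... = (SUM i<n. (?F a i) * of_real (L i))" unfolding L_def set_lebesgue_integral_def real_scaleR_def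
     by (intro sum.cong refl) (subst integral_mult_right_zero, subst integral_complex_of_real, rule refl)
    finally show ?thesis .
   qed
   ultimately show ?thesis by (simp add: exp_sum)
  qed
  have "(%k. of_real (measure (P (X k)) {b : space (P (X k)). ALL i:{..<n}. N k i b = m i})) ---->
   (?C n m L)" using B by (intro counts_limit ps lim) (auto simp: N_def intro!: measurable_card_points pp)
  also have "(?C n m L) = (PROD i<n. LINT t|circ. exp (?G t m i) * exp ((?E t) * of_real (L i)))"
  proof -
   interpret c: prob_space circ by (rule prob_space_circ)
   interpret pr: product_sigma_finite "%_::nat. circ" ..
   have "norm (exp (?G t m i) * exp ((?E t) * of_real (L i))) <= exp (2 * \<bar>L i\<bar>)" for t i
   proof -
    have n1: "norm (exp (?G t m i)) = 1" by simp
    have n2: "norm (exp ((?E t) * of_real (L i))) <= exp (norm ((?E t) * cor (L i)))" by (rule norm_exp)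
    have "norm (exp (\<i> * of_real t) - 1 :: complex) <= 2" by (rule order_trans[OF norm_triangle_ineq4]) simp
    then have n3: "norm ((?E t) * cor (L i)) <= 2 * \<bar>L i\<bar>" unfolding norm_mult norm_of_real by (rule mult_right_mono) simp
    show ?thesis unfolding norm_mult[of "exp (?G t m i)"] n1 mult_1 by (rule order_trans[OF n2]) (use n3 in simp)
   qed
   then have "integrable circ (%t. exp (?G t m i) * exp ((?E t) * of_real (L i)))" for i
    by (intro c.integrable_const_bound[where B="exp (2 * \<bar>L i\<bar>)"]) auto
   then show ?thesis unfolding prod.distrib[symmetric] by (intro pr.product_integral_prod) auto
  qed
  also have "... = of_real (counts_prob Q Z\<^sub>P n A m)" unfolding circle_poisson tgt by simp
  finally show "(%k. cor (?c (X k))) ----> of_real (counts_prob Q Z\<^sub>P n A m)" unfolding c .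
 qed
 then show "(?c ---> counts_prob Q Z\<^sub>P n A m) at_top" by (simp add: tendsto_of_real_iff)
qed

end

section \<open>Symmetric functions of an infinite sequence of independent points\<close>

text \<open>Allows an arbitrary injective choice of labels to be moved to the first labels under an
  integral that does not change when labels are permuted.\<close>

lemma permutation_extension:
 fixes f :: "nat => nat" assumes f: "inj_on f {..<t}" "f ` {..<t} \<subseteq> {..<k}"
 shows "EX p. p permutes {..<k} & (ALL i<t. p i = f i)"
proof -
 have c: "card (f ` {..<t}) = t" using f(1) by (simp add: card_image)
 then have tk: "t <= k" using card_mono[OF _ f(2)] by simp
 have "card {t..<k} = card ({..<k} - f ` {..<t})" using f(2) c by (subst card_Diff_subset) (auto intro: finite_subset)
 then obtain g where g: "bij_betw g {t..<k} ({..<k} - f ` {..<t})" using finite_same_card_bij[of "{t..<k}" "{..<k} - f ` {..<t}"] by auto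
 define h where "h = (%i. if i < t then f i else if i < k then g i else i)"
 have "bij_betw h ({..<t} Un {t..<k}) (f ` {..<t} Un ({..<k} - f ` {..<t}))"
 proof (rule bij_betw_combine)
  show "bij_betw h {..<t} (f ` {..<t})" using f(1) by (subst bij_betw_cong[of _ h f]) (auto simp: h_def bij_betw_def)
  show "bij_betw h {t..<k} ({..<k} - f ` {..<t})" using g by (subst bij_betw_cong[of _ h g]) (auto simp: h_def)
 qed auto
 moreover have "{..<t} Un {t..<k} = {..<k}" "f ` {..<t} Un ({..<k} - f ` {..<t}) = {..<k}" using tk f(2) by auto
 ultimately have "bij_betw h {..<k} {..<k}" by simp
 then have "h permutes {..<k}" using tk by (intro bij_imp_permutes) (auto simp: h_def)
 then show ?thesis by (intro exI[of _ h]) (auto simp: h_def)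
qed

lemma permutation_to_subset: assumes I: "I \<subseteq> {..<k}"
 shows "EX p. p permutes {..<k} & p ` {..<card I} = I & p ` {card I..<k} = {..<k} - I"
proof -
 have fI: "finite I" using I finite_subset by auto
 then obtain f where f: "bij_betw f {..<card I} I" using ex_bij_betw_nat_finite[OF fI] by (auto simp: atLeast0LessThan)
 obtain p where p: "p permutes {..<k}" "!!i. i < card I ==> p i = f i"
  using permutation_extension[of f "card I" k] f I by (auto simp: bij_betw_def)
 have im: "p ` {..<card I} = I" using f p(2) by (auto simp: bij_betw_def)
 have ck: "card I <= k" using card_mono[OF _ I] by simp
 have "p ` {card I..<k} = p ` ({..<k} - {..<card I})" by (intro arg_cong[where f="image p"]) auto
 also have "... = p ` {..<k} - p ` {..<card I}" using p(1) by (intro image_set_diff permutes_inj)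
 finally have "p ` {card I..<k} = {..<k} - I" using im permutes_image[OF p(1)] by simp
 then show ?thesis using p(1) im by blast
qed

lemma prod_subset_permute:
 fixes u w :: "'b => 'c :: comm_monoid_mult" assumes p: "p permutes {..<k}" "p ` {..<card I} = I" "p ` {card I..<k} = {..<k} - I"
 shows "(PROD i:I. u (y i)) * (PROD i:{..<k} - I. w (y i)) =
  (PROD i<card I. u ((y \<circ> p) i)) * (PROD i:{card I..<k}. w ((y \<circ> p) i))"
proof -
 have inj: "inj_on p A" for A using permutes_inj[OF p(1)] by (rule inj_on_subset) simp
 have "(PROD i:I. u (y i)) = (PROD i:p ` {..<card I}. u (y i))" using p(2) by simp
 also have "... = (PROD i<card I. u ((y \<circ> p) i))" by (simp add: prod.reindex[OF inj])
 finally have 1: "(PROD i:I. u (y i)) = (PROD i<card I. u ((y \<circ> p) i))" .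
 have "(PROD i:{..<k} - I. w (y i)) = (PROD i:p ` {card I..<k}. w (y i))" using p(3) by simp
 also have "... = (PROD i:{card I..<k}. w ((y \<circ> p) i))" by (simp add: prod.reindex[OF inj])
 finally show ?thesis using 1 by simp
qed

lemma sum_Pow_card:
 fixes f :: "nat => 'b :: comm_semiring_1" shows "(SUM I:Pow {..<k}. f (card I)) = (SUM t<=k. of_nat (k choose t) * f t)"
proof -
 have "(SUM I:Pow {..<k}. f (card I)) = (SUM t<=k. \<Sum>I | I : Pow {..<k} & card I = t. f (card I))"
  by (intro sum.group[symmetric]) (auto dest: card_mono[rotated])
 also have "... = (SUM t<=k. of_nat (k choose t) * f t)"
 proof (intro sum.cong refl)
  fix t
  have "(\<Sum>I | I : Pow {..<k} & card I = t. f (card I)) = (\<Sum>I | I \<subseteq> {..<k} & card I = t. f t)"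
   by (intro sum.cong) auto
  then show "(\<Sum>I | I : Pow {..<k} & card I = t. f (card I)) = of_nat (k choose t) * f t" by (simp add: n_subsets)
 qed
 finally show ?thesis .
qed

context sequence_space
begin

lemma distr_permute: assumes "p permutes A" shows "distr S S (%y. y \<circ> p) = S"
 using distr_PiM_reindex[of UNIV "%_. M" p UNIV] permutes_inj[OF assms] prob_space_axioms
 by (simp add: comp_def M.prob_space_axioms restrict_def)

lemma measurable_permute [measurable]: "(%y. y \<circ> p) : S \<rightarrow>\<^sub>M S"
 unfolding comp_def by (rule measurable_PiM_single') (auto simp: space_PiM)

lemma nn_integral_permute: assumes "p permutes A" and f: "f : bmeas S" shows "(nni S (%y. f (y \<circ> p))) = (nni S (%y. f y))"
 using f by (subst (2) distr_permute[OF assms(1), symmetric]) (simp add: nn_integral_distr)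

lemma integral_permute:
 fixes f :: "_ => real" assumes "p permutes A" and f: "f : bmeas S" shows "(LINT y|S. f (y \<circ> p)) = (LINT y|S. f y)"
 using f by (subst (2) distr_permute[OF assms(1), symmetric]) (simp add: integral_distr)

lemma comb_seq_pair_eq: "(%p. f ((%(w, w'). comb_seq n w w') p)) = (%(w, w'). f (comb_seq n w w'))" by auto

text \<open>The first n entries of one independent sequence followed by another independent sequence
  have the same law as a single sequence, so Fubini separates the first n points from the
  rest.\<close>

lemma nn_integral_comb: assumes f: "f : bmeas S" shows "(nni S (%y. f y)) = (nni S (%T. nni S (%Y. f (comb_seq n T Y))))"
proof -
 have m: "(%(T, Y). comb_seq n T Y) : S \<Otimes>\<^sub>M S \<rightarrow>\<^sub>M S" by (rule measurable_comb_seq)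
 have "(nni S (%y. f y)) = (nni (distr (S \<Otimes>\<^sub>M S) S (%(T, Y). comb_seq n T Y)) (%y. f y))" by (simp only: PiM_comb_seq)
 also have "... = (nni (S \<Otimes>\<^sub>M S) (%p. f ((%(T, Y). comb_seq n T Y) p)))" by (subst nn_integral_distr) (use m f in auto)
 also have "... = (nni S (%T. nni S (%Y. f (comb_seq n T Y))))" using measurable_compose[OF m f] by (subst P.nn_integral_fst[symmetric]) auto
 finally show ?thesis .
qed

lemma integrable_comb:
 fixes f :: "_ => real" assumes f: "integrable S f" shows "integrable (S \<Otimes>\<^sub>M S) (%(T, Y). f (comb_seq n T Y))"
proof -
 let ?A = "%(T, Y). comb_seq n T Y"
 have m: "?A : S \<Otimes>\<^sub>M S \<rightarrow>\<^sub>M S" by (rule measurable_comb_seq)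
 have "integrable (distr (S \<Otimes>\<^sub>M S) S ?A) f" using f by (simp only: PiM_comb_seq)
 then have "integrable (S \<Otimes>\<^sub>M S) (%p. f (?A p))"
  using m borel_measurable_integrable[OF f] by (subst (asm) integrable_distr_eq) auto
 then show ?thesis unfolding comb_seq_pair_eq .
qed

lemma integral_comb:
 fixes f :: "_ => real" assumes f: "integrable S f" shows "(LINT y|S. f y) = (LINT T|S. LINT Y|S. f (comb_seq n T Y))"
proof -
 interpret PP: pair_sigma_finite S S ..
 have m: "(%(T, Y). comb_seq n T Y) : S \<Otimes>\<^sub>M S \<rightarrow>\<^sub>M S" by (rule measurable_comb_seq)
 have "(LINT y|S. f y) = (LINT y|distr (S \<Otimes>\<^sub>M S) S (%(T, Y). comb_seq n T Y). f y)" by (simp only: PiM_comb_seq)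
 also have "... = (LINT p|(S \<Otimes>\<^sub>M S). f ((%(T, Y). comb_seq n T Y) p))" using f by (intro integral_distr m) auto
 also have "... = (LINT p|(S \<Otimes>\<^sub>M S). (%(T, Y). f (comb_seq n T Y)) p)" unfolding comb_seq_pair_eq ..
 also have "... = (LINT T|S. LINT Y|S. f (comb_seq n T Y))" using PP.integral_fst'[OF integrable_comb[OF f]] by simp
 finally show ?thesis .
qed

lemma has_bochner_integral_prod_components:
 fixes f :: "nat => 'a => real" assumes I: "finite I" and f: "!!i. i : I ==> integrable M (f i)"
 shows "hbi S (%y. PROD i:I. f i (y i)) (PROD i:I. integral\<^sup>L M (f i))"
proof -
 let ?A = "%y. PROD i:I. f i (y i)"
 have d: "distr S (PiM I (%_. M)) (%x. restrict x I) = PiM I (%_. M)" using distr_PiM_restrict_finite[OF I] by simp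
 have m: "(%x. restrict x I) : S \<rightarrow>\<^sub>M PiM I (%_. M)" by (rule measurable_restrict_subset) simp
 have e: "(PROD i:I. f i (restrict y I i)) = (PROD i:I. f i (y i))" for y :: "nat => 'a" by (intro prod.cong) auto
 have i: "integrable (PiM I (%_. M)) ?A" using I f by (rule product_integrable_prod)
 then have "integrable (distr S (PiM I (%_. M)) (%x. restrict x I)) ?A" by (simp only: d)
 then have 1: "integrable S ?A" using i m by (subst (asm) integrable_distr_eq) (auto simp: e simp del: restrict_apply)
 have "(LINT y|PiM I (%_. M). (PROD i:I. f i (y i))) = (LINT y|distr S (PiM I (%_. M)) (%x. restrict x I). (PROD i:I. f i (y i)))"
  by (simp only: d)
 also have "... = (LINT y|S. (PROD i:I. f i (y i)))" using i m by (subst integral_distr) (auto simp: e simp del: restrict_apply)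
 finally show ?thesis using 1 product_integral_prod[OF I f] by (simp add: hbi_iff)
qed

lemma measurable_component_S [measurable]: "(%y. y i) : S \<rightarrow>\<^sub>M M" by simp

text \<open>The product is expanded over the subset of labels that receive the weight u. By symmetry
  that subset may be replaced by an initial segment, so only its size counts and binomial
  coefficients appear.\<close>

lemma nn_integral_prod_add:
 fixes u w :: "'a => ennreal" assumes sym: "!!p y. p permutes {..<k} ==> G (y \<circ> p) = G y"
  and [measurable]: "G : bmeas S" "u : bmeas M" "w : bmeas M"
 shows "(nni S (%y. (PROD i<k. u (y i) + w (y i)) * G y)) =
  (SUM t<=k. of_nat (k choose t) * (nni S (%y. (PROD i<t. u (y i)) * (PROD i:{t..<k}. w (y i)) * G y)))"
proof -
 have "(nni S (%y. (PROD i<k. u (y i) + w (y i)) * G y)) =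
   (nni S (%y. (SUM I:Pow {..<k}. (PROD i:I. u (y i)) * (PROD i:{..<k} - I. w (y i)) * G y)))"
  by (simp add: prod_add sum_distrib_right)
 also have "... = (SUM I:Pow {..<k}. nni S (%y. (PROD i:I. u (y i)) * (PROD i:{..<k} - I. w (y i)) * G y))"
  by (intro nn_integral_sum) measurable
 also have "... = (SUM I:Pow {..<k}. nni S (%y. (PROD i<card I. u (y i)) * (PROD i:{card I..<k}. w (y i)) * G y))"
 proof (intro sum.cong refl)
  fix I assume "I : Pow {..<k}"
  then obtain p where p: "p permutes {..<k}" "p ` {..<card I} = I" "p ` {card I..<k} = {..<k} - I" using permutation_to_subset[of I k] by auto
  show "(nni S (%y. (PROD i:I. u (y i)) * (PROD i:{..<k} - I. w (y i)) * G y)) =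
    (nni S (%y. (PROD i<card I. u (y i)) * (PROD i:{card I..<k}. w (y i)) * G y))" unfolding prod_subset_permute[OF p, of u _ w]
   by (subst nn_integral_permute[OF p(1), symmetric]) (auto simp: sym[OF p(1)])
 qed
 also have "... = (SUM t<=k. of_nat (k choose t) * (nni S (%y. (PROD i<t. u (y i)) * (PROD i:{t..<k}. w (y i)) * G y)))"
  by (rule sum_Pow_card)
 finally show ?thesis .
qed

lemma integrable_weighted:
 fixes G :: "(nat => 'a) => real" assumes I: "finite I"
  and [measurable]: "G : bmeas S" and f: "!!i. i : I ==> f i : bmeas M"
  and G: "!!y. \<bar>G y\<bar> <= C * (PROD i:I. b (y i))" and C: "0 <= C" and b: "!!z. 0 <= b z"
  and int: "!!i. i : I ==> integrable M (%z. \<bar>f i z\<bar> * b z)"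
 shows "integrable S (%y. (PROD i:I. f i (y i)) * G y)"
  "\<bar>LINT y|S. (PROD i:I. f i (y i)) * G y\<bar> <= C * (PROD i:I. LINT z|M. \<bar>f i z\<bar> * b z)"
  "(LINT y|S. \<bar>(PROD i:I. f i (y i)) * G y\<bar>) <= C * (PROD i:I. LINT z|M. \<bar>f i z\<bar> * b z)"
proof -
 let ?E = "LINT y|S. \<bar>(PROD i:I. f i (y i)) * G y\<bar>"
 let ?D = "PROD i:I. LINT z|M. \<bar>f i z\<bar> * b z"
 let ?A = "%y. PROD i:I. \<bar>f i (y i)\<bar> * b (y i)"
 note [measurable] = f
 have B: "hbi S (%y. C * (?A y)) (C * ?D)"
  using I int by (intro hbi_mult has_bochner_integral_prod_components[where f="%i z. \<bar>f i z\<bar> * b z"])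
 have le: "\<bar>(PROD i:I. f i (y i)) * G y\<bar> <= C * (?A y)" for y
 proof -
  have "\<bar>(PROD i:I. f i (y i)) * G y\<bar> <= (PROD i:I. \<bar>f i (y i)\<bar>) * (C * (PROD i:I. b (y i)))"
   unfolding abs_mult abs_prod using G by (intro mult_left_mono prod_nonneg) auto
  then show ?thesis by (simp add: prod.distrib mult_ac)
 qed
 show 1: "integrable S (%y. (PROD i:I. f i (y i)) * G y)"
 proof (rule integrable_le)
  show "integrable S (%y. C * (?A y))" using B by (simp add: hbi_iff)
  show "AE y in S. norm ((PROD i:I. f i (y i)) * G y) <= norm (C * (?A y))"
   using le by (intro AE_I2) (auto intro: order_trans[OF _ abs_ge_self])
 qed measurable
 show 3: "?E <= C * ?D"
 proof -
  have "?E <= (LINT y|S. C * (?A y))" using 1 B le by (intro integral_mono) (auto simp: hbi_iff)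
  also have "... = C * ?D" by (rule has_bochner_integral_integral_eq[OF B])
  finally show ?thesis .
 qed
 show "\<bar>LINT y|S. (PROD i:I. f i (y i)) * G y\<bar> <= C * ?D" using order_trans[OF integral_abs_bound 3] .
qed

lemma prod_split_weights:
 fixes u w :: "'a => 'b :: comm_monoid_mult" and t k :: nat assumes "t <= k"
 shows "(PROD i<t. u (y i)) * (PROD i:{t..<k}. w (y i)) = (PROD i<k. (if i < t then u else w) (y i))"
proof -
 have "{..<k} = {..<t} Un {t..<k}" using assms by auto
 then have "(PROD i<k. (if i < t then u else w) (y i)) = (PROD i<t. (if i < t then u else w) (y i)) * (PROD i:{t..<k}. (if i < t then u else w) (y i))"
  by (simp only: prod.union_disjoint[OF finite_lessThan finite_atLeastLessThan, of t t k] ivl_disj_int)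
 then show ?thesis by simp
qed

lemma integral_prod_add:
 fixes u w :: "'a => real" assumes sym: "!!p y. p permutes {..<k} ==> G (y \<circ> p) = G y"
  and [measurable]: "G : bmeas S" "u : bmeas M" "w : bmeas M"
  and G: "!!y. \<bar>G y\<bar> <= C * (PROD i<k. b (y i))" and C: "0 <= C" and b: "!!z. 0 <= b z"
  and int: "integrable M (%z. \<bar>u z\<bar> * b z)" "integrable M (%z. \<bar>w z\<bar> * b z)"
 shows "(LINT y|S. (PROD i<k. u (y i) + w (y i)) * G y) =
  (SUM t<=k. of_nat (k choose t) * (LINT y|S. (PROD i<t. u (y i)) * (PROD i:{t..<k}. w (y i)) * G y))"
proof -
 let ?B = "%I y. PROD i<k. (if i : I then u else w) (y i)"
 let ?A = "%I y. PROD i:{..<k} - I. w (y i)"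
 have "(LINT y|S. (PROD i<k. u (y i) + w (y i)) * G y) = (LINT y|S. (SUM I:Pow {..<k}. (PROD i:I. u (y i)) * (?A I y) * G y))"
  by (simp add: prod_add sum_distrib_right)
 also have "... = (SUM I:Pow {..<k}. LINT y|S. (PROD i:I. u (y i)) * (?A I y) * G y)"
 proof (rule Bochner_Integration.integral_sum)
  fix I assume I: "I : Pow {..<k}"
  have "integrable S (%y. (?B I y) * G y)" using G C b int by (intro integrable_weighted[where C=C and b=b]) auto
  also have "(%y. (?B I y) * G y) = (%y. (PROD i:I. u (y i)) * (?A I y) * G y)"
  proof (intro ext arg_cong2[where f="(*)"] refl)
   fix y
   have "{..<k} = I Un ({..<k} - I)" using I by auto
   then have "(?B I y) = (PROD i:I Un ({..<k} - I). (if i : I then u else w) (y i))" by simp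
   also have "... = (PROD i:I. u (y i)) * (?A I y)" using I by (subst prod.union_disjoint) (auto intro: finite_subset)
   finally show "(?B I y) = (PROD i:I. u (y i)) * (?A I y)" .
  qed
  finally show "integrable S (%y. (PROD i:I. u (y i)) * (?A I y) * G y)" .
 qed
 also have "... = (SUM I:Pow {..<k}. LINT y|S. (PROD i<card I. u (y i)) * (PROD i:{card I..<k}. w (y i)) * G y)"
 proof (intro sum.cong refl)
  fix I assume "I : Pow {..<k}"
  then obtain p where p: "p permutes {..<k}" "p ` {..<card I} = I" "p ` {card I..<k} = {..<k} - I" using permutation_to_subset[of I k] by auto
  show "(LINT y|S. (PROD i:I. u (y i)) * (?A I y) * G y) = (LINT y|S. (PROD i<card I. u (y i)) * (PROD i:{card I..<k}. w (y i)) * G y)"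
   unfolding prod_subset_permute[OF p, of u _ w] by (subst integral_permute[OF p(1), symmetric]) (auto simp: sym[OF p(1)])
 qed
 also have "... = (SUM t<=k. of_nat (k choose t) * (LINT y|S. (PROD i<t. u (y i)) * (PROD i:{t..<k}. w (y i)) * G y))"
  by (rule sum_Pow_card)
 finally show ?thesis .
qed

end

lemma ennreal_suminf_diagonal:
 fixes a :: "nat => nat => ennreal" shows "(\<Sum>t. \<Sum>m. a t m) = (\<Sum>k. SUM t<=k. a t (k - t))"
proof -
 let ?A = "%k. \<Sum>t. a t (k - t) * ind {(k, t). t <= k} (k, t)"
 have bij: "bij_betw (%(t, m). (t + m, t)) UNIV {(k::nat, t). t <= k}"
  by (rule bij_betw_byWitness[where f'="%(k, t). (t, k - t)"]) (auto simp: le_iff_add)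
 have "(\<Sum>t. \<Sum>m. a t m) = (nni (count_space UNIV) (%t. nni (count_space UNIV) (%m. a t m)))" by (simp add: nn_integral_count_space_nat)
 also have "... = (nni (count_space UNIV) (%p. (%(t, m). a t m) p))" by (subst nn_integral_fst_count_space[symmetric]) simp
 also have "... = (nni (count_space UNIV) (%p. (%(k, t). a t (k - t)) ((%(t, m). (t + m, t)) p)))"
  by (intro nn_integral_cong) auto
 also have "... = (nni (count_space {(k, t). t <= k}) (%p. (%(k, t). a t (k - t)) p))" by (rule nn_integral_bij_count_space[OF bij])
 also have "... = (nni (count_space UNIV) (%p. (%(k, t). a t (k - t)) p * ind {(k, t). t <= k} p))"
  by (subst nn_integral_count_space_indicator) auto
 also have "... = (nni (count_space UNIV) (%k. nni (count_space UNIV) (%t. a t (k - t) * ind {(k, t). t <= k} (k, t))))"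
  by (subst nn_integral_fst_count_space[symmetric]) simp
 also have "... = (\<Sum>k. \<Sum>t. a t (k - t) * ind {(k, t). t <= k} (k, t))" by (simp add: nn_integral_count_space_nat)
 also have "... = (\<Sum>k. SUM t<=k. a t (k - t))"
 proof (intro suminf_cong)
  fix k
  have "(?A k) = (SUM t<=k. a t (k - t) * ind {(k, t). t <= k} (k, t))" by (intro suminf_finite) auto
  then show "(?A k) = (SUM t<=k. a t (k - t))" by simp
 qed
 finally show ?thesis .
qed

text \<open>The product majorant makes the double family absolutely summable; its sum is then
  computed once by rows and once along antidiagonals.\<close>

lemma suminf_diagonal:
 fixes a :: "nat => nat => real"
 assumes le: "!!t m. \<bar>a t m\<bar> <= c t * d m" and c: "summable c" "!!t. 0 <= c t" and d: "summable d" "!!m. 0 <= d m"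
 shows "(%t. \<Sum>m. a t m) sums (\<Sum>k. SUM t<=k. a t (k - t))"
proof -
 let ?A = "%t. %m. norm (case (t, m) of (t, m) => c t * d m)"
 define f where "f = (%(t, m). a t m)"
 have sc: "c summable_on UNIV" and sd: "d summable_on UNIV" using c d by (auto simp: summable_on_UNIV_nonneg_real_iff)
 have "(%p. norm ((%(t, m). c t * d m) p)) summable_on (SIGMA t:UNIV. UNIV)" unfolding Infinite_Sum.abs_summable_on_Sigma_iff
 proof (intro conjI ballI)
  show "(?A t) summable_on UNIV" for t using sd c(2) d(2) by (simp add: summable_on_cmult_right)
  have "infsum (?A t) UNIV = c t * infsum d UNIV" for t using c(2) d(2) by (simp add: infsum_cmult_right')
  moreover have "infsum d UNIV >= 0" using d(2) by (intro infsum_nonneg)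
  ultimately show "(%t. norm (infsum (?A t) UNIV)) summable_on UNIV" using sc c(2) by (simp add: summable_on_cmult_left)
 qed
 then have "(%p. norm (f p)) summable_on (SIGMA t:UNIV. UNIV)"
 proof (rule Infinite_Sum.abs_summable_on_comparison_test')
  show "norm (f p) <= norm ((%(t, m). c t * d m) p)" for p using le[of "fst p" "snd p"] by (simp add: f_def case_prod_beta)
 qed
 then have "f summable_on (SIGMA t:UNIV. UNIV)" by (rule abs_summable_summable)
 then obtain S0 where S0: "(f has_sum S0) (SIGMA t:UNIV. UNIV)" by (auto simp: summable_on_def)
 have row: "((%m. f (t, m)) has_sum (\<Sum>m. a t m)) UNIV" for t
 proof -
  have "summable (%m. norm (a t m))"
  proof (rule summable_comparison_test'[OF summable_mult[OF d(1), of "c t"]])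
   show "norm (norm (a t m)) <= c t * d m" for m using le[of t m] by simp
  qed
  from norm_summable_imp_has_sum[OF this] summable_norm_cancel[OF this]
  show ?thesis by (simp add: f_def summable_sums)
 qed
 have 1: "(%t. \<Sum>m. a t m) sums S0" by (rule has_sum_imp_sums[OF has_sum_SigmaD[OF S0 row]])
 have bij: "bij_betw (%(k, t). (t, k - t)) (SIGMA k:UNIV. {..k::nat}) (UNIV :: (nat \<times> nat) set)"
  by (rule bij_betw_byWitness[where f'="%(t, m). (t + m, t)"]) auto
 have "((%p. f ((%(k, t). (t, k - t)) p)) has_sum S0) (SIGMA k:UNIV. {..k})"
  using S0 by (subst has_sum_reindex_bij_betw[OF bij]) (simp add: UNIV_Times_UNIV)
 moreover have "((%t. f ((%(k, t). (t, k - t)) (k, t))) has_sum (SUM t<=k. a t (k - t))) {..k}" for k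
  by (rule has_sum_finiteI) (auto simp: f_def)
 ultimately have "(%k. SUM t<=k. a t (k - t)) sums S0" by (intro has_sum_imp_sums[OF has_sum_SigmaD])
 with 1 show ?thesis by (simp add: sums_iff)
qed

section \<open>A reference measure and Fredholm series with fixed points\<close>

definition nu_density :: "plane => real" where
 "nu_density z = std_normal_density (fst z) * std_normal_density (snd z)"

text \<open>A probability measure equivalent to Lebesgue measure. Infinite sequences of independent
  points can be drawn from it, so tuples of all lengths live on one space; the weight
  \<open>lw\<close> converts integrals back to Lebesgue measure.\<close>

definition nu :: "plane measure" where
 "nu = density lborel (%z. ennreal (nu_density z))"

definition lw :: "plane => real" where
 "lw z = 1 / nu_density z"

lemma nu_density_pos: "nu_density z > 0" by (simp add: nu_density_def normal_density_pos)

lemma nu_density_measurable [measurable]: "nu_density : bmeas borel"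
proof -
 have "nu_density = (%z. std_normal_density (fst z) * std_normal_density (snd z))" by (simp add: nu_density_def fun_eq_iff)
 also have "... : bmeas (borel \<Otimes>\<^sub>M borel)" by measurable
 finally show ?thesis by (simp add: borel_prod)
qed

lemma lw_measurable [measurable]: "lw : bmeas borel" unfolding lw_def[abs_def] by measurable

lemma lw_pos: "lw z > 0" "lw z >= 0" using nu_density_pos[of z] by (auto simp: lw_def)

lemma sets_nu [measurable_cong, simp]: "sets nu = sets borel" by (simp add: nu_def)

lemma borel_measurable_nu [simp]: "bmeas nu = bmeas borel" by (rule measurable_cong_sets) simp_all

lemma space_nu [simp]: "space nu = UNIV" by (simp add: nu_def)

interpretation nu_prob: prob_space nu
proof
 have "hbi (lborel :: plane measure) nu_density (1 * 1)" unfolding nu_density_def[abs_def]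
  by (intro has_bochner_integral_product) (auto simp: hbi_iff)
 then have "(nni lborel (%z. ennreal (nu_density z))) = 1"
  using nu_density_pos by (subst nn_integral_eq_integral) (auto simp: hbi_iff less_imp_le)
 then show "emeasure nu (space nu) = 1" unfolding nu_def by (simp add: emeasure_density)
qed

interpretation nu: sequence_space nu ..

lemma nn_integral_nu_lw: assumes [measurable]: "f : bmeas borel" shows "(nni nu (%z. ennreal (lw z) * f z)) = (nni lborel (%z. f z))"
proof -
 have "ennreal (nu_density z) * (ennreal (lw z) * f z) = f z" for z
  using nu_density_pos[of z] by (simp add: lw_def mult.assoc[symmetric] ennreal_mult[symmetric] less_imp_le)
 then show ?thesis unfolding nu_def by (subst nn_integral_density) auto
qed

lemma has_bochner_integral_nu_lw:
 fixes f :: "plane => 'a :: {banach, second_countable_topology}" assumes "hbi lborel f I"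
 shows "hbi nu (%z. lw z *\<^sub>R f z) I"
proof -
 have [measurable]: "f : bmeas borel" using assms by (auto dest: borel_measurable_has_bochner_integral)
 have "nu_density z *\<^sub>R (lw z *\<^sub>R f z) = f z" for z using nu_density_pos[of z] by (simp add: lw_def)
 then show ?thesis unfolding nu_def using assms less_imp_le[OF nu_density_pos] by (intro has_bochner_integral_density) auto
qed

lemma comb_seq_assoc: "comb_seq (n + t) (comb_seq n x T) Y = comb_seq n x (comb_seq t T Y)" by (auto simp: comb_seq_def fun_eq_iff)

lemma prod_comb_seq_low: "(PROD i<t. u (comb_seq t T Y i)) = (PROD i<t. u (T i))" by (intro prod.cong) (auto simp: comb_seq_def)

lemma prod_comb_seq_high: "(PROD i:{t..<t + m}. w (comb_seq t T Y i)) = (PROD i<m. w (Y i))"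
proof -
 have "(PROD i:{t..<t + m}. w (comb_seq t T Y i)) = (PROD i:{0..<m}. w (comb_seq t T Y (i + t)))"
  using prod.shift_bounds_nat_ivl[of "%i. w (comb_seq t T Y i)" 0 t m] by (simp add: add.commute)
 then show ?thesis by (simp add: comb_seq_add atLeast0LessThan)
qed

lemma measurable_rho: assumes "(%(a, b). K a b) : bmeas (borel \<Otimes>\<^sub>M borel)"
  and "!!i. i < n ==> (%w. X w i) : M \<rightarrow>\<^sub>M borel"
 shows "(%w. rho K n (X w)) : bmeas M" unfolding rho_def using measurable_kernel_det[OF assms] by measurable

lemma rho_cong: "(!!i. i < n ==> x i = y i) ==> rho K n x = rho K n y"
 unfolding rho_def by (simp add: kernel_det_cong[of n x y])

lemma rho_permute: "p permutes {..<n} ==> rho K n (x \<circ> p) = rho K n x" unfolding rho_def by (simp add: kernel_det_permute)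

text \<open>The Fredholm series in which n points are held fixed and the weight w is taken against
  \<open>nu\<close>. Weight 0 leaves the correlation function; minus \<open>lw\<close> on a window,
  which is weight -1 against Lebesgue measure, gives the Janossy density of the window.\<close>

definition Theta :: "kernel => nat => (nat => plane) => (plane => real) => real" where
 "Theta K n x w = (\<Sum>m. (LINT y|nu.S. (PROD i<m. w (y i)) * rho K (n + m) (comb_seq n x y)) / fact m)"

lemma measurable_comp_S [measurable]: "(%y. y i) : nu.S \<rightarrow>\<^sub>M borel"
 using nu.measurable_component_S[of i] by (simp cong: measurable_cong_sets)

context
 fixes K :: kernel assumes psd: "psd_kernel K" and mK: "(%(a, b). K a b) : bmeas (borel \<Otimes>\<^sub>M borel)"
begin

lemma measurable_diag: "(%z. Re (K z z)) : bmeas borel"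
proof -
 have "(%z::plane. (%(a, b). K a b) (z, z)) : bmeas borel" by (rule measurable_compose[OF _ mK]) simp
 then show ?thesis by simp
qed

lemma measurable_rho_comb: assumes [measurable]: "X : M \<rightarrow>\<^sub>M nu.S" "Y : M \<rightarrow>\<^sub>M nu.S"
 shows "(%w. rho K k (comb_seq n (X w) (Y w))) : bmeas M"
 by (rule measurable_rho[OF mK]) (rule measurable_compose[OF _ measurable_comp_S], measurable)

lemma measurable_rho_comb1 [measurable]:
 "(%y. rho K k (comb_seq n x y)) : bmeas nu.S"
proof (rule measurable_rho_comb)
 show "(%y. x) : nu.S \<rightarrow>\<^sub>M nu.S" by (rule measurable_const) (simp add: space_PiM)
qed simp

lemma rho_comb_permute: assumes p: "p permutes {..<m}" shows "rho K (n + m) (comb_seq n x (y \<circ> p)) = rho K (n + m) (comb_seq n x y)"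
proof -
 define q where "q = (%i. if i < n then i else p (i - n) + n)"
 have pm: "p i < m" if "i < m" for i using permutes_lessThan[OF p that] .
 have "inj q"
 proof (rule injI)
  fix i j assume e: "q i = q j"
  show "i = j"
  proof (cases "i < n"; cases "j < n")
   assume "~ i < n" "~ j < n"
   then have "p (i - n) = p (j - n)" using e by (simp add: q_def)
   then have "i - n = j - n" using permutes_inj[OF p] by (simp only: inj_eq)
   then show ?thesis using \<open>~ i < n\<close> \<open>~ j < n\<close> by linarith
  qed (use e in \<open>simp_all add: q_def\<close>)
 qed
 moreover have "q ` {..<n + m} \<subseteq> {..<n + m}"
 proof (rule image_subsetI)
  fix i assume "i : {..<n + m}"
  then show "q i : {..<n + m}" using pm[of "i - n"] by (cases "i < n") (simp_all add: q_def)
 qed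
 ultimately have "bij_betw q {..<n + m} {..<n + m}" by (metis bij_betw_def endo_inj_surj finite_lessThan inj_on_subset subset_UNIV)
 moreover have "q i = i" if "i ~: {..<n + m}" for i using that permutes_not_in[OF p, of "i - n"] by (simp add: q_def)
 ultimately have "q permutes {..<n + m}" by (rule bij_imp_permutes)
 moreover have "comb_seq n x (y \<circ> p) = comb_seq n x y \<circ> q" by (auto simp: comb_seq_def q_def fun_eq_iff)
 ultimately show ?thesis by (simp add: rho_permute)
qed

lemma rho_comb_bound:
 "\<bar>rho K (n + m) (comb_seq n x y)\<bar> <= (PROD i<n. Re (K (x i) (x i))) * (PROD i<m. Re (K (y i) (y i)))"
proof -
 let ?A = "%n i. K (comb_seq n x y i) (comb_seq n x y i)"
 have "\<bar>rho K (n + m) (comb_seq n x y)\<bar> <= (PROD i<n + m. Re (?A n i))" using psd_rho[OF psd] by simp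
 also have "{..<n + m} = {..<n} Un {n..<n + m}" by auto
 also have "(PROD i:{..<n} Un {n..<n + m}. Re (?A n i)) = (PROD i<n. Re (?A n i)) * (PROD i:{n..<n + m}. Re (?A n i))"
  by (intro prod.union_disjoint) auto
 also have "... = (PROD i<n. Re (K (x i) (x i))) * (PROD i<m. Re (K (y i) (y i)))"
  using prod_comb_seq_low[of "%z. Re (K z z)" n x y] prod_comb_seq_high[of "%z. Re (K z z)" n x y m] by simp
 finally show ?thesis .
qed

lemma prod_diag_nonneg: "0 <= (PROD i<n. Re (K (x i) (x i)))" using psd_diag(2)[OF psd] by (intro prod_nonneg) auto

lemma weighted_rho:
 assumes [measurable]: "!!i. f i : bmeas borel" and int: "!!i. i < m ==> integrable nu (%z. \<bar>f i z\<bar> * Re (K z z))"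
 shows "integrable nu.S (%y. (PROD i<m. f i (y i)) * rho K (n + m) (comb_seq n x y))"
  "\<bar>LINT y|nu.S. (PROD i<m. f i (y i)) * rho K (n + m) (comb_seq n x y)\<bar> <=
   (PROD i<n. Re (K (x i) (x i))) * (PROD i<m. LINT z|nu. \<bar>f i z\<bar> * Re (K z z))"
  "(LINT y|nu.S. \<bar>(PROD i<m. f i (y i)) * rho K (n + m) (comb_seq n x y)\<bar>) <=
   (PROD i<n. Re (K (x i) (x i))) * (PROD i<m. LINT z|nu. \<bar>f i z\<bar> * Re (K z z))"
proof -
 let ?A = "PROD i<m. LINT z|nu. \<bar>f i z\<bar> * Re (K z z)"
 have m: "f i : bmeas nu" for i by (subst measurable_cong_sets[OF sets_nu refl]) fact
 have int': "integrable nu (%z. \<bar>f i z\<bar> * Re (K z z))" if "i : {..<m}" for i using int that by simp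
 note W = nu.integrable_weighted[OF finite_lessThan measurable_rho_comb1 m rho_comb_bound prod_diag_nonneg psd_diag(2)[OF psd] int']
 show "integrable nu.S (%y. (PROD i<m. f i (y i)) * rho K (n + m) (comb_seq n x y))"
  "\<bar>LINT y|nu.S. (PROD i<m. f i (y i)) * rho K (n + m) (comb_seq n x y)\<bar> <= (PROD i<n. Re (K (x i) (x i))) * ?A"
  "(LINT y|nu.S. \<bar>(PROD i<m. f i (y i)) * rho K (n + m) (comb_seq n x y)\<bar>) <= (PROD i<n. Re (K (x i) (x i))) * ?A" by (rule W; simp)+
qed

lemma Theta_summable: assumes w[measurable]: "w : bmeas borel" and int: "integrable nu (%z. \<bar>w z\<bar> * Re (K z z))"
 shows "summable (%m. (LINT y|nu.S. (PROD i<m. w (y i)) * rho K (n + m) (comb_seq n x y)) / fact m)"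
proof (rule summable_comparison_test')
 let ?C = "PROD i<n. Re (K (x i) (x i))" and ?W = "LINT z|nu. \<bar>w z\<bar> * Re (K z z)"
 show "summable (%m. ?C * (?W ^ m / fact m))" using summable_exp_generic[of ?W] by (intro summable_mult) (simp add: field_simps)
 show "norm ((LINT y|nu.S. (PROD i<m. w (y i)) * rho K (n + m) (comb_seq n x y)) / fact m) <= ?C * (?W ^ m / fact m)" for m
  using weighted_rho(2)[of "%_. w" m n x] int by (simp add: divide_right_mono)
qed

text \<open>In the k-th term the product of the weights u + w is expanded: t points get u and k - t
  points get w. Summing with t fixed, the points with weight w rebuild a series in which the other t
  points are held fixed as well. Hadamard's inequality makes the double family absolutely summable,
  so it may be rearranged.\<close>

theorem Theta_add: assumes u[measurable]: "u : bmeas borel" and iu: "integrable nu (%z. \<bar>u z\<bar> * Re (K z z))"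
  and w[measurable]: "w : bmeas borel" and iw: "integrable nu (%z. \<bar>w z\<bar> * Re (K z z))"
 shows "(%t. (LINT T|nu.S. (PROD i<t. u (T i)) * Theta K (n + t) (comb_seq n x T) w) / fact t) sums Theta K n x (%z. u z + w z)"
  "integrable nu.S (%T. (PROD i<t. u (T i)) * Theta K (n + t) (comb_seq n x T) w)"
proof -
 let ?G = "%F t m T. LINT Y|nu.S. \<bar>F t m (comb_seq t T Y)\<bar>"
 let ?E = "%t. %T. (PROD i<t. u (T i)) * Theta K (n + t) (comb_seq n x T) w"
 let ?D = "%k. LINT y|nu.S. (PROD i<k. u (y i) + w (y i)) * rho K (n + k) (comb_seq n x y)"
 let ?A = "%t. LINT T|nu.S. (PROD i<t. u (T i)) * Theta K (n + t) (comb_seq n x T) w"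
 define C where "C = (PROD i<n. Re (K (x i) (x i)))"
 define U where "U = (LINT z|nu. \<bar>u z\<bar> * Re (K z z))"
 define W where "W = (LINT z|nu. \<bar>w z\<bar> * Re (K z z))"
 have C0: "0 <= C" unfolding C_def by (rule prod_diag_nonneg)
 have U0: "0 <= U" "0 <= W" unfolding U_def W_def using psd_diag(2)[OF psd] by (auto intro!: integral_nonneg)
 define F where "F = (%t m y. (PROD i<t. u (y i)) * (PROD i:{t..<t + m}. w (y i)) * rho K (n + (t + m)) (comb_seq n x y))"
 define h where "h = (%(t::nat) i. if i < t then u else w)"
 have [measurable]: "h t i : bmeas borel" for t i by (simp add: h_def)
 have F': "F t m = (%y. (PROD i<t + m. h t i (y i)) * rho K (n + (t + m)) (comb_seq n x y))" for t m
  unfolding F_def h_def using nu.prod_split_weights[of t "t + m" u _ w] by (simp add: fun_eq_iff)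
 have ih: "integrable nu (%z. \<bar>h t i z\<bar> * Re (K z z))" for t i using iu iw by (simp add: h_def)
 have ph: "(PROD i<t + m. LINT z|nu. \<bar>h t i z\<bar> * Re (K z z)) = U ^ t * W ^ m" for t m
 proof -
  have e: "{..<t + m} = {..<t} Un {t..<t + m}" by auto
  have "(PROD i<t + m. LINT z|nu. \<bar>h t i z\<bar> * Re (K z z)) =
   (PROD i<t. LINT z|nu. \<bar>h t i z\<bar> * Re (K z z)) * (PROD i:{t..<t + m}. LINT z|nu. \<bar>h t i z\<bar> * Re (K z z))"
   by (subst e, rule prod.union_disjoint) auto
  then show ?thesis by (simp add: h_def U_def W_def)
 qed
 have Fi: "integrable nu.S (F t m)" and Fb: "(LINT y|nu.S. \<bar>F t m y\<bar>) <= C * (U ^ t * W ^ m)" for t m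
  unfolding F' C_def ph[symmetric] by (rule weighted_rho[OF _ ih]; simp)+
 define a where "a = (%t m. (LINT y|nu.S. F t m y) / (fact t * fact m))"
 have ab: "\<bar>a t m\<bar> <= (C * (U ^ t / fact t)) * (W ^ m / fact m)" for t m
 proof -
  have "\<bar>LINT y|nu.S. F t m y\<bar> <= C * (U ^ t * W ^ m)" using Fb[of t m] integral_abs_bound order_trans by blast
  then show ?thesis by (simp add: a_def field_simps)
 qed
 have se: "summable (%m. U ^ m / fact m)" "summable (%m. W ^ m / fact m)"
  using summable_exp_generic[of U] summable_exp_generic[of W] by (simp_all add: field_simps)
 have S1: "(%t. \<Sum>m. a t m) sums (\<Sum>k. SUM t<=k. a t (k - t))"
  by (rule suminf_diagonal[OF ab summable_mult[OF se(1)] _ se(2)]) (use C0 U0 in simp_all)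
 \<comment> \<open>Along an antidiagonal the factorials combine to a binomial coefficient, which
   gives back the k-th term for the weight u + w.\<close>
 have diag: "(SUM t<=k. a t (k - t)) = (?D k) / fact k" for k
 proof -
  have "(?D k) =
   (SUM t<=k. of_nat (k choose t) * (LINT y|nu.S. (PROD i<t. u (y i)) * (PROD i:{t..<k}. w (y i)) * rho K (n + k) (comb_seq n x y)))"
   using iu iw by (intro nu.integral_prod_add[where b="%z. Re (K z z)" and C=C] rho_comb_permute)
    (auto simp: C_def intro!: rho_comb_bound prod_diag_nonneg psd_diag(2)[OF psd])
  also have "... = (SUM t<=k. fact k * a t (k - t))" by (intro sum.cong refl) (auto simp: a_def F_def binomial_fact)
  finally show ?thesis by (simp add: sum_distrib_left[symmetric])
 qed
 have TH: "Theta K n x (%z. u z + w z) = (\<Sum>k. SUM t<=k. a t (k - t))" by (simp add: Theta_def diag)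
 \<comment> \<open>With t fixed, the sum over m is pulled inside the integral over the first t
   points. What remains under the integral is the series with n + t fixed points.\<close>
 have row: "(%m. a t m * fact t) sums (?A t) & integrable nu.S (?E t)" for t
 proof -
  define f where "f = (%m T. (PROD i<t. u (T i)) * ((LINT Y|nu.S. (PROD i<m. w (Y i)) * rho K ((n + t) + m) (comb_seq (n + t) (comb_seq n x T) Y)) / fact m))"
  have FTY: "F t m (comb_seq t T Y) = (PROD i<t. u (T i)) * ((PROD i<m. w (Y i)) * rho K ((n + t) + m) (comb_seq (n + t) (comb_seq n x T) Y))" for m T Y
   by (simp add: F_def prod_comb_seq_low prod_comb_seq_high comb_seq_assoc add.assoc)
  have fF: "f m T = (LINT Y|nu.S. F t m (comb_seq t T Y)) / fact m" for m T unfolding f_def FTY by simp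
  interpret PP: pair_sigma_finite nu.S nu.S ..
  have fi: "integrable nu.S (f m)" for m unfolding fF[abs_def] using PP.integrable_fst'[OF nu.integrable_comb[OF Fi[of t m], of t]] by simp
  have fint: "integral\<^sup>L nu.S (f m) = a t m * fact t" for m
   unfolding fF[abs_def] using nu.integral_comb[OF Fi[of t m], of t] by (simp add: a_def)
  have fn: "(LINT T|nu.S. norm (f m T)) <= C * U ^ t * (W ^ m / fact m)" for m
  proof -
   have ai: "integrable nu.S (%y. \<bar>F t m y\<bar>)" using Fi by auto
   have "(LINT T|nu.S. norm (f m T)) <= (LINT T|nu.S. (?G F t m T) / fact m)"
   proof (rule integral_mono)
    show "integrable nu.S (%T. norm (f m T))" using fi by auto
    show "integrable nu.S (%T. (?G F t m T) / fact m)" using PP.integrable_fst'[OF nu.integrable_comb[OF ai, of t]] by simp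
    show "norm (f m T) <= (?G F t m T) / fact m" for T unfolding fF by (simp add: divide_right_mono integral_abs_bound)
   qed
   also have "... = (LINT y|nu.S. \<bar>F t m y\<bar>) / fact m" using nu.integral_comb[OF ai, of t] by simp
   also have "... <= C * (U ^ t * W ^ m) / fact m" using Fb by (intro divide_right_mono) auto
   finally show ?thesis by simp
  qed
  have s1: "AE T in nu.S. summable (%m. norm (f m T))"
  proof (rule AE_I2)
   fix T
   let ?B = "\<bar>PROD i<t. u (T i)\<bar> * (PROD i<n + t. Re (K (comb_seq n x T i) (comb_seq n x T i)))"
   show "summable (%m. norm (f m T))"
   proof (rule summable_comparison_test'[OF summable_mult[OF se(2), of ?B]])
    fix m
    have "\<bar>LINT Y|nu.S. (PROD i<m. w (Y i)) * rho K ((n + t) + m) (comb_seq (n + t) (comb_seq n x T) Y)\<bar> <=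
     (PROD i<n + t. Re (K (comb_seq n x T i) (comb_seq n x T i))) * W ^ m"
     using weighted_rho(2)[of "%_. w" m "n + t" "comb_seq n x T"] iw by (simp add: W_def)
    from mult_left_mono[OF this, of "\<bar>PROD i<t. u (T i)\<bar>"]
    show "norm (norm (f m T)) <= ?B * (W ^ m / fact m)" by (simp add: f_def abs_mult field_simps)
   qed
  qed
  have s2: "summable (%m. LINT T|nu.S. norm (f m T))"
  proof (rule summable_comparison_test'[OF summable_mult[OF se(2), of "C * U ^ t"]])
   show "norm (LINT T|nu.S. norm (f m T)) <= C * U ^ t * (W ^ m / fact m)" for m using fn[of m] by (simp add: integral_nonneg)
  qed
  have e: "(\<Sum>m. f m T) = (PROD i<t. u (T i)) * Theta K (n + t) (comb_seq n x T) w" for T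
   unfolding f_def Theta_def by (rule suminf_mult) (rule Theta_summable[OF w iw])
  show ?thesis using sums_integral[OF fi s1 s2] integrable_suminf[OF fi s1 s2] unfolding e fint by simp
 qed
 show "integrable nu.S (?E t)" using row by blast
 have "(\<Sum>m. a t m) = (?A t) / fact t" for t using sums_divide[OF conjunct1[OF row[of t]], of "fact t"] by (simp add: sums_iff)
 with S1 show "(%t. (?A t) / fact t) sums Theta K n x (%z. u z + w z)" by (simp add: TH)
qed

lemma Theta_zero: "Theta K n x (%_. 0) = rho K n x"
proof -
 have "(LINT y|nu.S. (PROD i<m. 0) * rho K (n + m) (comb_seq n x y)) / fact m = (if m = 0 then rho K n x else 0)" for m
 proof (cases "m = 0")
  case True
  have "rho K n (comb_seq n x y) = rho K n x" for y by (rule rho_cong) (simp add: comb_seq_def)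
  then show ?thesis using True by (simp add: nu.P.prob_space)
 qed (simp add: power_0_left)
 then have "Theta K n x (%_. 0) = (\<Sum>m. if m = 0 then rho K n x else 0)" unfolding Theta_def by (simp only:)
 then show ?thesis using sums_single[of 0 "%_. rho K n x"] by (simp add: sums_iff)
qed

lemma measurable_Theta: assumes [measurable]: "w : bmeas borel" "X : M \<rightarrow>\<^sub>M nu.S"
 shows "(%a. Theta K n (X a) w) : bmeas M"
proof -
 have [measurable]: "(%(a, y). rho K k (comb_seq n (X a) y)) : bmeas (M \<Otimes>\<^sub>M nu.S)" for k
  unfolding case_prod_beta by (rule measurable_rho_comb) measurable
 show ?thesis unfolding Theta_def by measurable
qed

lemma Theta_cong: "(!!i. i < n ==> x i = y i) ==> Theta K n x w = Theta K n y w"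
proof -
 assume "!!i. i < n ==> x i = y i"
 then have "comb_seq n x Y = comb_seq n y Y" for Y by (auto simp: comb_seq_def fun_eq_iff)
 then show ?thesis by (simp add: Theta_def)
qed

lemma Theta_permute: assumes p: "p permutes {..<n}" shows "Theta K n (x \<circ> p) w = Theta K n x w"
proof -
 have "rho K (n + m) (comb_seq n (x \<circ> p) y) = rho K (n + m) (comb_seq n x y)" for m y
 proof -
  have "comb_seq n (x \<circ> p) y = comb_seq n x y \<circ> p"
   using permutes_lessThan[OF p] permutes_not_in[OF p] by (auto simp: comb_seq_def fun_eq_iff)
  moreover have "p permutes {..<n + m}" using p by (rule permutes_subset) auto
  ultimately show ?thesis by (simp add: rho_permute)
 qed
 then show ?thesis by (simp add: Theta_def)
qed

end

lemma rho_tendsto: assumes "!!z w. (%j. Kj j z w) ----> K z w"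
 shows "(%j. rho (Kj j) n x) ----> rho K n x" unfolding rho_def det_leibniz
 by (intro tendsto_Re tendsto_sum tendsto_mult tendsto_const tendsto_prod assms)

text \<open>Carries nonnegativity of Janossy densities from approximating kernels to their limit. A
  common bound on the diagonals is enough for domination, again by Hadamard's inequality.\<close>

lemma Theta_tendsto:
 fixes Kj :: "nat => kernel"
 assumes psd: "!!j. psd_kernel (Kj j)" and mj: "!!j. (%(a, b). Kj j a b) : bmeas (borel \<Otimes>\<^sub>M borel)"
  and mK: "(%(a, b). K a b) : bmeas (borel \<Otimes>\<^sub>M borel)"
  and lim: "!!z w. (%j. Kj j z w) ----> K z w" and le: "!!j z. Re (Kj j z z) <= b z"
  and w[measurable]: "w : bmeas borel" and int: "integrable nu (%z. \<bar>w z\<bar> * b z)"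
 shows "(%j. Theta (Kj j) n x w) ----> Theta K n x w"
proof -
 let ?A = "%m y. PROD i<m. \<bar>w (y i)\<bar> * b (y i)"
 have b0: "0 <= b z" for z using psd_diag(2)[OF psd, of 0 z] le[of 0 z] by linarith
 define C where "C = (PROD i<n. b (x i))"
 define W where "W = (LINT z|nu. \<bar>w z\<bar> * b z)"
 define a where "a = (%m j. (LINT y|nu.S. (PROD i<m. w (y i)) * rho (Kj j) (n + m) (comb_seq n x y)) / fact m)"
 define l where "l = (%m. (LINT y|nu.S. (PROD i<m. w (y i)) * rho K (n + m) (comb_seq n x y)) / fact m)"
 have C0: "0 <= C" unfolding C_def using b0 by (intro prod_nonneg) auto
 have bd: "\<bar>rho (Kj j) (n + m) (comb_seq n x y)\<bar> <= C * (PROD i<m. b (y i))" for j m y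
 proof -
  have "(PROD i<n. Re (Kj j (x i) (x i))) * (PROD i<m. Re (Kj j (y i) (y i))) <= C * (PROD i<m. b (y i))"
   unfolding C_def using le psd_diag(2)[OF psd] b0 by (intro mult_mono prod_mono prod_nonneg) auto
  then show ?thesis using rho_comb_bound[OF psd mj, of j n m x y] by linarith
 qed
 have B: "hbi nu.S (%y. C * (?A m y)) (C * W ^ m)" for m
  using hbi_mult[OF nu.has_bochner_integral_prod_components[OF finite_lessThan, of m "%_ z. \<bar>w z\<bar> * b z"], of C] int
  by (simp add: W_def)
 have m1: "(%y. rho (Kj j) k (comb_seq n x y)) : bmeas nu.S" for j k by (rule measurable_rho_comb1[OF psd mj])
 have m2: "(%y. rho K k (comb_seq n x y)) : bmeas nu.S" for k by (rule borel_measurable_LIMSEQ_real[OF rho_tendsto[OF lim] m1])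
 note [measurable] = m1 m2
 have pw: "\<bar>(PROD i<m. w (y i)) * rho (Kj j) (n + m) (comb_seq n x y)\<bar> <= C * (?A m y)" for m j y
 proof -
  have "\<bar>(PROD i<m. w (y i)) * rho (Kj j) (n + m) (comb_seq n x y)\<bar> <= (PROD i<m. \<bar>w (y i)\<bar>) * (C * (PROD i<m. b (y i)))"
   unfolding abs_mult abs_prod using bd by (intro mult_left_mono prod_nonneg) auto
  then show ?thesis by (simp add: prod.distrib mult_ac)
 qed
 have 1: "(%j. a m j) ----> l m" for m unfolding a_def l_def
 proof (intro tendsto_divide tendsto_const integral_dominated_convergence[where w="%y. C * (?A m y)"])
  show "integrable nu.S (%y. C * (?A m y))" using B[of m] unfolding hbi_iff by blast
  show "AE y in nu.S. norm ((PROD i<m. w (y i)) * rho (Kj j) (n + m) (comb_seq n x y)) <= C * (?A m y)" for j using pw by auto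
  show "AE y in nu.S. (%j. (PROD i<m. w (y i)) * rho (Kj j) (n + m) (comb_seq n x y)) ----> (PROD i<m. w (y i)) * rho K (n + m) (comb_seq n x y)"
   by (intro AE_I2 tendsto_mult tendsto_const rho_tendsto lim)
 qed auto
 have 2: "norm (a m j) <= C * (W ^ m / fact m)" for m j
 proof -
  have "\<bar>LINT y|nu.S. (PROD i<m. w (y i)) * rho (Kj j) (n + m) (comb_seq n x y)\<bar> <=
   (LINT y|nu.S. \<bar>(PROD i<m. w (y i)) * rho (Kj j) (n + m) (comb_seq n x y)\<bar>)" by (rule integral_abs_bound)
  also have "... <= (LINT y|nu.S. C * (?A m y))"
   using B[of m] pw C0 b0 by (intro integral_mono_AE') (auto simp: hbi_iff prod_nonneg)
  also have "... = C * W ^ m" by (rule has_bochner_integral_integral_eq[OF B])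
  finally show ?thesis by (simp add: a_def divide_right_mono)
 qed
 have s: "summable (%m. C * (W ^ m / fact m))" using summable_exp_generic[of W] by (intro summable_mult) (simp add: field_simps)
 have "\<forall>\<^sub>F (m, j) in sequentially \<times>\<^sub>F sequentially. norm (a m j) <= C * (W ^ m / fact m)"
  using 2 by (intro always_eventually) auto
 from tannerys_theorem[where a=a and b=l, OF 1 this s] show ?thesis by (simp add: Theta_def a_def l_def)
qed

text \<open>Resampling one coordinate of an independent sequence does not change its law.\<close>

lemma integral_nu_update:
 fixes f :: "_ => real" assumes f: "integrable nu.S f" shows "(LINT y|nu.S. f y) = (LINT y|nu.S. LINT z|nu. f (y(j := z)))"
proof -
 interpret PP: pair_sigma_finite nu nu.S ..
 let ?h = "%(z, y). y(j := z)"
 have d: "distr (nu \<Otimes>\<^sub>M nu.S) nu.S ?h = nu.S" using distr_pair_PiM_eq_PiM[of UNIV "%_. nu" j] nu_prob.prob_space_axioms by simp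
 have m: "?h : nu \<Otimes>\<^sub>M nu.S \<rightarrow>\<^sub>M nu.S"
 proof (rule measurable_PiM_single')
  show "(%p. ?h p i) : nu \<Otimes>\<^sub>M nu.S \<rightarrow>\<^sub>M nu" for i by (cases "i = j") (auto simp: case_prod_beta)
 qed (auto simp: space_PiM)
 have fb: "f : bmeas nu.S" using f by auto
 have "integrable (distr (nu \<Otimes>\<^sub>M nu.S) nu.S ?h) f" using f by (simp only: d)
 then have i: "integrable (nu \<Otimes>\<^sub>M nu.S) (%p. f (?h p))" using m fb by (subst (asm) integrable_distr_eq) auto
 have e: "(%p. f (?h p)) = case_prod (%z y. f (y(j := z)))" by auto
 have "(LINT y|nu.S. f y) = (LINT y|distr (nu \<Otimes>\<^sub>M nu.S) nu.S ?h. f y)" by (simp only: d)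
 also have "... = (LINT p|(nu \<Otimes>\<^sub>M nu.S). f (?h p))" using m fb by (intro integral_distr)
 also have "... = (LINT y|nu.S. LINT z|nu. f (y(j := z)))" using PP.integral_snd[OF i[unfolded e]] unfolding e by simp
 finally show ?thesis .
qed

section \<open>Positivity for projections of finite rank\<close>

context
 fixes K :: kernel and N :: nat assumes psd: "psd_kernel K" and mK: "(%(a, b). K a b) : bmeas (borel \<Otimes>\<^sub>M borel)"
  and rep: "!!a b. hbi lborel (%z. K a z * K z b) (K a b)"
  and tr: "hbi lborel (%z. K z z) (of_nat N)"
begin

lemma integral_rho_Suc:
 "hbi lborel (%z. rho K (Suc k) (x(k := z))) ((real N - real k) * rho K k x)"
proof -
 have "hbi lborel (%z. Re (kernel_det K (Suc k) (x(k := z)))) (Re ((of_nat N - of_nat k) * kernel_det K k x))"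
  by (rule has_bochner_integral_bounded_linear[OF bounded_linear_Re integral_kernel_det_Suc[OF rep tr]])
 then show ?thesis by (simp add: rho_def)
qed

text \<open>A projection of rank \<open>N\<close> has at most \<open>N\<close> points: beyond that, the nonnegative functions
  \<open>rho\<close> have a nonpositive integral.\<close>

lemma rho_rank: assumes "k > N" shows "rho K k x = 0"
proof -
 have "0 <= (LINT z|lborel. rho K (Suc k) (x(k := z)))" using psd_rho[OF psd] by (intro Bochner_Integration.integral_nonneg) auto
 also have "... = (real N - real k) * rho K k x" by (rule has_bochner_integral_integral_eq[OF integral_rho_Suc])
 finally show ?thesis using assms psd_rho(2)[OF psd, of k x] by (auto simp: zero_le_mult_iff)
qed

lemma integrable_lw_diag: "integrable nu (%z. \<bar>lw z\<bar> * Re (K z z))"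
proof -
 have "hbi lborel (%z. Re (K z z)) (Re (of_nat N))" by (rule has_bochner_integral_bounded_linear[OF bounded_linear_Re tr])
 from has_bochner_integral_nu_lw[OF this] show ?thesis using lw_pos(2) by (simp add: hbi_iff)
qed

text \<open>Let r = N - n be the number of points missing from the full N. A term with m extra
  points equals, up to the factor (r - m)!, one with r extra points of which r - m are integrated
  against Lebesgue measure. So r! times the series is the binomial expansion of the integral of a
  product of w + \<open>lw\<close>, and these factors are nonnegative.\<close>

lemma Theta_nonneg_finite_rank: assumes w[measurable]: "w : bmeas borel" and w1: "!!z. - lw z <= w z" "!!z. w z <= 0"
 shows "0 <= Theta K n x w"
proof (cases "n > N")
 case True
 then have "rho K (n + m) y = 0" for m y by (intro rho_rank) simp
 then show ?thesis by (simp add: Theta_def)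
next
 case False
 have iw: "integrable nu (%z. \<bar>w z\<bar> * Re (K z z))"
 proof (rule integrable_le[OF integrable_lw_diag])
  show "(%z. \<bar>w z\<bar> * Re (K z z)) : bmeas nu" using measurable_diag[OF psd mK] by simp
  have "\<bar>w z\<bar> <= \<bar>lw z\<bar>" for z using w1[of z] lw_pos(2)[of z] by simp
  then show "AE z in nu. norm (\<bar>w z\<bar> * Re (K z z)) <= norm (\<bar>lw z\<bar> * Re (K z z))"
   using psd_diag(2)[OF psd] by (simp add: abs_mult mult_right_mono)
 qed
 define F where "F = (%m t y. (PROD i<m. w (y i)) * (PROD i:{m..<m + t}. lw (y i)) * rho K (n + (m + t)) (comb_seq n x y))"
 define h where "h = (%(m::nat) i. if i < m then w else lw)"
 have [measurable]: "h t i : bmeas borel" for t i by (simp add: h_def)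
 have F': "F m t = (%y. (PROD i<m + t. h m i (y i)) * rho K (n + (m + t)) (comb_seq n x y))" for t m
  unfolding F_def h_def using nu.prod_split_weights[of m "m + t" w _ lw] by (simp add: fun_eq_iff)
 have ih: "integrable nu (%z. \<bar>h t i z\<bar> * Re (K z z))" for t i using iw integrable_lw_diag by (simp add: h_def)
 have Fi: "integrable nu.S (F m t)" for m t unfolding F' by (rule weighted_rho(1)[OF psd mK _ ih]) simp
 \<comment> \<open>The weight \<open>lw\<close> integrates one further point against Lebesgue
   measure. Dyson's rule then multiplies by N minus the number of points already present.\<close>
 have step: "(LINT y|nu.S. F m (Suc t) y) = (real N - real (n + (m + t))) * (LINT y|nu.S. F m t y)" for m t
 proof -
  define j where "j = m + t"
  have upd: "F m (Suc t) (y(j := z)) = ((PROD i<m. w (y i)) * (PROD i:{m..<m + t}. lw (y i))) * (lw z *\<^sub>R rho K (Suc (n + j)) ((comb_seq n x y)(n + j := z)))" for y z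
  proof -
   have "(PROD i<m. w ((y(j := z)) i)) = (PROD i<m. w (y i))" by (intro prod.cong) (auto simp: j_def)
   moreover have "(PROD i:{m..<m + Suc t}. lw ((y(j := z)) i)) = lw z * (PROD i:{m..<m + t}. lw (y i))"
   proof -
    have "(PROD i:{m..<m + t}. lw ((y(j := z)) i)) = (PROD i:{m..<m + t}. lw (y i))" by (intro prod.cong) (auto simp: j_def)
    then show ?thesis by (simp add: j_def)
   qed
   moreover have "comb_seq n x (y(j := z)) = (comb_seq n x y)(n + j := z)" by (auto simp: comb_seq_def fun_eq_iff)
   ultimately show ?thesis by (simp add: F_def j_def)
  qed
  have inner: "(LINT z|nu. F m (Suc t) (y(j := z))) = (real N - real (n + j)) * F m t y" for y
  proof -
   have "(LINT z|nu. lw z *\<^sub>R rho K (Suc (n + j)) ((comb_seq n x y)(n + j := z))) = (real N - real (n + j)) * rho K (n + j) (comb_seq n x y)"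
    by (rule has_bochner_integral_integral_eq[OF has_bochner_integral_nu_lw[OF integral_rho_Suc]])
   then show ?thesis unfolding upd by (simp add: F_def j_def)
  qed
  show ?thesis using integral_nu_update[OF Fi[of m "Suc t"], of j] unfolding inner by (simp add: j_def)
 qed
 define V where "V = (%m. LINT y|nu.S. (PROD i<m. w (y i)) * rho K (n + m) (comb_seq n x y))"
 define r where "r = N - n"
 have F0: "(LINT y|nu.S. F m 0 y) = V m" for m by (simp add: F_def V_def)
 \<comment> \<open>Iterating the recursion multiplies by (r - m) (r - m - 1) and so on. The quotient
   of factorials is written without division; for t = r - m it is (r - m)!.\<close>
 have VF: "(LINT y|nu.S. F m t y) * fact (r - (m + t)) = fact (r - m) * V m" if "m + t <= r" for m t using that
 proof (induction t)
  case (Suc t)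
  have e: "real N - real (n + (m + t)) = real (r - (m + t))" using Suc.prems False by (simp add: r_def of_nat_diff)
  have "r - (m + t) = Suc (r - (m + Suc t))" using Suc.prems by simp
  then have f: "(fact (r - (m + t)) :: real) = real (r - (m + t)) * fact (r - (m + Suc t))" by (metis fact_Suc of_nat_mult of_nat_fact)
  have "(LINT y|nu.S. F m (Suc t) y) * fact (r - (m + Suc t)) = (LINT y|nu.S. F m t y) * (real (r - (m + t)) * fact (r - (m + Suc t)))"
   by (simp only: step e mult_ac)
  also have "... = fact (r - m) * V m" using Suc.IH Suc.prems unfolding f[symmetric] by simp
  finally show ?case .
 qed (simp add: F0)
 have V0: "V m = 0" if "m > r" for m
 proof -
  have "rho K (n + m) y = 0" for y using that False by (intro rho_rank) (simp add: r_def)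
  then show ?thesis by (simp add: V_def)
 qed
 have "Theta K n x w = (\<Sum>m. V m / fact m)" by (simp add: Theta_def V_def)
 also have "... = (SUM m<=r. V m / fact m)" using V0 by (intro suminf_finite) (auto simp: not_le)
 finally have "fact r * Theta K n x w = (SUM m<=r. fact r * (V m / fact m))" by (simp add: sum_distrib_left)
 also have "... = (SUM m<=r. of_nat (r choose m) * (LINT y|nu.S. F m (r - m) y))"
 proof (intro sum.cong refl)
  fix m assume "m : {..r}"
  then have m: "m <= r" by simp
  have "(LINT y|nu.S. F m (r - m) y) = fact (r - m) * V m" using VF[of m "r - m"] m by simp
  then show "fact r * (V m / fact m) = of_nat (r choose m) * (LINT y|nu.S. F m (r - m) y)" using m by (simp add: binomial_fact)
 qed
 also have "... = (SUM m<=r. of_nat (r choose m) * (LINT y|nu.S. (PROD i<m. w (y i)) * (PROD i:{m..<r}. lw (y i)) * rho K (n + r) (comb_seq n x y)))"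
  by (intro sum.cong refl) (simp add: F_def)
 also have "... = (LINT y|nu.S. (PROD i<r. w (y i) + lw (y i)) * rho K (n + r) (comb_seq n x y))" using iw integrable_lw_diag
  by (intro nu.integral_prod_add[symmetric, where b="%z. Re (K z z)" and C="PROD i<n. Re (K (x i) (x i))"] rho_comb_permute[OF psd mK])
   (auto intro!: rho_comb_bound[OF psd mK] prod_diag_nonneg[OF psd mK] psd_diag(2)[OF psd] measurable_rho_comb1[OF psd mK])
 also have "... >= 0"
 proof (intro Bochner_Integration.integral_nonneg mult_nonneg_nonneg prod_nonneg ballI)
  show "0 <= w (y i) + lw (y i)" for y i using w1(1)[of "y i"] by simp
 qed (use psd_rho(2)[OF psd] in auto)
 finally show ?thesis using fact_gt_zero[of r, where 'a=real] by (auto simp: zero_le_mult_iff not_le)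
qed

end

section \<open>Labelled configurations and their weights\<close>

abbreviation lab :: "(nat \<times> (nat => plane)) measure" where
 "lab \<equiv> count_space UNIV \<Otimes>\<^sub>M nu.S"

definition labj :: "nat \<times> (nat => plane) => nat \<times> (nat => plane) => nat \<times> (nat => plane)" where
 "labj s r = (fst s + fst r, comb_seq (fst s) (snd s) (snd r))"

lemma space_lab [simp]: "space lab = UNIV" by (auto simp: space_pair_measure space_PiM)

lemma measurable_labj [measurable]: assumes [measurable]: "f : M \<rightarrow>\<^sub>M lab" "g : M \<rightarrow>\<^sub>M lab"
 shows "(%x. labj (f x) (g x)) : M \<rightarrow>\<^sub>M lab"
proof -
 have "(%x. comb_seq (fst (f x)) (snd (f x)) (snd (g x))) : M \<rightarrow>\<^sub>M nu.S"
  by (rule measurable_compose_countable[where f="%n x. comb_seq n (snd (f x)) (snd (g x))"]) measurable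
 moreover have "(%x. fst (f x) + fst (g x)) : M \<rightarrow>\<^sub>M count_space UNIV" by measurable
 ultimately show ?thesis unfolding labj_def by (rule measurable_Pair[rotated])
qed

definition wgt :: "(plane => real) => nat \<times> (nat => plane) => ennreal" where
 "wgt u s = ennreal (1 / fact (fst s)) * (PROD i<fst s. ennreal (u (snd s i)))"

text \<open>Up to the factor exp of the integral of u, for nonnegative integrable u, this is the law
  of a Poisson process with density u against \<open>nu\<close>, with its points in random
  order.\<close>

definition lam :: "(plane => real) => (nat \<times> (nat => plane)) measure" where
 "lam u = density lab (wgt u)"

lemma measurable_wgt [measurable]: assumes [measurable]: "u : bmeas borel" shows "wgt u : bmeas lab"
proof -
 have "(%s. (%n s. ennreal (1 / fact n) * (PROD i<n. ennreal (u (snd s i)))) (fst s) s) : bmeas lab"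
  by (rule measurable_compose_countable) measurable
 then show ?thesis by (simp add: wgt_def[abs_def])
qed

lemma sets_lam [measurable_cong, simp]: "sets (lam u) = sets lab" by (simp add: lam_def)

lemma nn_integral_lab: assumes "f : bmeas lab" shows "(nni lab (%s. f s)) = (\<Sum>t. nni nu.S (%T. f (t, T)))"
 by (subst nu.P.nn_integral_fst[symmetric, OF assms]) (simp add: nn_integral_count_space_nat)

lemma nn_integral_lam: assumes [measurable]: "u : bmeas borel" "f : bmeas lab"
 shows "(nni (lam u) (%s. f s)) = (\<Sum>t. nni nu.S (%T. wgt u (t, T) * f (t, T)))"
 unfolding lam_def by (subst nn_integral_density) (auto simp: nn_integral_lab)

lemma measurable_lab_Pair [measurable]: "(%T. (t, T)) : nu.S \<rightarrow>\<^sub>M lab" by measurable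

text \<open>Superposition of Poisson processes, for the unnormalised measures. The join lists the
  points of weight u first, which a function symmetric in the labels cannot see; hence the
  restriction to such functions.\<close>

lemma lam_add: assumes u[measurable]: "u : bmeas borel" and w[measurable]: "w : bmeas borel"
  and u0: "!!z. 0 <= u z" and w0: "!!z. 0 <= w z" and H[measurable]: "H : bmeas lab"
  and sym: "!!n p x. p permutes {..<n} ==> H (n, x \<circ> p) = H (n, x)"
 shows "(nni (lam u) (%s. nni (lam w) (%r. H (labj s r)))) = (nni (lam (%z. u z + w z)) (%s. H s))"
proof -
 interpret lab: pair_sigma_finite "count_space (UNIV :: nat set)" nu.S
  by (intro pair_sigma_finite.intro sigma_finite_measure_count_space nu.P.sigma_finite_measure_axioms)
 have m2: "(%(s, r). H (labj s r)) : bmeas (lab \<Otimes>\<^sub>M lab)" by measurable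
 have m3: "(%s. nni (lam w) (%r. H (labj s r))) : bmeas lab"
 proof -
  have "(%s. nni lab (%r. wgt w r * H (labj s r))) : bmeas lab" by measurable
  then show ?thesis unfolding lam_def by (subst nn_integral_density) auto
 qed
 define Q where "Q = (%t m. nni nu.S (%y. (PROD i<t. ennreal (u (y i))) * (PROD i:{t..<t + m}. ennreal (w (y i))) * H (t + m, y)))"
 define a where "a = (%t m. ennreal (1 / fact t) * (ennreal (1 / fact m) * Q t m))"
 have "(nni (lam u) (%s. nni (lam w) (%r. H (labj s r)))) =
   (\<Sum>t. nni nu.S (%T. wgt u (t, T) * (\<Sum>m. nni nu.S (%Y. wgt w (m, Y) * H (labj (t, T) (m, Y))))))"
  using m3 by (subst nn_integral_lam) (auto intro!: suminf_cong nn_integral_cong simp: nn_integral_lam)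
 also have "... = (\<Sum>t. \<Sum>m. a t m)"
 proof (intro suminf_cong)
  fix t
  have [measurable]: "(%T. nni nu.S (%Y. wgt w (m, Y) * H (labj (t, T) (m, Y)))) : bmeas nu.S" for m by measurable
  have "(nni nu.S (%T. wgt u (t, T) * (\<Sum>m. nni nu.S (%Y. wgt w (m, Y) * H (labj (t, T) (m, Y)))))) =
   (nni nu.S (%T. (\<Sum>m. wgt u (t, T) * (nni nu.S (%Y. wgt w (m, Y) * H (labj (t, T) (m, Y)))))))"
   by (simp add: ennreal_suminf_cmult)
  also have "... = (\<Sum>m. nni nu.S (%T. wgt u (t, T) * (nni nu.S (%Y. wgt w (m, Y) * H (labj (t, T) (m, Y))))))"
   by (intro nn_integral_suminf) measurable
  also have "... = (\<Sum>m. a t m)"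
  proof (intro suminf_cong)
   fix m
   have "(nni nu.S (%T. wgt u (t, T) * (nni nu.S (%Y. wgt w (m, Y) * H (labj (t, T) (m, Y)))))) =
    (nni nu.S (%T. nni nu.S (%Y. (%y. ennreal (1 / fact t) * (ennreal (1 / fact m) * ((PROD i<t. ennreal (u (y i))) * (PROD i:{t..<t + m}. ennreal (w (y i))) * H (t + m, y)))) (comb_seq t T Y))))"
   proof (rule nn_integral_cong)
    fix T
    have "wgt u (t, T) * (nni nu.S (%Y. wgt w (m, Y) * H (labj (t, T) (m, Y)))) =
     (nni nu.S (%Y. wgt u (t, T) * (wgt w (m, Y) * H (labj (t, T) (m, Y)))))" by (rule nn_integral_cmult[symmetric]) measurable
    also have "... = (nni nu.S (%Y. (%y. ennreal (1 / fact t) * (ennreal (1 / fact m) * ((PROD i<t. ennreal (u (y i))) * (PROD i:{t..<t + m}. ennreal (w (y i))) * H (t + m, y)))) (comb_seq t T Y)))"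
    proof (rule nn_integral_cong)
     fix Y
     show "wgt u (t, T) * (wgt w (m, Y) * H (labj (t, T) (m, Y))) =
      (%y. ennreal (1 / fact t) * (ennreal (1 / fact m) * ((PROD i<t. ennreal (u (y i))) * (PROD i:{t..<t + m}. ennreal (w (y i))) * H (t + m, y)))) (comb_seq t T Y)"
      unfolding wgt_def labj_def fst_conv snd_conv
       prod_comb_seq_low[of "%z. ennreal (u z)"] prod_comb_seq_high[of "%z. ennreal (w z)"] by (simp only: mult_ac)
    qed
    finally show "wgt u (t, T) * (nni nu.S (%Y. wgt w (m, Y) * H (labj (t, T) (m, Y)))) = (nni nu.S (%Y. (%y. ennreal (1 / fact t) * (ennreal (1 / fact m) * ((PROD i<t. ennreal (u (y i))) * (PROD i:{t..<t + m}. ennreal (w (y i))) * H (t + m, y)))) (comb_seq t T Y)))" .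
   qed
   also have "... = (nni nu.S (%y. ennreal (1 / fact t) * (ennreal (1 / fact m) * ((PROD i<t. ennreal (u (y i))) * (PROD i:{t..<t + m}. ennreal (w (y i))) * H (t + m, y)))))"
    by (rule nu.nn_integral_comb[symmetric]) measurable
   also have "... = a t m" unfolding a_def Q_def by (subst nn_integral_cmult; measurable?; subst nn_integral_cmult; measurable?)
   finally show "(nni nu.S (%T. wgt u (t, T) * (nni nu.S (%Y. wgt w (m, Y) * H (labj (t, T) (m, Y)))))) = a t m" .
  qed
  finally show "(nni nu.S (%T. wgt u (t, T) * (\<Sum>m. nni nu.S (%Y. wgt w (m, Y) * H (labj (t, T) (m, Y)))))) = (\<Sum>m. a t m)" .
 qed
 also have "... = (\<Sum>k. SUM t<=k. a t (k - t))" by (rule ennreal_suminf_diagonal)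
 also have "... = (\<Sum>k. nni nu.S (%y. wgt (%z. u z + w z) (k, y) * H (k, y)))"
 proof (intro suminf_cong)
  fix k
  have "(nni nu.S (%y. wgt (%z. u z + w z) (k, y) * H (k, y))) =
   (nni nu.S (%y. ennreal (1 / fact k) * ((PROD i<k. ennreal (u (y i)) + ennreal (w (y i))) * H (k, y))))"
   using u0 w0 by (auto intro!: nn_integral_cong simp: wgt_def mult_ac)
  also have "... = ennreal (1 / fact k) * (nni nu.S (%y. (PROD i<k. ennreal (u (y i)) + ennreal (w (y i))) * H (k, y)))"
   by (rule nn_integral_cmult) measurable
  also have "(nni nu.S (%y. (PROD i<k. ennreal (u (y i)) + ennreal (w (y i))) * H (k, y))) =
   (SUM t<=k. of_nat (k choose t) * (nni nu.S (%y. (PROD i<t. ennreal (u (y i))) * (PROD i:{t..<k}. ennreal (w (y i))) * H (k, y))))"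
   by (rule nu.nn_integral_prod_add[where u="%z. ennreal (u z)" and w="%z. ennreal (w z)" and G="%y. H (k, y)"])
    (auto simp: sym)
  also have "... = (SUM t<=k. of_nat (k choose t) * Q t (k - t))" by (intro sum.cong refl) (auto simp: Q_def)
  also have "ennreal (1 / fact k) * ... = (SUM t<=k. a t (k - t))" unfolding sum_distrib_left
  proof (intro sum.cong refl)
   fix t assume t: "t : {..k}"
   have "(1 / fact k) * real (k choose t) = (1 / fact t) * (1 / fact (k - t))" using t by (simp add: binomial_fact)
   then have "ennreal (1 / fact k) * of_nat (k choose t) = ennreal (1 / fact t) * ennreal (1 / fact (k - t))"
    by (simp only: ennreal_of_nat_eq_real_of_nat ennreal_mult[symmetric] zero_le_divide_1_iff fact_ge_zero of_nat_0_le_iff)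
   then show "ennreal (1 / fact k) * (of_nat (k choose t) * Q t (k - t)) = a t (k - t)" by (simp add: a_def mult.assoc[symmetric])
  qed
  finally show "(SUM t<=k. a t (k - t)) = (nni nu.S (%y. wgt (%z. u z + w z) (k, y) * H (k, y)))" by simp
 qed
 also have "... = (nni (lam (%z. u z + w z)) (%s. H s))" by (subst nn_integral_lam) auto
 finally show ?thesis .
qed

section \<open>Windows, shells and Janossy densities\<close>

definition window :: "nat => plane set" where
 "window k = ball 0 (real k)"

text \<open>Lebesgue measure on the window, expressed as a density against \<open>nu\<close>. Window
  0 is an open ball of radius 0 and hence empty, so the chain below can start without
  points.\<close>

definition wind :: "nat => plane => real" where
 "wind k z = ind (window k) z * lw z"

definition shell :: "nat => plane => real" where
 "shell k z = ind (window (Suc k) - window k) z * lw z"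

lemma window_borel [measurable]: "window k : sets borel" by (simp add: window_def)

lemma window_bounded: "bounded (window k)" by (simp add: window_def)

lemma wind_measurable [measurable]: "wind k : bmeas borel" "shell k : bmeas borel"
 unfolding wind_def[abs_def] shell_def[abs_def] by measurable

lemma wind_nonneg: "0 <= wind k z" "0 <= shell k z" using lw_pos(2) by (auto simp: wind_def shell_def)

lemma wind_Suc: "wind k z + shell k z = wind (Suc k) z" by (auto simp: wind_def shell_def window_def indicator_def)

lemma wind_0: "wind 0 z = 0" by (simp add: wind_def window_def)

text \<open>The assumption \<open>pos\<close> is the property that positive semidefiniteness does
  not provide; through it the series below can serve as densities of a Markov chain.\<close>

locale janossy_kernel =
 fixes K :: kernel assumes psd: "psd_kernel K" and mK: "(%(a, b). K a b) : bmeas (borel \<Otimes>\<^sub>M borel)"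
  and loc: "!!A. A : sets borel ==> bounded A ==> set_integrable lborel A (%z. Re (K z z))"
  and pos: "!!k n x. 0 <= Theta K n x (%z. - wind k z)"
begin

lemma integrable_wind: assumes "A : sets borel" "bounded A" shows "integrable nu (%z. \<bar>ind A z * lw z\<bar> * Re (K z z))"
proof -
 have "hbi lborel (%z. ind A z *\<^sub>R Re (K z z)) (LINT z|lborel. ind A z *\<^sub>R Re (K z z))"
  using loc[OF assms] unfolding set_integrable_def by (rule has_bochner_integral_integrable)
 from has_bochner_integral_nu_lw[OF this]
 show ?thesis using lw_pos(2) by (simp add: hbi_iff abs_mult mult_ac)
qed

lemma integrable_wind_diag: "integrable nu (%z. \<bar>wind k z\<bar> * Re (K z z))" "integrable nu (%z. \<bar>- wind k z\<bar> * Re (K z z))"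
 "integrable nu (%z. \<bar>shell k z\<bar> * Re (K z z))" unfolding wind_def shell_def abs_minus_cancel
 by (intro integrable_wind; auto simp: window_bounded intro: bounded_subset[OF window_bounded])+

text \<open>For points in window k this is the Janossy density: the density of the event that these
  are all the points of the process in the window.\<close>

definition J :: "nat => nat \<times> (nat => plane) => real" where
 "J k s = Theta K (fst s) (snd s) (%z. - wind k z)"

lemma J_nonneg: "0 <= J k s" by (simp add: J_def pos)

lemma measurable_J [measurable]: "J k : bmeas lab"
proof -
 have "(%s. (%n s. Theta K n (snd s) (%z. - wind k z)) (fst s) s) : bmeas lab"
  by (rule measurable_compose_countable) (auto intro!: measurable_Theta[OF psd mK])
 then show ?thesis by (simp add: J_def[abs_def])
qed

lemma J_permute: "p permutes {..<n} ==> J k (n, x \<circ> p) = J k (n, x)" by (simp add: J_def Theta_permute[OF psd mK])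

text \<open>The expansion \<open>Theta_add\<close> read as an integral over labelled configurations.
  Taking the shell for u gives consistency of successive windows; taking the whole window cancels
  the weight and returns the correlation function.\<close>

lemma nn_integral_lam_Theta: assumes u[measurable]: "u : bmeas borel" and u0: "!!z. 0 <= u z"
  and iu: "integrable nu (%z. \<bar>u z\<bar> * Re (K z z))"
 shows "(nni (lam u) (%r. ennreal (J k (labj s r)))) = ennreal (Theta K (fst s) (snd s) (%z. u z + - wind k z))"
proof -
 let ?A = "%t. nni nu.S (%T. wgt u (t, T) * ennreal (J k (labj s (t, T))))"
 define n where "n = fst s"
 define x where "x = snd s"
 let ?w = "%z. - wind k z"
 have [measurable]: "(%r. ennreal (J k (labj s r))) : bmeas lab" by measurable
 have "(nni (lam u) (%r. ennreal (J k (labj s r)))) = (\<Sum>t. nni nu.S (%T. wgt u (t, T) * ennreal (J k (labj s (t, T)))))"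
  by (rule nn_integral_lam) measurable
 also have "... = (\<Sum>t. ennreal ((LINT T|nu.S. (PROD i<t. u (T i)) * Theta K (n + t) (comb_seq n x T) ?w) / fact t))"
 proof (intro suminf_cong)
  fix t
  have "(?A t) = (nni nu.S (%T. ennreal (((PROD i<t. u (T i)) * Theta K (n + t) (comb_seq n x T) ?w) / fact t)))"
  proof (intro nn_integral_cong)
   fix T
   have "wgt u (t, T) * ennreal (J k (labj s (t, T))) = ennreal ((1 / fact t) * (PROD i<t. u (T i)) * Theta K (n + t) (comb_seq n x T) ?w)"
    using u0 pos by (simp add: wgt_def prod_ennreal J_def labj_def n_def x_def ennreal_mult[symmetric] prod_nonneg)
   then show "wgt u (t, T) * ennreal (J k (labj s (t, T))) = ennreal (((PROD i<t. u (T i)) * Theta K (n + t) (comb_seq n x T) ?w) / fact t)"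
    by simp
  qed
  also have "... = ennreal (LINT T|nu.S. ((PROD i<t. u (T i)) * Theta K (n + t) (comb_seq n x T) ?w) / fact t)"
   using Theta_add(2)[OF psd mK u iu _ integrable_wind_diag(2), where t=t and n=n and x=x] u0 pos
   by (intro nn_integral_eq_integral) (auto simp: prod_nonneg)
  finally show "(?A t) = ennreal ((LINT T|nu.S. (PROD i<t. u (T i)) * Theta K (n + t) (comb_seq n x T) ?w) / fact t)" by simp
 qed
 also have "... = ennreal (Theta K n x (%z. u z + ?w z))"
 proof -
  have "(%t. (LINT T|nu.S. (PROD i<t. u (T i)) * Theta K (n + t) (comb_seq n x T) ?w) / fact t) sums Theta K n x (%z. u z + ?w z)"
   by (rule Theta_add(1)[OF psd mK u iu _ integrable_wind_diag(2)]) simp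
  moreover have "0 <= (LINT T|nu.S. (PROD i<t. u (T i)) * Theta K (n + t) (comb_seq n x T) ?w) / fact t" for t
   using u0 pos by (intro divide_nonneg_nonneg Bochner_Integration.integral_nonneg) (auto simp: prod_nonneg)
  ultimately show ?thesis by (intro suminf_ennreal_eq)
 qed
 finally show ?thesis by (simp add: n_def x_def)
qed

lemma J_consistent: "(nni (lam (shell k)) (%r. ennreal (J (Suc k) (labj s r)))) = ennreal (J k s)"
proof -
 have "shell k z + - wind (Suc k) z = - wind k z" for z using wind_Suc[of k z] by simp
 then show ?thesis using nn_integral_lam_Theta[OF wind_measurable(2) wind_nonneg(2) integrable_wind_diag(3), where k="Suc k" and s=s]
  by (simp add: J_def)
qed

lemma J_recover: "(nni (lam (wind k)) (%r. ennreal (J k (labj s r)))) = ennreal (rho K (fst s) (snd s))"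
 using nn_integral_lam_Theta[OF wind_measurable(1) wind_nonneg(1) integrable_wind_diag(1), where k=k and s=s] by (simp add: Theta_zero[OF psd mK])

lemma J_0: "J 0 s = rho K (fst s) (snd s)" by (simp add: J_def wind_0 Theta_zero[OF psd mK])

text \<open>The conditional law of the configuration in the next window given the one in window k:
  points of the shell are added with the quotient of the two Janossy densities as density. States of
  density 0 stay where they are, so the transition has total mass 1 everywhere.\<close>

definition step :: "nat => nat \<times> (nat => plane) => (nat \<times> (nat => plane)) measure" where
 "step k s = (if J k s > 0 then distr (density (lam (shell k)) (%r. ennreal (J (Suc k) (labj s r) / J k s))) lab (labj s)
  else return lab s)"

lemma sets_step [simp, measurable_cong]: "sets (step k s) = sets lab" by (simp add: step_def)

lemma nn_integral_step: assumes [measurable]: "f : bmeas lab" and J: "J k s > 0"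
 shows "(nni (step k s) (%r. f r)) = (nni (lam (shell k)) (%r. ennreal (J (Suc k) (labj s r) / J k s) * f (labj s r)))"
proof -
 have m: "labj s : density (lam (shell k)) (%r. ennreal (J (Suc k) (labj s r) / J k s)) \<rightarrow>\<^sub>M lab" by measurable
 show ?thesis unfolding step_def using J m by (simp add: nn_integral_distr) (subst nn_integral_density, auto)
qed

lemma nn_integral_step_0: assumes "f : bmeas lab" and "~ J k s > 0" shows "(nni (step k s) (%r. f r)) = f s"
 unfolding step_def using assms by (simp add: nn_integral_return)

lemma prob_space_step: "prob_space (step k s)"
proof (cases "J k s > 0")
 case True
 have "(nni (step k s) (%r. 1)) = (nni (lam (shell k)) (%r. ennreal (J (Suc k) (labj s r) / J k s)))"
  using nn_integral_step[OF _ True, of "%_. 1"] by simp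
 also have "... = (nni (lam (shell k)) (%r. ennreal (1 / J k s) * ennreal (J (Suc k) (labj s r))))"
  using True J_nonneg by (auto intro!: nn_integral_cong simp: ennreal_mult[symmetric])
 also have "... = ennreal (1 / J k s) * (nni (lam (shell k)) (%r. ennreal (J (Suc k) (labj s r))))" by (intro nn_integral_cmult) measurable
 also have "... = ennreal (1 / J k s) * ennreal (J k s)" by (simp only: J_consistent)
 also have "... = 1" using True by (simp add: ennreal_mult[symmetric])
 finally show ?thesis by (intro prob_spaceI) simp
next
 case False
 then show ?thesis by (simp add: step_def prob_space_return)
qed

lemma measurable_step [measurable]: "step k : lab \<rightarrow>\<^sub>M subprob_algebra lab"
proof (rule measurable_subprob_algebra)
 fix s
 show "subprob_space (step k s)" using prob_space_step by (rule prob_space_imp_subprob_space)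
 show "sets (step k s) = sets lab" by simp
next
 interpret lab: pair_sigma_finite "count_space (UNIV :: nat set)" nu.S
  by (intro pair_sigma_finite.intro sigma_finite_measure_count_space nu.P.sigma_finite_measure_axioms)
 fix A assume A[measurable]: "A : sets lab"
 have e: "emeasure (step k s) A = (if J k s > 0 then
   (nni lab (%r. wgt (shell k) r * (ennreal (J (Suc k) (labj s r) / J k s) * ind A (labj s r)))) else ind A s)" for s
 proof (cases "J k s > 0")
  case True
  have "emeasure (step k s) A = (nni (step k s) (%r. ind A r))" by simp
  also have "... = (nni (lam (shell k)) (%r. ennreal (J (Suc k) (labj s r) / J k s) * ind A (labj s r)))"
   by (rule nn_integral_step[OF _ True]) measurable
  finally show ?thesis using True unfolding lam_def by (subst (asm) nn_integral_density) auto
 next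
  case False
  then show ?thesis by (simp add: step_def)
 qed
 show "(%s. emeasure (step k s) A) : bmeas lab" unfolding e by measurable
qed

end

lemma nn_integral_nu_lborel_pow: assumes [measurable]: "F : bmeas (lborel_pow n)"
 shows "(nni nu.S (%T. (PROD i<n. ennreal (lw (T i))) * F (restrict T {..<n}))) = (nni (lborel_pow n) (%x. F x))"
proof -
 let ?D = "%x. restrict x {..<n}"
 let ?C = "%x. PROD i<n. ennreal (lw (x i))"
 let ?B = "%x. PROD i<n. ennreal (lw (x i))"
 interpret pl: product_sigma_finite "%_::nat. lborel :: plane measure" ..
 let ?N = "PiM {..<n} (%_. nu)"
 have sets_N [measurable_cong]: "sets ?N = sets (lborel_pow n)" by (intro sets_PiM_cong) auto
 have d: "distr nu.S ?N ?D = ?N" using nu.distr_PiM_restrict_finite[of "{..<n}"] by simp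
 have m: "?D : nu.S \<rightarrow>\<^sub>M ?N" by (rule measurable_restrict_subset) simp
 have Fm: "F : bmeas ?N" by measurable
 have c: "(%x. x i) : ?N \<rightarrow>\<^sub>M borel" if "i < n" for i
  using measurable_component_singleton[of i "{..<n}" "%_. nu"] that by (subst measurable_cong_sets[OF refl sets_nu, symmetric]) simp
 have dm: "?B : bmeas ?N"
  by (intro borel_measurable_prod_ennreal) (rule measurable_compose[OF c, of _ "%z. ennreal (lw z)"], auto)
 have dens: "lborel_pow n = density ?N ?B"
 proof (rule pl.PiM_eqI[symmetric])
  fix A :: "nat => plane set" assume A: "!!i. i : {..<n} ==> A i : sets lborel"
  have [measurable]: "A i : sets borel" if "i < n" for i using A that by auto
  have S: "Pi\<^sub>E {..<n} A : sets ?N" using A by (intro sets_PiM_I_finite) auto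
  have "emeasure (density ?N ?B) (Pi\<^sub>E {..<n} A) = (nni ?N (%x. (?C x) * ind (Pi\<^sub>E {..<n} A) x))"
   by (rule emeasure_density[OF dm S])
  also have "... = (nni ?N (%x. (PROD i<n. ennreal (lw (x i)) * ind (A i) (x i))))"
  proof (rule nn_integral_cong)
   fix x assume "x : space ?N"
   then have "ind (Pi\<^sub>E {..<n} A) x = (PROD i<n. ind (A i) (x i) :: ennreal)"
    by (auto simp: indicator_def space_PiM PiE_iff prod_zero_iff intro!: prod_zero)
   then show "(?C x) * ind (Pi\<^sub>E {..<n} A) x = (PROD i<n. ennreal (lw (x i)) * ind (A i) (x i))" by (simp add: prod.distrib)
  qed
  also have "... = (PROD i<n. nni nu (%z. ennreal (lw z) * ind (A i) z))" by (rule nu.product_nn_integral_prod) auto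
  also have "... = (PROD i<n. emeasure lborel (A i))" by (intro prod.cong refl) (simp add: nn_integral_nu_lw)
  finally show "emeasure (density ?N ?B) (Pi\<^sub>E {..<n} A) = (PROD i:{..<n}. emeasure lborel (A i))" .
 qed (auto simp: sets_N)
 have "(nni (lborel_pow n) (%x. F x)) = (nni (density ?N ?B) (%x. F x))" by (simp only: dens[symmetric])
 also have "... = (nni ?N (%x. (?C x) * F x))" by (rule nn_integral_density[OF dm Fm])
 also have "... = (nni (distr nu.S ?N ?D) (%x. (?C x) * F x))" by (simp only: d)
 also have "... = (nni nu.S (%T. (PROD i<n. ennreal (lw (restrict T {..<n} i))) * F (restrict T {..<n})))"
  by (intro nn_integral_distr[OF m]) (simp only: measurable_distr_eq1, rule borel_measurable_times_ennreal[OF dm Fm])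
 also have "... = (nni nu.S (%T. (PROD i<n. ennreal (lw (T i))) * F (restrict T {..<n})))"
  by (intro nn_integral_cong arg_cong2[where f="(*)"] prod.cong) auto
 finally show ?thesis by simp
qed

lemma AE_nu_distinct: "AE y in nu.S. ALL i j. i ~= j --> y i ~= y j"
proof -
 have "AE y in nu.S. y i ~= y j" if "i ~= j" for i j
 proof -
  have S: "{y : space nu.S. y i = y j} : sets nu.S" by measurable
  let ?f = "ind {y : space nu.S. y i = y j} :: _ => real"
  have int: "integrable nu.S ?f" using S by (auto simp: nu.P.emeasure_eq_measure)
  have n0: "measure nu {c} = 0" for c
  proof -
   have "emeasure nu {c} = 0"
    unfolding nu_def by (subst emeasure_density) (auto simp: nn_integral_0_iff_AE AE_lborel_singleton intro!: AE_I'[where N="{c}"])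
   then show ?thesis by (simp add: measure_def)
  qed
  have "(LINT y|nu.S. ?f y) = (LINT y|nu.S. LINT z|nu. ?f (y(i := z)))" by (rule integral_nu_update[OF int])
  also have "(%y. LINT z|nu. ?f (y(i := z))) = (%y. LINT z|nu. ind {y j} z)"
   using that by (auto simp: fun_eq_iff indicator_def space_PiM intro!: integral_eq)
  also have "... = (%y. 0)" by (simp add: n0)
  finally have "(LINT y|nu.S. ?f y) = 0" by simp
  then have "AE y in nu.S. ?f y = 0" using integral_nonneg_eq_0_iff_AE[OF int] by simp
  then show ?thesis by (auto simp: indicator_def elim!: AE_mp intro!: AE_I2 split: if_splits)
 qed
 then show ?thesis by (subst AE_all_countable, intro allI, subst AE_all_countable, intro allI) (auto intro: AE_impI)
qed

lemma borel_measurable_lam [simp]: "bmeas (lam u) = bmeas lab" by (rule measurable_cong_sets) simp_all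

section \<open>The Markov chain over growing windows\<close>

context janossy_kernel
begin

definition transk :: "nat => (nat => nat \<times> (nat => plane)) => (nat \<times> (nat => plane)) measure" where
 "transk i w = (case i of 0 => return lab (0, %_. 0) | Suc k => step k (w k))"

lemma measurable_transk: "transk i : PiM {0..<i} (%_. lab) \<rightarrow>\<^sub>M subprob_algebra lab"
proof (cases i)
  case 0
  have "return lab (0, %_. 0) : space (subprob_algebra lab)"
   by (simp add: space_subprob_algebra prob_space_return prob_space_imp_subprob_space)
  then have "(%w. return lab (0, %_. 0)) : PiM {0..<i} (%_. lab) \<rightarrow>\<^sub>M subprob_algebra lab"
   by (rule measurable_const)
  then show ?thesis using 0 by (simp add: transk_def[abs_def])
 next
  case (Suc k)
  have "(%w. w k) : PiM {0..<i} (%_. lab) \<rightarrow>\<^sub>M lab" using Suc by (intro measurable_component_singleton) auto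
  then have "(%w. step k (w k)) : PiM {0..<i} (%_. lab) \<rightarrow>\<^sub>M subprob_algebra lab"
   by (rule measurable_compose[OF _ measurable_step])
  then show ?thesis using Suc by (simp add: transk_def[abs_def])
 qed

lemma prob_space_transk: "prob_space (transk i x)" by (cases i) (auto simp: transk_def prob_space_step prob_space_return)

sublocale chain: Ionescu_Tulcea transk "%_. lab" by (rule Ionescu_Tulcea.intro) (rule measurable_transk prob_space_transk)+

definition L :: "(nat => nat \<times> (nat => plane)) measure" where
 "L = chain.PF.lim"

lemma sets_L [measurable_cong, simp]: "sets L = sets (PiM UNIV (%_. lab))" by (simp add: L_def)

lemma space_L [simp]: "space L = UNIV" by (auto simp: L_def space_PiM)

lemma measurable_L_component [measurable]: "(%w. w k) : L \<rightarrow>\<^sub>M lab" by measurable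

lemma prob_space_L: "prob_space L"
proof -
 have m: "(%x. restrict x {}) : L \<rightarrow>\<^sub>M PiM {} (%_. lab)"
  by (subst measurable_cong_sets[OF sets_L refl]) (rule measurable_restrict_subset, simp)
 have "distr L (PiM {} (%_. lab)) (%x. restrict x {}) = chain.CI {}" unfolding L_def by (rule chain.distr_lim) simp
 moreover have "prob_space (chain.CI {})" using chain.PF.prob_space_P[of "{}"] by simp
 ultimately show ?thesis using prob_space_distrD[OF m] by simp
qed

lemma nn_integral_L_C: assumes [measurable]: "g : bmeas (PiM {0..<n} (%_. lab))"
 shows "(nni L (%w. g (restrict w {0..<n}))) = (nni (chain.C 0 n (%_. undefined)) (%x. g x))"
proof -
 let ?A = "%x. restrict x {0..<n}"
 have u: "n <= chain.up_to {0..<n}" using chain.up_to_less[of "{0..<n}" "n - 1"] by (cases n) auto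
 have sp: "(%_. undefined) : space (PiM {0..<0} (%_. lab))" by (auto simp: space_PiM PiE_iff extensional_def)
 have CI: "chain.CI {0..<n} = chain.C 0 n (%_. undefined)" unfolding chain.CI_def using chain.distr_C[OF u sp] by simp
 have m: "?A : L \<rightarrow>\<^sub>M PiM {0..<n} (%_. lab)"
  by (subst measurable_cong_sets[OF sets_L refl]) (rule measurable_restrict_subset, simp)
 have "(nni L (%w. g (restrict w {0..<n}))) = (nni (distr L (PiM {0..<n} (%_. lab)) ?A) (%x. g x))" using m by (subst nn_integral_distr) auto
 also have "distr L (PiM {0..<n} (%_. lab)) ?A = chain.C 0 n (%_. undefined)"
  unfolding L_def CI[symmetric] by (rule chain.distr_lim) simp
 finally show ?thesis .
qed

lemma nn_integral_C_Suc: assumes g[measurable]: "g : bmeas (PiM {0..<Suc n} (%_. lab))"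
 shows "(nni (chain.C 0 (Suc n) (%_. undefined)) (%x. g x)) =
  (nni (chain.C 0 n (%_. undefined)) (%x. nni (transk n x) (%s. g (x(n := s)))))"
proof -
 have sp: "(%_. undefined) : space (PiM {0..<0} (%_. lab))" by (auto simp: space_PiM PiE_iff extensional_def)
 have sC: "sets (chain.C 0 n (%_. undefined)) = sets (PiM {0..<n} (%_. lab))" using chain.sets_C[OF sp, of n] by simp
 have spC: "space (chain.C 0 n (%_. undefined)) = space (PiM {0..<n} (%_. lab))" using chain.space_C[OF sp, of n] by simp
 have eP: "chain.eP n : chain.C 0 n (%_. undefined) \<rightarrow>\<^sub>M subprob_algebra (PiM {0..<Suc n} (%_. lab))"
  by (subst measurable_cong_sets[OF sC refl]) (rule chain.measurable_eP)
 have "(nni (chain.C 0 (Suc n) (%_. undefined)) (%x. g x)) = (nni (chain.C 0 n (%_. undefined)) (%x. nni (chain.eP n x) (%y. g y)))"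
  using nn_integral_bind[OF g eP] by simp
 also have "... = (nni (chain.C 0 n (%_. undefined)) (%x. nni (transk n x) (%s. g (x(n := s)))))"
  using spC by (intro nn_integral_cong chain.nn_integral_eP) auto
 finally show ?thesis .
qed

lemma nn_integral_L_step: assumes f[measurable]: "(%(s, s'). f s s') : bmeas (lab \<Otimes>\<^sub>M lab)"
 shows "(nni L (%w. f (w k) (w (Suc k)))) = (nni L (%w. nni (step k (w k)) (%s. f (w k) s)))"
proof -
 let ?A = "%x. nni (step k (x k)) (%s. f (x k) s)"
 have m1: "(%x. f (x k) (x (Suc k))) : bmeas (PiM {0..<Suc (Suc k)} (%_. lab))"
  using measurable_compose[OF _ f, of "%x. (x k, x (Suc k))" "PiM {0..<Suc (Suc k)} (%_. lab)"] by simp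
 have m0: "(%s. nni (step k s) (%s'. f s s')) : bmeas lab"
  by (rule nn_integral_measurable_subprob_algebra2[OF f measurable_step])
 have m2: "?A : bmeas (PiM {0..<Suc k} (%_. lab))" by (rule measurable_compose[OF _ m0, of "%x. x k"]) simp
 have "(nni L (%w. f (w k) (w (Suc k)))) = (nni L (%w. (%x. f (x k) (x (Suc k))) (restrict w {0..<Suc (Suc k)})))" by simp
 also have "... = (nni (chain.C 0 (Suc (Suc k)) (%_. undefined)) (%x. f (x k) (x (Suc k))))" by (rule nn_integral_L_C[OF m1])
 also have "... = (nni (chain.C 0 (Suc k) (%_. undefined)) (%x. nni (transk (Suc k) x) (%s. f ((x(Suc k := s)) k) ((x(Suc k := s)) (Suc k)))))"
  by (rule nn_integral_C_Suc[OF m1])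
 also have "... = (nni (chain.C 0 (Suc k) (%_. undefined)) (%x. nni (step k (x k)) (%s. f (x k) s)))" by (simp add: transk_def)
 also have "... = (nni L (%w. ?A (restrict w {0..<Suc k})))" by (rule nn_integral_L_C[OF m2, symmetric])
 finally show ?thesis by simp
qed

lemma nn_integral_L_0: assumes h[measurable]: "h : bmeas lab" shows "(nni L (%w. h (w 0))) = h (0, %_. 0)"
proof -
 have m: "(%x. h (x 0)) : bmeas (PiM {0..<Suc 0} (%_. lab))" by (rule measurable_compose[OF _ h]) simp
 have "(nni L (%w. h (w 0))) = (nni L (%w. (%x. h (x 0)) (restrict w {0..<Suc 0})))" by simp
 also have "... = (nni (chain.C 0 (Suc 0) (%_. undefined)) (%x. h (x 0)))" by (rule nn_integral_L_C[OF m])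
 also have "... = (nni (chain.C 0 0 (%_. undefined)) (%x. nni (transk 0 x) (%s. h ((x(0 := s)) 0))))"
  by (rule nn_integral_C_Suc[OF m])
 also have "... = (nni (chain.C 0 0 (%_. undefined)) (%x. h (0, %_. 0)))" by (simp add: transk_def nn_integral_return)
 also have "... = h (0, %_. 0)"
 proof -
  have sp: "(%_. undefined) : space (PiM {0..<0} (%_. lab))" by (auto simp: space_PiM PiE_iff extensional_def)
  show ?thesis using prob_space.emeasure_space_1[OF chain.prob_space_C[OF sp, of 0]] by (simp del: chain.C.simps)
 qed
 finally show ?thesis .
qed

text \<open>In the induction step the quotient in the transition cancels \<open>J k\<close>, and
  superposition merges window and shell. Only symmetric functions can be tested: the chain lists its
  points shell by shell, so the labelled law itself is not symmetric.\<close>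

lemma chain_law: assumes h[measurable]: "h : bmeas lab"
  and sym: "!!n p x. p permutes {..<n} ==> h (n, x \<circ> p) = h (n, x)" and h0: "!!x y. h (0, x) = h (0, y)"
 shows "(nni L (%w. h (w k))) = (nni (lam (wind k)) (%s. h s * ennreal (J k s)))" using assms
proof (induction k arbitrary: h)
 case (0 h)
 note [measurable] = 0(1)
 have "(nni (lam (wind 0)) (%s. h s * ennreal (J 0 s))) = (\<Sum>t. nni nu.S (%T. wgt (wind 0) (t, T) * (h (t, T) * ennreal (J 0 (t, T)))))"
  by (rule nn_integral_lam) measurable
 \<comment> \<open>Window 0 is empty, so every state with a point has weight 0, and on the empty
   state the density is the 0-point determinant 1.\<close>
 also have "... = (\<Sum>t. if t = 0 then h (0, %_. 0) else 0)"
 proof (intro suminf_cong)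
  fix t
  show "(nni nu.S (%T. wgt (wind 0) (t, T) * (h (t, T) * ennreal (J 0 (t, T))))) = (if t = 0 then h (0, %_. 0) else 0)"
  proof (cases "t = 0")
   case True
   have "wgt (wind 0) (0, T) * (h (0, T) * ennreal (J 0 (0, T))) = h (0, %_. 0)" for T
    using 0(3)[of T "%_. 0"] by (simp add: wgt_def J_0 rho_def)
   then show ?thesis using True by (simp add: nu.P.emeasure_space_1)
  next
   case False
   then have "wgt (wind 0) (t, T) = 0" for T by (auto simp: wgt_def wind_0 power_0_left)
   then show ?thesis using False by simp
  qed
 qed
 also have "... = h (0, %_. 0)" by (subst suminf_finite[of "{0}"]) auto
 finally show ?case by (simp add: nn_integral_L_0)
next
 case (Suc k h)
 note [measurable] = Suc.prems(1)
 note sym = Suc.prems(2) and h0 = Suc.prems(3)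
 have [measurable]: "(%r. h (labj s r)) : bmeas lab" for s by (rule measurable_compose[OF _ Suc.prems(1)]) measurable
 define hh where "hh = (%s. nni (step k s) (%s'. h s'))"
 have hhm[measurable]: "hh : bmeas lab"
  unfolding hh_def by (rule nn_integral_measurable_subprob_algebra2[OF _ measurable_step]) measurable
 have jp: "labj (n, x \<circ> p) r = (n + fst r, snd (labj (n, x) r) \<circ> p)" if "p permutes {..<n}" for n x p r
  using permutes_lessThan[OF that] permutes_not_in[OF that] by (auto simp: labj_def comb_seq_def fun_eq_iff)
 have jfst: "labj (n, x) r = (n + fst r, snd (labj (n, x) r))" for n x r by (simp add: labj_def)
 have hj: "h (labj (n, x \<circ> p) r) = h (labj (n, x) r)" "J (Suc k) (labj (n, x \<circ> p) r) = J (Suc k) (labj (n, x) r)"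
  if p: "p permutes {..<n}" for n x p r
 proof -
  have p': "p permutes {..<n + fst r}" using p by (rule permutes_subset) auto
  show "h (labj (n, x \<circ> p) r) = h (labj (n, x) r)" unfolding jp[OF p] sym[OF p'] jfst[symmetric] ..
  show "J (Suc k) (labj (n, x \<circ> p) r) = J (Suc k) (labj (n, x) r)" unfolding jp[OF p] J_permute[OF p'] jfst[symmetric] ..
 qed
 \<comment> \<open>Where \<open>J k s\<close> is positive it cancels against the denominator of the
   transition. Where it is 0, consistency forces the next density to vanish almost everywhere on the
   shell, so the default transition does no harm.\<close>
 have hhJ: "hh s * ennreal (J k s) = (nni (lam (shell k)) (%r. h (labj s r) * ennreal (J (Suc k) (labj s r))))" for s
 proof (cases "J k s > 0")
  case True
  have "hh s * ennreal (J k s) = (nni (lam (shell k)) (%r. ennreal (J (Suc k) (labj s r) / J k s) * h (labj s r))) * ennreal (J k s)"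
   unfolding hh_def by (subst nn_integral_step[OF _ True]) auto
  also have "... = (nni (lam (shell k)) (%r. ennreal (J (Suc k) (labj s r) / J k s) * h (labj s r) * ennreal (J k s)))"
   by (rule nn_integral_multc[symmetric]) (simp, measurable)
  also have "... = (nni (lam (shell k)) (%r. h (labj s r) * ennreal (J (Suc k) (labj s r))))"
  proof (rule nn_integral_cong)
   fix r
   have "ennreal (J (Suc k) (labj s r) / J k s) * ennreal (J k s) = ennreal (J (Suc k) (labj s r))"
    using True J_nonneg by (simp add: ennreal_mult[symmetric])
   then show "ennreal (J (Suc k) (labj s r) / J k s) * h (labj s r) * ennreal (J k s) = h (labj s r) * ennreal (J (Suc k) (labj s r))"
    by (metis mult.assoc mult.commute)
  qed
  finally show ?thesis .
 next
  case False
  then have J0: "J k s = 0" using J_nonneg[of k s] by simp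
  have "(nni (lam (shell k)) (%r. ennreal (J (Suc k) (labj s r)))) = 0" by (simp add: J_consistent J0)
  then have AE0: "AE r in lam (shell k). ennreal (J (Suc k) (labj s r)) = 0" by (subst (asm) nn_integral_0_iff_AE) auto
  have "(nni (lam (shell k)) (%r. h (labj s r) * ennreal (J (Suc k) (labj s r)))) = (nni (lam (shell k)) (%r. 0))"
   by (intro nn_integral_cong_AE) (use AE0 in \<open>eventually_elim, simp\<close>)
  then show ?thesis by (simp add: J0)
 qed
 have "(nni L (%w. h (w (Suc k)))) = (nni L (%w. hh (w k)))" unfolding hh_def by (rule nn_integral_L_step[of "%s s'. h s'"]) measurable
 also have "... = (nni (lam (wind k)) (%s. hh s * ennreal (J k s)))"
 proof (rule Suc.IH[OF hhm])
  show "hh (n, x \<circ> p) = hh (n, x)" if p: "p permutes {..<n}" for n p x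
  proof (cases "J k (n, x) > 0")
   case True
   then have T2: "J k (n, x \<circ> p) > 0" by (simp add: J_permute[OF p])
   show ?thesis unfolding hh_def
    by (subst nn_integral_step[OF _ True], simp, subst nn_integral_step[OF _ T2], simp) (simp add: hj[OF p] J_permute[OF p])
  next
   case False
   then have F2: "~ J k (n, x \<circ> p) > 0" by (simp add: J_permute[OF p])
   show ?thesis unfolding hh_def by (subst nn_integral_step_0[OF _ False], simp, subst nn_integral_step_0[OF _ F2], simp) (rule sym[OF p])
  qed
  show "hh (0, x) = hh (0, y)" for x y
  proof -
   have Jxy: "J k (0, x) = J k (0, y)" unfolding J_def by (simp add: Theta_cong[OF psd mK, of 0 x y])
   have jxy: "labj (0, x) = labj (0, y)" by (simp add: labj_def fun_eq_iff comb_seq_0)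
   show ?thesis
   proof (cases "J k (0, x) > 0")
    case True
    then have T2: "J k (0, y) > 0" by (simp add: Jxy)
    show ?thesis unfolding hh_def by (subst nn_integral_step[OF _ True], simp, subst nn_integral_step[OF _ T2], simp) (simp add: Jxy jxy)
   next
    case False
    then have F2: "~ J k (0, y) > 0" by (simp add: Jxy)
    show ?thesis unfolding hh_def by (subst nn_integral_step_0[OF _ False], simp, subst nn_integral_step_0[OF _ F2], simp) (rule h0)
   qed
  qed
 qed
 also have "... = (nni (lam (wind k)) (%s. nni (lam (shell k)) (%r. (%s. h s * ennreal (J (Suc k) s)) (labj s r))))"
  by (simp only: hhJ)
 also have "... = (nni (lam (%z. wind k z + shell k z)) (%s. h s * ennreal (J (Suc k) s)))"
  by (rule lam_add) (auto simp: wind_nonneg sym J_permute)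
 also have "(%z. wind k z + shell k z) = wind (Suc k)" by (rule ext) (rule wind_Suc)
 finally show ?case .
qed

end

section \<open>Final sigma-algebra and sums over labels\<close>

text \<open>The largest sigma-algebra that makes f measurable. A sum over tuples of points is
  measurable on it as soon as its composition with f is, which can be checked on labels; the
  configuration sigma-algebra is coarser, so the identity remains a point process.\<close>

definition final_space :: "'a measure => 'b set => ('a => 'b) => 'b measure" where
 "final_space M \<Omega> f = sigma \<Omega> {E : Pow \<Omega>. f -` E Int space M : sets M}"

lemma space_final_space [simp]: "space (final_space M \<Omega> f) = \<Omega>" unfolding final_space_def by (rule space_measure_of) auto

lemma sets_final_space: assumes f: "f : space M \<rightarrow> \<Omega>"
 shows "sets (final_space M \<Omega> f) = {E : Pow \<Omega>. f -` E Int space M : sets M}"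
proof -
 let ?E = "{E : Pow \<Omega>. f -` E Int space M : sets M}"
 have "sigma_algebra \<Omega> ?E" unfolding sigma_algebra_iff2
 proof (intro conjI ballI allI impI)
  fix E assume E: "E : ?E"
  have "f -` (\<Omega> - E) Int space M = space M - (f -` E Int space M)" using f by auto
  also have "... : sets M" using E by auto
  finally show "\<Omega> - E : ?E" by auto
 next
  fix E :: "nat => 'b set" assume E: "range E \<subseteq> ?E"
  have "f -` (\<Union>i. E i) Int space M = (\<Union>i. f -` E i Int space M)" by auto
  also have "... : sets M" using E by (intro sets.countable_UN) auto
  finally show "(\<Union>i. E i) : ?E" using E by auto
 qed auto
 then show ?thesis unfolding final_space_def by (rule sigma_algebra.sets_measure_of_eq)
qed

lemma measurable_final_space: assumes f: "f : space M \<rightarrow> \<Omega>" shows "f : M \<rightarrow>\<^sub>M final_space M \<Omega> f"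
 by (rule measurableI) (use f in \<open>auto simp: sets_final_space[OF f]\<close>)

lemma measurable_from_final_space:
 assumes f: "f : space M \<rightarrow> \<Omega>" and g: "(%x. g (f x)) : M \<rightarrow>\<^sub>M K" and gs: "g : \<Omega> \<rightarrow> space K"
 shows "g : final_space M \<Omega> f \<rightarrow>\<^sub>M K"
proof (rule measurableI)
 fix B assume B: "B : sets K"
 have "f -` (g -` B Int \<Omega>) Int space M = (%x. g (f x)) -` B Int space M" using f by auto
 also have "... : sets M" using g B by (rule measurable_sets)
 finally show "g -` B Int space (final_space M \<Omega> f) : sets (final_space M \<Omega> f)" by (simp add: sets_final_space[OF f])
qed (use gs in auto)

definition pts :: "nat \<times> (nat => plane) => plane set" where
 "pts s = snd s ` {..<fst s}"

definition extends :: "nat => nat \<times> (nat => plane) => nat \<times> (nat => plane) => bool" where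
 "extends k s s' \<longleftrightarrow> fst s <= fst s' & (ALL i. i < fst s --> snd s' i = snd s i) &
  (ALL i. fst s <= i & i < fst s' --> snd s' i : window (Suc k) - window k)"

lemma extends_refl: "extends k s s" by (auto simp: extends_def)

lemma pts_extends: assumes "extends k s s'" shows "pts s \<subseteq> pts s'" "pts s' \<subseteq> pts s Un (window (Suc k) - window k)"
proof
 fix z assume "z : pts s"
 then obtain i where "i < fst s" "z = snd s i" by (auto simp: pts_def)
 then show "z : pts s'" using assms unfolding extends_def pts_def by (intro image_eqI[of _ _ i]) auto
next
 show "pts s' \<subseteq> pts s Un (window (Suc k) - window k)"
 proof
  fix z assume "z : pts s'"
  then obtain i where i: "i < fst s'" "z = snd s' i" by (auto simp: pts_def)
  show "z : pts s Un (window (Suc k) - window k)"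
  proof (cases "i < fst s")
   case True
   then have "z = snd s i" using assms i by (simp add: extends_def)
   then show ?thesis using True by (auto simp: pts_def)
  next
   case False
   then show ?thesis using assms i by (simp add: extends_def)
  qed
 qed
qed

lemma pred_borel_eq:
 fixes f g :: "'a => plane" assumes [measurable]: "f : M \<rightarrow>\<^sub>M borel" "g : M \<rightarrow>\<^sub>M borel"
 shows "Measurable.pred M (%x. f x = g x)"
proof -
 have "{x : space M. f x = g x} : sets M" by (rule measurable_equality_set[OF assms])
 then show ?thesis unfolding pred_def .
qed

lemma pred_shell: "Measurable.pred borel (%z. z : window (Suc k) - window k)" unfolding pred_def by simp

lemma pred_nat_le:
 fixes f g :: "'a => nat" assumes "f : M \<rightarrow>\<^sub>M count_space UNIV" "g : M \<rightarrow>\<^sub>M count_space UNIV"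
 shows "Measurable.pred M (%x. f x <= g x)"
proof (rule measurable_compose_countable[where f="%n x. n <= g x" and g=f, OF _ assms(1)])
 show "Measurable.pred M (%x. n <= g x)" for n by (rule measurable_compose[OF assms(2)]) simp
qed

lemma pred_nat_less:
 fixes f g :: "'a => nat" assumes "f : M \<rightarrow>\<^sub>M count_space UNIV" "g : M \<rightarrow>\<^sub>M count_space UNIV"
 shows "Measurable.pred M (%x. f x < g x)"
proof (rule measurable_compose_countable[where f="%n x. n < g x" and g=f, OF _ assms(1)])
 show "Measurable.pred M (%x. n < g x)" for n by (rule measurable_compose[OF assms(2)]) simp
qed

lemma measurable_extends [measurable]: "Measurable.pred (lab \<Otimes>\<^sub>M lab) (%p. extends k (fst p) (snd p))"
proof -
 have m: "(%p. snd (snd p) i) : lab \<Otimes>\<^sub>M lab \<rightarrow>\<^sub>M borel" "(%p. snd (fst p) i) : lab \<Otimes>\<^sub>M lab \<rightarrow>\<^sub>M borel" for i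
  by measurable
 have "(%p. fst (fst p)) : lab \<Otimes>\<^sub>M lab \<rightarrow>\<^sub>M count_space UNIV" "(%p. fst (snd p)) : lab \<Otimes>\<^sub>M lab \<rightarrow>\<^sub>M count_space UNIV"
  by measurable
 have "Measurable.pred (lab \<Otimes>\<^sub>M lab) (%p. snd (snd p) i = snd (fst p) i)" "Measurable.pred (lab \<Otimes>\<^sub>M lab) (%p. snd (snd p) i : window (Suc k) - window k)" for i
  by (rule pred_borel_eq[OF m]) (rule measurable_compose[OF m(1)], rule pred_shell)
 moreover have "Measurable.pred (lab \<Otimes>\<^sub>M lab) (%p. i < fst (fst p))" "Measurable.pred (lab \<Otimes>\<^sub>M lab) (%p. fst (fst p) <= i)"
   "Measurable.pred (lab \<Otimes>\<^sub>M lab) (%p. i < fst (snd p))" for i by (rule pred_nat_less pred_nat_le; simp)+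
 moreover have "Measurable.pred (lab \<Otimes>\<^sub>M lab) (%p. fst (fst p) <= fst (snd p))" by (rule pred_nat_le; simp)
 ultimately show ?thesis unfolding extends_def by (intro pred_intros_logic(2-6) pred_intros_countable(1))
qed

lemma measurable_inj [measurable]: "Measurable.pred lab (%s. inj_on (snd s) {..<fst s})"
proof -
 have m: "(%s. snd s i) : lab \<rightarrow>\<^sub>M borel" for i by measurable
 have "Measurable.pred lab (%s. i < fst s)" for i by (rule pred_nat_less) simp_all
 moreover have "Measurable.pred lab (%s. snd s i = snd s j)" for i j by (rule pred_borel_eq[OF m m])
 moreover have "Measurable.pred lab (%s. i = j)" for i j :: nat by simp
 ultimately have "Measurable.pred lab (%s. ALL i j. i < fst s --> j < fst s --> snd s i = snd s j --> i = j)"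
  by (intro pred_intros_logic(2-6) pred_intros_countable(1))
 moreover have "inj_on (snd s) {..<fst s} \<longleftrightarrow> (ALL i j. i < fst s --> j < fst s --> snd s i = snd s j --> i = j)"
  for s :: "nat \<times> (nat => plane)" by (auto simp: inj_on_def)
 ultimately show ?thesis by (simp only:)
qed

definition injt :: "nat => nat => (nat => nat) set" where
 "injt n m = {c : {..<n} \<rightarrow>\<^sub>E {..<m}. inj_on c {..<n}}"

lemma card_injt: assumes "n <= m" shows "card (injt n m) * fact (m - n) = fact m"
proof -
 have "(PROD i=0..<n. m - i) * fact (m - n) = fact m" using assms
 proof (induction n)
  case (Suc n)
  have "m - n = Suc (m - Suc n)" using Suc.prems by simp
  then have "fact (m - n) = (m - n) * fact (m - Suc n)" by (metis fact_Suc of_nat_id)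
  then show ?case using Suc by (simp add: mult.assoc)
 qed simp
 then show ?thesis using card_inj_on_subset_funcset[of "{..<n}" "{..<m}" "{..<n}"] by (simp add: injt_def)
qed

lemma injt_empty: "m < n ==> injt n m = {}" using card_inj[of _ "{..<n}" "{..<m}"] by (force simp: injt_def PiE_iff)

text \<open>When the labelling is injective, tuples of distinct points correspond to injective
  tuples of labels, an index set that depends only on the number of points.\<close>

lemma sum_distinct_tuples_labels: assumes x: "inj_on x {..<m}"
 shows "(SUM y:distinct_tuples n (x ` {..<m}). a y) = (SUM c:injt n m. a (\<lambda>i\<in>{..<n}. x (c i)))"
proof -
 let ?A = "%c. \<lambda>i\<in>{..<n}. x (c i)"
 have "bij_betw ?A (injt n m) (distinct_tuples n (x ` {..<m}))" unfolding bij_betw_def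
 proof
  show "inj_on ?A (injt n m)"
  proof (rule inj_onI)
   fix c d assume c: "c : injt n m" and d: "d : injt n m" and e: "(\<lambda>i\<in>{..<n}. x (c i)) = (\<lambda>i\<in>{..<n}. x (d i))"
   have "c i = d i" if "i : {..<n}" for i
   proof -
    have "x (c i) = x (d i)" using fun_cong[OF e, of i] that by simp
    moreover have "c i : {..<m}" "d i : {..<m}" using c d that by (auto simp: injt_def PiE_iff)
    ultimately show ?thesis using x by (auto dest: inj_onD)
   qed
   then show "c = d" using c d by (intro extensionalityI[of _ "{..<n}"]) (auto simp: injt_def PiE_iff)
  qed
  show "?A ` injt n m = distinct_tuples n (x ` {..<m})"
  proof (rule subset_antisym; rule subsetI)
   fix y assume "y : ?A ` injt n m"
   then obtain c where c: "c : injt n m" "y = (\<lambda>i\<in>{..<n}. x (c i))" by auto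
   have cm: "ALL i:{..<n}. c i : {..<m}" using c(1) by (simp add: injt_def PiE_iff)
   have "inj_on y {..<n}"
   proof (rule inj_onI)
    fix i j assume ij: "i : {..<n}" "j : {..<n}" "y i = y j"
    then have "x (c i) = x (c j)" by (simp add: c(2))
    then have "c i = c j" using inj_onD[OF x] cm ij by blast
    then show "i = j" using c(1) ij by (auto simp: injt_def dest: inj_onD)
   qed
   then show "y : distinct_tuples n (x ` {..<m})" using cm by (auto simp: distinct_tuples_def c(2) PiE_iff)
  next
   fix y assume y: "y : distinct_tuples n (x ` {..<m})"
   then have "ALL i:{..<n}. EX j:{..<m}. y i = x j" by (auto simp: distinct_tuples_def PiE_iff)
   then obtain f where "ALL i:{..<n}. f i : {..<m} & y i = x (f i)" by metis
   then have f: "!!i. i < n ==> f i < m & y i = x (f i)" by simp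
   define c where "c = (\<lambda>i\<in>{..<n}. f i)"
   have "y = (\<lambda>i\<in>{..<n}. x (c i))" using y f by (intro extensionalityI[of _ "{..<n}"]) (auto simp: distinct_tuples_def PiE_iff c_def)
   moreover have "c : injt n m"
   proof -
    have "inj_on c {..<n}"
    proof (rule inj_onI)
     fix i j assume ij: "i : {..<n}" "j : {..<n}" "c i = c j"
     then have "y i = y j" using f by (simp add: c_def)
     then show "i = j" using y ij by (auto simp: distinct_tuples_def dest: inj_onD)
    qed
    then show ?thesis using f by (auto simp: injt_def c_def PiE_iff)
   qed
   ultimately show "y : ?A ` injt n m" by blast
  qed
 qed
 from sum.reindex_bij_betw[OF this, of a] show ?thesis by simp
qed

section \<open>Gluing the windows to one configuration\<close>

context janossy_kernel
begin

text \<open>The points added in a step carry the weight \<open>shell k\<close>, which vanishes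
  outside the shell; a transition that moves old points or places new ones elsewhere has probability
  0.\<close>

lemma AE_extends: "AE w in L. extends k (w k) (w (Suc k))"
proof -
 define f where "f = (%s s'. ind {p. ~ extends k (fst p) (snd p)} (s, s') :: ennreal)"
 have fm: "(%(s, s'). f s s') : bmeas (lab \<Otimes>\<^sub>M lab)"
 proof -
  have "(ind {p : space (lab \<Otimes>\<^sub>M lab). ~ extends k (fst p) (snd p)} :: _ => ennreal) : bmeas (lab \<Otimes>\<^sub>M lab)"
   by measurable
  also have "?this \<longleftrightarrow> ?thesis" by (intro measurable_cong) (auto simp: f_def indicator_def)
  finally show ?thesis .
 qed
 have [measurable]: "(%r. f s (labj s r)) : bmeas lab" for s
  using measurable_compose[OF _ fm, of "%r. (s, labj s r)" lab] by simp
 have fm2: "f s : bmeas lab" for s using measurable_compose[OF _ fm, of "%r. (s, r)" lab] by simp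
 have z: "(nni (step k s) (%s'. f s s')) = 0" for s
 proof (cases "J k s > 0")
  case True
  have "(nni (step k s) (%s'. f s s')) = (nni (lam (shell k)) (%r. ennreal (J (Suc k) (labj s r) / J k s) * f s (labj s r)))"
   by (rule nn_integral_step[OF fm2 True])
  also have "... = (\<Sum>t. nni nu.S (%T. wgt (shell k) (t, T) * (ennreal (J (Suc k) (labj s (t, T)) / J k s) * f s (labj s (t, T)))))"
   by (rule nn_integral_lam) measurable
  also have "... = (\<Sum>t. nni nu.S (%T. 0))"
  proof (intro suminf_cong nn_integral_cong)
   fix t T
   show "wgt (shell k) (t, T) * (ennreal (J (Suc k) (labj s (t, T)) / J k s) * f s (labj s (t, T))) = 0"
   proof (cases "ALL i<t. T i : window (Suc k) - window k")
    case True
    then have "extends k s (labj s (t, T))" by (auto simp: extends_def labj_def comb_seq_def)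
    then show ?thesis by (simp add: f_def)
   next
    case False
    then obtain i where "i < t" "T i ~: window (Suc k) - window k" by blast
    then have "wgt (shell k) (t, T) = 0" by (auto simp: wgt_def shell_def intro!: prod_zero bexI[of _ i])
    then show ?thesis by simp
   qed
  qed
  finally show ?thesis by simp
 next
  case False
  show ?thesis by (subst nn_integral_step_0[OF fm2 False]) (simp add: f_def extends_refl)
 qed
 have "(nni L (%w. f (w k) (w (Suc k)))) = 0" by (subst nn_integral_L_step[OF fm]) (simp add: z)
 moreover have "(%w. f (w k) (w (Suc k))) : bmeas L"
  using measurable_compose[OF _ fm, of "%w. (w k, w (Suc k))" L] by simp
 ultimately have "AE w in L. f (w k) (w (Suc k)) = 0" by (subst (asm) nn_integral_0_iff_AE) auto
 then show ?thesis by eventually_elim (auto simp: f_def indicator_def split: if_splits)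
qed

lemma AE_start: "AE w in L. fst (w 0) = 0"
proof -
 let ?h = "%s :: nat \<times> (nat => plane). if fst s = 0 then 0 else 1 :: ennreal"
 have [measurable]: "?h : bmeas lab" by measurable
 have "(nni L (%w. ?h (w 0))) = 0" by (subst nn_integral_L_0) auto
 moreover have "(%w. ?h (w 0)) : bmeas L" by measurable
 ultimately have "AE w in L. ?h (w 0) = 0" by (subst (asm) nn_integral_0_iff_AE) auto
 then show ?thesis by eventually_elim (auto split: if_splits)
qed

text \<open>Injectivity does not depend on the order of the labels, so the law of the chain at one
  time decides it; there the points have a density against independent draws from a measure without
  atoms.\<close>

lemma AE_inj: "AE w in L. inj_on (snd (w k)) {..<fst (w k)}"
proof -
 let ?h = "%s :: nat \<times> (nat => plane). if inj_on (snd s) {..<fst s} then 0 else 1 :: ennreal"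
 have [measurable]: "?h : bmeas lab" by measurable
 have "(nni L (%w. ?h (w k))) = (nni (lam (wind k)) (%s. ?h s * ennreal (J k s)))"
 proof (rule chain_law)
  fix n :: nat and p :: "nat => nat" and x :: "nat => plane" assume p: "p permutes {..<n}"
  have "inj_on (x \<circ> p) {..<n} \<longleftrightarrow> inj_on x (p ` {..<n})"
   using permutes_inj[OF p] by (metis comp_inj_on_iff inj_on_subset subset_UNIV)
  then show "?h (n, x \<circ> p) = ?h (n, x)" by (simp add: permutes_image[OF p])
 qed auto
 also have "... = (\<Sum>t. nni nu.S (%T. wgt (wind k) (t, T) * (?h (t, T) * ennreal (J k (t, T)))))" by (rule nn_integral_lam) measurable
 also have "... = (\<Sum>t. nni nu.S (%T. 0))"
 proof (intro suminf_cong nn_integral_cong_AE)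
  fix t
  show "AE T in nu.S. wgt (wind k) (t, T) * (?h (t, T) * ennreal (J k (t, T))) = 0" using AE_nu_distinct
  proof eventually_elim
   case (elim T)
   then have "inj_on T {..<t}" by (auto simp: inj_on_def)
   then show ?case by simp
  qed
 qed
 finally have "(nni L (%w. ?h (w k))) = 0" by simp
 moreover have "(%w. ?h (w k)) : bmeas L" by measurable
 ultimately have "AE w in L. ?h (w k) = 0" by (subst (asm) nn_integral_0_iff_AE) auto
 then show ?thesis by eventually_elim (auto split: if_splits)
qed

definition good :: "(nat => nat \<times> (nat => plane)) => bool" where
 "good w \<longleftrightarrow> fst (w 0) = 0 & (ALL k. extends k (w k) (w (Suc k))) & (ALL k. inj_on (snd (w k)) {..<fst (w k)})"

lemma AE_good: "AE w in L. good w" unfolding good_def using AE_start AE_extends AE_inj by (simp add: AE_conj_iff AE_all_countable)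

lemma measurable_good [measurable]: "Measurable.pred L good"
proof -
 have [measurable]: "Measurable.pred L (%w. extends k (w k) (w (Suc k)))" for k
  using measurable_compose[OF _ measurable_extends, of "%w. (w k, w (Suc k))" L k] by simp
 have [measurable]: "Measurable.pred L (%w. inj_on (snd (w k)) {..<fst (w k)})" for k
  by (rule measurable_compose[OF measurable_L_component measurable_inj])
 show ?thesis unfolding good_def[abs_def] by measurable
qed

text \<open>The empty set on the exceptional event keeps every value locally finite, so that the map
  takes its values in \<open>configs\<close> everywhere.\<close>

definition points :: "(nat => nat \<times> (nat => plane)) => plane set" where
 "points w = (if good w then (\<Union>k. pts (w k)) else {})"

lemma good_pts_window: assumes "good w" shows "pts (w k) \<subseteq> window k"
proof (induction k)
 case 0
 then show ?case using assms by (simp add: good_def pts_def)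
next
 case (Suc k)
 have "extends k (w k) (w (Suc k))" using assms by (simp add: good_def)
 moreover have "window k \<subseteq> window (Suc k)" by (auto simp: window_def)
 ultimately show ?case using pts_extends(2) Suc by blast
qed

lemma good_pts_mono: "good w ==> pts (w k) \<subseteq> pts (w (Suc k))" by (rule pts_extends(1)[of k]) (simp add: good_def)

lemma good_pts_restrict: assumes "good w" "k <= l" shows "pts (w l) Int window k = pts (w k)" using assms(2)
proof (induction l rule: dec_induct)
 case base
 then show ?case using good_pts_window[OF assms(1)] by blast
next
 case (step l)
 have "extends l (w l) (w (Suc l))" using assms by (simp add: good_def)
 from pts_extends[OF this] have "pts (w (Suc l)) Int window l = pts (w l) Int window l" by blast
 moreover have "window k \<subseteq> window l" using step by (auto simp: window_def)
 ultimately show ?case using step by blast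
qed

lemma points_window: assumes "good w" shows "points w Int window k = pts (w k)"
proof
 show "points w Int window k \<subseteq> pts (w k)"
 proof
  fix z assume "z : points w Int window k"
  then obtain l where l: "z : pts (w l)" "z : window k" using assms by (auto simp: points_def)
  show "z : pts (w k)"
  proof (cases "k <= l")
   case True
   then show ?thesis using good_pts_restrict[OF assms True] l by blast
  next
   case False
   then show ?thesis using good_pts_restrict[OF assms, of l k] l by auto
  qed
 qed
 show "pts (w k) \<subseteq> points w Int window k" using good_pts_window[OF assms] assms by (auto simp: points_def)
qed

lemma bounded_in_window: assumes "bounded A" shows "EX k. A \<subseteq> window k"
proof -
 obtain R where R: "!!z. z : A ==> norm z <= R" using assms by (auto simp: bounded_iff)
 obtain k where "R < real k" using reals_Archimedean2 by blast
 then have "A \<subseteq> window k" using R by (force simp: window_def)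
 then show ?thesis ..
qed

lemma points_configs: "points w : configs" unfolding configs_def
proof (intro CollectI allI impI)
 fix A :: "plane set" assume "bounded A"
 then obtain k where k: "A \<subseteq> window k" using bounded_in_window by blast
 show "finite (points w Int A)"
 proof (cases "good w")
  case True
  have "points w Int A \<subseteq> pts (w k)" using points_window[OF True, of k] k by blast
  then show ?thesis by (rule finite_subset) (simp add: pts_def)
 qed (simp add: points_def)
qed

lemma npts_pts: assumes "inj_on (snd s) {..<fst s}" shows "npts A (pts s) = (SUM i<fst s. ind A (snd s i))"
proof -
 have "npts A (pts s) = of_nat (card (pts s Int A))" by (rule npts_eq_card) (simp add: pts_def)
 also have "of_nat (card (pts s Int A)) = (SUM z:pts s. ind A z :: ennreal)" by (simp add: indicator_def sum.If_cases pts_def)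
 also have "... = (SUM i<fst s. ind A (snd s i))" unfolding pts_def using assms by (simp add: sum.reindex)
 finally show ?thesis .
qed

text \<open>On the good event a count is the increasing limit of the counts among the labelled
  points of the windows, and each of these is a finite sum over labels.\<close>

lemma measurable_points: "points : L \<rightarrow>\<^sub>M config_space" unfolding config_space_def
proof (rule measurable_measure_of)
 show "points : space L \<rightarrow> configs" using points_configs by auto
 fix E assume "E : {{S : configs. npts A S : B} |A B. A : sets borel & B : sets borel}"
 then obtain A B where E: "E = {S : configs. npts A S : B}" and [measurable]: "A : sets borel" "B : sets borel" by auto
 have [measurable]: "(%s. SUM i<fst s. ind A (snd s i) :: ennreal) : bmeas lab"
  by (rule measurable_compose_countable[where f="%n s. SUM i<n. ind A (snd s i)"]) measurable
 have e: "npts A (points w) = (if good w then (SUP k. SUM i<fst (w k). ind A (snd (w k) i)) else 0)" for w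
 proof (cases "good w")
  case True
  have "(SUP k. emeasure (count_space UNIV) (pts (w k) Int A)) = emeasure (count_space UNIV) (\<Union>k. pts (w k) Int A)"
   using good_pts_mono[OF True] by (intro SUP_emeasure_incseq) (auto intro!: incseq_SucI)
  also have "(\<Union>k. pts (w k) Int A) = points w Int A" using True by (auto simp: points_def)
  finally have "npts A (points w) = (SUP k. npts A (pts (w k)))" by (simp add: npts_def)
  then show ?thesis using True npts_pts by (simp add: good_def)
 qed (simp add: points_def npts_def)
 have m: "(%w. npts A (points w)) : bmeas L" unfolding e by measurable
 have "points -` E Int space L = (%w. npts A (points w)) -` B Int space L" using points_configs by (auto simp: E)
 also have "... : sets L" using m by (rule measurable_sets) simp
 finally show "points -` E Int space L : sets L" .
qed auto

definition tsum :: "nat => ((nat => plane) => 'b :: comm_monoid_add) => nat \<times> (nat => plane) => 'b" where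
 "tsum n f s = (SUM c:injt n (fst s). f (\<lambda>i\<in>{..<n}. snd s (c i)))"

lemma measurable_pick: assumes "c : injt n m"
 shows "(%x. \<lambda>i\<in>{..<n}. x (c i)) : nu.S \<rightarrow>\<^sub>M lborel_pow n" by (rule measurable_restrict) simp

lemma measurable_tsum_ennreal:
 fixes f :: "(nat => plane) => ennreal" assumes f: "f : bmeas (lborel_pow n)"
 shows "tsum n f : bmeas lab"
proof -
 have "(%s. (%m s. SUM c:injt n m. f (\<lambda>i\<in>{..<n}. snd s (c i))) (fst s) s) : bmeas lab"
 proof (rule measurable_compose_countable)
  fix m
  show "(%s. SUM c:injt n m. f (\<lambda>i\<in>{..<n}. snd s (c i))) : bmeas lab"
  proof (rule borel_measurable_sum)
   fix c assume c: "c : injt n m"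
   have "(%s. \<lambda>i\<in>{..<n}. snd s (c i)) : lab \<rightarrow>\<^sub>M lborel_pow n"
    using measurable_compose[OF _ measurable_pick[OF c], of snd lab] by simp
   then show "(%s. f (\<lambda>i\<in>{..<n}. snd s (c i))) : bmeas lab" using f by (rule measurable_compose)
  qed
 qed simp
 then show ?thesis by (simp add: tsum_def[abs_def])
qed

end

lemma prod_lessThan_add:
 fixes f :: "nat => 'a :: comm_monoid_mult" shows "(PROD i<n + l. f i) = (PROD i<n. f i) * (PROD i:{n..<n + l}. f i)"
proof -
 have "{..<n + l} = {..<n} Un {n..<n + l}" by auto
 then show ?thesis by (simp add: prod.union_disjoint ivl_disj_int)
qed

lemma measurable_lborel_pow_component: "i < n ==> (%x. x i) : lborel_pow n \<rightarrow>\<^sub>M borel"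
 using measurable_component_singleton[of i "{..<n}" "%_. lborel :: plane measure"] by (simp only: measurable_lborel1 lessThan_iff simp_thms)

section \<open>Correlation functions of the glued process\<close>

context janossy_kernel
begin

lemma tsum_permute:
 fixes a :: "(nat => plane) => 'b :: comm_monoid_add" assumes p: "p permutes {..<m}"
 shows "tsum n a (m, x \<circ> p) = tsum n a (m, x)"
proof -
 let ?A = "%c. restrict (p \<circ> c) {..<n}"
 have b: "bij_betw ?A (injt n m) (injt n m)"
 proof (rule bij_betw_byWitness[where f'="%c. restrict (pinv p \<circ> c) {..<n}"])
  have k: "(%c. restrict (q \<circ> c) {..<n}) ` injt n m \<subseteq> injt n m" if "q permutes {..<m}" for q
  proof
   fix d assume "d : (%c. restrict (q \<circ> c) {..<n}) ` injt n m"
   then obtain c where c: "c : injt n m" and d: "d = restrict (q \<circ> c) {..<n}" by blast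
   have "inj_on d {..<n}"
   proof (rule inj_onI)
    fix i j assume ij: "i : {..<n}" "j : {..<n}" "d i = d j"
    then have "c i = c j" using injD[OF permutes_inj[OF that]] by (simp add: d)
    then show "i = j" using c ij by (simp add: injt_def inj_on_def)
   qed
   moreover have "d i < m" if i: "i < n" for i
   proof -
    have "c i : {..<m}" using c i by (simp add: injt_def PiE_iff)
    then have "q (c i) : {..<m}" using permutes_in_image[OF \<open>q permutes {..<m}\<close>] by blast
    then show ?thesis using i by (simp add: d)
   qed
   ultimately show "d : injt n m" by (simp add: injt_def PiE_iff d)
  qed
  have i: "restrict (q \<circ> restrict (r \<circ> c) {..<n}) {..<n} = c" if "c : injt n m" "!!i. q (r i) = i" for q r c
  proof
   fix i
   have "c : extensional {..<n}" using that(1) by (simp add: injt_def PiE_iff)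
   then show "restrict (q \<circ> restrict (r \<circ> c) {..<n}) {..<n} i = c i" using that(2) by (cases "i < n") (simp_all add: extensional_def)
  qed
  show "?A ` injt n m \<subseteq> injt n m"
   "(%c. restrict (pinv p \<circ> c) {..<n}) ` injt n m \<subseteq> injt n m" using k[OF p] k[OF permutes_inv[OF p]] by auto
  show "ALL c:injt n m. restrict (pinv p \<circ> restrict (p \<circ> c) {..<n}) {..<n} = c"
   "ALL c:injt n m. restrict (p \<circ> restrict (pinv p \<circ> c) {..<n}) {..<n} = c"
   by (intro ballI i permutes_inverses[OF p]; assumption)+
 qed
 have "tsum n a (m, x) = (SUM c:injt n m. a (\<lambda>i\<in>{..<n}. x (restrict (p \<circ> c) {..<n} i)))"
  unfolding tsum_def fst_conv snd_conv by (rule sum.reindex_bij_betw[OF b, symmetric])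
 also have "... = tsum n a (m, x \<circ> p)" unfolding tsum_def fst_conv snd_conv
  by (intro sum.cong refl arg_cong[of _ _ a]) (auto simp: restrict_def)
 finally show ?thesis ..
qed

lemma wgt_permute: assumes "p permutes {..<m}" shows "wgt u (m, x \<circ> p) = wgt u (m, x)"
 using prod.permute[OF assms, of "%i. ennreal (u (x i))"] by (simp add: wgt_def o_def)

text \<open>By symmetry each injective choice of n labels contributes as much as the first n. Their
  number turns the weight 1/(n+l)! into 1/l!, so the remaining l points are integrated against the
  window measure, and \<open>J_recover\<close> replaces the Janossy density by the correlation
  function.\<close>

lemma tuple_law: assumes n: "n >= 1" and f[measurable]: "f : bmeas (lborel_pow n)"
  and supp: "!!x i. f x ~= 0 ==> i < n ==> x i : window k"
 shows "(nni L (%b. tsum n f (b k))) = (nni (lborel_pow n) (%x. f x * ennreal (rho K n x)))"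
proof -
 let ?I = "%T. f (restrict T {..<n}) * ennreal (rho K n (restrict T {..<n}))"
 let ?H = "%g m. nni nu.S (%T. g m T)"
 let ?G = "%T. PROD i<n. ennreal (lw (T i))"
 let ?F = "nni L (%b. tsum n f (b k))"
 let ?E = "%m T. tsum n f (m, T) * ennreal (J k (m, T))"
 let ?D = "%T d m. f (\<lambda>i\<in>{..<n}. T (d i)) * ennreal (J k (m, T))"
 let ?B = "%T. PROD i<n. ennreal (wind k (T i))"
 let ?A = "%l Y T. wgt (wind k) (l, Y) * ennreal (J k (labj (n, T) (l, Y)))"
 have mr[measurable]: "(%x. restrict x {..<n}) : nu.S \<rightarrow>\<^sub>M lborel_pow n" by (rule measurable_restrict) simp
 have mw[measurable]: "(%T. wgt (wind k) (m, T)) : bmeas nu.S" for m by measurable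
 have mJ[measurable]: "(%T. J k (m, T)) : bmeas nu.S" for m by (rule measurable_compose[OF measurable_lab_Pair measurable_J])
 have mf[measurable]: "(%T. f (restrict T {..<n})) : bmeas nu.S" by (rule measurable_compose[OF mr f])
 define g where "g m T = wgt (wind k) (m, T) * (f (restrict T {..<n}) * ennreal (J k (m, T)))" for m T
 have mg[measurable]: "g m : bmeas nu.S" for m unfolding g_def by measurable
 define c where "c m = of_nat (card (injt n m)) * (?H g m)" for m
 have mt[measurable]: "tsum n f : bmeas lab" by (rule measurable_tsum_ennreal[OF f])
 have "?F = (nni (lam (wind k)) (%s. tsum n f s * ennreal (J k s)))"
 proof (rule chain_law[OF mt])
  show "tsum n f (m, x \<circ> p) = tsum n f (m, x)" if "p permutes {..<m}" for m p x by (rule tsum_permute[OF that])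
  show "tsum n f (0, x) = tsum n f (0, y)" for x y using n by (simp add: tsum_def injt_empty)
 qed
 also have "... = (\<Sum>m. nni nu.S (%T. wgt (wind k) (m, T) * (?E m T)))" by (rule nn_integral_lam) simp_all
 also have "(%m. nni nu.S (%T. wgt (wind k) (m, T) * (?E m T))) = c"
 proof
  fix m
  have "(nni nu.S (%T. wgt (wind k) (m, T) * (?E m T)))
    = (nni nu.S (%T. (SUM d:injt n m. wgt (wind k) (m, T) * (?D T d m))))"
   by (simp add: tsum_def sum_distrib_left sum_distrib_right)
  also have "... = (SUM d:injt n m. nni nu.S (%T. wgt (wind k) (m, T) * (?D T d m)))"
  proof (rule nn_integral_sum)
   fix d assume d: "d : injt n m"
   have [measurable]: "(%T. f (\<lambda>i\<in>{..<n}. T (d i))) : bmeas nu.S"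
    by (rule measurable_compose[OF measurable_pick[OF d] f])
   show "(%T. wgt (wind k) (m, T) * (?D T d m)) : bmeas nu.S" by measurable
  qed
  \<comment> \<open>The injection d is extended to a permutation of all m labels. Weight and density
    are symmetric, so permuting the labels reduces d to the choice of the first n.\<close>
  also have "... = (SUM d:injt n m. nni nu.S (%T. g m T))"
  proof (rule sum.cong[OF refl])
   fix d assume d: "d : injt n m"
   then obtain p where p: "p permutes {..<m}" and pd: "!!i. i < n ==> p i = d i"
    using permutation_extension[of d n m] by (auto simp: injt_def PiE_iff)
   have "(nni nu.S (%T. wgt (wind k) (m, T) * (?D T d m))) = (nni nu.S (%T. g m (T \<circ> p)))"
   proof (rule nn_integral_cong)
    fix T :: "nat => plane"
    have "(\<lambda>i\<in>{..<n}. T (d i)) = restrict (T \<circ> p) {..<n}" using pd by (auto simp: restrict_def)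
    then show "wgt (wind k) (m, T) * (?D T d m) = g m (T \<circ> p)" unfolding g_def by (simp only: wgt_permute[OF p] J_permute[OF p])
   qed
   also have "... = (?H g m)" by (rule nu.nn_integral_permute[OF p mg])
   finally show "(nni nu.S (%T. wgt (wind k) (m, T) * (?D T d m))) = (?H g m)" .
  qed
  finally show "(nni nu.S (%T. wgt (wind k) (m, T) * (?E m T))) = c m" by (simp add: c_def)
 qed
 \<comment> \<open>Terms with m < n vanish, as there are no injective choices, so the index can be
   shifted by n. This is the diagonal rearrangement of a family concentrated in row n.\<close>
 also have "(\<Sum>m. c m) = (\<Sum>l. c (n + l))"
 proof -
  define a where "a t l = (if t = n then c (n + l) else 0)" for t l
  have "(\<Sum>t. \<Sum>l. a t l) = (\<Sum>t. if t = n then (\<Sum>l. c (n + l)) else 0)" by (intro suminf_cong) (simp add: a_def)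
  also have "... = (\<Sum>l. c (n + l))" using sums_single[of n "%_. \<Sum>l. c (n + l)"] by (simp add: sums_iff)
  finally have 1: "(\<Sum>t. \<Sum>l. a t l) = (\<Sum>l. c (n + l))" .
  have "(SUM t<=m. a t (m - t)) = c m" for m
  proof (cases "n <= m")
   case True
   then have "(SUM t<=m. a t (m - t)) = (SUM t:{n}. a t (m - t))" by (intro sum.mono_neutral_right) (auto simp: a_def)
   then show ?thesis using True by (simp add: a_def)
  next
   case False
   then have "c m = 0" by (simp add: c_def injt_empty)
   moreover have "(SUM t<=m. a t (m - t)) = 0" using False by (intro sum.neutral) (auto simp: a_def)
   ultimately show ?thesis by simp
  qed
  then show ?thesis using ennreal_suminf_diagonal[of a] 1 by simp
 qed
 also have "(%l. c (n + l)) = (%l. nni nu.S (%T. nni nu.S (%Y. (?B T) * f (restrict T {..<n}) * (?A l Y T))))"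
 proof
  fix l
  define C :: ennreal where "C = of_nat (card (injt n (n + l)))"
  \<comment> \<open>There are (n+l)!/l! injective choices, which cancels the factor 1/(n+l)! of the
    labelled measure.\<close>
  have C: "C * ennreal (1 / fact (n + l)) = ennreal (1 / fact l)"
  proof -
   have "real (card (injt n (n + l))) * fact l = fact (n + l)"
    using card_injt[of n "n + l"] by (metis add_diff_cancel_left' le_add1 of_nat_fact of_nat_mult)
   then have e: "real (card (injt n (n + l))) * (1 / fact (n + l)) = 1 / fact l" by (simp add: field_simps)
   show ?thesis unfolding C_def ennreal_of_nat_eq_real_of_nat
    by (subst ennreal_mult[symmetric]) (simp_all only: e of_nat_0_le_iff divide_nonneg_nonneg fact_ge_zero zero_le_one)
  qed
  have "c (n + l) = (nni nu.S (%y. C * g (n + l) y))" unfolding c_def C_def by (rule nn_integral_cmult[symmetric]) simp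
  also have "... = (nni nu.S (%T. nni nu.S (%Y. C * g (n + l) (comb_seq n T Y))))" by (rule nu.nn_integral_comb) measurable
  also have "... = (nni nu.S (%T. nni nu.S (%Y. (?B T) * f (restrict T {..<n}) * (?A l Y T))))"
  proof (intro nn_integral_cong)
   fix T Y :: "nat => plane"
   have r: "restrict (comb_seq n T Y) {..<n} = restrict T {..<n}" by (auto simp: comb_seq_def restrict_def)
   have w: "wgt (wind k) (n + l, comb_seq n T Y) = ennreal (1 / fact (n + l)) * ((?B T) * (PROD i<l. ennreal (wind k (Y i))))"
    unfolding wgt_def fst_conv snd_conv prod_lessThan_add
    by (simp only: prod_comb_seq_low[where u="%z. ennreal (wind k z)"] prod_comb_seq_high[where w="%z. ennreal (wind k z)"])
   show "C * g (n + l) (comb_seq n T Y) = (?B T) * f (restrict T {..<n}) * (?A l Y T)"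
    unfolding g_def r w labj_def fst_conv snd_conv wgt_def[of _ "(l, Y)"] C[symmetric] by (simp only: mult_ac)
  qed
  finally show "c (n + l) = ..." .
 qed
 finally have s1: "?F = (\<Sum>l. (nni nu.S (%T. nni nu.S (%Y. (?B T) * f (restrict T {..<n}) * (?A l Y T)))))" .
 have s2: "(\<Sum>l. (nni nu.S (%T. nni nu.S (%Y. (?B T) * f (restrict T {..<n}) * (?A l Y T)))))
  = (\<Sum>l. (nni nu.S (%T. (?B T) * f (restrict T {..<n}) * (nni nu.S (%Y. (?A l Y T))))))"
 proof (intro suminf_cong nn_integral_cong nn_integral_cmult)
  fix l T
  have "(%Y. J k (labj (n, T) (l, Y))) : bmeas nu.S" by (rule measurable_compose[OF _ measurable_J]) measurable
  then show "(%Y. wgt (wind k) (l, Y) * ennreal (J k (labj (n, T) (l, Y)))) : bmeas nu.S" by measurable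
 qed
 have s3: "(\<Sum>l. (nni nu.S (%T. (?B T) * f (restrict T {..<n}) * (nni nu.S (%Y. (?A l Y T)))))) = (nni nu.S (%T. (\<Sum>l. (?B T) * f (restrict T {..<n}) * (nni nu.S (%Y. (?A l Y T))))))"
 proof (rule nn_integral_suminf[symmetric])
  fix l
  have mjj: "(%p. J k (labj (n, fst p) (l, snd p))) : bmeas (nu.S \<Otimes>\<^sub>M nu.S)"
   by (rule measurable_compose[OF _ measurable_J]) measurable
  have "(%p. wgt (wind k) (l, snd p) * ennreal (J k (labj (n, fst p) (l, snd p)))) : bmeas (nu.S \<Otimes>\<^sub>M nu.S)"
   using mjj by measurable
  then have "(%T. nni nu.S (%Y. (?A l Y T))) : bmeas nu.S"
   using nu.P.borel_measurable_nn_integral_fst[of "%p. wgt (wind k) (l, snd p) * ennreal (J k (labj (n, fst p) (l, snd p)))" nu.S] by simp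
  then show "(%T. (?B T) * f (restrict T {..<n}) * (nni nu.S (%Y. (?A l Y T)))) : bmeas nu.S" by measurable
 qed
 have s4: "(nni nu.S (%T. (\<Sum>l. (?B T) * f (restrict T {..<n}) * (nni nu.S (%Y. (?A l Y T)))))) = (nni nu.S (%T. (?G T) * (?I T)))"
 proof (rule nn_integral_cong)
  fix T
  have mj: "(%r. ennreal (J k (labj (n, T) r))) : bmeas lab"
   by (rule measurable_compose[OF _ measurable_ennreal], rule measurable_compose[OF _ measurable_J]) measurable
  have 1: "(\<Sum>l. (nni nu.S (%Y. (?A l Y T)))) = ennreal (rho K n T)"
   using nn_integral_lam[OF wind_measurable(1) mj, of k] J_recover[of k "(n, T)"] by simp
  have 2: "rho K n T = rho K n (restrict T {..<n})" by (rule rho_cong) simp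
  \<comment> \<open>The test vanishes unless all n points lie in the window, and there the window
    weight is the full Lebesgue weight.\<close>
  have 3: "(?B T) * f (restrict T {..<n}) = (?G T) * f (restrict T {..<n})"
  proof (cases "f (restrict T {..<n}) = 0")
   case False
   then have "T i : window k" if "i < n" for i using supp[OF False that] that by simp
   then have "(?B T) = (?G T)" by (intro prod.cong) (auto simp: wind_def)
   then show ?thesis by simp
  qed simp
  show "(\<Sum>l. (?B T) * f (restrict T {..<n}) * (nni nu.S (%Y. (?A l Y T)))) = (?G T) * (?I T)"
   unfolding ennreal_suminf_cmult 1 2 3 by (simp only: mult.assoc)
 qed
 have mr: "rho K n : bmeas (lborel_pow n)" by (rule measurable_rho[OF mK, where X="%x. x", OF measurable_lborel_pow_component])
 have mF: "(%x. f x * ennreal (rho K n x)) : bmeas (lborel_pow n)"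
  using f measurable_compose[OF mr measurable_ennreal] by (rule borel_measurable_times_ennreal)
 note s5 = nn_integral_nu_lborel_pow[OF mF]
 show ?thesis by (rule trans[OF s1 trans[OF s2 trans[OF s3 trans[OF s4 s5]]]])
qed

lemma integrable_test: assumes a[measurable]: "a : bmeas (lborel_pow n)" and B: "!!x. \<bar>a x\<bar> <= B"
  and supp: "!!x i. a x ~= 0 ==> i < n ==> x i : window k"
 shows "integrable (lborel_pow n) (%x. a x * rho K n x)"
proof -
 let ?A = "%x. PROD i<n. ind (window k) (x i) * Re (K (x i) (x i))"
 interpret pl: product_sigma_finite "%_::nat. lborel :: plane measure" by standard
 have m[measurable]: "rho K n : bmeas (lborel_pow n)"
  by (rule measurable_rho[OF mK, where X="%x. x", OF measurable_lborel_pow_component])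
 have "integrable lborel (%z. ind (window k) z * Re (K z z))"
  using loc[OF window_borel window_bounded] by (simp add: set_integrable_def)
 then have i: "integrable (lborel_pow n) (%x. B * (?A x))" by (intro integrable_mult_right pl.product_integrable_prod) auto
 show ?thesis
 proof (rule integrable_le[OF i])
  show "AE x in lborel_pow n. norm (a x * rho K n x) <= norm (B * (?A x))"
  proof (rule AE_I2)
   fix x
   have B0: "0 <= B" using B[of x] by linarith
   have p0: "0 <= (?A x)" using psd_diag(2)[OF psd] by (intro prod_nonneg) auto
   show "norm (a x * rho K n x) <= norm (B * (?A x))"
   proof (cases "a x = 0")
    case False
    then have "(?A x) = (PROD i<n. Re (K (x i) (x i)))" using supp by (intro prod.cong) auto
    then show ?thesis using mult_mono[OF B[of x] psd_rho(3)[OF psd, of n x] B0 psd_rho(2)[OF psd, of n x]] psd_rho(2)[OF psd, of n x] B0 p0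
     by (simp add: abs_mult)
   qed (use B0 p0 in simp)
  qed
 qed simp
qed

lemma tuple_law_real: assumes n: "n >= 1" and a[measurable]: "a : bmeas (lborel_pow n)" and B: "!!x. \<bar>a x\<bar> <= B"
  and supp: "!!x i. a x ~= 0 ==> i < n ==> x i : window k"
 shows "hbi L (%w. tsum n a (w k)) (LINT x|lborel_pow n. a x * rho K n x)"
proof -
 let ?D = "%p m. %w. tsum n p (w k) - tsum n m (w k)"
 let ?C = "%f. nni L (%w. ennreal (tsum n f (w k)))"
 let ?A = "%f. LINT x|lborel_pow n. f x * rho K n x"
 have nonneg: "hbi L (%w. tsum n f (w k)) (?A f)"
  if f[measurable]: "f : bmeas (lborel_pow n)" and fB: "!!x. \<bar>f x\<bar> <= B"
   and fs: "!!x i. f x ~= 0 ==> i < n ==> x i : window k" and f0: "!!x. 0 <= f x" for f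
 proof (rule has_bochner_integral_nn_integral)
  have "(?C f) = (nni L (%w. tsum n (%x. ennreal (f x)) (w k)))"
   using f0 by (intro nn_integral_cong) (simp add: tsum_def sum_ennreal)
  also have "... = (nni (lborel_pow n) (%x. ennreal (f x) * ennreal (rho K n x)))"
   using fs f0 by (intro tuple_law[OF n]) (auto simp: ennreal_eq_0_iff)
  also have "... = (nni (lborel_pow n) (%x. ennreal (f x * rho K n x)))"
   using f0 psd_rho(2)[OF psd] by (intro nn_integral_cong) (simp add: ennreal_mult)
  also have "... = ennreal (?A f)"
  proof (rule nn_integral_eq_integral)
   show "integrable (lborel_pow n) (%x. f x * rho K n x)" using fs by (intro integrable_test[OF f fB, where k=k])
  qed (use f0 psd_rho(2)[OF psd] in auto)
  finally show "(?C f) = ennreal (?A f)" .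
  show "0 <= (?A f)" using f0 psd_rho(2)[OF psd] by (intro Bochner_Integration.integral_nonneg) auto
  have m: "tsum n (%x. ennreal (f x)) : bmeas lab" by (rule measurable_tsum_ennreal) measurable
  have "(%s. enn2real (tsum n (%x. ennreal (f x)) s)) : bmeas lab" by (rule borel_measurable_enn2real[OF m])
  moreover have "enn2real (tsum n (%x. ennreal (f x)) s) = tsum n f s" for s
   using f0 by (simp add: tsum_def sum_ennreal sum_nonneg)
  ultimately have "tsum n f : bmeas lab" by simp
  then show "(%w. tsum n f (w k)) : bmeas L" by (rule measurable_compose[OF measurable_L_component])
 qed (use f0 in \<open>auto simp: tsum_def intro!: sum_nonneg AE_I2\<close>)
 define p m where "p x = max 0 (a x)" and "m x = max 0 (- a x)" for x
 have mp[measurable]: "p : bmeas (lborel_pow n)" "m : bmeas (lborel_pow n)" unfolding p_def m_def by measurable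
 have pB: "\<bar>p x\<bar> <= B" "\<bar>m x\<bar> <= B" for x using B[of x] by (auto simp: p_def m_def)
 have ps: "p x ~= 0 ==> i < n ==> x i : window k" "m x ~= 0 ==> i < n ==> x i : window k" for x i
  using supp[of x i] by (auto simp: p_def m_def split: if_splits)
 have pm: "a x = p x - m x" for x by (auto simp: p_def m_def)
 have "hbi L (?D p m) ((LINT x|lborel_pow n. p x * rho K n x) - (LINT x|lborel_pow n. m x * rho K n x))"
  by (intro has_bochner_integral_diff nonneg mp pB) (auto simp: ps, auto simp: p_def m_def)
 also have "(?D p m) = (%w. tsum n a (w k))" by (simp add: tsum_def sum_subtractf pm)
 also have "(LINT x|lborel_pow n. p x * rho K n x) - (LINT x|lborel_pow n. m x * rho K n x) = (LINT x|lborel_pow n. a x * rho K n x)"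
 proof -
  have "integrable (lborel_pow n) (%x. p x * rho K n x)" "integrable (lborel_pow n) (%x. m x * rho K n x)"
   using ps by (auto intro: integrable_test[OF mp(1) pB(1), where k=k] integrable_test[OF mp(2) pB(2), where k=k])
  then show ?thesis by (simp add: pm left_diff_distrib)
 qed
 finally show ?thesis .
qed

definition point_law :: "plane set measure" where
 "point_law = distr L (final_space L configs points) points"

lemma points_final: "points : space L \<rightarrow> configs" using points_configs by auto

lemma sum_points:
 assumes "good w" and "!!x i. x : space (lborel_pow n) ==> f x ~= 0 ==> i < n ==> x i : window k"
 shows "(\<Sum>\<^sub>\<infinity>x\<in>distinct_tuples n (points w). f x) = (tsum n f (w k) :: real)"
proof -
 let ?A = "points w Int window k"
 define p where "p x = (if x : space (lborel_pow n) then f x else 0)" for x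
 have sp: "distinct_tuples n S \<subseteq> space (lborel_pow n)" for S by (auto simp: distinct_tuples_def space_PiM)
 have "(\<Sum>\<^sub>\<infinity>x\<in>distinct_tuples n (points w). f x) = (\<Sum>\<^sub>\<infinity>x\<in>distinct_tuples n (points w). p x)"
  using sp by (intro infsum_cong) (auto simp: p_def)
 also have "... = (SUM x:distinct_tuples n ?A. p x)"
 proof (rule infsum_distinct_tuples)
  show "finite ?A" unfolding points_window[OF assms(1)] by (simp add: pts_def)
  show "p x = 0" if "i < n" "x i ~: window k" for x i using assms(2)[of x i] that by (auto simp: p_def)
 qed
 also have "... = (SUM x:distinct_tuples n ?A. f x)" using sp by (intro sum.cong) (auto simp: p_def)
 also have "... = tsum n f (w k)" unfolding points_window[OF assms(1)] pts_def tsum_def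
  using assms(1) by (intro sum_distinct_tuples_labels) (simp add: good_def)
 finally show ?thesis .
qed

lemma correlation_point_law: assumes n: "n >= 1" shows "correlation_function point_law (%S. S) n (kernel_det K n)"
 unfolding correlation_function_def
proof (intro conjI allI impI)
 show "kernel_det K n : bmeas (lborel_pow n)"
  by (rule measurable_kernel_det[OF mK, where X="%x. x", OF measurable_lborel_pow_component])
 fix f :: "(nat => plane) => real"
 assume f[measurable]: "f : bmeas (lborel_pow n)" and "EX B. ALL x:space (lborel_pow n). \<bar>f x\<bar> <= B"
  and "EX R. ALL x:space (lborel_pow n). f x ~= 0 --> (ALL i<n. norm (x i) <= R)"
 then obtain B R where B: "!!x. x : space (lborel_pow n) ==> \<bar>f x\<bar> <= B"
  and R: "!!x i. x : space (lborel_pow n) ==> f x ~= 0 ==> i < n ==> norm (x i) <= R" by blast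
 obtain k where k: "R < real k" using reals_Archimedean2 by blast
 have supp: "x i : window k" if "x : space (lborel_pow n)" "f x ~= 0" "i < n" for x i using R[OF that] k by (simp add: window_def)
 \<comment> \<open>The test is controlled only on the space of the product measure. Extending it by
   0 outside makes its bound and its support valid for all functions, as the preceding lemmas
   require.\<close>
 define a where "a x = (if x : space (lborel_pow n) then f x else 0)" for x
 have ma: "a : bmeas (lborel_pow n)" using f by (subst measurable_cong[where g=f]) (auto simp: a_def)
 have Ba: "\<bar>a x\<bar> <= max 0 B" for x using B[of x] by (auto simp: a_def)
 have sa: "x i : window k" if "a x ~= 0" "i < n" for x i using supp[of x i] that by (auto simp: a_def split: if_splits)
 have hb: "hbi L (%w. tsum n a (w k)) (LINT x|lborel_pow n. a x * rho K n x)"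
  by (rule tuple_law_real[OF n ma Ba]) (rule sa)
 have "tsum n a s = tsum n f s" for s unfolding tsum_def by (intro sum.cong refl) (simp add: a_def space_PiM)
 moreover have eq: "(LINT x|lborel_pow n. a x * rho K n x) = (LINT x|lborel_pow n. f x * rho K n x)"
  by (intro integral_eq) (auto simp: a_def)
 ultimately have hb: "hbi L (%w. tsum n f (w k)) (LINT x|lborel_pow n. f x * rho K n x)" using hb by simp
 define F where "F S = (\<Sum>\<^sub>\<infinity>x\<in>distinct_tuples n S. f x)" for S
 have Fp: "F (points w) = (if good w then tsum n f (w k) else 0)" for w
 proof (cases "good w")
  case True
  then show ?thesis using sum_points[OF True, of n f k] supp by (simp add: F_def)
 next
  case False
  have "distinct_tuples n {} = {}" using n PiE_mem[of _ "{..<n}" "%_. {}" 0] by (auto simp: distinct_tuples_def)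
  then show ?thesis using False by (simp add: F_def points_def)
 qed
 have mt[measurable]: "(%w. tsum n f (w k)) : bmeas L" using hb by (rule borel_measurable_has_bochner_integral)
 have mFp: "(%w. F (points w)) : bmeas L" unfolding Fp by measurable
 have hbF: "hbi L (%w. F (points w)) (LINT x|lborel_pow n. f x * rho K n x)"
 proof (subst has_bochner_integral_cong_AE)
  show "(%w. F (points w)) : bmeas L" by (rule mFp)
  show "(%w. tsum n f (w k)) : bmeas L" by (rule mt)
  show "AE w in L. F (points w) = tsum n f (w k)" using AE_good by eventually_elim (simp add: Fp)
 qed (rule hb)
 have mF: "F : bmeas (final_space L configs points)" by (rule measurable_from_final_space[OF points_final mFp]) simp
 have mp: "points : L \<rightarrow>\<^sub>M final_space L configs points" by (rule measurable_final_space[OF points_final])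
 show "integrable point_law (%w. \<Sum>\<^sub>\<infinity>x\<in>distinct_tuples n w. f x)"
  unfolding point_law_def F_def[symmetric] using hbF mp mF by (simp add: integrable_distr_eq hbi_iff)
 have e: "(%x. cor (f x) * kernel_det K n x) = (%x. cor (f x * rho K n x))" by (simp add: psd_rho(1)[OF psd])
 have "integrable (lborel_pow n) (%x. a x * rho K n x)" by (rule integrable_test[OF ma Ba]) (rule sa)
 also have "?this \<longleftrightarrow> integrable (lborel_pow n) (%x. f x * rho K n x)"
  by (intro Bochner_Integration.integrable_cong) (auto simp: a_def)
 finally show "integrable (lborel_pow n) (%x. cor (f x) * kernel_det K n x)" unfolding e by (rule integrable_of_real)
 show "cor (LINT w|point_law. (\<Sum>\<^sub>\<infinity>x\<in>distinct_tuples n w. f x)) = (LINT x|lborel_pow n. cor (f x) * kernel_det K n x)"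
  unfolding point_law_def F_def[symmetric] e integral_complex_of_real using hbF mp mF by (simp add: integral_distr hbi_iff)
qed

theorem determinantal_point_law: "determinantal point_law (%S. S) K" unfolding determinantal_def point_process_def
proof (intro conjI allI impI correlation_point_law)
 show "prob_space point_law" unfolding point_law_def by (rule prob_space.prob_space_distr[OF prob_space_L measurable_final_space[OF points_final]])
 have "(%S. S) : final_space L configs points \<rightarrow>\<^sub>M config_space"
 proof (rule measurable_from_final_space[OF points_final])
  show "(%w. points w) : L \<rightarrow>\<^sub>M config_space" by (rule measurable_points)
 qed (simp add: space_config_space)
 then show "(%S. S) : point_law \<rightarrow>\<^sub>M config_space" unfolding point_law_def by simp
qed

end

section \<open>The one-dimensional contour integral\<close>

text \<open>One exponential factor of \<open>M_integrand\<close>: the factor in v has y equal to the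
  second coordinate of the second point, the factor in u has y equal to minus that of the first
  point.\<close>

definition wave :: "real => real => real => complex => complex" where
 "wave s x y v = exp (- (1/2) * (of_real s * v - of_real y)^2 + \<i>/3 * v^3 + \<i> * of_real x * v)"

definition ampl_at :: "real => real => real => real => complex" where
 "ampl_at d s x y = (LBINT t. wave s x y (line d t))"

lemma norm_wave: "norm (wave s x y (line d t)) = exp (- ((s * t - y)^2) / 2 + s^2 * d^2 / 2 - t^2 * d + d^3 / 3 - x * d)"
 unfolding wave_def norm_exp_eq_Re line_def by (simp add: power2_eq_square power3_eq_cube) (simp add: field_simps)

text \<open>Completing the square in t. The condition on s and d covers both the real line when s is
  nonzero and every positive height when s = 0.\<close>

lemma norm_wave_gaussian: assumes "s^2 + 2 * d > 0" shows "norm (wave s x y (line d t)) =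
  exp (s^2 * d^2 / 2 + d^3 / 3 - x * d - y^2 * d / (s^2 + 2 * d)) * exp (- (d + s^2 / 2) * (t - s * y / (s^2 + 2 * d))^2)"
proof -
 define q where "q = s^2 + 2 * d"
 have q: "q > 0" using assms by (simp add: q_def)
 have d: "d = (q - s^2) / 2" by (simp add: q_def)
 have "- ((s * t - y)^2) / 2 - t^2 * d = - (y^2 * d / q) + - (q / 2) * (t - s * y / q)^2"
  using q unfolding d by (simp add: field_simps power2_eq_square)
 then have "- ((s * t - y)^2) / 2 + s^2 * d^2 / 2 - t^2 * d + d^3 / 3 - x * d =
   s^2 * d^2 / 2 + d^3 / 3 - x * d - y^2 * d / q + - (q / 2) * (t - s * y / q)^2" by linarith
 moreover have "d + s^2 / 2 = q / 2" by (simp add: q_def)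
 ultimately show ?thesis unfolding norm_wave exp_add[symmetric] q_def[symmetric] by (simp only:)
qed

lemma continuous_wave: "continuous_on UNIV (%t. wave s x y (line d t))" unfolding wave_def line_def by (intro continuous_intros)

lemma measurable_wave [measurable]: "(%t. wave s x y (line d t)) : bmeas borel"
 using continuous_wave by (rule borel_measurable_continuous_onI)

lemma has_integral_norm_wave: assumes "s^2 + 2 * d > 0" shows "hbi lborel (%t. norm (wave s x y (line d t)))
  (exp (s^2 * d^2 / 2 + d^3 / 3 - x * d - y^2 * d / (s^2 + 2 * d)) * sqrt (pi / (d + s^2 / 2)))" unfolding norm_wave_gaussian[OF assms] using assms
 by (intro hbi_mult hbi_gauss) auto

lemma integrable_wave: "s^2 + 2 * d > 0 ==> integrable lborel (%t. wave s x y (line d t))"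
 using has_integral_norm_wave[of s d x y] by (auto simp: hbi_iff intro: integrable_norm_cancel)

lemma norm_ampl_at: assumes "s^2 + 2 * d > 0"
 shows "norm (ampl_at d s x y) <= exp (s^2 * d^2 / 2 + d^3 / 3 - x * d - y^2 * d / (s^2 + 2 * d)) * sqrt (pi / (d + s^2 / 2))"
proof -
 have "norm (ampl_at d s x y) <= (LBINT t. norm (wave s x y (line d t)))" unfolding ampl_at_def by (rule integral_norm_bound)
 then show ?thesis using has_integral_norm_wave[OF assms, of x y] by (simp add: hbi_iff)
qed

lemma integral_window_tendsto:
 fixes f :: "real => complex" assumes f: "integrable lborel f" and c: "continuous_on UNIV f"
 shows "((%T. integral {-T..T} f) ---> (LBINT t. f t)) at_top"
proof -
 let ?A = "%x. (%T. ind {-T..T} x *\<^sub>R f x) ---> f x"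
 have e: "integral {-T..T} f = (LBINT t. ind {-T..T} t *\<^sub>R f t)" for T
 proof -
  have "set_integrable lborel {-T..T} f" unfolding set_integrable_def using f by (intro integrable_mult_indicator) auto
  from set_borel_integral_eq_integral(2)[OF this] show ?thesis by (simp add: set_lebesgue_integral_def)
 qed
 show ?thesis unfolding e
 proof (rule integral_dominated_convergence_at_top[where w="%t. norm (f t)"])
  have [measurable]: "f : bmeas borel" using f by simp
  show "f : bmeas lborel" "(%t. ind {-T..T} t *\<^sub>R f t) : bmeas lborel" for T by auto
  show "AE x in lborel. (?A x) at_top"
  proof (rule AE_I2)
   fix x
   have "eventually (%T. ind {-T..T} x *\<^sub>R f x = f x) at_top"
    using eventually_ge_at_top[of "\<bar>x\<bar>"] by eventually_elim (simp add: indicator_def abs_le_iff)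
   then show "(?A x) at_top" by (rule tendsto_eventually)
  qed
  show "\<forall>\<^sub>F T in at_top. AE x in lborel. norm (ind {-T..T} x *\<^sub>R f x) <= norm (f x)" by (auto simp: indicator_def)
 qed (use f in auto)
qed

text \<open>Estimates the vertical side at abscissa t of the rectangle between two contours. The
  integrand at height s is bounded by a constant times exp(-t^2 s), which is not small near height
  0. The side is therefore cut at distance (d' - d)/|t| from its lower end: the lower piece is
  short, and on the upper one the integrand is at most of order exp(-|t| (d' - d)).\<close>

lemma primitive_increment:
 assumes H: "!!v. (H has_field_derivative wave c x f v) (at v)" and d: "0 <= d" "d <= d'" and t: "\<bar>t\<bar> >= 1"
 shows "norm (H (line d' t) - H (line d t)) <= exp (c^2 * d'^2 / 2 + d'^3 / 3 + \<bar>x\<bar> * d') * ((d' - d) / \<bar>t\<bar> + (d' - d) * exp (- (\<bar>t\<bar> * (d' - d))))"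
proof -
 let ?D = "%s. wave c x f (line s t)"
 let ?A = "- (\<bar>t\<bar> * (d' - d))"
 define C where "C = exp (c^2 * d'^2 / 2 + d'^3 / 3 + \<bar>x\<bar> * d')"
 have bound: "norm (?D s) <= C * exp (- (t^2 * s))" if "0 <= s" "s <= d'" for s
 proof -
  have "c^2 * s^2 <= c^2 * d'^2" using that by (intro mult_left_mono power_mono) auto
  moreover have "s^3 <= d'^3" using that by (intro power_mono) auto
  moreover have "- x * s <= \<bar>x\<bar> * d'" using that by (intro mult_mono) auto
  moreover have "0 <= (c * t - f)^2" by simp
  ultimately have "- ((c * t - f)^2) / 2 + c^2 * s^2 / 2 - t^2 * s + s^3 / 3 - x * s <= c^2 * d'^2 / 2 + d'^3 / 3 + \<bar>x\<bar> * d' + - (t^2 * s)"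
   by linarith
  then show ?thesis unfolding norm_wave C_def exp_add[symmetric] by (simp only: exp_le_cancel_iff)
 qed
 have seg: "norm (H (line b t) - H (line a t)) <= B * (b - a)"
  if "0 <= a" "a <= b" "b <= d'" and B: "!!s. a <= s ==> s <= b ==> norm (?D s) <= B" for a b B
 proof -
  have "norm (H (line b t) - H (line a t)) <= B * norm (line b t - line a t)"
  proof (rule field_differentiable_bound)
   show "convex (closed_segment (line a t) (line b t))" by simp
   fix z assume "z : closed_segment (line a t) (line b t)"
   then obtain u where u: "0 <= u" "u <= 1" "z = (1 - u) *\<^sub>R line a t + u *\<^sub>R line b t" by (auto simp: closed_segment_def)
   have z: "z = line (a + u * (b - a)) t" unfolding u(3) line_def by (simp add: complex_eq_iff algebra_simps)
   have "u * (b - a) <= 1 * (b - a)" using u that by (intro mult_right_mono) auto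
   then have "norm (wave c x f (line (a + u * (b - a)) t)) <= B" using u that by (intro B) auto
   then show "norm (wave c x f z) <= B" by (simp add: z)
   show "(H has_field_derivative wave c x f z) (at z within closed_segment (line a t) (line b t))" using H by (rule has_field_derivative_at_within)
  qed auto
  also have "line b t - line a t = \<i> * of_real (b - a)" by (simp add: line_def algebra_simps)
  also have "norm (\<i> * of_real (b - a)) = b - a" using that unfolding norm_mult norm_of_real by simp
  finally show ?thesis .
 qed
 define m where "m = d + (d' - d) / \<bar>t\<bar>"
 have m: "d <= m" "m <= d'"
 proof -
  show "d <= m" using d t by (simp add: m_def)
  have "(d' - d) / \<bar>t\<bar> <= (d' - d) / 1" using d t by (intro divide_left_mono) auto
  then show "m <= d'" by (simp add: m_def)
 qed
 have "norm (H (line m t) - H (line d t)) <= C * (m - d)"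
 proof (rule seg)
  fix s assume s: "d <= s" "s <= m"
  have "exp (- (t^2 * s)) <= 1" using s d by simp
  then have "C * exp (- (t^2 * s)) <= C * 1" unfolding C_def by (intro mult_left_mono) auto
  then show "norm (?D s) <= C" using bound[of s] s m d by simp
 qed (use d m in auto)
 moreover have "norm (H (line d' t) - H (line m t)) <= C * exp ?A * (d' - m)"
 proof (rule seg)
  fix s assume s: "m <= s" "s <= d'"
  have "\<bar>t\<bar> * (d' - d) = t^2 * ((d' - d) / \<bar>t\<bar>)" proof -
   have r: "r * y = r^2 * (y / r)" if "r > 0" for r y :: real using that by (simp add: power2_eq_square)
   show ?thesis using r[of "\<bar>t\<bar>" "d' - d"] t by simp
  qed
  also have "... <= t^2 * s" using s d by (intro mult_left_mono) (auto simp: m_def)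
  finally have "C * exp (- (t^2 * s)) <= C * exp ?A" unfolding C_def by simp
  then show "norm (?D s) <= C * exp ?A" using bound[of s] s m d by simp
 qed (use d m in auto)
 moreover have "C * exp ?A * (d' - m) <= C * exp ?A * (d' - d)" using m by (intro mult_left_mono) (auto simp: C_def)
 moreover have "norm (H (line d' t) - H (line d t)) <= norm (H (line m t) - H (line d t)) + norm (H (line d' t) - H (line m t))"
  using norm_triangle_ineq[of "H (line m t) - H (line d t)" "H (line d' t) - H (line m t)"] by simp
 ultimately have "norm (H (line d' t) - H (line d t)) <= C * (m - d) + C * exp ?A * (d' - d)" by linarith
 then show ?thesis unfolding C_def m_def by (simp add: algebra_simps)
qed

text \<open>Moving the contour with a primitive: the integrals over the same range at two heights
  differ by the two vertical sides. The case d = 0 with s = 0 is included, where the integral exists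
  only as an improper one; it is the integral that defines the Airy function.\<close>

lemma contour_limit: assumes d: "0 <= d" "d <= d'" "0 < d'"
 shows "((%T. integral {-T..T} (%t. wave a c y (line d t))) ---> ampl_at d' a c y) at_top"
proof -
 let ?A = "%t. wave a c y (line d' t)"
 have "wave a c y holomorphic_on UNIV" unfolding wave_def by (intro holomorphic_intros)
 then obtain H where H: "!!v. (H has_field_derivative wave a c y v) (at v)" using holomorphic_convex_primitive'[of UNIV "wave a c y"] by auto
 have I: "integral {-T..T} (%t. wave a c y (line s t)) = H (line s T) - H (line s (-T))" if "T >= 1" for s T
 proof (rule integral_unique, rule fundamental_theorem_of_calculus)
  fix x
  have l: "(line s has_vector_derivative 1) (at x within {-T..T})"
   unfolding line_def by (auto intro!: derivative_eq_intros simp: has_vector_derivative_def scaleR_conv_of_real)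
  from field_vector_diff_chain_within[OF l has_field_derivative_at_within[OF H]]
  show "((%t. H (line s t)) has_vector_derivative wave a c y (line s x)) (at x within {-T..T})" by (simp add: o_def)
 qed (use that in simp)
 define C where "C = exp (a^2 * d'^2 / 2 + d'^3 / 3 + \<bar>c\<bar> * d')"
 define D where "D = d' - d"
 have D: "D >= 0" using d by (simp add: D_def)
 let ?b = "%T::real. C * (D / T + D * exp (- (T * D)))"
 have "((%T::real. D / T) ---> 0) at_top" by real_asymp
 moreover have "((%T::real. D * exp (- (T * D))) ---> 0) at_top"
 proof (cases "D = 0")
  case False
  then have "D > 0" using D by simp
  then show ?thesis by real_asymp
 qed simp
 ultimately have "(?b ---> C * (0 + 0)) at_top" by (intro tendsto_intros)
 then have b: "(?b ---> 0) at_top" by simp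
 have l1: "((%T. H (line d' T) - H (line d T)) ---> 0) at_top"
 proof (rule Lim_null_comparison[OF _ b])
  show "\<forall>\<^sub>F T in at_top. norm (H (line d' T) - H (line d T)) <= ?b T" using eventually_ge_at_top[of 1]
  proof eventually_elim
   case (elim T)
   then show ?case using primitive_increment[OF H d(1,2), of T] by (simp add: C_def D_def)
  qed
 qed
 have l2: "((%T. H (line d' (-T)) - H (line d (-T))) ---> 0) at_top"
 proof (rule Lim_null_comparison[OF _ b])
  show "\<forall>\<^sub>F T in at_top. norm (H (line d' (-T)) - H (line d (-T))) <= ?b T" using eventually_ge_at_top[of 1]
  proof eventually_elim
   case (elim T)
   then show ?case using primitive_increment[OF H d(1,2), of "-T"] by (simp add: C_def D_def)
  qed
 qed
 have "a^2 + 2 * d' > 0" using d by (simp add: add_nonneg_pos)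
 then have l3: "((%T. integral {-T..T} ?A) ---> ampl_at d' a c y) at_top"
  unfolding ampl_at_def by (intro integral_window_tendsto integrable_wave continuous_wave)
 have "((%T. integral {-T..T} ?A - (H (line d' T) - H (line d T)) + (H (line d' (-T)) - H (line d (-T))))
   ---> ampl_at d' a c y - 0 + 0) at_top" by (intro tendsto_intros l1 l2 l3)
 moreover have "\<forall>\<^sub>F T in at_top. integral {-T..T} ?A - (H (line d' T) - H (line d T)) + (H (line d' (-T)) - H (line d (-T))) =
   integral {-T..T} (%t. wave a c y (line d t))" using eventually_ge_at_top[of 1] by eventually_elim (simp add: I)
 ultimately show ?thesis by (simp add: tendsto_cong)
qed

lemma ampl_at_eq: assumes "0 <= d" "d <= d'" "0 < d'" "s^2 + 2 * d > 0" shows "ampl_at d s x y = ampl_at d' s x y"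
proof (rule tendsto_unique[OF _ _ contour_limit[OF assms(1-3)]])
 show "((%T. integral {-T..T} (%t. wave s x y (line d t))) ---> ampl_at d s x y) at_top"
  unfolding ampl_at_def using assms by (intro integral_window_tendsto integrable_wave continuous_wave)
qed simp

definition ampl :: "real => real => real => complex" where
 "ampl = ampl_at 1"

lemma ampl_eq: assumes "0 <= d" "s^2 + 2 * d > 0" shows "ampl s x y = ampl_at d s x y"
proof (cases "d <= 1")
 case True
 then show ?thesis using ampl_at_eq[of d 1 s x y] assms by (simp add: ampl_def)
next
 case False
 have "s^2 + 2 * 1 > 0" by (simp add: add_nonneg_pos)
 then show ?thesis using ampl_at_eq[of 1 d s x y] assms False by (simp add: ampl_def)
qed

lemma ampl_bound: assumes "0 <= d" "s^2 + 2 * d > 0"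
 shows "norm (ampl s x y) <= exp (s^2 * d^2 / 2 + d^3 / 3 - x * d - y^2 * d / (s^2 + 2 * d)) * sqrt (pi / (d + s^2 / 2))"
 unfolding ampl_eq[OF assms] by (rule norm_ampl_at[OF assms(2)])

text \<open>Conjugation reflects the contour in the imaginary axis and changes the sign of y. This
  is why one factor of the kernel is the conjugate of the other when the two points agree.\<close>

lemma cnj_ampl: "cnj (ampl s x y) = ampl s x (- y)"
proof -
 have w: "cnj (wave s x y (line 1 t)) = wave s x (- y) (line 1 (- t))" for t unfolding wave_def line_def
  by (simp add: exp_cnj power2_eq_square power3_eq_cube algebra_simps)
 have "cnj (ampl s x y) = (LBINT t. wave s x (- y) (line 1 (- t)))" unfolding ampl_def ampl_at_def w[symmetric] by simp
 also have "... = ampl s x (- y)" unfolding ampl_def ampl_at_def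
  using lborel_integral_real_affine[of "-1" "%t. wave s x (- y) (line 1 t)" 0] by simp
 finally show ?thesis .
qed

lemma measurable_ampl: "(%z. ampl s (fst z) (snd z)) : bmeas borel"
proof -
 have "continuous_on UNIV (%p :: (real \<times> real) \<times> real. wave s (fst (fst p)) (snd (fst p)) (line 1 (snd p)))"
  unfolding wave_def line_def by (intro continuous_intros)
 then have "(%p :: (real \<times> real) \<times> real. wave s (fst (fst p)) (snd (fst p)) (line 1 (snd p))) : bmeas borel"
  by (rule borel_measurable_continuous_onI)
 then have "(%p :: (real \<times> real) \<times> real. wave s (fst (fst p)) (snd (fst p)) (line 1 (snd p))) : bmeas (borel \<Otimes>\<^sub>M lborel)"
  by (subst measurable_cong_sets[OF sets_pair_measure_cong[OF refl sets_lborel] refl]) (simp add: borel_prod)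
 then show ?thesis unfolding ampl_def ampl_at_def
  using lborel.borel_measurable_lebesgue_integral[of "%z t. wave s (fst z) (snd z) (line 1 t)" borel] by (simp add: case_prod_beta')
qed

section \<open>The double contour integral as a Gram kernel\<close>

lemma (in pair_sigma_finite) int_product:
 fixes f :: "'a => complex" and g :: "'b => complex"
 assumes f[measurable]: "integrable M1 f" and g[measurable]: "integrable M2 g"
 shows "integrable (M1 \<Otimes>\<^sub>M M2) (%p. f (fst p) * g (snd p))"
proof (rule Fubini_integrable)
 have [measurable]: "f : bmeas M1" "g : bmeas M2" using f g by auto
 show "(%p. f (fst p) * g (snd p)) : bmeas (M1 \<Otimes>\<^sub>M M2)" by measurable
 show "integrable M1 (%x. LINT y|M2. norm (f (fst (x, y)) * g (snd (x, y))))" using f by (simp add: norm_mult)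
 show "AE x in M1. integrable M2 (%y. f (fst (x, y)) * g (snd (x, y)))" using g by simp
qed

lemma half_line_FTC:
 fixes f F :: "real => complex" assumes f: "integrable lborel (%x. ind {0..} x *\<^sub>R f x)" and c: "continuous_on UNIV f"
  and F: "!!x. (F has_vector_derivative f x) (at x)" and L: "(F ---> L) at_top"
 shows "(LBINT x. ind {0..} x *\<^sub>R f x) = L - F 0"
proof (rule tendsto_unique)
 let ?D = "%x. ind {0..} x *\<^sub>R f x"
 let ?C = "%T. LBINT x. ind {0..T} x *\<^sub>R f x"
 let ?B = "%T. LBINT x. ind {0..T} x *\<^sub>R f x"
 let ?A = "%x. (%T. ind {0..T} x *\<^sub>R f x) ---> ind {0..} x *\<^sub>R f x"
 have [measurable]: "f : bmeas borel" using c by (rule borel_measurable_continuous_onI)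
 show "(?C ---> (LBINT x. ind {0..} x *\<^sub>R f x)) at_top"
 proof (rule integral_dominated_convergence_at_top[where w="%x. norm (?D x)"])
  show "AE x in lborel. (?A x) at_top"
  proof (rule AE_I2)
   fix x
   have "eventually (%T. ind {0..T} x *\<^sub>R f x = ind {0..} x *\<^sub>R f x) at_top"
    using eventually_ge_at_top[of x] by eventually_elim (simp add: indicator_def)
   then show "(?A x) at_top" by (rule tendsto_eventually)
  qed
  show "\<forall>\<^sub>F T in at_top. AE x in lborel. norm (ind {0..T} x *\<^sub>R f x) <= norm (?D x)" by (auto simp: indicator_def)
  show "integrable lborel (%x. norm (?D x))" using f by (rule integrable_norm)
 qed simp_all
 have "(?B T) = F T - F 0" if "T >= 0" for T
 proof -
  have i: "integrable lborel (%x. ind {0..T} x *\<^sub>R f x)"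
   by (rule integrable_le[OF f]) (auto simp: indicator_def)
  then have "(?B T) = integral {0..T} f"
   using set_borel_integral_eq_integral(2)[of "{0..T}" f] by (simp add: set_integrable_def set_lebesgue_integral_def)
  also have "... = F T - F 0"
   using that F by (intro integral_unique fundamental_theorem_of_calculus) (auto intro: has_vector_derivative_at_within)
  finally show ?thesis .
 qed
 then have "\<forall>\<^sub>F T in at_top. F T - F 0 = (?B T)" by (intro eventually_mono[OF eventually_ge_at_top[of 0]]) simp
 moreover have "((%T. F T - F 0) ---> L - F 0) at_top" by (intro tendsto_intros L)
 ultimately show "(?C ---> L - F 0) at_top" by (rule Lim_transform_eventually[rotated])
qed simp

lemma int_exp_half:
 fixes k :: real assumes "k > 0" shows "integrable lborel (%x. ind {0..} x * exp (- k * x))"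
proof -
 let ?A = "%x. ind {0..} x *\<^sub>R (ind {-1<..} x * exp (- k * x))"
 have "integrable lborel ?A" using has_bochner_integral_exp_tail[OF assms, of "-1"]
  by (intro integrable_mult_indicator) (auto simp: hbi_iff)
 also have "?A = (%x. ind {0..} x * exp (- k * x))" by (auto simp: indicator_def)
 finally show ?thesis .
qed

lemma has_integral_exp_half_line: assumes w: "Im w > 0"
 shows "hbi lborel (%x. ind {0..} x *\<^sub>R exp (\<i> * of_real x * w)) (- 1 / (\<i> * w))"
proof -
 let ?B = "%x. exp (\<i> * of_real x * w) / (\<i> * w)"
 let ?A = "%x. exp (\<i> * of_real x * w)"
 have w0: "w ~= 0" using w by auto
 have n: "norm (exp (\<i> * of_real x * w)) = exp (- Im w * x)" for x by (simp add: norm_exp_eq_Re mult.commute)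
 have m: "?A : bmeas borel" by (intro borel_measurable_continuous_onI continuous_intros)
 have i: "integrable lborel (%x. ind {0..} x *\<^sub>R exp (\<i> * of_real x * w))"
  by (rule integrable_le[OF int_exp_half[OF w]]) (use m in \<open>auto simp: n indicator_def\<close>)
 have "(LBINT x. ind {0..} x *\<^sub>R exp (\<i> * of_real x * w)) = 0 - exp (\<i> * of_real 0 * w) / (\<i> * w)"
 proof (rule half_line_FTC[OF i])
  show "continuous_on UNIV ?A" by (intro continuous_intros)
  show "(?B has_vector_derivative exp (\<i> * of_real x * w)) (at x)" for x
   using w0 by (auto intro!: derivative_eq_intros has_vector_derivative_real_field simp: field_simps)
  have "((%x. exp (- Im w * x)) ---> 0) at_top" using w by real_asymp
  then have "(?A ---> 0) at_top" unfolding n[symmetric] by (rule tendsto_norm_zero_cancel)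
  then show "(?B ---> 0) at_top" by (rule tendsto_divide_zero)
 qed
 then show ?thesis using i by (simp add: hbi_iff)
qed

definition kconst :: real where
 "kconst = 1 / (4 * pi powr (5/2))"

lemma kconst_pos: "kconst > 0" by (simp add: kconst_def)

definition gramk :: "real => kernel" where
 "gramk s z w = of_real kconst *
  (LBINT l. ind {0..} l *\<^sub>R (ampl s (fst z + l) (- snd z) * ampl s (fst w + l) (snd w)))"

lemma wave_shift: "wave s x y v * exp (\<i> * of_real l * v) = wave s (x + l) y v" unfolding wave_def exp_add[symmetric] by (simp add: algebra_simps)

text \<open>On the contours u + v has imaginary part d1 + d2 > 0, so the integral of exp(i l (u+v))
  over l from 0 to infinity is -1/(i(u+v)); its sign absorbs the one in front of the kernel. After
  Fubini the factors exp(i l u) and exp(i l v) shift the two abscissas by l. The result no longer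
  contains the heights.\<close>

lemma M_kernel_gram: assumes d: "d1 > 0" "d2 > 0"
 shows "integrable (lborel \<Otimes>\<^sub>M lborel) (%(s, t). M_integrand a z w (line d2 t) (line d1 s))"
  and "M_kernel d1 d2 a z w = gramk a z w"
proof -
 let ?D = "%l. ampl a (fst z + l) (- snd z) * ampl a (fst w + l) (snd w)"
 let ?C = "lborel \<Otimes>\<^sub>M lborel"
 define A where "A t = wave a (fst z) (- snd z) (line d2 t)" for t
 define B where "B s = wave a (fst w) (snd w) (line d1 s)" for s
 have q: "a^2 + 2 * d1 > 0" "a^2 + 2 * d2 > 0" using d by (simp_all add: add_nonneg_pos)
 have Ai: "integrable lborel A" unfolding A_def using q by (intro integrable_wave)
 have Bi: "integrable lborel B" unfolding B_def using q by (intro integrable_wave)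
 define W where "W p = line d2 (snd p) + line d1 (fst p)" for p :: "real \<times> real"
 have W: "Im (W p) = d1 + d2" for p by (simp add: W_def line_def)
 have M: "M_integrand a z w (line d2 (snd p)) (line d1 (fst p)) = B (fst p) * A (snd p) / (\<i> * W p)" for p
  unfolding M_integrand_def W_def A_def B_def wave_def exp_add[symmetric] case_prod_beta by (simp add: algebra_simps)
 define G where "G q = B (fst (fst q)) * A (snd (fst q)) * (ind {0..} (snd q) *\<^sub>R exp (\<i> * of_real (snd q) * W (fst q)))" for q :: "(real \<times> real) \<times> real"
 interpret l3: pair_sigma_finite "lborel \<Otimes>\<^sub>M lborel :: (real \<times> real) measure" "lborel :: real measure" ..
 have mA[measurable]: "A : bmeas borel" "B : bmeas borel" using Ai Bi by auto
 have mW[measurable]: "W : bmeas (borel \<Otimes>\<^sub>M borel)" unfolding W_def line_def by measurable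
 have mG: "G : bmeas (?C \<Otimes>\<^sub>M lborel)" unfolding G_def by measurable
 have BA: "integrable ?C (%p. B (fst p) * A (snd p))" by (rule lborel_pair.int_product[OF Bi Ai])
 have "integrable lborel (%l. ind {0..} l *\<^sub>R exp (\<i> * of_real l * (\<i> * of_real (d1 + d2))))"
  using has_integral_exp_half_line[of "\<i> * of_real (d1 + d2)"] d by (auto simp: hbi_iff)
 from l3.int_product[OF BA this]
 \<comment> \<open>The modulus of exp(i l W) depends only on the constant imaginary part of W, so
   the integrand in three variables is dominated by a product of integrable functions.\<close>
 have Gi: "integrable (?C \<Otimes>\<^sub>M lborel) G"
 proof (rule integrable_le[OF _ mG], intro AE_I2)
  fix q
  show "norm (G q) <= norm (B (fst (fst q)) * A (snd (fst q)) * (ind {0..} (snd q) *\<^sub>R exp (\<i> * of_real (snd q) * (\<i> * of_real (d1 + d2)))))"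
   unfolding G_def norm_mult norm_scaleR by (simp add: norm_exp_eq_Re W mult.commute)
 qed
 have inner: "hbi lborel (%l. G (p, l)) (- (B (fst p) * A (snd p) / (\<i> * W p)))" for p unfolding G_def fst_conv snd_conv
  using hbi_mult[OF has_integral_exp_half_line[of "W p"], of "B (fst p) * A (snd p)"] d by (simp add: W)
 then have iG: "(LBINT l. G (p, l)) = - M_integrand a z w (line d2 (snd p)) (line d1 (fst p))" for p by (simp add: hbi_iff M)
 have "integrable ?C (%p. LBINT l. G (p, l))" using l3.integrable_fst'[OF Gi] by simp
 then have Mi: "integrable ?C (%p. M_integrand a z w (line d2 (snd p)) (line d1 (fst p)))" unfolding iG by simp
 then show "integrable ?C (%(s, t). M_integrand a z w (line d2 t) (line d1 s))" by (simp add: case_prod_beta')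
 have "(LBINT s. LBINT t. M_integrand a z w (line d2 t) (line d1 s)) = (LINT p|?C. M_integrand a z w (line d2 (snd p)) (line d1 (fst p)))"
  using lborel_pair.integral_fst'[OF Mi] by simp
 also have "... = - (LINT p|?C. (LBINT l. G (p, l)))" unfolding iG by simp
 also have "(LINT p|?C. (LBINT l. G (p, l))) = (LBINT l. (LINT p|?C. G (p, l)))"
  using l3.Fubini_integral[of "%p l. G (p, l)"] Gi by (simp add: case_prod_beta')
 also have "... = (LBINT l. ind {0..} l *\<^sub>R (?D l))"
 proof (rule integral_eq[OF refl])
  fix l :: real
  have G: "G (p, l) = ind {0..} l *\<^sub>R (wave a (fst w + l) (snd w) (line d1 (fst p)) * wave a (fst z + l) (- snd z) (line d2 (snd p)))" for p
  proof -
   have "exp (\<i> * of_real l * W p) = exp (\<i> * of_real l * line d1 (fst p)) * exp (\<i> * of_real l * line d2 (snd p))"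
    unfolding exp_add[symmetric] by (simp add: W_def algebra_simps)
   then show ?thesis unfolding G_def A_def B_def fst_conv snd_conv wave_shift[symmetric] by (simp add: mult_ac)
  qed
  have i: "integrable lborel (%s. wave a (fst w + l) (snd w) (line d1 s))" "integrable lborel (%t. wave a (fst z + l) (- snd z) (line d2 t))"
   using q by (intro integrable_wave; simp)+
  have "(LINT p|?C. G (p, l)) = ind {0..} l *\<^sub>R
    (LINT p|?C. wave a (fst w + l) (snd w) (line d1 (fst p)) * wave a (fst z + l) (- snd z) (line d2 (snd p)))" unfolding G by simp
  also have "(LINT p|?C. wave a (fst w + l) (snd w) (line d1 (fst p)) * wave a (fst z + l) (- snd z) (line d2 (snd p)))
    = ampl a (fst w + l) (snd w) * ampl a (fst z + l) (- snd z)"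
   using lborel_pair.integral_fst'[OF lborel_pair.int_product[OF i]] d q
   by (simp add: ampl_eq[of d1 a "fst w + l" "snd w"] ampl_eq[of d2 a "fst z + l" "- snd z"] ampl_at_def)
  finally show "(LINT p|?C. G (p, l)) = ind {0..} l *\<^sub>R (?D l)" by (simp add: mult.commute)
 qed
 finally show "M_kernel d1 d2 a z w = gramk a z w" by (simp add: M_kernel_def gramk_def kconst_def)
qed

definition ampc :: "real => real => real" where
 "ampc d s = exp (s^2 * d^2 / 2 + d^3 / 3) * sqrt (pi / (d + s^2 / 2))"

lemma ampc_nonneg: "0 <= d ==> 0 <= ampc d s" by (simp add: ampc_def)

text \<open>The height d is a free parameter of the bound: 1 is used for a fixed s, and
  \<open>tilt s\<close> in the scaling limit.\<close>

lemma ampl_le: assumes "d > 0" shows "norm (ampl s x y) <= ampc d s * (exp (- d * x) * exp (- (d / (s^2 + 2 * d)) * y^2))"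
proof -
 have "s^2 + 2 * d > 0" using assms by (simp add: add_nonneg_pos)
 moreover have "exp (s^2 * d^2 / 2 + d^3 / 3 - x * d - y^2 * d / (s^2 + 2 * d)) =
   exp (s^2 * d^2 / 2 + d^3 / 3) * (exp (- d * x) * exp (- (d / (s^2 + 2 * d)) * y^2))" unfolding exp_add[symmetric] by (simp add: mult.commute)
 ultimately show ?thesis using ampl_bound[of d s x y] assms unfolding ampc_def by (simp only: mult_ac less_imp_le)
qed

lemma ampl_le_decay: assumes "d > 0" shows "norm (ampl s x y) <= ampc d s * exp (- d * x)"
proof -
 let ?A = "- (d / (s^2 + 2 * d)) * y^2"
 have "exp ?A <= 1" using assms by simp
 then have "ampc d s * (exp (- d * x) * exp ?A) <= ampc d s * (exp (- d * x) * 1)"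
  using assms ampc_nonneg by (intro mult_left_mono) auto
 with ampl_le[OF assms, of s x y] show ?thesis by simp
qed

lemma measurable_ampl_comp [measurable]: assumes [measurable]: "f : bmeas M" "g : bmeas M"
 shows "(%x. ampl s (f x) (g x)) : bmeas M"
proof -
 have "(%x. (f x, g x)) : M \<rightarrow>\<^sub>M borel" by (simp add: borel_prod[symmetric])
 from measurable_compose[OF this measurable_ampl[of s]] show ?thesis by simp
qed

lemma gram_integrable:
 "integrable lborel (%l. ind {0..} l *\<^sub>R (ampl s (x + l) y * ampl s (x' + l) y'))"
proof (rule integrable_le)
 define C where "C = (ampc 1 s)^2 * exp (- x - x')"
 show "integrable lborel (%l. C * (ind {0..} l * exp (- 2 * l)))" using int_exp_half[of 2] by simp
 have "norm (ampl s (x + l) y) * norm (ampl s (x' + l) y') <= (ampc 1 s * exp (- 1 * (x + l))) * (ampc 1 s * exp (- 1 * (x' + l)))" for l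
  by (intro mult_mono ampl_le_decay) (auto simp: ampc_nonneg)
 also have "(ampc 1 s * exp (- 1 * (x + l))) * (ampc 1 s * exp (- 1 * (x' + l))) = C * exp (- 2 * l)" for l
  unfolding C_def by (simp add: power2_eq_square mult_ac exp_add[symmetric])
 finally show "AE l in lborel. norm (ind {0..} l *\<^sub>R (ampl s (x + l) y * ampl s (x' + l) y')) <= norm (C * (ind {0..} l * exp (- 2 * l)))"
  by (intro AE_I2) (auto simp: indicator_def norm_mult abs_mult C_def)
qed measurable

lemma gramk_cnj: "gramk s w z = cnj (gramk s z w)" unfolding gramk_def complex_cnj_mult integral_cnj[symmetric]
 by (simp add: cnj_ampl mult.commute flip: Bochner_Integration.integral_cnj)

text \<open>The quadratic form is a positive constant times the integral of the squared modulus of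
  the combination F of shifted amplitudes.\<close>

lemma psd_gram: "psd_kernel (gramk s)" unfolding psd_kernel_def
proof (intro conjI allI)
 show "gramk s b a = cnj (gramk s a b)" for a b by (rule gramk_cnj)
 fix n :: nat and x :: "nat => plane" and c :: "nat => complex"
 define F where "F l = (SUM i<n. c i * ampl s (fst (x i) + l) (snd (x i)))" for l
 have "(SUM i<n. SUM j<n. cnj (c i) * c j * gramk s (x i) (x j)) =
  of_real kconst * (SUM i<n. SUM j<n. LBINT l. cnj (c i) * c j * (ind {0..} l *\<^sub>R (ampl s (fst (x i) + l) (- snd (x i)) * ampl s (fst (x j) + l) (snd (x j)))))"
  unfolding gramk_def sum_distrib_left by (intro sum.cong refl, subst integral_mult_right_zero) (simp only: mult_ac)
 also have "(SUM i<n. SUM j<n. LBINT l. cnj (c i) * c j * (ind {0..} l *\<^sub>R (ampl s (fst (x i) + l) (- snd (x i)) * ampl s (fst (x j) + l) (snd (x j)))))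
  = (LBINT l. (SUM i<n. SUM j<n. cnj (c i) * c j * (ind {0..} l *\<^sub>R (ampl s (fst (x i) + l) (- snd (x i)) * ampl s (fst (x j) + l) (snd (x j))))))"
  by (subst Bochner_Integration.integral_sum; (intro Bochner_Integration.integrable_sum integrable_mult_right gram_integrable)?)
   (intro sum.cong refl Bochner_Integration.integral_sum[symmetric] integrable_mult_right gram_integrable)
 also have "... = (LBINT l. cor (ind {0..} l * (norm (F l))^2))"
 proof (rule integral_eq[OF refl])
  fix l
  have "cor ((norm (F l))^2) = cnj (F l) * F l" by (metis complex_norm_square mult.commute)
  also have "... = (SUM i<n. SUM j<n. cnj (c i) * c j * (ampl s (fst (x i) + l) (- snd (x i)) * ampl s (fst (x j) + l) (snd (x j))))"
   unfolding F_def cnj_sum sum_product by (simp add: cnj_ampl mult_ac)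
  finally show "(SUM i<n. SUM j<n. cnj (c i) * c j * (ind {0..} l *\<^sub>R (ampl s (fst (x i) + l) (- snd (x i)) * ampl s (fst (x j) + l) (snd (x j))))) = cor (ind {0..} l * (norm (F l))^2)"
   by (simp add: indicator_def)
 qed
 also have "... = cor (LBINT l. ind {0..} l * (norm (F l))^2)" by (rule integral_complex_of_real)
 finally have "(SUM i<n. SUM j<n. cnj (c i) * c j * gramk s (x i) (x j)) = cor (kconst * (LBINT l. ind {0..} l * (norm (F l))^2))"
  by simp
 moreover have "0 <= kconst * (LBINT l. ind {0..} l * (norm (F l))^2)"
  using kconst_pos by (intro mult_nonneg_nonneg Bochner_Integration.integral_nonneg) auto
 ultimately show "0 <= Re (SUM i<n. SUM j<n. cnj (c i) * c j * gramk s (x i) (x j))" by simp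
qed

lemma gram_diag: "gramk s z z = of_real (kconst * (LBINT l. ind {0..} l * (norm (ampl s (fst z + l) (snd z)))^2))"
proof -
 have "ind {0..} l *\<^sub>R (ampl s (fst z + l) (- snd z) * ampl s (fst z + l) (snd z)) = cor (ind {0..} l * (norm (ampl s (fst z + l) (snd z)))^2)" for l
  using complex_norm_square[of "ampl s (fst z + l) (snd z)"] by (simp add: cnj_ampl[symmetric] indicator_def mult.commute)
 then show ?thesis unfolding gramk_def by (simp only: integral_complex_of_real of_real_mult[of kconst])
qed

lemma ampl_square_integrable:
 "integrable lborel (%l. ind {0..} l * (norm (ampl s (x + l) y))^2)"
 using integrable_norm[OF gram_integrable[of s x y x y]] by (simp add: norm_mult power2_eq_square)

lemma gram_diag_bound: assumes d: "d > 0"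
 shows "Re (gramk s z z) <= kconst * (ampc d s)^2 / (2 * d) * (exp (- (2 * d) * fst z) * exp (- (2 * d / (s^2 + 2 * d)) * (snd z - 0)^2))"
proof -
 let ?B = "%l. ind {0..} l * exp (- (2 * d) * l)"
 let ?A = "%l. norm (ampl s (fst z + l) (snd z))"
 define E where "E = exp (- (2 * d) * fst z) * exp (- (2 * d / (s^2 + 2 * d)) * (snd z)^2)"
 have hb: "hbi lborel (%l. ind {0..} l * exp (- (2 * d) * l)) (1 / (2 * d))"
 proof -
  have "hbi lborel (%l. ind {0..} l *\<^sub>R exp (\<i> * of_real l * (\<i> * of_real (2 * d)))) (- 1 / (\<i> * (\<i> * of_real (2 * d))))"
   using d by (intro has_integral_exp_half_line) simp
  from has_bochner_integral_Re[OF this] show ?thesis by (simp add: exp_of_real mult_ac flip: of_real_mult of_real_minus of_real_divide)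
 qed
 have "(LBINT l. ind {0..} l * (?A l)^2) <= (LBINT l. (ampc d s)^2 * E * (?B l))"
 proof (rule integral_mono)
  show "integrable lborel (%l. (ampc d s)^2 * E * (?B l))" using hb by (simp add: hbi_iff)
  fix l
  have "(?A l)^2 <= (ampc d s * (exp (- d * (fst z + l)) * exp (- (d / (s^2 + 2 * d)) * (snd z)^2)))^2"
   by (intro power_mono ampl_le d) simp
  also have "... = (ampc d s)^2 * E * exp (- (2 * d) * l)"
   unfolding E_def power_mult_distrib exp_of_nat_mult[symmetric] mult.assoc exp_add[symmetric] by (simp add: algebra_simps)
  finally show "ind {0..} l * (?A l)^2 <= (ampc d s)^2 * E * (?B l)" by (simp add: indicator_def)
 qed (rule ampl_square_integrable)
 also have "... = (ampc d s)^2 * E * (1 / (2 * d))" using hb by (simp add: hbi_iff)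
 finally have "kconst * (LBINT l. ind {0..} l * (?A l)^2) <= kconst * ((ampc d s)^2 * E * (1 / (2 * d)))"
  using kconst_pos by (intro mult_left_mono) auto
 then show ?thesis unfolding gram_diag E_def by (simp add: mult_ac)
qed

lemma measurable_gramk: "(%(a, b). gramk s a b) : bmeas (borel \<Otimes>\<^sub>M borel)"
proof -
 have [measurable]: "fst : bmeas (borel :: plane measure)" "snd : bmeas (borel :: plane measure)"
  by (auto simp: borel_prod[symmetric])
 have "(%p. \<integral>l. ind {0..} l *\<^sub>R (ampl s (fst (fst p) + l) (- snd (fst p)) * ampl s (fst (snd p) + l) (snd (snd p))) \<partial>lborel)
  : bmeas (borel \<Otimes>\<^sub>M borel :: (plane \<times> plane) measure)"
  by (rule lborel.borel_measurable_lebesgue_integral) measurable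
 then show ?thesis unfolding gramk_def case_prod_beta by (intro borel_measurable_times borel_measurable_const)
qed

text \<open>At height 1 the diagonal bound decays exponentially to the right and like a Gaussian in
  the second coordinate, but it grows to the left. Half planes bounded on the left are therefore the
  natural domain of finite trace.\<close>

lemma gram_right_of: shows "set_integrable lborel (right_of t) (%z. Re (gramk s z z))" unfolding set_integrable_def
proof (rule integrable_le)
 let ?B = "%z. ind (right_of t) z *\<^sub>R Re (gramk s z z)"
 let ?A = "%z k. (ind {t<..} (fst z) * exp (- 2 * fst z)) * exp (- k * (snd z - 0)^2)"
 define k where "k = 2 * 1 / (s^2 + 2 * 1)"
 have k: "k > 0" by (simp add: k_def add_nonneg_pos)
 define C where "C = kconst * (ampc 1 s)^2 / (2 * 1)"
 have C: "C >= 0" using kconst_pos by (simp add: C_def)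
 show "integrable lborel (%z :: plane. C * (?A z k))"
  using has_bochner_integral_product[OF has_bochner_integral_exp_tail[of 2 t] hbi_gauss[OF k, of 0]]
  by (simp add: hbi_iff)
 show "(%z. ind (right_of t) z *\<^sub>R Re (gramk s z z)) : bmeas lborel"
  using measurable_compose[OF _ measurable_gramk[of s], of "%z. (z, z)" borel] by simp
 show "AE z in lborel. norm (?B z) <= norm (C * (?A z k))"
 proof (rule AE_I2)
  fix z :: plane
  show "norm (?B z) <= norm (C * (?A z k))"
  proof (cases "z : right_of t")
   case True
   then have "fst z > t" by (auto simp: right_of_def)
   then show ?thesis using True C psd_diag(2)[OF psd_gram, of s z] gram_diag_bound[of 1 s z] by (simp add: C_def k_def)
  qed simp
 qed
qed

lemma gram_loc: assumes "A : sets borel" "bounded A" shows "set_integrable lborel A (%z. Re (gramk s z z))"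
proof -
 obtain R where R: "!!z. z : A ==> norm z <= R" using assms(2) by (auto simp: bounded_iff)
 have "A \<subseteq> right_of (- R - 1)"
 proof
  fix z assume "z : A"
  then have "\<bar>fst z\<bar> <= R" using R[of z] norm_fst_le[of "fst z" "snd z"] by simp
  then show "z : right_of (- R - 1)" by (auto simp: right_of_def mem_Times_iff)
 qed
 then show ?thesis using assms(1) by (intro set_integrable_subset[OF gram_right_of]) auto
qed

lemma ampl_tendsto:
 fixes s x :: "nat => real" assumes s: "s ----> b" and x: "x ----> a"
 shows "(%n. ampl (s n) (x n) y) ----> ampl b a y"
proof -
 obtain S where S: "!!n. \<bar>s n\<bar> <= S" using convergent_imp_Bseq[OF convergentI[OF s]] by (auto simp: Bseq_def)
 obtain X where X: "!!n. \<bar>x n\<bar> <= X" using convergent_imp_Bseq[OF convergentI[OF x]] by (auto simp: Bseq_def)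
 show ?thesis unfolding ampl_def ampl_at_def
 proof (rule integral_dominated_convergence[where w="%t. exp (S^2 / 2 + 1 / 3 + X) * exp (- 1 * (t - 0)^2)"])
  show "integrable lborel (%t. exp (S^2 / 2 + 1 / 3 + X) * exp (- 1 * (t - 0)^2))"
   using hbi_gauss[of 1 0] by (simp add: hbi_iff)
  show "AE t in lborel. (%n. wave (s n) (x n) y (line 1 t)) ----> wave b a y (line 1 t)"
   unfolding wave_def by (intro AE_I2 tendsto_intros s x)
  show "AE t in lborel. norm (wave (s n) (x n) y (line 1 t)) <= exp (S^2 / 2 + 1 / 3 + X) * exp (- 1 * (t - 0)^2)" for n
  proof (rule AE_I2)
   fix t
   have "(s n)^2 <= S^2" using power_mono[OF S[of n], of 2] by simp
   moreover have "- x n <= X" using X[of n] by linarith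
   moreover have "0 <= (s n * t - y)^2" by simp
   ultimately have "- ((s n * t - y)^2) / 2 + (s n)^2 * 1^2 / 2 - t^2 * 1 + 1^3 / 3 - x n * 1 <= S^2 / 2 + 1 / 3 + X + - 1 * (t - 0)^2"
    unfolding power_one diff_0_right mult_1_right by linarith
   then show "norm (wave (s n) (x n) y (line 1 t)) <= exp (S^2 / 2 + 1 / 3 + X) * exp (- 1 * (t - 0)^2)"
    unfolding norm_wave exp_add[symmetric] by (simp only: exp_le_cancel_iff)
  qed
 qed simp_all
qed

lemma ampc_le: assumes "\<bar>s\<bar> <= S" shows "ampc 1 s <= exp (S^2 / 2 + 1 / 3) * sqrt pi" unfolding ampc_def
proof (rule mult_mono)
 have "s^2 <= S^2" using power_mono[OF assms, of 2] by simp
 then show "exp (s^2 * 1^2 / 2 + 1^3 / 3) <= exp (S^2 / 2 + 1 / 3)" by simp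
 have "pi / (1 + s^2 / 2) <= pi / 1" by (intro divide_left_mono) (auto simp: add_pos_nonneg)
 then show "sqrt (pi / (1 + s^2 / 2)) <= sqrt pi" by simp
qed auto

text \<open>Continuity in s is used at s = 0, where the kernel is reached only as a limit of kernels
  with positive s. Height 1 gives estimates that stay uniform there.\<close>

lemma gramk_tendsto:
 fixes s :: "nat => real" assumes s: "s ----> a"
 shows "(%n. gramk (s n) z w) ----> gramk a z w"
proof -
 let ?B = "%l. ind {0..} l * exp (- 2 * l)"
 let ?A = "%n l. ampl (s n) (fst z + l) (- snd z) * ampl (s n) (fst w + l) (snd w)"
 obtain S where S: "!!n. \<bar>s n\<bar> <= S" using convergent_imp_Bseq[OF convergentI[OF s]] by (auto simp: Bseq_def)
 define C where "C = exp (S^2 / 2 + 1 / 3) * sqrt pi"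
 have b: "norm (ampl (s n) x y) <= C * exp (- x)" for n x y
 proof -
  have "ampc 1 (s n) * exp (- x) <= C * exp (- x)" unfolding C_def by (intro mult_right_mono ampc_le S) simp
  moreover have "norm (ampl (s n) x y) <= ampc 1 (s n) * exp (- x)" using ampl_le_decay[of 1 "s n" x y] by simp
  ultimately show ?thesis by (rule order_trans[rotated])
 qed
 show ?thesis unfolding gramk_def
 proof (intro tendsto_mult tendsto_const integral_dominated_convergence[where w="%l. C^2 * exp (- fst z - fst w) * (?B l)"])
  show "integrable lborel (%l. C^2 * exp (- fst z - fst w) * (?B l))" using int_exp_half[of 2] by simp
  show "AE l in lborel. (%n. ind {0..} l *\<^sub>R (?A n l))
    ----> ind {0..} l *\<^sub>R (ampl a (fst z + l) (- snd z) * ampl a (fst w + l) (snd w))"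
   by (intro AE_I2 tendsto_intros ampl_tendsto s)
  show "AE l in lborel. norm (ind {0..} l *\<^sub>R (?A n l)) <= C^2 * exp (- fst z - fst w) * (?B l)" for n
  proof (rule AE_I2)
   fix l
   have "norm (ampl (s n) (fst z + l) (- snd z)) * norm (ampl (s n) (fst w + l) (snd w)) <= (C * exp (- (fst z + l))) * (C * exp (- (fst w + l)))"
    by (intro mult_mono b) (auto simp: C_def)
   also have "... = C^2 * exp (- fst z - fst w) * exp (- 2 * l)" by (simp add: power2_eq_square mult_ac exp_add[symmetric])
   finally show "norm (ind {0..} l *\<^sub>R (?A n l)) <= C^2 * exp (- fst z - fst w) * (?B l)" by (simp add: indicator_def norm_mult)
  qed
 qed measurable
qed

lemma measurable_cnj [measurable (raw)]: "f : bmeas M ==> (%x. cnj (f x)) : bmeas M"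
 by (rule measurable_compose[where g=cnj]) (auto intro: borel_measurable_continuous_onI continuous_on_cnj)

section \<open>Plancherel's formula\<close>

lemma gaussian_four:
 fixes a r :: real assumes e: "a > 0"
 shows "(LBINT x. of_real (exp (- ((a * x)^2) / 2)) * exp (\<i> * of_real (x * r))) = cor (sqrt (2 * pi) / a * exp (- ((r / a)^2) / 2))"
proof -
 let ?A = "%t. LBINT x. of_real (exp (- (x^2) / 2)) * exp (\<i> * of_real (x * t))"
 have *: "of_real (1 / sqrt (2 * pi)) * (?A t) = cor (exp (- (t^2) / 2))" for t
 proof -
  have "of_real (1 / sqrt (2 * pi)) * (?A t) = (LBINT x. of_real (1 / sqrt (2 * pi)) * (of_real (exp (- (x^2) / 2)) * exp (\<i> * of_real (x * t))))"
   by (rule integral_mult_right_zero[symmetric])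
  also have "... = (LBINT x. std_normal_density x *\<^sub>R iexp (t * x))"
  proof (rule integral_eq[OF refl])
   fix x
   show "of_real (1 / sqrt (2 * pi)) * (of_real (exp (- (x^2) / 2)) * exp (\<i> * of_real (x * t))) = std_normal_density x *\<^sub>R iexp (t * x)"
    by (simp add: std_normal_density_def scaleR_conv_of_real mult.commute)
  qed
  also have "... = (LINT x|std_normal_distribution. iexp (t * x))" by (rule integral_density[symmetric]) auto
  also have "... = char std_normal_distribution t" by (simp add: char_def)
  also have "... = cor (exp (- (t^2) / 2))" by (simp add: char_std_normal_distribution)
  finally show ?thesis .
 qed
 have 1: "(?A t) = cor (sqrt (2 * pi) * exp (- (t^2) / 2))" for t
 proof -
  have "cor (sqrt (2 * pi)) * (of_real (1 / sqrt (2 * pi)) * X) = X" for X unfolding mult.assoc[symmetric] of_real_mult[symmetric] by simp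
  from this[of "LBINT x. of_real (exp (- (x^2) / 2)) * exp (\<i> * of_real (x * t))"] show ?thesis unfolding * by (simp only: of_real_mult)
 qed
 have "(LBINT x. of_real (exp (- ((a * x)^2) / 2)) * exp (\<i> * of_real (x * r))) =
  \<bar>1 / a\<bar> *\<^sub>R (LBINT x. of_real (exp (- ((a * (0 + 1 / a * x))^2) / 2)) * exp (\<i> * of_real ((0 + 1 / a * x) * r)))"
  using e by (intro lborel_integral_real_affine) simp
 also have "... = (1 / a) *\<^sub>R (LBINT x. of_real (exp (- (x^2) / 2)) * exp (\<i> * of_real (x * (r / a))))" using e by simp
 also have "... = cor (sqrt (2 * pi) / a * exp (- ((r / a)^2) / 2))" unfolding 1 by (simp add: scaleR_conv_of_real)
 finally show ?thesis .
qed

definition four :: "(real => complex) => real => complex" where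
 "four G x = (LBINT t. G t * exp (\<i> * of_real (x * t)))"

lemma gaussian_integrable:
 fixes a :: real assumes "a > 0" shows "integrable lborel (%x::real. exp (- ((a * x)^2) / 2))"
proof -
 have "integrable lborel (%x::real. exp (- (a^2 / 2) * (x - 0)^2))"
  using hbi_gauss[of "a^2 / 2" 0] assms by (simp add: hbi_iff)
 then show ?thesis by (simp add: power_mult_distrib)
qed

lemma integral_gaussian: "(LBINT x::real. exp (- (x^2) / 2)) = sqrt (2 * pi)"
 using hbi_gauss[of "1 / 2" 0] by (simp add: hbi_iff mult.commute)

lemma measurable_four: assumes [measurable]: "G : bmeas borel" shows "four G : bmeas borel"
proof -
 have "(%p. G (snd p) * exp (\<i> * of_real (fst p * snd p))) : bmeas (borel \<Otimes>\<^sub>M lborel)" by measurable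
 then show ?thesis unfolding four_def
  using lborel.borel_measurable_lebesgue_integral[of "%x t. G t * exp (\<i> * of_real (x * t))" borel] by (simp add: case_prod_beta')
qed

text \<open>The Gaussian factor makes the triple integral absolutely convergent. Integrating x first
  gives the Fourier transform of the Gaussian, a kernel of width a that smooths G.\<close>

lemma four_regularized: assumes G: "integrable lborel G" and e: "a > 0"
 shows "integrable lborel (%x. (norm (four G x))^2 * exp (- ((a * x)^2) / 2))"
  and "cor (LBINT x. (norm (four G x))^2 * exp (- ((a * x)^2) / 2)) =
   (LBINT s. cnj (G s) * (LBINT r. of_real (sqrt (2 * pi) * exp (- (r^2) / 2)) * G (s + a * r)))"
proof -
 let ?K = "%s r. sqrt (2 * pi) / a * exp (- (((s + a * r - s) / a)^2) / 2)"
 let ?J = "%x. %t. G t * exp (\<i> * of_real (x * t))"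
 let ?I = "%p x. (cnj (G (fst p)) * exp (- (\<i> * of_real (x * fst p)))) * (G (snd p) * exp (\<i> * of_real (x * snd p)))"
 let ?F = "%x. %s. cnj (G s) * exp (- (\<i> * of_real (x * s)))"
 let ?D = "%t s. sqrt (2 * pi) / a * exp (- (((t - s) / a)^2) / 2)"
 let ?C = "%x. - ((a * x)^2) / 2"
 let ?B = "%s. LBINT r. of_real (sqrt (2 * pi) * exp (- (r^2) / 2)) * G (s + a * r)"
 let ?A = "lborel \<Otimes>\<^sub>M lborel"
 interpret l3: pair_sigma_finite "lborel :: real measure" "lborel \<Otimes>\<^sub>M lborel :: (real \<times> real) measure" ..
 have [measurable]: "G : bmeas borel" using G by auto
 have cG: "integrable lborel (%s. cnj (G s))" using G by simp
 define E where "E x = cor (exp (?C x))" for x :: real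
 have [measurable]: "E : bmeas borel" unfolding E_def by measurable
 have Ei: "integrable lborel E" unfolding E_def by (intro integrable_of_real gaussian_integrable e)
 have PG: "integrable ?A (%p. cnj (G (fst p)) * G (snd p))" by (rule lborel_pair.int_product[OF cG G])
 define H where "H q = E (fst q) * (cnj (G (fst (snd q))) * G (snd (snd q)) * exp (\<i> * of_real (fst q * (snd (snd q) - fst (snd q)))))" for q :: "real \<times> real \<times> real"
 have nG: "norm (exp (\<i> * cor x)) = 1" for x by simp
 have Hi: "integrable (lborel \<Otimes>\<^sub>M ?A) H"
 proof (rule integrable_le[OF l3.int_product[OF Ei PG]])
  let ?M = "lborel \<Otimes>\<^sub>M ?A :: (real \<times> real \<times> real) measure"
  have p: "fst : bmeas ?M" "(%q. fst (snd q)) : bmeas ?M" "(%q. snd (snd q)) : bmeas ?M"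
   using measurable_fst[of "lborel :: real measure" "lborel \<Otimes>\<^sub>M lborel :: (real \<times> real) measure"]
    measurable_compose[OF measurable_snd measurable_fst, of "lborel :: real measure" "lborel :: real measure" "lborel :: real measure"]
    measurable_compose[OF measurable_snd measurable_snd, of "lborel :: real measure" "lborel :: real measure" "lborel :: real measure"]
   by (simp_all only: measurable_lborel1)
  note [measurable] = p
  have "(%q. cnj (G (fst (snd q)))) : bmeas ?M" by (rule measurable_compose[OF p(2)]) measurable
  moreover have "(%q. G (snd (snd q))) : bmeas ?M" by (rule measurable_compose[OF p(3)]) measurable
  moreover have "(%q. E (fst q)) : bmeas ?M" by (rule measurable_compose[OF p(1)]) measurable
  moreover have "(%q. exp (\<i> * cor (fst q * (snd (snd q) - fst (snd q))))) : bmeas ?M"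
   by (rule measurable_compose[where g="%x. exp (\<i> * cor x)" and N=borel];
     intro borel_measurable_times borel_measurable_diff p borel_measurable_continuous_onI continuous_intros)
  ultimately show "H : bmeas ?M" unfolding H_def by (intro borel_measurable_times)
 qed (simp add: H_def norm_mult)
 have sq: "cor ((norm (four G x))^2 * exp (?C x)) = (LINT p|?A. H (x, p))" for x
 proof -
  have i: "integrable lborel (?F x)" "integrable lborel (?J x)"
  proof -
   have m[measurable]: "(?F x) : bmeas lborel" by measurable
   show "integrable lborel (?F x)" by (rule integrable_le[OF G m]) (simp add: norm_mult)
   have m2: "(?J x) : bmeas lborel" by measurable
   show "integrable lborel (?J x)" by (rule integrable_le[OF G m2]) (simp add: norm_mult)
  qed
  have c: "cnj (four G x) = (LBINT s. cnj (G s) * exp (- (\<i> * of_real (x * s))))"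
   unfolding four_def by (simp add: exp_cnj flip: Bochner_Integration.integral_cnj)
  have "cor ((norm (four G x))^2) = cnj (four G x) * four G x" by (metis complex_norm_square mult.commute)
  also have "... = (LINT p|?A. (cnj (G (fst p)) * exp (- (\<i> * of_real (x * fst p)))) * (G (snd p) * exp (\<i> * of_real (x * snd p))))"
   using lborel_pair.integral_fst'[OF lborel_pair.int_product[OF i]] unfolding c by (simp add: four_def)
  finally have "cor ((norm (four G x))^2) * E x = (LINT p|?A. E x * (?I p x))" by (simp add: mult.commute)
  also have "... = (LINT p|?A. H (x, p))"
  proof (rule integral_eq[OF refl])
   fix p :: "real \<times> real"
   have "exp (- (\<i> * of_real (x * fst p))) * exp (\<i> * of_real (x * snd p)) = exp (\<i> * cor (x * (snd p - fst p)))"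
    unfolding exp_add[symmetric] by (simp add: algebra_simps)
   note e = this[symmetric]
   show "E x * (?I p x) = H (x, p)" unfolding H_def fst_conv snd_conv e by (simp only: mult_ac)
  qed
  finally show ?thesis by (simp add: E_def)
 qed
 have "integrable lborel (%x. cor ((norm (four G x))^2 * exp (?C x)))" unfolding sq using l3.integrable_fst'[OF Hi] by simp
 then show "integrable lborel (%x. (norm (four G x))^2 * exp (?C x))" by (simp only: complex_of_real_integrable_eq)
 have "cor (LBINT x. (norm (four G x))^2 * exp (?C x)) = (LBINT x. (LINT p|?A. H (x, p)))"
  unfolding sq[symmetric] by (rule integral_complex_of_real[symmetric])
 also have "... = (LINT p|?A. (LBINT x. H (x, p)))" using l3.Fubini_integral[of "%x p. H (x, p)"] Hi by (simp add: case_prod_beta')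
 also have "... = (LBINT s. LBINT t. (LBINT x. H (x, (s, t))))"
  using lborel_pair.integral_fst'[of "%p. LBINT x. H (x, p)"] l3.integrable_snd[of "%x p. H (x, p)"] Hi by (simp add: case_prod_beta')
 also have "... = (LBINT s. cnj (G s) * (?B s))"
 proof (rule integral_eq[OF refl])
  fix s
  have "(LBINT x. H (x, (s, t))) = cnj (G s) * (cor (?D t s) * G t)" for t
  proof -
   have "(LBINT x. H (x, (s, t))) = (LBINT x. (cnj (G s) * G t) * (of_real (exp (?C x)) * exp (\<i> * of_real (x * (t - s)))))"
    unfolding H_def E_def by (simp add: mult_ac)
   also have "... = (cnj (G s) * G t) * (LBINT x. (of_real (exp (?C x)) * exp (\<i> * of_real (x * (t - s)))))" by (rule integral_mult_right_zero)
   finally show ?thesis unfolding gaussian_four[OF e] by (simp only: mult_ac)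
  qed
  then have "(LBINT t. (LBINT x. H (x, (s, t)))) = cnj (G s) * (LBINT t. cor (?D t s) * G t)" by simp
  also have "(LBINT t. cor (?D t s) * G t) = \<bar>a\<bar> *\<^sub>R (LBINT r. cor (?K s r) * G (s + a * r))"
   using e by (intro lborel_integral_real_affine) simp
  also have "... = (LBINT r. a *\<^sub>R (cor (?K s r) * G (s + a * r)))" using e by simp
  also have "... = (?B s)" using e by (intro integral_eq) (auto simp: scaleR_conv_of_real)
  finally show "(LBINT t. (LBINT x. H (x, (s, t)))) = cnj (G s) * (?B s)" .
 qed
 finally show "cor (LBINT x. (norm (four G x))^2 * exp (?C x)) = (LBINT s. cnj (G s) * (?B s))" .
qed

text \<open>The width tends to 0. The regularised integrals increase to the left side, and the
  smoothed functions converge at continuity points of G and stay bounded. Boundedness and continuity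
  almost everywhere hold for all functions to which this is applied. The transform
  \<open>four\<close> is unnormalised, which accounts for 2 pi.\<close>

theorem plancherel: assumes G: "integrable lborel G" and B: "!!t. norm (G t) <= B" and c: "AE t in lborel. isCont G t"
 shows "(nni lborel (%x. ennreal ((norm (four G x))^2))) = ennreal (2 * pi) * (nni lborel (%t. ennreal ((norm (G t))^2)))"
proof -
 let ?E = "LBINT s. cnj (G s) * (of_real (2 * pi) * G s)"
 let ?D = "nni lborel (%x. ennreal ((norm (four G x))^2))"
 let ?C = "%x e n. (norm (four G x))^2 * exp (- ((e n * x)^2) / 2)"
 have [measurable]: "G : bmeas borel" using G by auto
 have B0: "0 <= B" using B[of 0] norm_ge_zero[of "G 0"] by linarith
 define e where "e n = 1 / real (Suc n)" for n
 have e: "e n > 0" for n by (simp add: e_def)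
 have e0: "e ----> 0" unfolding e_def using LIMSEQ_Suc[OF lim_inverse_n] by (simp add: inverse_eq_divide)
 define g where "g r = sqrt (2 * pi) * exp (- (r^2) / 2)" for r :: real
 have g0: "0 <= g r" for r by (simp add: g_def)
 have gi: "integrable lborel g" and gI: "(LBINT r. g r) = 2 * pi"
  unfolding g_def integral_mult_right_zero integral_gaussian using gaussian_integrable[of 1] by (intro integrable_mult_right, simp) simp
 have [measurable]: "g : bmeas borel" using gi by auto
 have bnd: "norm (cor (g r) * G x) <= B * g r" for r x
  using mult_left_mono[OF B[of x] g0[of r]] g0[of r] by (simp add: norm_mult mult.commute)
 define I where "I n s = (LBINT r. of_real (g r) * G (s + e n * r))" for n s
 have Im[measurable]: "I n : bmeas borel" for n
 proof -
  have "(%p. of_real (g (snd p)) * G (fst p + e n * snd p)) : bmeas (borel \<Otimes>\<^sub>M lborel)" by measurable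
  then show ?thesis unfolding I_def
   using lborel.borel_measurable_lebesgue_integral[of "%s r. of_real (g r) * G (s + e n * r)" borel] by (simp add: case_prod_beta')
 qed
 have ii: "integrable lborel (%r. cor (g r) * G (s + e n * r))" for n s
  by (rule integrable_le[OF integrable_mult_right[OF gi, of B]]) (use bnd B0 g0 in \<open>auto simp: abs_mult\<close>)
 have Ib: "norm (I n s) <= B * (2 * pi)" for n s
 proof -
  have "norm (I n s) <= (LBINT r. B * g r)" unfolding I_def by (rule Bochner_Integration.integral_norm_bound_integral[OF ii]) (use gi bnd in auto)
  then show ?thesis using gI by simp
 qed
 have Il: "(%n. I n s) ----> of_real (2 * pi) * G s" if "isCont G s" for s
 proof -
  have "(%n. I n s) ----> (LBINT r. of_real (g r) * G s)" unfolding I_def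
  proof (rule integral_dominated_convergence[where w="%r. B * g r"])
   show "AE r in lborel. (%n. of_real (g r) * G (s + e n * r)) ----> of_real (g r) * G s"
   proof (rule AE_I2)
    fix r
    have "(%n. s + e n * r) ----> s + 0 * r" by (intro tendsto_intros e0)
    then have "(%n. G (s + e n * r)) ----> G s" using isCont_tendsto_compose[OF that] by simp
    then show "(%n. of_real (g r) * G (s + e n * r)) ----> of_real (g r) * G s" by (intro tendsto_intros)
   qed
  qed (use gi bnd in auto)
  also have "(LBINT r. of_real (g r) * G s) = cor (LBINT r. g r) * G s" by (simp flip: integral_complex_of_real)
  finally show ?thesis using gI by simp
 qed
 define A where "A n = (LBINT x. (norm (four G x))^2 * exp (- ((e n * x)^2) / 2))" for n
 have "(%n. LBINT s. cnj (G s) * I n s) ----> ?E"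
 proof (rule integral_dominated_convergence[where w="%s. norm (G s) * (B * (2 * pi))"])
  show "AE s in lborel. (%n. cnj (G s) * I n s) ----> cnj (G s) * (of_real (2 * pi) * G s)"
   using c by eventually_elim (intro tendsto_intros Il)
  show "AE s in lborel. norm (cnj (G s) * I n s) <= norm (G s) * (B * (2 * pi))" for n
   using Ib by (intro AE_I2) (simp add: norm_mult mult_left_mono)
 qed (use G in auto)
 also have "(%n. LBINT s. cnj (G s) * I n s) = (%n. cor (A n))"
  unfolding A_def four_regularized(2)[OF G e] I_def g_def ..
 also have "?E = (LBINT s. cor (2 * pi * (norm (G s))^2))"
  by (intro integral_eq) (auto simp: complex_norm_square mult_ac simp del: of_real_power)
 also have "... = cor (2 * pi * (LBINT s. (norm (G s))^2))" by (subst integral_complex_of_real) simp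
 finally have lim: "A ----> 2 * pi * (LBINT s. (norm (G s))^2)" by (simp only: tendsto_of_real_iff)
 have [measurable]: "four G : bmeas borel" by (rule measurable_four) simp
 have "(%n. nni lborel (%x. ennreal (?C x e n))) ----> ?D"
 proof (rule nn_integral_LIMSEQ)
  show "incseq (%n x. ennreal (?C x e n))"
  proof (rule incseq_SucI, rule le_funI)
   fix n x
   have "(e (Suc n) * x)^2 <= (e n * x)^2" unfolding power_mult_distrib by (intro mult_right_mono power_mono) (auto simp: e_def field_simps)
   then show "ennreal (?C x e n) <= ennreal ((norm (four G x))^2 * exp (- ((e (Suc n) * x)^2) / 2))" by (intro ennreal_leI mult_left_mono) auto
  qed
  fix x
  have "(%n. (norm (four G x))^2 * exp (- ((e n * x)^2) / 2)) ----> (norm (four G x))^2 * exp (- ((0 * x)^2) / 2)"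
   by (intro tendsto_intros e0) auto
  then show "(%n. ennreal (?C x e n)) ----> ennreal ((norm (four G x))^2)" by (intro tendsto_ennrealI) simp
 qed simp
 also have "(%n. nni lborel (%x. ennreal (?C x e n))) = (%n. ennreal (A n))"
  unfolding A_def by (intro ext nn_integral_eq_integral four_regularized(1)[OF G e]) auto
 finally have "?D = ennreal (2 * pi * (LBINT s. (norm (G s))^2))" using tendsto_ennrealI[OF lim] LIMSEQ_unique by blast
 also have "... = ennreal (2 * pi) * ennreal (LBINT s. (norm (G s))^2)" by (intro ennreal_mult) auto
 also have "ennreal (LBINT s. (norm (G s))^2) = (nni lborel (%t. ennreal ((norm (G t))^2)))"
 proof (rule nn_integral_eq_integral[symmetric])
  show "integrable lborel (%t. (norm (G t))^2)"
  proof (rule integrable_le)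
   show "integrable lborel (%t. B * norm (G t))" using G by simp
   show "AE t in lborel. norm ((norm (G t))^2) <= norm (B * norm (G t))" using B B0 by (intro AE_I2) (simp add: power2_eq_square mult_right_mono)
  qed simp
 qed simp
 finally show ?thesis .
qed

text \<open>An isometry preserves norms; polarization turns this into the inner products that
  express orthonormality.\<close>

lemma has_bochner_integral_polarization:
 fixes f g :: "'a => complex" assumes [measurable]: "f : bmeas M" "g : bmeas M"
  and N: "!!c. c : {1, -1, \<i>, -\<i>} ==> (nni M (%z. ennreal ((norm (f z + c * g z))^2))) = ennreal (N c)"
  and N0: "!!c. 0 <= N c"
 shows "hbi M (%z. f z * cnj (g z)) ((of_real (N 1) - of_real (N (-1)) + \<i> * of_real (N \<i>) - \<i> * of_real (N (-\<i>))) / 4)"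
proof -
 have h: "hbi M (%z. cor ((norm (f z + c * g z))^2)) (of_real (N c))" if "c : {1, -1, \<i>, -\<i>}" for c
  by (rule has_bochner_integral_of_real, rule has_bochner_integral_nn_integral[OF _ _ N0 N[OF that]]) auto
 have "hbi M (%z. (cor ((norm (f z + 1 * g z))^2) - cor ((norm (f z + -1 * g z))^2)
   + \<i> * cor ((norm (f z + \<i> * g z))^2) - \<i> * cor ((norm (f z + -\<i> * g z))^2)) / 4)
  ((of_real (N 1) - of_real (N (-1)) + \<i> * of_real (N \<i>) - \<i> * of_real (N (-\<i>))) / 4)"
  by (intro has_bochner_integral_divide_zero has_bochner_integral_diff has_bochner_integral_add hbi_mult h) auto
 moreover have "(cor ((norm (a + 1 * b))^2) - cor ((norm (a + -1 * b))^2)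
   + \<i> * cor ((norm (a + \<i> * b))^2) - \<i> * cor ((norm (a + -\<i> * b))^2)) / 4 = a * cnj b" for a b
  unfolding cmod_power2 by (simp add: complex_eq_iff power2_eq_square field_simps)
 ultimately show ?thesis by simp
qed

lemma norm_four_le: assumes "integrable lborel p" shows "norm (four p x) <= (LBINT t. norm (p t))" unfolding four_def
 using integral_norm_bound[of lborel "%t. p t * exp (\<i> * of_real (x * t))"] by (simp add: norm_mult)

lemma continuous_four: assumes p: "integrable lborel p" shows "isCont (four p) x" unfolding continuous_at_sequentially
proof (intro allI impI)
 fix s :: "nat => real" assume s: "s ----> x"
 have [measurable]: "p : bmeas borel" using p by auto
 show "(four p \<circ> s) ----> four p x" unfolding four_def o_def
 proof (rule integral_dominated_convergence[where w="%t. norm (p t)"])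
  show "AE t in lborel. (%n. p t * exp (\<i> * of_real (s n * t))) ----> p t * exp (\<i> * of_real (x * t))"
   by (intro AE_I2 tendsto_intros s)
 qed (use p in \<open>auto simp: norm_mult\<close>)
qed

lemma nn_integral_gaussian_shift:
 fixes m :: real shows "(nni lborel (%y. ennreal (exp (- ((y + m)^2))))) = ennreal (sqrt pi)"
proof -
 have h: "hbi lborel (%y. exp (- ((y + m)^2))) (sqrt pi)" using hbi_gauss[of 1 "- m"] by simp
 then have "(nni lborel (%y. ennreal (exp (- ((y + m)^2))))) = ennreal (LBINT y. exp (- ((y + m)^2)))"
  by (intro nn_integral_eq_integral) (auto simp: hbi_iff)
 then show ?thesis using h by (simp add: hbi_iff)
qed

section \<open>Approximation by projections of finite rank\<close>

text \<open>The integral operator that superposes shifted amplitudes. On the half-line of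
  nonnegative l, \<open>gramk\<close> is \<open>kconst\<close> times this operator composed with its
  adjoint.\<close>

definition supp :: "real => (real => complex) => plane => complex" where
 "supp s p z = (LBINT l. p l * ampl s (fst z + l) (- snd z))"

text \<open>For s > 0 the contour can be lowered to the real line, where the amplitude is an
  ordinary Fourier transform in x.\<close>

lemma ampl_four: assumes "s > 0" shows "ampl s x y = four (%t. wave s 0 y (of_real t)) x"
proof -
 have "ampl s x y = ampl_at 0 s x y" using assms by (intro ampl_eq) auto
 also have "... = four (%t. wave s 0 y (of_real t)) x" unfolding ampl_at_def four_def line_def
  using wave_shift[of s 0 y _ x] by (simp add: mult.assoc)
 finally show ?thesis .
qed

lemma norm_wave_0: "norm (wave s 0 y (of_real t)) = exp (- ((s * t - y)^2) / 2)" using norm_wave[of s 0 y 0 t] by (simp add: line_def)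

lemma integrable_wave_0: "s > 0 ==> integrable lborel (%t. wave s 0 y (of_real t))"
 using integrable_wave[of s 0 0 y] by (simp add: line_def)

lemma continuous_wave_0: "isCont (%t. wave s 0 y (of_real t)) t" unfolding wave_def by (intro continuous_intros)

lemma norm_ampl_le: assumes "s > 0" shows "norm (ampl s x y) <= sqrt (2 * pi) / s"
proof -
 have "sqrt (pi / (0 + s^2 / 2)) = sqrt (2 * pi) / s" using assms by (simp add: real_sqrt_divide real_sqrt_mult mult.commute)
 then show ?thesis using ampl_bound[of 0 s x y] assms by simp
qed

lemma supp_integrable: assumes "s > 0" "integrable lborel p" shows "integrable lborel (%l. p l * ampl s (a + l) b)"
proof (rule integrable_le)
 show "integrable lborel (%l. norm (p l) * (sqrt (2 * pi) / s))" using assms by simp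
 have [measurable]: "p : bmeas borel" using assms by auto
 show "(%l. p l * ampl s (a + l) b) : bmeas lborel" by measurable
 show "AE l in lborel. norm (p l * ampl s (a + l) b) <= norm (norm (p l) * (sqrt (2 * pi) / s))"
 proof (rule AE_I2)
  fix l
  have "norm (p l) * norm (ampl s (a + l) b) <= norm (p l) * (sqrt (2 * pi) / s)" by (intro mult_left_mono norm_ampl_le assms(1)) simp
  then show "norm (p l * ampl s (a + l) b) <= norm (norm (p l) * (sqrt (2 * pi) / s))" using assms(1) by (simp add: norm_mult abs_mult)
 qed
qed

lemma supp_four: assumes s: "s > 0" and a: "integrable lborel a"
 shows "supp s a z = four (%t. wave s 0 (- snd z) (of_real t) * four a t) (fst z)"
proof -
 let ?A = "%t. \<i> * of_real (fst z * t)"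
 define g where "g t = wave s 0 (- snd z) (of_real t)" for t
 have gi: "integrable lborel g" unfolding g_def by (rule integrable_wave_0[OF s])
 have [measurable]: "g : bmeas borel" "a : bmeas borel" using gi a by auto
 define H where "H l t = a l * (g t * exp (\<i> * of_real ((fst z + l) * t)))" for l t
 have mH: "(%p. H (fst p) (snd p)) : bmeas (lborel \<Otimes>\<^sub>M lborel)"
 proof -
  have [measurable]: "(%p. exp (\<i> * cor ((fst z + fst p) * snd p))) : bmeas (borel \<Otimes>\<^sub>M borel)"
   unfolding borel_prod by (intro borel_measurable_continuous_onI continuous_intros)
  show ?thesis unfolding H_def by measurable
 qed
 have Hi: "integrable (lborel \<Otimes>\<^sub>M lborel) (%p. H (fst p) (snd p))"
  by (rule integrable_le[OF lborel_pair.int_product[OF a gi] mH]) (simp add: H_def norm_mult)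
 have "supp s a z = (LBINT l. LBINT t. H l t)" unfolding supp_def ampl_four[OF s] four_def H_def g_def by simp
 also have "... = (LBINT t. LBINT l. H l t)" using lborel_pair.Fubini_integral[of H] Hi by (simp add: case_prod_beta')
 also have "... = (LBINT t. (g t * four a t) * exp (?A t))"
 proof (rule integral_eq[OF refl])
  fix t
  have "H l t = (g t * exp (?A t)) * (a l * exp (\<i> * of_real (t * l)))" for l
  proof -
   have "exp (\<i> * cor ((fst z + l) * t)) = exp (?A t) * exp (\<i> * of_real (t * l))"
    unfolding exp_add[symmetric] by (simp add: algebra_simps)
   then show ?thesis unfolding H_def by (simp only: mult_ac)
  qed
  then have "(LBINT l. H l t) = (g t * exp (?A t)) * four a t" unfolding four_def by (simp only: integral_mult_right_zero)
  then show "(LBINT l. H l t) = (g t * four a t) * exp (?A t)" by (simp only: mult_ac)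
 qed
 finally show ?thesis unfolding four_def[of "%t. wave s 0 (- snd z) (of_real t) * four a t"] g_def .
qed

lemma measurable_supp [measurable]: assumes [measurable]: "p : bmeas borel" shows "supp s p : bmeas borel"
proof -
 have [measurable]: "fst : bmeas (borel :: plane measure)" "snd : bmeas (borel :: plane measure)"
  by (auto simp: borel_prod[symmetric])
 have "(%z. \<integral>l. p l * ampl s (fst z + l) (- snd z) \<partial>lborel) : bmeas (borel :: plane measure)"
  by (rule lborel.borel_measurable_lebesgue_integral) measurable
 then show ?thesis by (simp add: supp_def[abs_def])
qed

text \<open>For a fixed second coordinate y the image is the Fourier transform of a Gaussian wave
  times the transform of a, so Plancherel removes the first coordinate. The squared modulus of the
  wave is a Gaussian in y of mass sqrt pi for every frequency, and a second use of Plancherel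
  returns to a. The product 2 pi times sqrt pi times 2 pi is 4 pi^(5/2), which explains the constant
  in the kernel.\<close>

theorem supp_isometry: assumes s: "s > 0" and a: "integrable lborel a" "!!l. norm (a l) <= B" "AE l in lborel. isCont a l"
 shows "(nni lborel (%z. ennreal ((norm (supp s a z))^2))) = ennreal (1 / kconst) * (nni lborel (%l. ennreal ((norm (a l))^2)))"
proof -
 let ?H = "%g y. %t. g y t * four a t"
 let ?G = "%y t. exp (- ((y + s * t)^2))"
 let ?F = "nni lborel (%l. ennreal ((norm (a l))^2))"
 let ?E = "nni lborel (%z. ennreal ((norm (supp s a z))^2))"
 let ?D = "%t. (norm (four a t))^2"
 let ?A = "nni lborel (%y. nni lborel (%t. ennreal (?G y t) * ennreal (?D t)))"
 have [measurable]: "a : bmeas borel" using a by auto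
 have fm[measurable]: "four a : bmeas borel" by (rule measurable_four) simp
 define g where "g y t = wave s 0 (- y) (of_real t)" for y t
 have ng: "norm (g y t) = exp (- ((y + s * t)^2) / 2)" for y t unfolding g_def norm_wave_0 by (simp add: add.commute)
 have gi: "integrable lborel (g y)" for y unfolding g_def by (rule integrable_wave_0[OF s])
 have [measurable]: "g y : bmeas borel" for y using gi by auto
 define C where "C = (LBINT t. norm (a t))"
 have C: "norm (four a t) <= C" for t unfolding C_def by (rule norm_four_le[OF a(1)])
 have C0: "0 <= C" unfolding C_def by simp
 have pl: "(nni lborel (%x. ennreal ((norm (four (?H g y) x))^2))) = ennreal (2 * pi) * (nni lborel (%t. ennreal ((norm (g y t * four a t))^2)))" for y
 proof (rule plancherel)
  show "integrable lborel (?H g y)"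
  proof (rule integrable_le)
   show "integrable lborel (%t. norm (g y t) * C)" using gi by simp
   show "AE t in lborel. norm (g y t * four a t) <= norm (norm (g y t) * C)"
    using C C0 by (intro AE_I2) (auto simp: norm_mult abs_mult intro!: mult_left_mono)
  qed measurable
  show "norm (g y t * four a t) <= 1 * C" for t unfolding norm_mult using C by (intro mult_mono) (auto simp: ng)
  show "AE t in lborel. isCont (?H g y) t" unfolding g_def by (intro AE_I2 continuous_intros continuous_wave_0 continuous_four a)
 qed
 have ms: "(%p. ennreal ((norm (supp s a p))^2)) : bmeas (lborel \<Otimes>\<^sub>M lborel)"
  using measurable_supp[of a s] by (simp add: lborel_prod)
 have "?E = (nni lborel (%y. nni lborel (%x. ennreal ((norm (supp s a (x, y)))^2))))"
  using lborel_pair.nn_integral_snd[of "%p. ennreal ((norm (supp s a p))^2)"] ms by (simp add: lborel_prod case_prod_beta')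
 also have "... = (nni lborel (%y. ennreal (2 * pi) * (nni lborel (%t. ennreal (?G y t) * ennreal (?D t)))))"
 proof (rule nn_integral_cong)
  fix y
  have "(norm (g y t * four a t))^2 = exp (- ((y + s * t)^2)) * (norm (four a t))^2" for t
   unfolding norm_mult power_mult_distrib ng by (simp flip: exp_of_nat_mult)
  then show "(nni lborel (%x. ennreal ((norm (supp s a (x, y)))^2))) = ennreal (2 * pi) * (nni lborel (%t. ennreal (?G y t) * ennreal (?D t)))"
   using pl[of y] unfolding supp_four[OF s a(1)] fst_conv snd_conv g_def[symmetric] by (simp add: ennreal_mult)
 qed
 also have "... = ennreal (2 * pi) * ?A" by (rule nn_integral_cmult) measurable
 also have "?A = (nni lborel (%t. nni lborel (%y. ennreal (?G y t) * ennreal (?D t))))" by (rule lborel_pair.Fubini') measurable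
 also have "... = (nni lborel (%t. ennreal (sqrt pi) * ennreal (?D t)))"
  by (intro nn_integral_cong, subst nn_integral_multc) (simp_all add: nn_integral_gaussian_shift)
 also have "... = ennreal (sqrt pi) * (nni lborel (%t. ennreal (?D t)))" by (rule nn_integral_cmult) measurable
 also have "... = ennreal (sqrt pi) * (ennreal (2 * pi) * ?F)" by (subst plancherel[OF a]) (rule refl)
 finally have "?E = (ennreal (2 * pi) * (ennreal (sqrt pi) * ennreal (2 * pi))) * ?F" by (simp only: mult.assoc)
 also have "ennreal (2 * pi) * (ennreal (sqrt pi) * ennreal (2 * pi)) = ennreal (1 / kconst)"
 proof -
  have "pi powr (5/2) = pi powr 2 * pi powr (1/2)" unfolding powr_add[symmetric] by simp
  then have "1 / kconst = 2 * pi * (sqrt pi * (2 * pi))" by (simp add: kconst_def powr_half_sqrt power2_eq_square)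
  then show ?thesis by (simp only: ennreal_mult mult_nonneg_nonneg pi_ge_zero real_sqrt_ge_zero zero_le_numeral)
 qed
 finally show ?thesis .
qed

definition cell :: "nat => nat => real set" where
 "cell N j = {real j / real N..<(real j + 1) / real N}"

lemma cell_borel [measurable]: "cell N j : sets borel" by (simp add: cell_def)

lemma mem_cell: "N > 0 ==> l : cell N j \<longleftrightarrow> 0 <= l & j = nat \<lfloor>real N * l\<rfloor>"
proof -
 assume N: "N > 0"
 have "l : cell N j \<longleftrightarrow> real j <= real N * l & real N * l < real j + 1" using N by (auto simp: cell_def field_simps)
 also have "... \<longleftrightarrow> \<lfloor>real N * l\<rfloor> = int j" by (auto simp: floor_eq_iff)
 also have "... \<longleftrightarrow> 0 <= \<lfloor>real N * l\<rfloor> & j = nat \<lfloor>real N * l\<rfloor>" by presburger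
 also have "0 <= \<lfloor>real N * l\<rfloor> \<longleftrightarrow> 0 <= l" using N by (simp add: zero_le_mult_iff)
 finally show ?thesis .
qed

lemma cell_disjoint: "N > 0 ==> l : cell N j ==> l : cell N k ==> j = k" by (simp add: mem_cell)

lemma has_integral_cell: assumes "N > 0" shows "hbi lborel (ind (cell N j) :: real => real) (1 / real N)"
proof -
 have "(real j + 1) / real N - real j / real N = 1 / real N" using assms by (simp add: field_simps)
 moreover have "real j / real N <= (real j + 1) / real N" by (simp add: divide_right_mono)
 ultimately have "emeasure lborel (cell N j) = ennreal (1 / real N)" by (simp add: cell_def)
 then show ?thesis using has_bochner_integral_real_indicator[of "cell N j" lborel] by (simp add: measure_def)
qed

definition smode :: "nat => nat => real => complex" where
 "smode N j l = of_real (sqrt (real N) * ind (cell N j) l)"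

lemma integrable_smode: "N > 0 ==> integrable lborel (smode N j)"
 unfolding smode_def[abs_def] using has_integral_cell[of N j]
 by (intro integrable_of_real integrable_mult_right) (auto simp: hbi_iff)

lemma isCont_smode: "AE l in lborel. isCont (smode N j) l"
proof -
 define a b where "a = real j / real N" and "b = (real j + 1) / real N"
 have "{a, b} : null_sets lborel" by (intro countable_imp_null_set_lborel) simp
 then have "AE l in lborel. l ~: {a, b}" by (rule AE_not_in)
 then show ?thesis
 proof eventually_elim
  case (elim l)
  have "closure (cell N j) \<subseteq> {a..b}" by (rule closure_minimal) (auto simp: cell_def a_def b_def)
  moreover have "{a<..<b} \<subseteq> interior (cell N j)" by (rule interior_maximal) (auto simp: cell_def a_def b_def)
  ultimately have "l ~: frontier (cell N j)" using elim by (force simp: frontier_def)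
  then have "isCont (ind (cell N j) :: real => real) l" by (simp add: isCont_indicator)
  then show ?case unfolding smode_def[abs_def] by (intro continuous_intros)
 qed
qed

lemma norm_smode_le: "norm (smode N j l) <= sqrt (real N)" by (simp add: smode_def norm_mult indicator_def)

lemma nn_integral_smode: assumes N: "N > 0" and c: "norm c = 1"
 shows "(nni lborel (%l. ennreal ((norm (smode N j l + c * smode N k l))^2))) = ennreal (if j = k then (norm (1 + c))^2 else 2)"
proof -
 let ?A = "%l. norm (smode N j l + c * smode N k l)"
 have hb: "hbi lborel (%l. (?A l)^2) (if j = k then (norm (1 + c))^2 else 2)"
 proof (cases "j = k")
  case True
  have "(?A l)^2 = (norm (1 + c))^2 * real N * ind (cell N j) l" for l
  proof -
   have "smode N j l + c * smode N k l = (1 + c) * smode N j l" using True by (simp add: algebra_simps)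
   then show ?thesis by (simp add: norm_mult power_mult_distrib smode_def indicator_def)
  qed
  then show ?thesis using hbi_mult[OF has_integral_cell[OF N, of j], of "(norm (1 + c))^2 * real N"] N True by simp
 next
  case False
  have "(?A l)^2 = real N * ind (cell N j) l + real N * ind (cell N k) l" for l
   using cell_disjoint[OF N, of l j k] False c by (auto simp: smode_def indicator_def norm_mult)
  then show ?thesis
   using has_bochner_integral_add[OF hbi_mult[OF has_integral_cell[OF N, of j], of "real N"] hbi_mult[OF has_integral_cell[OF N, of k], of "real N"]] N False
   by simp
 qed
 then have "(nni lborel (%l. ennreal ((?A l)^2))) = ennreal (LBINT l. (?A l)^2)"
  by (intro nn_integral_eq_integral) (auto simp: hbi_iff)
 then show ?thesis using hb by (simp add: hbi_iff)
qed

definition mode :: "real => nat => nat => plane => complex" where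
 "mode s N j z = of_real (sqrt kconst) * supp s (smode N j) z"

text \<open>The N * N cells of length 1/N cover the interval from 0 to N, so with growing N the mesh
  shrinks and the whole half-line is exhausted at once.\<close>

definition mkern :: "real => nat => kernel" where
 "mkern s N z w = (SUM j<N * N. mode s N j z * cnj (mode s N j w))"

lemma measurable_smode [measurable]: "smode N j : bmeas borel" unfolding smode_def[abs_def] by measurable

lemma measurable_mode [measurable]: "mode s N j : bmeas borel" unfolding mode_def[abs_def] by measurable

text \<open>Normalised indicators of disjoint cells are orthonormal and \<open>sqrt kconst\<close>
  times \<open>supp\<close> is isometric. The squared norms entering the polarization are 4, 0, 2, 2
  for equal indices and 2 throughout for different ones.\<close>

lemma modes_orthonormal: assumes s: "s > 0" and N: "N > 0"
 shows "hbi lborel (%z. mode s N j z * cnj (mode s N k z)) (if j = k then 1 else 0)"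
proof -
 let ?B = "%n. of_real (n 1) - of_real (n (-1)) + \<i> * of_real (n \<i>) - \<i> * of_real (n (-\<i>))"
 let ?A = "%c. nni lborel (%z. ennreal ((norm (mode s N j z + c * mode s N k z))^2))"
 define n where "n c = (if j = k then (norm (1 + c))^2 else 2 :: real)" for c :: complex
 have "hbi lborel (%z. mode s N j z * cnj (mode s N k z)) ((?B n) / 4)"
 proof (rule has_bochner_integral_polarization)
  show "mode s N j : bmeas lborel" "mode s N k : bmeas lborel" by simp_all
  show "0 <= n c" for c by (simp add: n_def)
  fix c :: complex assume "c : {1, -1, \<i>, -\<i>}"
  then have c: "norm c = 1" by auto
  define p where "p l = smode N j l + c * smode N k l" for l
  have pi: "integrable lborel p" unfolding p_def using N by (intro Bochner_Integration.integrable_add integrable_mult_right integrable_smode)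
  have pb: "norm (p l) <= 2 * sqrt (real N)" for l
   using norm_triangle_ineq[of "smode N j l" "c * smode N k l"] norm_smode_le[of N j l] norm_smode_le[of N k l] c
   by (simp add: p_def norm_mult)
  have pc: "AE l in lborel. isCont p l" using isCont_smode[of N j] isCont_smode[of N k] unfolding p_def
   by eventually_elim (intro continuous_intros)
  have lin: "supp s p z = supp s (smode N j) z + c * supp s (smode N k) z" for z
  proof -
   have "supp s p z = (LBINT l. smode N j l * ampl s (fst z + l) (- snd z) + c * (smode N k l * ampl s (fst z + l) (- snd z)))"
    unfolding supp_def p_def by (simp add: algebra_simps)
   also have "... = supp s (smode N j) z + c * supp s (smode N k) z" unfolding supp_def
    using supp_integrable[OF s integrable_smode[OF N, of j], of "fst z" "- snd z"]
     supp_integrable[OF s integrable_smode[OF N, of k], of "fst z" "- snd z"] by simp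
   finally show ?thesis .
  qed
  have "(norm (mode s N j z + c * mode s N k z))^2 = kconst * (norm (supp s p z))^2" for z
  proof -
   have "mode s N j z + c * mode s N k z = of_real (sqrt kconst) * supp s p z" unfolding mode_def lin by (simp add: algebra_simps)
   then show ?thesis using kconst_pos by (simp add: norm_mult power_mult_distrib)
  qed
  then have "(?A c) = (nni lborel (%z. ennreal kconst * ennreal ((norm (supp s p z))^2)))"
   using kconst_pos by (simp add: ennreal_mult)
  also have "... = ennreal kconst * (nni lborel (%z. ennreal ((norm (supp s p z))^2)))"
   using measurable_supp[of p s] pi by (intro nn_integral_cmult) auto
  also have "... = ennreal kconst * (ennreal (1 / kconst) * (nni lborel (%l. ennreal ((norm (p l))^2))))"
   by (simp only: supp_isometry[OF s pi pb pc])
  also have "... = (nni lborel (%l. ennreal ((norm (p l))^2)))"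
   using kconst_pos by (simp add: mult.assoc[symmetric] ennreal_mult[symmetric])
  also have "... = ennreal (n c)" unfolding p_def n_def by (rule nn_integral_smode[OF N c])
  finally show "(?A c) = ennreal (n c)" .
 qed
 also have "(?B n) / 4 = (if j = k then 1 else 0 :: complex)" by (simp add: n_def cmod_power2)
 finally show ?thesis .
qed

lemma psd_mkern: "psd_kernel (mkern s N)" unfolding psd_kernel_def
proof (intro conjI allI)
 show "mkern s N b a = cnj (mkern s N a b)" for a b by (simp add: mkern_def mult.commute)
 fix n :: nat and x :: "nat => plane" and c :: "nat => complex"
 define F where "F k = (SUM i<n. cnj (c i) * mode s N k (x i))" for k
 have "(SUM i<n. SUM j<n. cnj (c i) * c j * mkern s N (x i) (x j)) =
  (SUM i<n. SUM j<n. SUM k<N * N. (cnj (c i) * mode s N k (x i)) * cnj (cnj (c j) * mode s N k (x j)))"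
  unfolding mkern_def sum_distrib_left by (simp add: mult_ac)
 also have "... = (SUM i<n. SUM k<N * N. SUM j<n. (cnj (c i) * mode s N k (x i)) * cnj (cnj (c j) * mode s N k (x j)))"
  by (intro sum.cong refl sum.swap)
 also have "... = (SUM k<N * N. SUM i<n. SUM j<n. (cnj (c i) * mode s N k (x i)) * cnj (cnj (c j) * mode s N k (x j)))" by (rule sum.swap)
 also have "... = (SUM k<N * N. F k * cnj (F k))" unfolding F_def cnj_sum sum_product ..
 also have "Re ... = (SUM k<N * N. (norm (F k))^2)" by (simp add: complex_mult_cnj cmod_power2)
 finally show "0 <= Re (SUM i<n. SUM j<n. cnj (c i) * c j * mkern s N (x i) (x j))" by (simp add: sum_nonneg)
qed

lemma measurable_mkern: "(%(a, b). mkern s N a b) : bmeas (borel \<Otimes>\<^sub>M borel)"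
 unfolding mkern_def by measurable

lemma mkern_reproducing: assumes "s > 0" "N > 0"
 shows "hbi lborel (%z. mkern s N a z * mkern s N z b) (mkern s N a b)"
proof -
 let ?A = "%j k. mode s N j a * cnj (mode s N k b)"
 have "hbi lborel (%z. SUM j<N * N. SUM k<N * N. (?A j k) * (mode s N k z * cnj (mode s N j z)))
  (SUM j<N * N. SUM k<N * N. (?A j k) * (if k = j then 1 else 0))"
  by (intro has_bochner_integral_sum hbi_mult modes_orthonormal assms)
 also have "(SUM j<N * N. SUM k<N * N. (?A j k) * (if k = j then 1 else 0)) = mkern s N a b" unfolding mkern_def
 proof (rule sum.cong[OF refl])
  fix j assume "j : {..<N * N}"
  then show "(SUM k<N * N. (?A j k) * (if k = j then 1 else 0)) = mode s N j a * cnj (mode s N j b)"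
   using sum.delta[of "{..<N * N}" j "%k. mode s N j a * cnj (mode s N k b)"] by (simp add: if_distrib cong: if_cong)
 qed
 also have "(%z. SUM j<N * N. SUM k<N * N. (?A j k) * (mode s N k z * cnj (mode s N j z))) = (%z. mkern s N a z * mkern s N z b)"
  unfolding mkern_def sum_product by (simp add: mult_ac)
 finally show ?thesis .
qed

lemma mkern_trace: assumes "s > 0" "N > 0" shows "hbi lborel (%z. mkern s N z z) (of_nat (N * N))"
proof -
 have "hbi lborel (%z. SUM j<N * N. mode s N j z * cnj (mode s N j z)) (SUM j<N * N. (if j = j then 1 else 0))"
  by (intro has_bochner_integral_sum modes_orthonormal assms)
 then show ?thesis unfolding mkern_def by simp
qed

definition cmean :: "real => nat => nat => real => real => complex" where
 "cmean s N j x y = of_nat N * (LBINT l. ind (cell N j) l *\<^sub>R ampl s (x + l) y)"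

lemma cmean_close: assumes s: "s > 0" and N: "N > 0" and e: "!!l. l : cell N j ==> norm (ampl s (x + l) y - c) <= e"
 shows "norm (cmean s N j x y - c) <= e"
proof -
 let ?I = "ind (cell N j) :: real => real"
 have I: "integrable lborel ?I" "(LBINT l. ?I l) = 1 / real N" using has_integral_cell[OF N, of j] by (auto simp: hbi_iff)
 have Ic: "integrable lborel (%l. cor (?I l))" using I by simp
 have i1: "integrable lborel (%l. ?I l *\<^sub>R ampl s (x + l) y)"
  using supp_integrable[OF s Ic, of x y] by (simp add: scaleR_conv_of_real)
 have i2: "integrable lborel (%l. ?I l *\<^sub>R c)" using I by simp
 have "cmean s N j x y - c = of_nat N * (LBINT l. ?I l *\<^sub>R ampl s (x + l) y - ?I l *\<^sub>R c)"
  unfolding cmean_def Bochner_Integration.integral_diff[OF i1 i2] using N I by (simp add: algebra_simps scaleR_conv_of_real)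
 also have "norm ... = real N * norm (LBINT l. ?I l *\<^sub>R ampl s (x + l) y - ?I l *\<^sub>R c)" by (simp add: norm_mult)
 also have "norm (LBINT l. ?I l *\<^sub>R ampl s (x + l) y - ?I l *\<^sub>R c) <= (LBINT l. e * ?I l)"
 proof (rule Bochner_Integration.integral_norm_bound_integral)
  show "integrable lborel (%l. ?I l *\<^sub>R ampl s (x + l) y - ?I l *\<^sub>R c)" using i1 i2 by simp
  show "integrable lborel (%l. e * ?I l)" using I by simp
  show "norm (?I l *\<^sub>R ampl s (x + l) y - ?I l *\<^sub>R c) <= e * ?I l" for l using e[of l] by (simp add: indicator_def)
 qed
 also have "(LBINT l. e * ?I l) = e / real N" using I by simp
 finally show ?thesis using N by (simp add: field_simps)
qed

text \<open>Cells have length at most 1, so replacing a point of the cell by any other costs at most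
  a factor e in the exponential bound.\<close>

lemma cmean_le: assumes s: "s > 0" and N: "N > 0" and l: "l : cell N j"
 shows "norm (cmean s N j x y) <= ampc 1 s * exp 1 * exp (- (x + l))"
proof -
 have "norm (cmean s N j x y - 0) <= ampc 1 s * exp 1 * exp (- (x + l))"
 proof (rule cmean_close[OF s N])
  fix m assume m: "m : cell N j"
  have "l - m <= (real j + 1) / real N - real j / real N" using l m by (simp add: cell_def)
  also have "... = 1 / real N" using N by (simp add: field_simps)
  also have "... <= 1" using N by simp
  finally have "exp (- (x + m)) <= exp 1 * exp (- (x + l))" unfolding exp_add[symmetric] by simp
  then have "ampc 1 s * exp (- (x + m)) <= ampc 1 s * (exp 1 * exp (- (x + l)))" by (intro mult_left_mono) (auto simp: ampc_nonneg)
  moreover have "norm (ampl s (x + m) y) <= ampc 1 s * exp (- (x + m))" using ampl_le_decay[of 1 s "x + m" y] by simp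
  ultimately show "norm (ampl s (x + m) y - 0) <= ampc 1 s * exp 1 * exp (- (x + l))" unfolding diff_0_right mult.assoc by linarith
 qed
 then show ?thesis by simp
qed

lemma cmean_tendsto: assumes s: "s > 0" and l: "l >= 0"
 shows "(%n. cmean s (Suc n) (nat \<lfloor>real (Suc n) * l\<rfloor>) x y) ----> ampl s (x + l) y"
proof (rule LIMSEQ_I)
 let ?A = "%m. ampl s (x + m) y - ampl s (x + l) y"
 fix r :: real assume r: "r > 0"
 have "isCont (%m. ampl s (x + m) y) l" unfolding ampl_four[OF s]
  by (intro isCont_o2[OF _ continuous_four] integrable_wave_0 s continuous_intros)
 then obtain d where d: "d > 0" "!!m. \<bar>m - l\<bar> < d ==> norm (?A m) < r / 2"
  using r unfolding continuous_at_eps_delta by (metis dist_norm half_gt_zero real_norm_def)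
 obtain n0 where n0: "1 / real (Suc n0) < d" using nat_approx_posE[OF d(1)] by (metis of_nat_Suc)
 show "EX no. ALL n>=no. norm (cmean s (Suc n) (nat \<lfloor>real (Suc n) * l\<rfloor>) x y - ampl s (x + l) y) < r"
 proof (intro exI allI impI)
  fix n assume n: "n >= n0"
  let ?j = "nat \<lfloor>real (Suc n) * l\<rfloor>"
  have lc: "l : cell (Suc n) ?j" using l by (subst mem_cell) simp_all
  have "norm (cmean s (Suc n) ?j x y - ampl s (x + l) y) <= r / 2"
  proof (rule cmean_close[OF s])
   fix m assume m: "m : cell (Suc n) ?j"
   have "\<bar>m - l\<bar> <= (real ?j + 1) / real (Suc n) - real ?j / real (Suc n)" using lc m by (auto simp: cell_def)
   also have "... = 1 / real (Suc n)" unfolding diff_divide_distrib[symmetric] by simp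
   also have "... <= 1 / real (Suc n0)" using n by (intro divide_left_mono) auto
   finally show "norm (?A m) <= r / 2" using d(2)[of m] n0 by simp
  qed simp
  then show "norm (cmean s (Suc n) ?j x y - ampl s (x + l) y) < r" using r by linarith
 qed
qed

definition stepd :: "real => nat => plane => plane => real => complex" where
 "stepd s N z w l = (SUM j<N * N. ind (cell N j) l *\<^sub>R (cmean s N j (fst z) (- snd z) * cnj (cmean s N j (fst w) (- snd w))))"

text \<open>The projection kernel arises from the Gram integral by replacing both amplitudes by
  their means over the cells. Its convergence is thus a matter of dominated convergence for step
  functions.\<close>

lemma mkern_stepd: assumes N: "N > 0" shows "mkern s N z w = of_real kconst * (LBINT l. stepd s N z w l)"
proof -
 let ?B = "sqrt kconst / sqrt (real N)"
 let ?A = "%j z. cmean s N j (fst z) (- snd z) * cnj (cmean s N j (fst w) (- snd w))"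
 have m: "mode s N j z = of_real ?B * cmean s N j (fst z) (- snd z)" for j z
 proof -
  have 1: "supp s (smode N j) z = of_real (sqrt (real N)) * (LBINT l. ind (cell N j) l *\<^sub>R ampl s (fst z + l) (- snd z))"
   unfolding supp_def smode_def integral_mult_right_zero[symmetric] by (simp add: scaleR_conv_of_real mult_ac)
  have 2: "cor (sqrt (real N)) = of_real (1 / sqrt (real N)) * of_nat N"
  proof -
   have "sqrt (real N) = 1 / sqrt (real N) * real N" using N by (simp add: real_div_sqrt)
   then show ?thesis by (metis of_real_mult of_real_of_nat_eq)
  qed
  have 3: "cor ?B = of_real (sqrt kconst) * of_real (1 / sqrt (real N))" unfolding of_real_mult[symmetric] by simp
  show ?thesis unfolding mode_def cmean_def 1 2 3 by (simp only: mult_ac)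
 qed
 have "(LBINT l. stepd s N z w l) = (SUM j<N * N. (1 / real N) *\<^sub>R (?A j z))" unfolding stepd_def
  by (intro has_bochner_integral_integral_eq has_bochner_integral_sum has_bochner_integral_scaleR_left has_integral_cell N)
 then have "of_real kconst * (LBINT l. stepd s N z w l) = (SUM j<N * N. of_real (kconst / real N) * (?A j z))"
  by (simp add: sum_distrib_left scaleR_conv_of_real)
 also have "... = mkern s N z w" unfolding mkern_def
 proof (rule sum.cong[OF refl])
  fix j
  have k: "cor (kconst / real N) = of_real ?B * of_real ?B" using kconst_pos unfolding of_real_mult[symmetric] by simp
  show "of_real (kconst / real N) * (?A j z) = mode s N j z * cnj (mode s N j w)" unfolding m k by (simp add: mult_ac)
 qed
 finally show ?thesis ..
qed

lemma stepd_eq: assumes N: "N > 0"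
 shows "stepd s N z w l = (let j = nat \<lfloor>real N * l\<rfloor> in if 0 <= l & j < N * N then cmean s N j (fst z) (- snd z) * cnj (cmean s N j (fst w) (- snd w)) else 0)"
proof -
 define f where "f j = cmean s N j (fst z) (- snd z) * cnj (cmean s N j (fst w) (- snd w))" for j
 have "stepd s N z w l = (SUM j<N * N. if j = nat \<lfloor>real N * l\<rfloor> then (if 0 <= l then f j else 0) else 0)"
  unfolding stepd_def f_def[symmetric] by (intro sum.cong refl) (simp add: indicator_def mem_cell[OF N])
 then show ?thesis by (simp add: sum.delta Let_def f_def)
qed

lemma norm_stepd: assumes s: "s > 0" and N: "N > 0"
 shows "norm (stepd s N z w l) <= (ampc 1 s * exp 1)^2 * exp (- fst z - fst w) * (ind {0..} l * exp (- 2 * l))"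
proof -
 define j where "j = nat \<lfloor>real N * l\<rfloor>"
 show ?thesis
 proof (cases "0 <= l & j < N * N")
  case True
  then have l: "l : cell N j" by (simp add: mem_cell[OF N] j_def)
  have "norm (stepd s N z w l) = norm (cmean s N j (fst z) (- snd z)) * norm (cmean s N j (fst w) (- snd w))"
   using True by (simp add: stepd_eq[OF N] j_def Let_def norm_mult)
  also have "... <= (ampc 1 s * exp 1 * exp (- (fst z + l))) * (ampc 1 s * exp 1 * exp (- (fst w + l)))"
   by (intro mult_mono cmean_le[OF s N l]) (auto simp: ampc_nonneg)
  also have "... = (ampc 1 s * exp 1)^2 * (exp (- (fst z + l)) * exp (- (fst w + l)))" by (simp only: power2_eq_square mult_ac)
  also have "exp (- (fst z + l)) * exp (- (fst w + l)) = exp (- fst z - fst w) * exp (- 2 * l)" by (simp add: exp_add[symmetric])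
  finally show ?thesis using True by simp
 next
  case False
  then have "stepd s N z w l = 0" unfolding stepd_eq[OF N] Let_def j_def[symmetric] by auto
  then show ?thesis by simp
 qed
qed

lemma measurable_stepd: "stepd s N z w : bmeas borel" unfolding stepd_def[abs_def] by measurable

lemma mkern_tendsto: assumes s: "s > 0" shows "(%n. mkern s (Suc n) z w) ----> gramk s z w"
 unfolding mkern_stepd[OF zero_less_Suc] gramk_def
proof (intro tendsto_mult tendsto_const integral_dominated_convergence[where w="%l. (ampc 1 s * exp 1)^2 * exp (- fst z - fst w) * (ind {0..} l * exp (- 2 * l))"])
 let ?B = "%l. ampl s (fst z + l) (- snd z) * ampl s (fst w + l) (snd w)"
 let ?A = "%n l. nat \<lfloor>real (Suc n) * l\<rfloor>"
 show "integrable lborel (%l. (ampc 1 s * exp 1)^2 * exp (- fst z - fst w) * (ind {0..} l * exp (- 2 * l)))"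
  by (intro integrable_mult_right int_exp_half) simp
 show "AE l in lborel. norm (stepd s (Suc n) z w l) <= (ampc 1 s * exp 1)^2 * exp (- fst z - fst w) * (ind {0..} l * exp (- 2 * l))" for n
  by (intro AE_I2 norm_stepd s) simp
 show "AE l in lborel. (%n. stepd s (Suc n) z w l) ----> ind {0..} l *\<^sub>R (?B l)"
 proof (rule AE_I2)
  fix l :: real
  show "(%n. stepd s (Suc n) z w l) ----> ind {0..} l *\<^sub>R (?B l)"
  proof (cases "l >= 0")
   case True
   have "(%n. cmean s (Suc n) (?A n l) (fst z) (- snd z) * cnj (cmean s (Suc n) (?A n l) (fst w) (- snd w)))
    ----> ampl s (fst z + l) (- snd z) * cnj (ampl s (fst w + l) (- snd w))"
    by (intro tendsto_intros cmean_tendsto s True)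
   moreover have "\<forall>\<^sub>F n in sequentially. cmean s (Suc n) (?A n l) (fst z) (- snd z) * cnj (cmean s (Suc n) (?A n l) (fst w) (- snd w)) = stepd s (Suc n) z w l"
   proof -
    \<comment> \<open>For n at least n0 the point l lies below n + 1 and hence in one of the first
      (n + 1)^2 cells, so it is not lost by the truncation.\<close>
    obtain n0 :: nat where n0: "l < real n0" using reals_Archimedean2 by blast
    have "nat \<lfloor>real (Suc n) * l\<rfloor> < Suc n * Suc n" if "n >= n0" for n
    proof -
     have "real (Suc n) * l < real (Suc n) * real (Suc n)" using n0 that by (intro mult_strict_left_mono) auto
     then have "\<lfloor>real (Suc n) * l\<rfloor> < int (Suc n * Suc n)" unfolding floor_less_iff of_int_of_nat_eq by (simp only: of_nat_mult)
     then show ?thesis using True by (subst nat_less_iff) simp_all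
    qed
    then show ?thesis unfolding eventually_sequentially stepd_eq[OF zero_less_Suc] Let_def using True by (intro exI[of _ n0]) auto
   qed
   ultimately show ?thesis using True by (simp add: cnj_ampl tendsto_cong)
  next
   case False
   then show ?thesis by (simp add: stepd_eq Let_def)
  qed
 qed
qed (use measurable_stepd in measurable)

lemma mkern_diag_le: assumes s: "s > 0" and N: "N > 0"
 shows "Re (mkern s N z z) <= kconst * ((ampc 1 s * exp 1)^2 * (LBINT l. ind {0..} l * exp (- 2 * l))) * exp (- fst z - fst z)"
proof -
 let ?C = "LBINT l. ind {0..} l * exp (- 2 * l)"
 let ?B = "ampc 1 s * exp 1"
 let ?A = "LBINT l. stepd s N z z l"
 have e: "integrable lborel (%l. ind {0..} l * exp (- 2 * l) :: real)" by (rule int_exp_half) simp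
 let ?w = "%l. ?B^2 * exp (- fst z - fst z) * (ind {0..} l * exp (- 2 * l))"
 have ew: "integrable lborel ?w" by (rule integrable_mult_right[OF e])
 have i: "integrable lborel (stepd s N z z)"
 proof (rule integrable_le[OF ew])
  show "stepd s N z z : bmeas lborel" using measurable_stepd by simp
  show "AE l in lborel. norm (stepd s N z z l) <= norm (?w l)" by (intro AE_I2 order_trans[OF norm_stepd[OF s N]]) simp
 qed
 have "norm ?A <= (LBINT l. ?w l)" by (rule Bochner_Integration.integral_norm_bound_integral[OF i ew norm_stepd[OF s N]])
 also have "... = ?B^2 * exp (- fst z - fst z) * ?C" by (rule integral_mult_right_zero)
 finally have "kconst * norm ?A <= kconst * (?B^2 * exp (- fst z - fst z) * ?C)" using kconst_pos by (intro mult_left_mono) auto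
 moreover have "Re (mkern s N z z) <= kconst * norm ?A"
  unfolding mkern_stepd[OF N] using complex_Re_le_cmod[of "LBINT l. stepd s N z z l"] kconst_pos by simp
 ultimately show ?thesis by (simp only: mult_ac)
qed

lemma integrable_wind_exp: "integrable nu (%z. \<bar>- wind k z\<bar> * (C * exp (- fst z - fst z)))"
proof -
 let ?B = "%z. ind (cball 0 (real k)) z *\<^sub>R (C * exp (- fst z - fst z))"
 let ?A = "%z. lw z *\<^sub>R (ind (window k) z * (C * exp (- fst z - fst z)))"
 have "integrable lborel (%z :: plane. ind (cball 0 (real k)) z *\<^sub>R (C * exp (- fst z - fst z)))"
  by (intro borel_integrable_compact compact_cball continuous_intros)
 then have "integrable lborel (%z :: plane. ind (window k) z *\<^sub>R (?B z))" by (rule integrable_mult_indicator[rotated]) simp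
 also have "(%z :: plane. ind (window k) z *\<^sub>R (?B z)) = (%z. ind (window k) z * (C * exp (- fst z - fst z)))"
  by (auto simp: window_def indicator_def fun_eq_iff)
 finally have "integrable lborel (%z :: plane. ind (window k) z * (C * exp (- fst z - fst z)))" .
 from has_bochner_integral_nu_lw[OF has_bochner_integral_integrable[OF this]]
 have "integrable nu ?A" unfolding hbi_iff by (rule conjunct1)
 also have "?A = (%z. \<bar>- wind k z\<bar> * (C * exp (- fst z - fst z)))" using lw_pos(2) by (simp add: wind_def abs_mult fun_eq_iff)
 finally show ?thesis .
qed

lemma Theta_gram_nonneg_pos: assumes s: "s > 0" shows "0 <= Theta (gramk s) n x (%z. - wind k z)"
proof (rule LIMSEQ_le_const)
 show "(%j. Theta (mkern s (Suc j)) n x (%z. - wind k z)) ----> Theta (gramk s) n x (%z. - wind k z)"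
  by (rule Theta_tendsto[OF psd_mkern measurable_mkern measurable_gramk mkern_tendsto[OF s] mkern_diag_le[OF s zero_less_Suc] _ integrable_wind_exp])
   simp
 have "0 <= Theta (mkern s (Suc j)) n x (%z. - wind k z)" for j
 proof (rule Theta_nonneg_finite_rank[OF psd_mkern measurable_mkern mkern_reproducing[OF s] mkern_trace[OF s]])
  show "- lw z <= - wind k z" "- wind k z <= 0" for z using lw_pos(2)[of z] by (auto simp: wind_def indicator_def)
 qed simp_all
 then show "EX N. ALL j>=N. 0 <= Theta (mkern s (Suc j)) n x (%z. - wind k z)" by blast
qed

lemma Theta_gram_nonneg_0: "0 <= Theta (gramk 0) n x (%z. - wind k z)"
proof (rule LIMSEQ_le_const)
 have s: "(%j. 1 / real (Suc j)) ----> 0" using LIMSEQ_Suc[OF lim_inverse_n] by (simp add: inverse_eq_divide)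
 define C where "C = kconst * (exp (1^2 / 2 + 1 / 3) * sqrt pi)^2 / (2 * 1)"
 have b: "Re (gramk (1 / real (Suc j)) z z) <= C * exp (- fst z - fst z)" for j z
 proof -
  let ?s = "1 / real (Suc j)"
  have "ampc 1 ?s <= exp (1^2 / 2 + 1 / 3) * sqrt pi" by (rule ampc_le) simp
  then have c: "kconst * (ampc 1 ?s)^2 / (2 * 1) <= C"
   unfolding C_def using kconst_pos by (intro divide_right_mono mult_left_mono power_mono) (auto simp: ampc_nonneg)
  have "exp (- (2 * 1 / (?s^2 + 2 * 1)) * (snd z - 0)^2) <= 1" by simp
  then have "exp (- (2 * 1) * fst z) * exp (- (2 * 1 / (?s^2 + 2 * 1)) * (snd z - 0)^2) <= exp (- (2 * 1) * fst z) * 1"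
   by (intro mult_left_mono) auto
  also have "... = exp (- fst z - fst z)" by simp
  finally have "kconst * (ampc 1 ?s)^2 / (2 * 1) * (exp (- (2 * 1) * fst z) * exp (- (2 * 1 / (?s^2 + 2 * 1)) * (snd z - 0)^2)) <= C * exp (- fst z - fst z)"
   using kconst_pos by (intro mult_mono c) (auto simp: C_def)
  then show ?thesis using gram_diag_bound[of 1 ?s z] by linarith
 qed
 show "(%j. Theta (gramk (1 / real (Suc j))) n x (%z. - wind k z)) ----> Theta (gramk 0) n x (%z. - wind k z)"
  by (rule Theta_tendsto[OF psd_gram measurable_gramk measurable_gramk gramk_tendsto[OF s] b _ integrable_wind_exp])
   simp
 show "EX N. ALL j>=N. 0 <= Theta (gramk (1 / real (Suc j))) n x (%z. - wind k z)"
  by (intro exI allI impI Theta_gram_nonneg_pos) simp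
qed

theorem janossy_kernel_gram: assumes "s >= 0" shows "janossy_kernel (gramk s)"
proof
 show "psd_kernel (gramk s)" by (rule psd_gram)
 show "(%(a, b). gramk s a b) : bmeas (borel \<Otimes>\<^sub>M borel)" by (rule measurable_gramk)
 show "set_integrable lborel A (%z. Re (gramk s z z))" if "A : sets borel" "bounded A" for A by (rule gram_loc[OF that])
 show "0 <= Theta (gramk s) n x (%z. - wind k z)" for k n x
  using Theta_gram_nonneg_pos[of s] Theta_gram_nonneg_0 assms by (cases "s = 0") auto
qed

section \<open>Asymptotics of the amplitude under the scaling\<close>

abbreviation tilt :: "real => real" where
 "tilt s \<equiv> c_shift s / s^2"

lemma c_shift_at_top: "filterlim c_shift at_top at_top" unfolding c_shift_def a_scale_def by real_asymp

lemma b_scale_square: assumes "s > 1" shows "(b_scale s)^2 = s^2 * a_scale s"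
proof -
 have "(s powr (3/2))^2 = s^3" using assms by (simp add: powr_power)
 moreover have "((6 * ln s) powr (1/4))^2 = sqrt (6 * ln s)" using assms by (simp add: powr_power powr_half_sqrt)
 ultimately show ?thesis by (simp add: b_scale_def a_scale_def power_divide power2_eq_square power3_eq_cube)
qed

text \<open>At height \<open>tilt s\<close> the amplitude decays at this rate in the rescaled
  abscissa. The limit is 1/2 because two amplitudes multiply to the exponential decay of the
  intensity.\<close>

lemma tilt_a: "((%s. tilt s * a_scale s) ---> 1 / 2) at_top"
proof -
 have k: "inverse (6 powr (1 / 2)) * 3 * inverse (6 powr (1 / 2)) = (1 / 2 :: real)" by (simp add: powr_half_sqrt field_simps)
 show ?thesis unfolding c_shift_def a_scale_def by (real_asymp simp: k)
qed

lemma scale_limits: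
 "((%s. tilt s * b_scale s / s^2) ---> 0) at_top"
 "((%s. tilt s / s^2) ---> 0) at_top"
 "((%s. (b_scale s)^2 / s^3) ---> 0) at_top"
 "((%s. b_scale s / s^3) ---> 0) at_top"
 "((%s. (tilt s)^2 / s) ---> 0) at_top"
 "((%s. a_scale s / s) ---> 0) at_top"
 "((%s. tilt s) ---> 0) at_top" unfolding c_shift_def a_scale_def b_scale_def by real_asymp+

text \<open>The corresponding rate in the second coordinate. By \<open>b_scale_square\<close> it is
  the same quantity as the rate in the abscissa, which is the relation that fixes
  \<open>b_scale\<close> in terms of \<open>a_scale\<close>.\<close>

lemma tilt_b: "((%s. tilt s * (b_scale s)^2 / s^2) ---> 1 / 2) at_top"
proof (rule Lim_transform_eventually[OF tilt_a])
 show "\<forall>\<^sub>F s in at_top. tilt s * a_scale s = tilt s * (b_scale s)^2 / s^2"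
  using eventually_gt_at_top[of 1] by eventually_elim (simp add: b_scale_square)
qed

lemma tilt_b_decay: "((%b. (b_scale b)^2 * (tilt b / (b^2 + 2 * tilt b))) ---> 1 / 2) at_top"
proof -
 let ?A = "%b. tilt b * a_scale b / (1 + 2 * (tilt b / b^2))"
 have "(?A ---> (1 / 2) / (1 + 2 * 0)) at_top" by (intro tendsto_intros tilt_a scale_limits) simp
 then have "(?A ---> 1 / 2) at_top" by simp
 moreover have "\<forall>\<^sub>F b in at_top. tilt b * a_scale b / (1 + 2 * (tilt b / b^2)) = (b_scale b)^2 * (tilt b / (b^2 + 2 * tilt b))"
  using eventually_gt_at_top[of 1]
 proof eventually_elim
  case (elim s)
  have "r * a / (1 + 2 * (r / q)) = (q * a) * (r / (q + 2 * r))" if "q > 0" for q r a :: real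
  proof -
   have "1 + 2 * (r / q) = (q + 2 * r) / q" using that by (simp add: field_simps)
   then show ?thesis by simp
  qed
  from this[of "s^2" "tilt s" "a_scale s"] show ?case unfolding b_scale_square[OF elim] using elim by (simp only: zero_less_power)
 qed
 ultimately show ?thesis by (rule Lim_transform_eventually)
qed

lemma oscillation_at_top: "filterlim (%s. a_scale s * b_scale s / s) at_top at_top" unfolding a_scale_def b_scale_def by real_asymp

text \<open>Half of the total factor of the rescaled Gram integral, to be put on each of the two
  amplitudes: the Jacobian contributes a b, the substitution in the half-line another a.\<close>

definition amp_scale :: "real => real" where
 "amp_scale s = sqrt ((a_scale s)^2 * b_scale s * kconst)"

text \<open>The size of the rescaled amplitude: 1/s comes from the substitution in the contour
  integral, the exponential is the part of the integrand at the tilted height that is common to all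
  points.\<close>

definition core_scale :: "real => real" where
 "core_scale s = amp_scale s / s * exp (- ((c_shift s)^2 / (2 * s^2)) + (tilt s)^3 / 3)"

text \<open>The logarithmic terms in \<open>c_shift\<close> are chosen such that all powers of \<open>\<sigma>\<close> and \<open>ln \<sigma>\<close>
  cancel here.\<close>

lemma core_scale_square: assumes s: "s > 1" shows "(core_scale s)^2 = 2 * pi * kconst *
  exp (- ((5/4 * ln (6 * ln s) + ln (2 * pi))^2 / (6 * ln s)) + 2 * (tilt s)^3 / 3)"
proof -
 let ?B = "%q m. - (q^2 / m) + 2 * (tilt s)^3 / 3"
 let ?A = "- ((c_shift s)^2 / s^2) + 2 * (tilt s)^3 / 3"
 define l where "l = ln s"
 have l: "l > 0" using s by (simp add: l_def)
 define m where "m = 6 * l"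
 have m: "m > 0" using l by (simp add: m_def)
 define q where "q = 5/4 * ln m + ln (2 * pi)"
 have a: "a_scale s = s / sqrt m" by (simp add: a_scale_def m_def l_def)
 have b: "b_scale s = s powr (3/2) / m powr (1/4)" by (simp add: b_scale_def m_def l_def)
 have c: "c_shift s = s / sqrt m * (3 * l - q)" by (simp add: c_shift_def a q_def m_def l_def)
 have "(c_shift s)^2 / s^2 = (3 * l - q)^2 / m" unfolding c using s m by (simp add: power_mult_distrib power_divide)
 also have "... = 3/2 * l - q + q^2 / m" using l by (simp add: m_def power2_eq_square field_simps)
 finally have cc: "(c_shift s)^2 / s^2 = 3/2 * l - q + q^2 / m" .
 have "(core_scale s)^2 = (a_scale s)^2 * b_scale s * kconst / s^2 * exp ?A"
 proof -
  have "0 <= (a_scale s)^2 * b_scale s * kconst" using scales_pos[OF s] kconst_pos by simp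
  moreover have "exp (- ((c_shift s)^2 / (2 * s^2)) + (tilt s)^3 / 3)^2 = exp ?A"
   unfolding exp_of_nat_mult[symmetric, where n=2, simplified] power2_eq_square[of "exp _"] exp_add[symmetric] by (simp add: field_simps)
  ultimately show ?thesis unfolding core_scale_def amp_scale_def power_mult_distrib power_divide by simp
 qed
 also have "exp ?A = exp (- (3/2 * l)) * exp (5/4 * ln m) * (2 * pi) * exp (?B q m)"
 proof -
  have "- ((c_shift s)^2 / s^2) + 2 * (tilt s)^3 / 3 = - (3/2 * l) + 5/4 * ln m + ln (2 * pi) + (?B q m)" unfolding cc q_def by simp
  then show ?thesis by (simp only: exp_add exp_ln mult_pos_pos pi_gt_zero zero_less_numeral)
 qed
 also have "(a_scale s)^2 * b_scale s * kconst / s^2 * (exp (- (3/2 * l)) * exp (5/4 * ln m) * (2 * pi) * exp (?B q m))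
  = (((a_scale s)^2 / s^2) * b_scale s * exp (- (3/2 * l)) * exp (5/4 * ln m)) * (2 * pi * kconst * exp (?B q m))" by simp
 also have "((a_scale s)^2 / s^2) * b_scale s * exp (- (3/2 * l)) * exp (5/4 * ln m) = 1"
 proof -
  have 1: "(a_scale s)^2 / s^2 = 1 / m" unfolding a using s m by (simp add: power_divide)
  have 2: "exp (- (3/2 * l)) = 1 / s powr (3/2)" using s by (simp add: powr_def l_def exp_minus inverse_eq_divide)
  have 3: "exp (5/4 * ln m) = m * m powr (1/4)"
  proof -
   have "exp (5/4 * ln m) = m powr (1 + 1/4)" using m by (simp add: powr_def)
   also have "... = m powr 1 * m powr (1/4)" by (rule powr_add)
   finally show ?thesis using m by simp
  qed
  have "s powr (3/2) > 0" "m powr (1/4) > 0" using s m by simp_all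
  then show ?thesis unfolding 1 2 3 b using m by (simp add: field_simps)
 qed
 finally show ?thesis by (simp add: q_def m_def l_def)
qed

lemma core_scale_pos: "s > 1 ==> core_scale s > 0" using scales_pos[of s] kconst_pos by (simp add: core_scale_def amp_scale_def)

lemma core_scale_tendsto: "(core_scale ---> sqrt (2 * pi * kconst)) at_top"
proof -
 let ?A = "%a. 2 * pi * kconst * exp (- ((5/4 * ln (6 * ln a) + ln (2 * pi))^2 / (6 * ln a)) + 2 * (tilt a)^3 / 3)"
 have "((%a. (5/4 * ln (6 * ln a) + ln (2 * pi))^2 / (6 * ln a)) ---> 0) at_top" by real_asymp
 then have "((%a. sqrt (?A a)) ---> sqrt (2 * pi * kconst * exp (- 0 + 2 * 0^3 / 3))) at_top"
  by (intro tendsto_intros scale_limits) simp_all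
 then have "((%a. sqrt (?A a)) ---> sqrt (2 * pi * kconst)) at_top" by simp
 moreover have "\<forall>\<^sub>F a in at_top. sqrt (?A a) = core_scale a" using eventually_gt_at_top[of 1]
 proof eventually_elim
  case (elim s)
  show ?case unfolding core_scale_square[OF elim, symmetric] using core_scale_pos[OF elim] by simp
 qed
 ultimately show ?thesis by (rule Lim_transform_eventually)
qed

definition samp :: "real => real => real => complex" where
 "samp s x y = of_real (amp_scale s) * ampl s (c_shift s + a_scale s * x) (b_scale s * y)"

lemma measurable_samp [measurable]: assumes [measurable]: "f : bmeas M" "g : bmeas M"
 shows "(%x. samp s (f x) (g x)) : bmeas M" unfolding samp_def by measurable

lemma scaled_gram: assumes d: "d > 1"
 shows "skern gramk d z w = (LBINT m. ind {0..} m *\<^sub>R (samp d (fst z + m) (- snd z) * samp d (fst w + m) (snd w)))"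
proof -
 let ?A = "%m. samp d (fst z + m) (- snd z) * samp d (fst w + m) (snd w)"
 define a b c where "a = a_scale d" and "b = b_scale d" and "c = c_shift d"
 have p: "a > 0" "b > 0" using scales_pos[OF d] by (auto simp: a_def b_def)
 define F where "F l = ind {0..} l *\<^sub>R (ampl d (c + a * fst z + l) (- (b * snd z)) * ampl d (c + a * fst w + l) (b * snd w))" for l :: real
 have "skern gramk d z w = of_real (a * b) * (of_real kconst * (LBINT l. F l))"
  unfolding skern_def strk_def[OF scales_pos[OF d]] stre_def[OF scales_pos[OF d]]
   gramk_def F_def a_def b_def c_def case_prod_beta fst_conv snd_conv ..
 also have "(LBINT l. F l) = \<bar>a\<bar> *\<^sub>R (LBINT m. F (0 + a * m))" using p by (intro lborel_integral_real_affine) simp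
 also have "of_real (a * b) * (of_real kconst * (\<bar>a\<bar> *\<^sub>R (LBINT m. F (0 + a * m)))) = of_real (a^2 * b * kconst) * (LBINT m. F (a * m))"
  using p by (simp add: scaleR_conv_of_real power2_eq_square)
 also have "... = (LBINT m. of_real (a^2 * b * kconst) * F (a * m))" by (rule integral_mult_right_zero[symmetric])
 also have "... = (LBINT m. ind {0..} m *\<^sub>R (?A m))"
 proof (rule integral_eq[OF refl])
  fix m
  have i: "ind {0..} (a * m) = (ind {0..} m :: real)" using p by (simp add: indicator_def zero_le_mult_iff)
  have s: "cor (a^2 * b * kconst) = of_real (amp_scale d) * of_real (amp_scale d)"
   unfolding of_real_mult[symmetric] amp_scale_def a_def[symmetric] b_def[symmetric] using p kconst_pos by simp
  have e: "c + a * fst z + a * m = c + a * (fst z + m)" "c + a * fst w + a * m = c + a * (fst w + m)" by (simp_all add: algebra_simps)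
  show "of_real (a^2 * b * kconst) * F (a * m) = ind {0..} m *\<^sub>R (?A m)"
   unfolding F_def i s e samp_def a_def[symmetric] b_def[symmetric] c_def[symmetric] by (simp add: mult_ac)
 qed
 finally show ?thesis .
qed

text \<open>The general amplitude bound at height \<open>tilt f\<close>. There the terms that depend
  on \<open>c_shift\<close> combine to the exponent contained in \<open>core_scale\<close>.\<close>

lemma norm_samp_le: assumes f: "f > 1" and c: "c_shift f > 0" shows "norm (samp f x y) <= core_scale f * sqrt (2 * pi) *
  (exp (- (tilt f * a_scale f) * x) * exp (- ((b_scale f)^2 * (tilt f / (f^2 + 2 * tilt f))) * y^2))"
proof -
 let ?B = "%d. - ((c_shift f)^2 / (2 * f^2)) + d^3 / 3"
 let ?A = "%d b. - (d / (f^2 + 2 * d)) * (b * y)^2"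
 define d where "d = tilt f"
 define a b where "a = a_scale f" and "b = b_scale f"
 have d: "d > 0" using f c by (simp add: d_def)
 have s0: "0 <= amp_scale f" using scales_pos[OF f] kconst_pos by (simp add: amp_scale_def)
 have cd: "c_shift f = d * f^2" using f by (simp add: d_def)
 have "norm (samp f x y) <= amp_scale f * (ampc d f * (exp (- d * (c_shift f + a * x)) * exp (?A d b)))"
  using mult_left_mono[OF ampl_le[OF d] s0] s0 by (simp add: samp_def norm_mult a_def b_def)
 also have "... = (amp_scale f * sqrt (pi / (d + f^2 / 2))) * (exp (f^2 * d^2 / 2 + d^3 / 3) * exp (- d * (c_shift f + a * x))) * exp (?A d b)"
  by (simp add: ampc_def)
 also have "exp (f^2 * d^2 / 2 + d^3 / 3) * exp (- d * (c_shift f + a * x)) = exp (?B d) * exp (- (d * a) * x)"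
  unfolding exp_add[symmetric] cd using f by (simp add: power2_eq_square field_simps)
 also have "(amp_scale f * sqrt (pi / (d + f^2 / 2))) * (exp (?B d) * exp (- (d * a) * x)) * exp (?A d b)
   <= (amp_scale f * (sqrt (2 * pi) / f)) * (exp (?B d) * exp (- (d * a) * x)) * exp (?A d b)"
 proof (intro mult_right_mono mult_left_mono s0)
  have "pi / (d + f^2 / 2) <= pi / (f^2 / 2)" using d f by (intro divide_left_mono) (auto simp: add_pos_pos)
  then have "sqrt (pi / (d + f^2 / 2)) <= sqrt (pi / (f^2 / 2))" by simp
  also have "... = sqrt (2 * pi) / f" using f by (simp add: real_sqrt_divide real_sqrt_mult mult.commute)
  finally show "sqrt (pi / (d + f^2 / 2)) <= sqrt (2 * pi) / f" .
 qed auto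
 also have "... = core_scale f * sqrt (2 * pi) * (exp (- (d * a) * x) * exp (- (b^2 * (d / (f^2 + 2 * d))) * y^2))"
  unfolding core_scale_def d_def[symmetric] power_mult_distrib by (simp add: mult_ac)
 finally show ?thesis unfolding d_def a_def b_def .
qed

lemma wave_polar: "wave s x y (line d t) = of_real (exp (- ((s * t - y)^2) / 2 + s^2 * d^2 / 2 - t^2 * d + d^3 / 3 - x * d)) *
  exp (\<i> * of_real (t^3 / 3 - t * d^2 + x * t - s * d * (s * t - y)))"
proof -
 have "- (1/2) * (of_real s * line d t - of_real y)^2 + \<i>/3 * (line d t)^3 + \<i> * of_real x * line d t =
  of_real (- ((s * t - y)^2) / 2 + s^2 * d^2 / 2 - t^2 * d + d^3 / 3 - x * d) + \<i> * of_real (t^3 / 3 - t * d^2 + x * t - s * d * (s * t - y))"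
  unfolding line_def by (simp add: complex_eq_iff power2_eq_square power3_eq_cube) (simp add: field_simps)
 then show ?thesis unfolding wave_def by (simp only: exp_add exp_of_real)
qed

text \<open>The phase of the wave at height \<open>tilt s\<close> at the point t = b y / s, where
  the Gaussian in the integrand is centred. In the abscissa it is linear, which later produces the
  rotation.\<close>

definition phase :: "real => real => real => real" where
 "phase s x y = (b_scale s * y / s)^3 / 3 - (b_scale s * y / s) * (tilt s)^2 + (c_shift s + a_scale s * x) * (b_scale s * y / s)"

lemma phase_minus: "phase s x (- y) = - phase s x y" by (simp add: phase_def power3_eq_cube)

lemma phase_add: "phase s (x + m) y = phase s x y + a_scale s * b_scale s / s * y * m" by (simp add: phase_def algebra_simps)

definition core :: "real => real => real => complex" where
 "core s x y = exp (- (\<i> * of_real (phase s x y))) * samp s x y"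

text \<open>The remaining decay t^2 d at height d, with t = (b y + p) / s, expanded in powers of the
  distance p from the Gaussian centre; only the first summand survives in the limit.\<close>

definition damp :: "real => real => real => real" where
 "damp s y p = tilt s * (b_scale s)^2 / s^2 * y^2 + 2 * (tilt s * b_scale s / s^2) * y * p + tilt s / s^2 * p^2"

definition core_phase :: "real => real => real => real => real" where
 "core_phase s x y p = (b_scale s)^2 / s^3 * y^2 * p + b_scale s / s^3 * y * p^2 + 1 / s^3 * (p^3 / 3) - (tilt s)^2 / s * p + a_scale s / s * x * p"

text \<open>Substituting t = (b y + p) / s centres the Gaussian at p = 0. The phase at the centre is
  divided out by \<open>core\<close>; \<open>core_phase\<close> is what is left of it.\<close>

lemma core_integral: assumes s: "s > 1" and c: "c_shift s > 0" shows "core s x y = of_real (core_scale s * exp (- (tilt s * a_scale s) * x)) *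
  (LBINT p. of_real (exp (- (p^2) / 2 - damp s y p)) * exp (\<i> * of_real (core_phase s x y p)))"
proof -
 let ?H = "%t b d f. exp (- ((s * t - b * y)^2) / 2 + s^2 * d^2 / 2 - t^2 * d + d^3 / 3 - f * d)"
 let ?G = "amp_scale s / s"
 let ?F = "%t d f b. t^3 / 3 - t * d^2 + f * t - s * d * (s * t - b * y)"
 let ?E = "- (\<i> * of_real (phase s x y))"
 let ?D = "%d a. core_scale s * exp (- (d * a) * x)"
 let ?C = "%p. \<i> * of_real (core_phase s x y p)"
 let ?B = "%p. - (p^2) / 2 - damp s y p"
 define d where "d = tilt s"
 define a b where "a = a_scale s" and "b = b_scale s"
 have d: "d > 0" using s c by (simp add: d_def)
 have cd: "c_shift s = d * s^2" using s by (simp add: d_def)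
 define u where "u = b * y / s"
 define f where "f = c_shift s + a * x"
 have "ampl s f (b * y) = (LBINT t. wave s f (b * y) (line d t))"
  using d s by (subst ampl_eq[of d]) (auto simp: ampl_at_def add_nonneg_pos)
 also have "... = \<bar>1 / s\<bar> *\<^sub>R (LBINT p. wave s f (b * y) (line d (u + 1 / s * p)))"
  using s by (intro lborel_integral_real_affine) simp
 finally have A: "ampl s f (b * y) = of_real (1 / s) * (LBINT p. wave s f (b * y) (line d (u + p / s)))"
  using s by (simp add: scaleR_conv_of_real)
 define X where "X = exp ?E * of_real ?G"
 have "core s x y = X * (LBINT p. wave s f (b * y) (line d (u + p / s)))"
  unfolding core_def samp_def a_def[symmetric] b_def[symmetric] f_def[symmetric] A X_def by simp
 also have "... = (LBINT p. X * wave s f (b * y) (line d (u + p / s)))" by (rule integral_mult_right_zero[symmetric])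
 also have "... = (LBINT p. of_real (?D d a) * (of_real (exp (?B p)) * exp (?C p)))"
 proof (rule integral_eq[OF refl])
  fix p
  define t where "t = u + p / s"
  have st: "s * t - b * y = p" using s by (simp add: t_def u_def field_simps)
  have damp: "damp s y p = t^2 * d"
   unfolding damp_def d_def[symmetric] b_def[symmetric] t_def u_def using s by (simp add: power2_eq_square field_simps)
  have re: "- ((s * t - b * y)^2) / 2 + s^2 * d^2 / 2 - t^2 * d + d^3 / 3 - f * d =
    (- ((c_shift s)^2 / (2 * s^2)) + d^3 / 3) + - (d * a) * x + (?B p)" unfolding st damp f_def cd using s by (simp add: power2_eq_square field_simps)
  have im: "- phase s x y + (?F t d f b) = core_phase s x y p"
  proof -
   have e1: "phase s x y = u^3 / 3 - u * d^2 + f * u" by (simp add: phase_def u_def f_def a_def b_def d_def)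
   have e2: "core_phase s x y p = u^2 * (p / s) + u * (p / s)^2 + (p / s)^3 / 3 - (p / s) * d^2 + a * x * (p / s)"
    unfolding core_phase_def d_def[symmetric] a_def[symmetric] b_def[symmetric] u_def using s by (simp add: power2_eq_square power3_eq_cube mult_ac)
   have e3: "f * (p / s) - s * d * p = a * x * (p / s)" unfolding f_def cd using s by (simp add: power2_eq_square field_simps)
   define q where "q = p / s"
   have "- (u^3 / 3 - u * d^2 + f * u) + (t^3 / 3 - t * d^2 + f * t - s * d * p) = (t^3 - u^3) / 3 - q * d^2 + (f * q - s * d * p)"
    unfolding t_def q_def[symmetric] by (simp add: field_simps)
   also have "(t^3 - u^3) / 3 = u^2 * q + u * q^2 + q^3 / 3"
    unfolding t_def q_def[symmetric] by (simp add: power2_eq_square power3_eq_cube field_simps)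
   finally show ?thesis unfolding e1 e2 st q_def[symmetric] e3[unfolded q_def[symmetric]] by simp
  qed
  have "X * wave s f (b * y) (line d t) = of_real ?G * of_real (?H t b d f) * (exp ?E * exp (\<i> * of_real (?F t d f b)))"
   unfolding X_def wave_polar by (simp only: mult_ac)
  also have "exp ?E * exp (\<i> * of_real (?F t d f b)) = exp (?C p)" unfolding exp_add[symmetric] im[symmetric] by (simp add: algebra_simps)
  also have "of_real ?G * of_real (?H t b d f) = cor (?D d a) * of_real (exp (?B p))"
   unfolding re of_real_mult[symmetric] exp_add core_scale_def d_def[symmetric] by (simp only: mult_ac)
  finally show "X * wave s f (b * y) (line d (u + p / s)) = of_real (?D d a) * (of_real (exp (?B p)) * exp (?C p))"
   unfolding t_def by (simp only: mult.assoc)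
 qed
 also have "... = of_real (?D d a) * (LBINT p. of_real (exp (?B p)) * exp (?C p))" by (rule integral_mult_right_zero)
 finally show ?thesis unfolding d_def a_def .
qed

lemma damp_nonneg: assumes "s > 1" "c_shift s > 0" shows "0 <= damp s y p"
proof -
 have "damp s y p = tilt s * (b_scale s * y / s + p / s)^2" unfolding damp_def using assms by (simp add: power2_eq_square field_simps)
 then show ?thesis using assms by simp
qed

definition lima :: "real => real => real" where
 "lima x y = sqrt (2 * pi * kconst) * exp (- (1/2) * x) * (sqrt (2 * pi) * exp (- (1/2 * y^2)))"

text \<open>The damping is nonnegative, so the standard Gaussian dominates. It tends to y^2/2 while
  the residual phase tends to 0, and a Gaussian integral remains.\<close>

lemma core_tendsto: "((%a. core a x y) ---> of_real (lima x y)) at_top"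
proof -
 let ?D = "sqrt (2 * pi * kconst) * exp (- (1/2) * x)"
 let ?C = "sqrt (2 * pi) * exp (- (1/2 * y^2))"
 let ?B = "%a. core_scale a * exp (- (tilt a * a_scale a) * x)"
 let ?A = "LBINT p. of_real (exp (- (p^2) / 2 - 1/2 * y^2)) * exp (\<i> * of_real 0)"
 let ?f = "%a p. cor (exp (- (p^2) / 2 - damp a y p)) * exp (\<i> * of_real (core_phase a x y p))"
 have dl: "((%a. damp a y p) ---> 1/2 * y^2) at_top" for p
 proof -
  have "((%a. damp a y p) ---> 1/2 * y^2 + 2 * 0 * y * p + 0 * p^2) at_top"
   unfolding damp_def by (intro tendsto_intros tilt_b scale_limits)
  then show ?thesis by simp
 qed
 have pl: "((%a. core_phase a x y p) ---> 0) at_top" for p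
 proof -
  have i: "((%a::real. 1 / a^3) ---> 0) at_top" by real_asymp
  have "((%a. core_phase a x y p) ---> 0 * y^2 * p + 0 * y * p^2 + 0 * (p^3 / 3) - 0 * p + 0 * x * p) at_top"
   unfolding core_phase_def by (intro tendsto_add tendsto_diff tendsto_mult tendsto_const scale_limits i)
  then show ?thesis by simp
 qed
 have "((%a. LBINT p. ?f a p) ---> ?A) at_top"
 proof (rule integral_dominated_convergence_at_top[where w="%p. exp (- (p^2) / 2)"])
  show "integrable lborel (%p::real. exp (- (p^2) / 2))" using gaussian_integrable[of 1] by simp
  show "(%p. ?f a p) : bmeas lborel" for a unfolding damp_def core_phase_def by measurable
  show "AE p in lborel. ((%a. ?f a p) ---> of_real (exp (- (p^2) / 2 - 1/2 * y^2)) * exp (\<i> * of_real 0)) at_top"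
   by (intro AE_I2 tendsto_intros dl pl)
  have "\<forall>\<^sub>F a in at_top. a > 1 & c_shift a > 0"
   using eventually_gt_at_top[of 1] filterlim_at_top_dense[THEN iffD1, OF c_shift_at_top] by (auto intro: eventually_conj)
  then show "\<forall>\<^sub>F a in at_top. AE p in lborel. norm (?f a p) <= exp (- (p^2) / 2)"
  proof eventually_elim
   case (elim s)
   show ?case using damp_nonneg[of s y] elim by (intro AE_I2) (simp add: norm_mult)
  qed
 qed simp
 moreover have "?A = cor ?C"
 proof -
  have "?A = (LBINT p. cor (exp (- (p^2) / 2) * exp (- (1/2 * y^2))))"
   by (intro integral_eq) (auto simp flip: exp_add)
  also have "... = cor (LBINT p. exp (- (p^2) / 2) * exp (- (1/2 * y^2)))" by (rule integral_complex_of_real)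
  finally show ?thesis by (simp add: integral_gaussian[simplified])
 qed
 ultimately have "((%a. of_real (?B a) * (LBINT p. ?f a p)) ---> of_real ?D * of_real ?C) at_top"
  by (intro tendsto_mult tendsto_of_real tendsto_exp tendsto_minus tendsto_const core_scale_tendsto tilt_a) simp
 also have "of_real ?D * of_real ?C = cor (lima x y)" by (simp add: lima_def)
 finally have lim: "((%a. of_real (?B a) * (LBINT p. ?f a p)) ---> cor (lima x y)) at_top" .
 have "\<forall>\<^sub>F a in at_top. a > 1 & c_shift a > 0"
  using eventually_gt_at_top[of 1] filterlim_at_top_dense[THEN iffD1, OF c_shift_at_top] by (auto intro: eventually_conj)
 then have "\<forall>\<^sub>F a in at_top. of_real (?B a) * (LBINT p. ?f a p) = core a x y" by eventually_elim (simp only: core_integral)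
 with lim show ?thesis by (rule Lim_transform_eventually)
qed

text \<open>The constants combine to 4 pi^2 \<open>kconst\<close> = pi^(-1/2), the prefactor of the
  Poisson intensity.\<close>

lemma lima_prod: "lima x y * lima x' y' = pi powr (-1/2) * exp (- (x + x') / 2 - (y^2 + y'^2) / 2)"
proof -
 let ?D = "exp (- (1/2) * x') * exp (- (1/2 * y'^2))"
 let ?C = "sqrt (2 * pi * kconst) * sqrt (2 * pi)"
 have p: "pi powr (5/2) = pi^2 * pi powr (1/2)"
 proof -
  have "pi powr (5/2) = pi powr 2 * pi powr (1/2)" unfolding powr_add[symmetric] by simp
  then show ?thesis by simp
 qed
 have "sqrt (2 * pi * kconst) * sqrt (2 * pi) * ?C = 4 * pi^2 * kconst"
 proof -
  have "sqrt A * sqrt B * (sqrt A * sqrt B) = A * B" if "0 <= A" "0 <= B" for A B :: real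
   using that by (metis mult.assoc mult.left_commute real_sqrt_mult_self abs_of_nonneg)
  from this[of "2 * pi * kconst" "2 * pi"] show ?thesis using kconst_pos by (simp add: power2_eq_square)
 qed
 also have "... = pi powr (-1/2)" unfolding kconst_def p by (simp add: powr_minus_divide[of pi "1/2", simplified])
 finally have k: "sqrt (2 * pi * kconst) * sqrt (2 * pi) * ?C = pi powr (-1/2)" .
 have "lima x y * lima x' y' = (sqrt (2 * pi * kconst) * sqrt (2 * pi) * ?C) * (exp (- (1/2) * x) * exp (- (1/2 * y^2)) * ?D)"
  unfolding lima_def by (simp only: mult_ac)
 also have "exp (- (1/2) * x) * exp (- (1/2 * y^2)) * ?D = exp (- (x + x') / 2 - (y^2 + y'^2) / 2)"
  unfolding exp_add[symmetric] by (simp add: field_simps)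
 finally show ?thesis unfolding k .
qed

definition amp_bound :: real where
 "amp_bound = sqrt (2 * pi * kconst) * sqrt (2 * pi) + 1"

text \<open>The actual decay rate is only known to be near 1/2, eventually between 1/4 and 3/4. The
  smaller rate gives the upper bound for x at least 0, the larger one for negative x.\<close>

definition envel :: "real => real" where
 "envel x = exp (- (1/4) * x) + exp (- (3/4) * x)"

lemma amp_bound_nonneg: "0 <= amp_bound" using kconst_pos by (simp add: amp_bound_def)

lemma envel_nonneg: "0 <= envel x" by (simp add: envel_def)

lemma exp_le_envel: assumes "1/4 <= k" "k <= 3/4" shows "exp (- k * x) <= envel x"
proof (cases "x >= 0")
 case True
 then have "exp (- k * x) <= exp (- (1/4) * x)" using assms mult_right_mono[of "1/4" k x] by simp
 also have "... <= envel x" by (simp add: envel_def)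
 finally show ?thesis .
next
 case False
 then have "exp (- k * x) <= exp (- (3/4) * x)" using assms mult_right_mono_neg[of k "3/4" x] by simp
 also have "... <= envel x" by (simp add: envel_def)
 finally show ?thesis .
qed

lemma eventually_samp_le:
 "\<forall>\<^sub>F a in at_top. a > 1 & (ALL x y m. m >= 0 -->
  norm (samp a (x + m) y) <= amp_bound * envel x * exp (- (1/4) * m) * exp (- (1/4) * y^2))"
proof -
 have t1: "((%a. core_scale a * sqrt (2 * pi)) ---> sqrt (2 * pi * kconst) * sqrt (2 * pi)) at_top"
  by (intro tendsto_intros core_scale_tendsto)
 have "\<forall>\<^sub>F a in at_top. core_scale a * sqrt (2 * pi) < amp_bound" by (rule order_tendstoD(2)[OF t1]) (simp add: amp_bound_def)
 moreover have "\<forall>\<^sub>F a in at_top. 1/4 < tilt a * a_scale a" "\<forall>\<^sub>F a in at_top. tilt a * a_scale a < 3/4"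
  by (rule order_tendstoD[OF tilt_a], simp)+
 moreover have "\<forall>\<^sub>F a in at_top. 1/4 < (b_scale a)^2 * (tilt a / (a^2 + 2 * tilt a))" by (rule order_tendstoD(1)[OF tilt_b_decay]) simp
 moreover have "\<forall>\<^sub>F a in at_top. a > (1::real)" by (rule eventually_gt_at_top)
 moreover have "\<forall>\<^sub>F a in at_top. c_shift a > 0" using filterlim_at_top_dense[THEN iffD1, OF c_shift_at_top] by blast
 ultimately show ?thesis
 proof eventually_elim
  case (elim s)
  show ?case
  proof (intro conjI allI impI)
   fix x y m :: real assume m: "m >= 0"
   let ?k = "tilt s * a_scale s" and ?l = "(b_scale s)^2 * (tilt s / (s^2 + 2 * tilt s))"
   have cs: "0 <= core_scale s" using core_scale_pos[of s] elim by simp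
   have 1: "exp (- ?k * (x + m)) <= envel x * exp (- (1/4) * m)"
   proof -
    have "exp (- ?k * (x + m)) = exp (- ?k * x) * exp (- ?k * m)" by (simp add: exp_add[symmetric] distrib_left)
    also have "... <= envel x * exp (- (1/4) * m)"
    proof (intro mult_mono exp_le_envel)
     show "exp (- ?k * m) <= exp (- (1/4) * m)" using elim m mult_right_mono[of "1/4" ?k m] by simp
    qed (use elim in \<open>auto simp: envel_nonneg\<close>)
    finally show ?thesis .
   qed
   have 2: "exp (- ?l * y^2) <= exp (- (1/4) * y^2)" using elim mult_right_mono[of "1/4" ?l "y^2"] by simp
   have "norm (samp s (x + m) y) <= core_scale s * sqrt (2 * pi) * (exp (- ?k * (x + m)) * exp (- ?l * y^2))"
    using elim by (intro norm_samp_le) auto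
   also have "... <= amp_bound * (envel x * exp (- (1/4) * m) * exp (- (1/4) * y^2))"
    using elim cs by (intro mult_mono 1 2) (auto simp: amp_bound_nonneg envel_nonneg)
   finally show "norm (samp s (x + m) y) <= amp_bound * envel x * exp (- (1/4) * m) * exp (- (1/4) * y^2)" by (simp only: mult.assoc)
  qed (use elim in simp)
 qed
qed

definition pair_bound :: "plane => plane => real => real" where
 "pair_bound z w m = amp_bound^2 * (envel (fst z) * envel (fst w)) * exp (- (1/4) * ((snd z)^2 + (snd w)^2)) * (ind {0..} m * exp (- (1/2) * m))"

lemma integrable_pair_bound: "integrable lborel (pair_bound z w)"
 unfolding pair_bound_def[abs_def] by (intro integrable_mult_right int_exp_half) simp

lemma scaled_pair_le:
 assumes "ALL x y m. m >= 0 --> norm (samp s (x + m) y) <= amp_bound * envel x * exp (- (1/4) * m) * exp (- (1/4) * y^2)"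
 shows "norm (ind {0..} m *\<^sub>R (samp s (fst z + m) (- snd z) * samp s (fst w + m) (snd w))) <= pair_bound z w m"
proof (cases "m >= 0")
 case True
 have "norm (samp s (fst z + m) (- snd z)) * norm (samp s (fst w + m) (snd w)) <=
  (amp_bound * envel (fst z) * exp (- (1/4) * m) * exp (- (1/4) * (- snd z)^2)) * (amp_bound * envel (fst w) * exp (- (1/4) * m) * exp (- (1/4) * (snd w)^2))"
  by (intro mult_mono assms[rule_format] True) (auto simp: amp_bound_nonneg envel_nonneg)
 also have "... = amp_bound^2 * (envel (fst z) * envel (fst w)) * (exp (- (1/4) * (snd z)^2) * exp (- (1/4) * (snd w)^2)) * (exp (- (1/4) * m) * exp (- (1/4) * m))"
  by (simp only: power2_eq_square mult_ac minus_mult_minus)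
 also have "... = pair_bound z w m"
 proof -
  have "exp (- (1/4) * (snd z)^2) * exp (- (1/4) * (snd w)^2) = exp (- (1/4) * ((snd z)^2 + (snd w)^2))"
   unfolding exp_add[symmetric] by (simp add: distrib_left)
  moreover have "exp (- (1/4) * m) * exp (- (1/4) * m) = exp (- (1/2) * m)" unfolding exp_add[symmetric] by simp
  ultimately show ?thesis using True by (simp only: pair_bound_def indicator_def atLeast_iff if_True mult_1 of_bool_eq)
 qed
 finally show ?thesis using True by (simp add: norm_mult)
next
 case False
 then show ?thesis by (simp add: pair_bound_def)
qed

text \<open>The square of the envelope is a sum of exponentials with positive rates 1/2, 1 and 3/2,
  which is integrable to the right of any t, and the second coordinate contributes a
  Gaussian.\<close>

lemma skern_dominated:
 "EX w. set_integrable lborel (right_of t) w & (\<forall>\<^sub>F a in at_top. ALL z:right_of t. Re (skern gramk a z z) <= w z)"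
proof -
 let ?B = "%s z m. samp s (fst z + m) (- snd z) * samp s (fst z + m) (snd z)"
 let ?A = "%z. (ind {t<..} (fst z) * exp (- (1/2) * fst z) + 2 * (ind {t<..} (fst z) * exp (- 1 * fst z)) + ind {t<..} (fst z) * exp (- (3/2) * fst z)) * exp (- (1/2) * (snd z - 0)^2)"
 define I where "I = (LBINT m::real. ind {0..} m * exp (- (1/2) * m))"
 define w where "w z = (LBINT m. pair_bound z z m)" for z
 have weq: "w z = amp_bound^2 * I * ((exp (- (1/2) * fst z) + 2 * exp (- 1 * fst z) + exp (- (3/2) * fst z)) * exp (- (1/2) * (snd z - 0)^2))" for z
 proof -
  have "envel x * envel x = exp (- (1/2) * x) + 2 * exp (- 1 * x) + exp (- (3/2) * x)" for x
  proof -
   have "envel x * envel x = exp (- (1/4) * x) * exp (- (1/4) * x) + 2 * (exp (- (1/4) * x) * exp (- (3/4) * x)) + exp (- (3/4) * x) * exp (- (3/4) * x)"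
    by (simp add: envel_def algebra_simps)
   then show ?thesis unfolding exp_add[symmetric] by (simp add: field_simps)
  qed
  then show ?thesis unfolding w_def pair_bound_def integral_mult_right_zero I_def[symmetric] by (simp add: mult_ac)
 qed
 have "set_integrable lborel (right_of t) w"
 proof -
  have tail: "hbi lborel (%x. ind {t<..} x * exp (- (1/2) * x) + 2 * (ind {t<..} x * exp (- 1 * x)) + ind {t<..} x * exp (- (3/2) * x))
   (exp (- (1/2) * t) / (1/2) + 2 * (exp (- 1 * t) / 1) + exp (- (3/2) * t) / (3/2))"
   by (intro has_bochner_integral_add hbi_mult has_bochner_integral_exp_tail) simp_all
  have g: "hbi lborel (%y::real. exp (- (1/2) * (y - 0)^2)) (sqrt (pi / (1/2)))" by (rule hbi_gauss) simp
  have "integrable (lborel :: plane measure) (%z. amp_bound^2 * I * (?A z))"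
   using has_bochner_integral_product[OF tail g] by (intro integrable_mult_right) (simp only: hbi_iff)
  also have "(%z :: plane. amp_bound^2 * I * (?A z)) = (%z. ind (right_of t) z *\<^sub>R w z)"
  proof
   fix z :: plane
   have "ind (right_of t) z = (ind {t<..} (fst z) :: real)" by (auto simp: right_of_def indicator_def mem_Times_iff)
   then show "amp_bound^2 * I * (?A z) = ind (right_of t) z *\<^sub>R w z" unfolding weq by (simp add: indicator_def)
  qed
  finally show ?thesis unfolding set_integrable_def .
 qed
 moreover have "\<forall>\<^sub>F a in at_top. ALL z:right_of t. Re (skern gramk a z z) <= w z"
  using eventually_samp_le
 proof eventually_elim
  case (elim s)
  show ?case
  proof
   fix z
   have m: "(%m. ind {0..} m *\<^sub>R (?B s z m)) : bmeas lborel" by measurable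
   have le: "norm (ind {0..} m *\<^sub>R (?B s z m)) <= pair_bound z z m" for m using elim by (intro scaled_pair_le) blast
   have i: "integrable lborel (%m. ind {0..} m *\<^sub>R (?B s z m))"
    by (rule integrable_le[OF integrable_pair_bound[of z z] m]) (intro AE_I2 order_trans[OF le], simp)
   have "Re (skern gramk s z z) <= norm (skern gramk s z z)" by (rule complex_Re_le_cmod)
   also have "... <= w z" unfolding scaled_gram[OF conjunct1[OF elim]] w_def
    by (rule Bochner_Integration.integral_norm_bound_integral[OF i integrable_pair_bound le])
   finally show "Re (skern gramk s z z) <= w z" .
  qed
 qed
 ultimately show ?thesis by blast
qed

definition twist :: "real => plane => plane => real" where
 "twist s z w = a_scale s * b_scale s / s * (snd w - snd z)"

definition limp :: "plane => plane => complex" where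
 "limp z w = of_real (lima (fst z) (snd z) * lima (fst w) (snd w))"

text \<open>The phases do not converge, but they have modulus 1. Once they are factored out, the
  error is at most the integral of the distance between the products of the cores and their limit,
  which tends to 0. What remains is the integral of exp(-m) times the rotation with frequency
  \<open>twist\<close>, which is explicit.\<close>

lemma skern_oscillatory:
 "((%a. skern gramk a z w - exp (\<i> * of_real (phase a (fst w) (snd w) - phase a (fst z) (snd z))) *
  (limp z w * (- 1 / (\<i> * (of_real (twist a z w) + \<i>))))) ---> 0) at_top"
proof -
 let ?D = "%a. \<i> * of_real (phase a (fst w) (snd w) - phase a (fst z) (snd z))"
 let ?C = "%H m G. %a. norm (H a m - G m)"
 let ?B = "%s. of_real (twist s z w) + \<i>"
 let ?A = "%a m. samp a (fst z + m) (- snd z) * samp a (fst w + m) (snd w)"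
 define H where "H a m = ind {0..} m *\<^sub>R (core a (fst z + m) (- snd z) * core a (fst w + m) (snd w))" for a m
 define G where "G m = ind {0..} m *\<^sub>R (cor (lima (fst z + m) (- snd z)) * of_real (lima (fst w + m) (snd w)))" for m :: real
 have Geq: "G m = limp z w * of_real (ind {0..} m * exp (- 1 * m))" for m
 proof -
  have "lima (fst z + m) (- snd z) * lima (fst w + m) (snd w) = lima (fst z) (snd z) * lima (fst w) (snd w) * exp (- 1 * m)"
   unfolding lima_prod mult.assoc exp_add[symmetric] by (simp add: field_simps)
  then show ?thesis unfolding G_def limp_def scaleR_conv_of_real of_real_mult[symmetric] by (simp add: mult_ac)
 qed
 have Gi: "integrable lborel G" unfolding Geq by (intro integrable_mult_right integrable_of_real int_exp_half) simp
 define U where "U a m = exp (\<i> * of_real (twist a z w * m))" for a m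
 have nU: "norm (U a m) = 1" for a m by (simp add: U_def)
 have mU: "U a : bmeas borel" for a unfolding U_def by measurable
 define t where "t a = exp (?D a)" for a
 have nt: "norm (t a) = 1" for a by (simp add: t_def)
 have factor: "ind {0..} m *\<^sub>R (?A a m) = t a * (U a m * H a m)" for a m
 proof -
  have s: "samp a x y = exp (\<i> * of_real (phase a x y)) * core a x y" for x y
   unfolding core_def mult.assoc[symmetric] exp_add[symmetric] by simp
  have "exp (\<i> * of_real (phase a (fst z + m) (- snd z))) * exp (\<i> * of_real (phase a (fst w + m) (snd w))) = t a * U a m"
  proof -
   define Q where "Q = a_scale a * b_scale a / a"
   show ?thesis unfolding t_def U_def exp_add[symmetric] phase_minus phase_add twist_def Q_def[symmetric] by (simp add: algebra_simps)
  qed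
  then have "samp a (fst z + m) (- snd z) * samp a (fst w + m) (snd w) = t a * U a m * (core a (fst z + m) (- snd z) * core a (fst w + m) (snd w))"
   unfolding s by (simp only: mult_ac)
  then show ?thesis by (simp add: H_def)
 qed
 have nH: "norm (H a m) = norm (ind {0..} m *\<^sub>R (?A a m))" for a m unfolding factor norm_mult nt nU by simp
 have mH: "H a : bmeas borel" for a
 proof -
  have "(%m. (inverse (t a) * inverse (U a m)) * (ind {0..} m *\<^sub>R (?A a m))) : bmeas borel"
   using mU[of a] by measurable
  moreover have "(inverse (t a) * inverse (U a m)) * (ind {0..} m *\<^sub>R (?A a m)) = H a m" for m
  proof -
   have "t a ~= 0" "U a m ~= 0" using nt[of a] nU[of a m] by auto
   then show ?thesis unfolding factor by (simp add: field_simps)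
  qed
  ultimately show ?thesis by simp
 qed
 have err: "((%a. LBINT m. norm (H a m - G m)) ---> (LBINT m::real. 0 :: real)) at_top"
 proof (rule integral_dominated_convergence_at_top[where w="%m. pair_bound z w m + norm (G m)"])
  show "integrable lborel (%m. pair_bound z w m + norm (G m))" using integrable_pair_bound Gi by simp
  have [measurable]: "H a : bmeas borel" "G : bmeas borel" for a using mH Gi by auto
  show "(%m. norm (H a m - G m)) : bmeas lborel" for a by measurable
  show "AE m in lborel. ((?C H m G) ---> 0) at_top"
  proof (rule AE_I2)
   fix m
   have "((%a. H a m) ---> G m) at_top" unfolding H_def G_def by (intro tendsto_intros core_tendsto)
   then have "((?C H m G) ---> norm (G m - G m)) at_top" by (intro tendsto_intros)
   then show "((?C H m G) ---> 0) at_top" by simp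
  qed
  show "\<forall>\<^sub>F a in at_top. AE m in lborel. norm (norm (H a m - G m)) <= pair_bound z w m + norm (G m)" using eventually_samp_le
  proof eventually_elim
   case (elim s)
   show ?case
   proof (rule AE_I2)
    fix m
    have "norm (H s m) <= pair_bound z w m" unfolding nH using elim by (intro scaled_pair_le) blast
    then show "norm (norm (H s m - G m)) <= pair_bound z w m + norm (G m)" using norm_triangle_ineq4[of "H s m" "G m"] by simp
   qed
  qed
 qed simp
 show ?thesis
 proof (rule Lim_null_comparison)
  show "((%a. LBINT m. norm (H a m - G m)) ---> 0) at_top" using err by simp
  show "\<forall>\<^sub>F a in at_top. norm (skern gramk a z w - exp (?D a) *
   (limp z w * (- 1 / (\<i> * (of_real (twist a z w) + \<i>))))) <= (LBINT m. norm (H a m - G m))" using eventually_samp_le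
  proof eventually_elim
   case (elim s)
   have mm[measurable]: "U s : bmeas borel" "H s : bmeas borel" "G : bmeas borel" using mU mH Gi by auto
   have Hi: "integrable lborel (H s)"
   proof (rule integrable_le[OF integrable_pair_bound[of z w]])
    show "AE m in lborel. norm (H s m) <= norm (pair_bound z w m)"
    proof (rule AE_I2)
     fix m
     have "norm (H s m) <= pair_bound z w m" unfolding nH using elim by (intro scaled_pair_le) blast
     then show "norm (H s m) <= norm (pair_bound z w m)" by simp
    qed
   qed simp
   have iU: "integrable lborel (%m. U s m * F m)" if F: "integrable lborel F" for F :: "real => complex"
   proof (rule integrable_le[OF F])
    have "F : bmeas borel" using F by auto
    then show "(%m. U s m * F m) : bmeas lborel" by measurable
   qed (simp add: norm_mult nU)
   have sk: "skern gramk s z w = t s * (LBINT m. U s m * H s m)"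
    unfolding scaled_gram[OF conjunct1[OF elim]] factor by (rule integral_mult_right_zero)
   have uG: "(LBINT m. U s m * G m) = limp z w * (- 1 / (\<i> * (?B s)))"
   proof -
    have "U s m * G m = limp z w * (ind {0..} m *\<^sub>R exp (\<i> * of_real m * (?B s)))" for m
    proof -
     have "exp (\<i> * cor m * (?B s)) = U s m * of_real (exp (- 1 * m))"
      unfolding U_def exp_of_real[symmetric] exp_add[symmetric] by (simp add: algebra_simps)
     then show ?thesis unfolding Geq by (simp add: scaleR_conv_of_real)
    qed
    then have "(LBINT m. U s m * G m) = limp z w * (LBINT m. ind {0..} m *\<^sub>R exp (\<i> * of_real m * (?B s)))"
     by (simp only: integral_mult_right_zero)
    then show ?thesis using has_integral_exp_half_line[of "of_real (twist s z w) + \<i>"] by (simp add: hbi_iff)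
   qed
   have "skern gramk s z w - t s * (limp z w * (- 1 / (\<i> * (?B s)))) = t s * (LBINT m. U s m * H s m - U s m * G m)"
    unfolding sk uG[symmetric] Bochner_Integration.integral_diff[OF iU[OF Hi] iU[OF Gi]] by (rule right_diff_distrib[symmetric])
   also have "norm ... <= (LBINT m. norm (H s m - G m))"
   proof -
    have "norm (t s * (LBINT m. U s m * H s m - U s m * G m)) = norm (LBINT m. U s m * H s m - U s m * G m)" by (simp add: norm_mult nt)
    also have "... <= (LBINT m. norm (U s m * H s m - U s m * G m))" by (rule integral_norm_bound)
    also have "... = (LBINT m. norm (H s m - G m))"
     by (intro integral_eq refl) (simp add: right_diff_distrib[symmetric] norm_mult nU)
    finally show ?thesis .
   qed
   finally show ?case unfolding t_def .
  qed
 qed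
qed

lemma limp_diag: "limp z z = of_real (pint z)"
 unfolding limp_def lima_prod poisson_intensity_def case_prod_beta by (simp add: field_simps)

lemma skern_diag: "((%s. skern gramk s z z) ---> of_real (pint z)) at_top"
proof -
 have "((%s. skern gramk s z z - limp z z) ---> 0) at_top"
  using skern_oscillatory[of z z] by (simp add: twist_def)
 then show ?thesis unfolding limp_diag by (simp add: LIM_zero_iff)
qed

text \<open>The explicit main term is at most \<open>limp\<close> divided by the frequency, and
  different second coordinates make the frequency tend to infinity.\<close>

lemma skern_off: assumes zw: "snd z ~= snd w" shows "((%a. skern gramk a z w) ---> 0) at_top"
proof -
 let ?B = "%s. of_real (twist s z w) + \<i>"
 let ?A = "%k. %a. norm (limp z w) / \<bar>k\<bar> * inverse (a_scale a * b_scale a / a)"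
 define E where "E a = exp (\<i> * of_real (phase a (fst w) (snd w) - phase a (fst z) (snd z))) *
  (limp z w * (- 1 / (\<i> * (of_real (twist a z w) + \<i>))))" for a
 define k where "k = snd w - snd z"
 have k: "k ~= 0" using zw by (simp add: k_def)
 have "(E ---> 0) at_top"
 proof (rule Lim_null_comparison)
  have "((?A k) ---> norm (limp z w) / \<bar>k\<bar> * 0) at_top"
   by (intro tendsto_intros tendsto_inverse_0_at_top oscillation_at_top)
  then show "((?A k) ---> 0) at_top" by simp
  show "\<forall>\<^sub>F a in at_top. norm (E a) <= norm (limp z w) / \<bar>k\<bar> * inverse (a_scale a * b_scale a / a)"
   using eventually_gt_at_top[of 1]
  proof eventually_elim
   case (elim s)
   define q where "q = a_scale s * b_scale s / s"
   have q: "q > 0" using scales_pos[OF elim] elim by (simp add: q_def)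
   have "\<bar>k\<bar> * q = \<bar>Re (?B s)\<bar>" unfolding twist_def q_def[symmetric] k_def[symmetric] using q by (simp add: abs_mult mult.commute)
   also have "... <= norm (?B s)" by (rule abs_Re_le_cmod)
   finally have kq: "\<bar>k\<bar> * q <= norm (?B s)" .
   have kq0: "0 < \<bar>k\<bar> * q" using k q by simp
   have "norm (limp z w) / norm (?B s) <= norm (limp z w) / (\<bar>k\<bar> * q)"
    by (intro divide_left_mono kq mult_pos_pos kq0 less_le_trans[OF kq0 kq]) simp
   also have "... = norm (limp z w) / \<bar>k\<bar> * inverse q" by (simp add: field_simps)
   finally show ?case unfolding q_def[symmetric] by (simp add: E_def norm_mult norm_divide)
  qed
 qed
 from tendsto_add[OF skern_oscillatory[of z w, folded E_def] this] show ?thesis by simp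
qed

section \<open>The Airy kernel at s = 0\<close>

text \<open>Turns out to be 2 pi times the k-th derivative of the Airy function: differentiating the
  wave in x brings down a factor i v. Height 1 makes all these integrals absolutely
  convergent.\<close>

definition airym :: "nat => real => complex" where
 "airym k x = (LBINT t. (\<i> * line 1 t)^k * wave 0 x 0 (line 1 t))"

lemma airym_0: "airym 0 x = ampl 0 x 0" by (simp add: airym_def ampl_def ampl_at_def)

text \<open>The power of the contour point is bounded by exp(k |t|), hence by a Gaussian growth
  exp(k^2/2 + t^2/2), which uses up half of the decay exp(-t^2) of the wave.\<close>

lemma moment_integrand_le:
 "norm (line 1 t ^ k * wave 0 x 0 (line 1 t)) <= exp (real k^2 / 2 + 1/3 - x) * exp (- (t^2) / 2)"
proof -
 have "norm (line 1 t) <= 1 + \<bar>t\<bar>" using norm_triangle_ineq[of "of_real t" "\<i> * of_real 1"] by (simp add: line_def norm_mult)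
 also have "... <= exp \<bar>t\<bar>" by (rule exp_ge_add_one_self)
 finally have "norm (line 1 t) ^ k <= exp \<bar>t\<bar> ^ k" by (intro power_mono) auto
 also have "... = exp (real k * \<bar>t\<bar>)" by (rule exp_of_nat_mult[symmetric])
 also have "... <= exp (real k^2 / 2 + t^2 / 2)"
 proof -
  have "0 <= (real k - \<bar>t\<bar>)^2" by simp
  then have "real k * \<bar>t\<bar> <= real k^2 / 2 + t^2 / 2" by (simp add: power2_diff)
  then show ?thesis by simp
 qed
 finally have "norm (line 1 t ^ k) <= exp (real k^2 / 2 + t^2 / 2)" by (simp add: norm_power)
 moreover have "norm (wave 0 x 0 (line 1 t)) = exp (- (t^2) + 1/3 - x)" unfolding norm_wave by simp
 ultimately have "norm (line 1 t ^ k * wave 0 x 0 (line 1 t)) <= exp (real k^2 / 2 + t^2 / 2) * exp (- (t^2) + 1/3 - x)"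
  unfolding norm_mult by (simp add: mult_right_mono)
 also have "... = exp (real k^2 / 2 + 1/3 - x) * exp (- (t^2) / 2)" unfolding exp_add[symmetric] by (simp add: field_simps)
 finally show ?thesis .
qed

lemma continuous_moment: "continuous_on UNIV (%t. line 1 t ^ k * wave 0 x 0 (line 1 t))"
 unfolding wave_def line_def by (intro continuous_intros)

lemma integrable_moment: "integrable lborel (%t. line 1 t ^ k * wave 0 x 0 (line 1 t))"
proof (rule integrable_le)
 show "integrable lborel (%t. exp (real k^2 / 2 + 1/3 - x) * exp (- (t^2) / 2))"
  using gaussian_integrable[of 1] by (intro integrable_mult_right) simp
 show "(%t. line 1 t ^ k * wave 0 x 0 (line 1 t)) : bmeas lborel"
  using borel_measurable_continuous_onI[OF continuous_moment] by simp
 show "AE t in lborel. norm (line 1 t ^ k * wave 0 x 0 (line 1 t)) <= norm (exp (real k^2 / 2 + 1/3 - x) * exp (- (t^2) / 2))"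
  using moment_integrand_le by (intro AE_I2) simp
qed

lemma integrable_airym: "integrable lborel (%t. (\<i> * line 1 t)^k * wave 0 x 0 (line 1 t))"
 using integrable_mult_right[OF integrable_moment[of k x], of "\<i>^k"] by (simp add: power_mult_distrib mult.assoc)

lemma norm_airym_le: "norm (airym k x) <= exp (real k^2 / 2 + 1/3) * sqrt (2 * pi) * exp (- x)"
proof -
 have "norm (airym k x) <= (LBINT t. exp (real k^2 / 2 + 1/3 - x) * exp (- (t^2) / 2))" unfolding airym_def
 proof (rule Bochner_Integration.integral_norm_bound_integral[OF integrable_airym])
  show "integrable lborel (%t. exp (real k^2 / 2 + 1/3 - x) * exp (- (t^2) / 2))"
   using gaussian_integrable[of 1] by (intro integrable_mult_right) simp
  show "norm ((\<i> * line 1 t)^k * wave 0 x 0 (line 1 t)) <= exp (real k^2 / 2 + 1/3 - x) * exp (- (t^2) / 2)" for t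
   using moment_integrand_le[of t k x] by (simp add: norm_mult norm_power)
 qed
 also have "... = exp (real k^2 / 2 + 1/3 - x) * sqrt (2 * pi)" unfolding integral_mult_right_zero integral_gaussian ..
 also have "exp (real k^2 / 2 + 1/3 - x) = exp (real k^2 / 2 + 1/3) * exp (- x)" unfolding exp_add[symmetric] by simp
 finally show ?thesis by (simp only: mult_ac)
qed

text \<open>Differentiation under the integral by the second-order Taylor remainder of the
  exponential; the moment of order k + 2 bounds the error by a multiple of h^2.\<close>

lemma has_derivative_airym: "(airym k has_vector_derivative airym (Suc k) x) (at x)"
proof -
 let ?D = "%t. (\<i> * line 1 t)^Suc k * wave 0 x 0 (line 1 t)"
 let ?B = "%t. line 1 t ^ (k + 2) * wave 0 x 0 (line 1 t)"
 let ?A = "%h. airym k (x + h) - airym k x - h *\<^sub>R airym (Suc k) x"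
 define C where "C = exp 1 * (LBINT t. norm (?B t))"
 have C0: "0 <= C" by (simp add: C_def)
 have est: "norm (?A h) <= C * h^2" if h: "\<bar>h\<bar> <= 1" for h
 proof -
  let ?f = "%t. (\<i> * line 1 t)^k * wave 0 x 0 (line 1 t) * (exp (\<i> * of_real h * line 1 t) - (1 + \<i> * of_real h * line 1 t))"
  have i1: "integrable lborel (%t. (\<i> * line 1 t)^k * wave 0 (x + h) 0 (line 1 t) - (\<i> * line 1 t)^k * wave 0 x 0 (line 1 t) - h *\<^sub>R (?D t))"
   by (intro Bochner_Integration.integrable_diff integrable_scaleR_right integrable_airym)
  have feq: "(\<i> * line 1 t)^k * wave 0 (x + h) 0 (line 1 t) - (\<i> * line 1 t)^k * wave 0 x 0 (line 1 t) - h *\<^sub>R (?D t) = ?f t" for t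
   unfolding wave_shift[symmetric] scaleR_conv_of_real by (simp add: algebra_simps)
  have e: "airym k (x + h) - airym k x - h *\<^sub>R airym (Suc k) x = (LBINT t. (\<i> * line 1 t)^k * wave 0 (x + h) 0 (line 1 t) - (\<i> * line 1 t)^k * wave 0 x 0 (line 1 t) - h *\<^sub>R (?D t))"
   unfolding airym_def
   by (subst Bochner_Integration.integral_diff, (intro Bochner_Integration.integrable_diff integrable_scaleR_right integrable_airym)+,
     subst Bochner_Integration.integral_diff, (intro integrable_airym)+, simp)
  have "norm (?A h) <= (LBINT t. exp 1 * h^2 * norm (?B t))" unfolding e
  proof (rule Bochner_Integration.integral_norm_bound_integral[OF i1])
   show "integrable lborel (%t. exp 1 * h^2 * norm (?B t))" by (intro integrable_mult_right integrable_norm integrable_moment)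
   fix t
   let ?z = "\<i> * of_real h * line 1 t"
   \<comment> \<open>On the line at height 1 the real part of \<open>?z\<close> is -h, so the
     exponential in the remainder is at most e for |h| at most 1.\<close>
   have "norm (exp ?z - (SUM j<=1. ?z ^ j / fact j)) <= exp \<bar>Re ?z\<bar> * (norm ?z) ^ Suc 1 / fact 1" by (rule Taylor_exp)
   then have "norm (exp ?z - (1 + ?z)) <= exp \<bar>h\<bar> * (norm ?z)^2" by (simp add: line_def power2_eq_square)
   also have "... <= exp 1 * (norm ?z)^2" using h by (intro mult_right_mono) auto
   also have "(norm ?z)^2 = h^2 * (norm (line 1 t))^2" by (simp add: norm_mult power_mult_distrib)
   finally have ez: "norm (exp ?z - (1 + ?z)) <= exp 1 * (h^2 * (norm (line 1 t))^2)" .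
   have "norm (?f t) = norm (line 1 t) ^ k * norm (wave 0 x 0 (line 1 t)) * norm (exp ?z - (1 + ?z))" by (simp add: norm_mult norm_power)
   also have "... <= norm (line 1 t) ^ k * norm (wave 0 x 0 (line 1 t)) * (exp 1 * (h^2 * (norm (line 1 t))^2))"
    by (intro mult_left_mono ez) simp
   also have "... = exp 1 * h^2 * norm (?B t)" by (simp add: norm_mult norm_power power_add power2_eq_square mult_ac)
   finally show "norm ((\<i> * line 1 t)^k * wave 0 (x + h) 0 (line 1 t) - (\<i> * line 1 t)^k * wave 0 x 0 (line 1 t) - h *\<^sub>R (?D t)) <= exp 1 * h^2 * norm (?B t)"
    unfolding feq .
  qed
  also have "... = exp 1 * h^2 * (LBINT t. norm (?B t))" by (rule integral_mult_right_zero)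
  also have "... = C * h^2" unfolding C_def by (simp only: mult_ac)
  finally show ?thesis .
 qed
 show ?thesis unfolding has_vector_derivative_def has_derivative_at
 proof
  show "bounded_linear (%h. h *\<^sub>R airym (Suc k) x)" by (rule bounded_linear_scaleR_left)
  show "((%h. norm (?A h) / norm h) ---> 0) (at 0)"
  proof (rule Lim_null_comparison)
   have "((%h. C * \<bar>h\<bar>) ---> C * \<bar>0\<bar>) (at 0)" by (intro tendsto_intros)
   then show "((%h. C * \<bar>h\<bar>) ---> 0) (at (0::real))" by simp
   have "\<forall>\<^sub>F h in at (0::real). \<bar>h\<bar> < 1 & h ~= 0"
    unfolding eventually_at by (intro exI[of _ 1]) (auto simp: dist_norm)
   then show "\<forall>\<^sub>F h in at 0. norm (norm (?A h) / norm h) <= C * \<bar>h\<bar>"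
   proof eventually_elim
    case (elim h)
    have "norm (?A h) / \<bar>h\<bar> <= C * h^2 / \<bar>h\<bar>" using elim by (intro divide_right_mono est) auto
    also have "... = C * \<bar>h\<bar>"
    proof -
     have "C * r^2 / r = C * r" if "r ~= 0" for r using that by (simp add: power2_eq_square)
     from this[of "\<bar>h\<bar>"] show ?thesis using elim by simp
    qed
    finally show ?case by simp
   qed
  qed
 qed
qed

text \<open>Airy's equation: the derivative of the wave along the contour is i (v^2 + x) times the
  wave, and its integral is 0 because the wave vanishes at both ends.\<close>

lemma airy_ode: "airym 2 x = of_real x * airym 0 x"
proof -
 let ?w = "%t. wave 0 x 0 (line 1 t)"
 define f where "f t = \<i> * (line 1 t ^ 2 * ?w t) + \<i> * of_real x * (line 1 t ^ 0 * ?w t)" for t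
 have fi: "integrable lborel f" unfolding f_def by (intro Bochner_Integration.integrable_add integrable_mult_right integrable_moment)
 have fc: "continuous_on UNIV f" unfolding f_def by (intro continuous_on_add continuous_on_mult_left continuous_moment)
 have der: "(?w has_vector_derivative f t) (at t within S)" for t S
 proof -
  have l: "(line 1 has_vector_derivative 1) (at t within S)"
   unfolding line_def by (auto intro!: derivative_eq_intros simp: has_vector_derivative_def scaleR_conv_of_real)
  have "(wave 0 x 0 has_field_derivative (\<i> * v^2 + \<i> * of_real x) * wave 0 x 0 v) (at v)" for v
   unfolding wave_def by (auto intro!: derivative_eq_intros simp: power2_eq_square algebra_simps)
  from field_vector_diff_chain_within[OF l has_field_derivative_at_within[OF this]]
  show ?thesis by (simp add: o_def f_def algebra_simps)
 qed
 have "((%T. integral {-T..T} f) ---> (LBINT t. f t)) at_top" by (rule integral_window_tendsto[OF fi fc])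
 moreover have "((%T. integral {-T..T} f) ---> 0) at_top"
 proof (rule Lim_null_comparison)
  show "((%T::real. 2 * exp (1/3 - x) * exp (- (T^2))) ---> 0) at_top" by real_asymp
  show "\<forall>\<^sub>F T in at_top. norm (integral {-T..T} f) <= 2 * exp (1/3 - x) * exp (- (T^2))" using eventually_ge_at_top[of 0]
  proof eventually_elim
   case (elim T)
   have "integral {-T..T} f = ?w T - ?w (- T)" using elim by (intro integral_unique fundamental_theorem_of_calculus der) simp
   moreover have "norm (?w T - ?w (- T)) <= norm (?w T) + norm (?w (- T))" by (rule norm_triangle_ineq4)
   moreover have "norm (?w s) = exp (1/3 - x) * exp (- (s^2))" for s unfolding norm_wave exp_add[symmetric] by simp
   ultimately show ?case by (simp add: mult_ac)
  qed
 qed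
 ultimately have "(LBINT t. f t) = 0" by (rule tendsto_unique[rotated]) simp
 moreover have "(LBINT t. f t) = - \<i> * airym 2 x + \<i> * of_real x * airym 0 x"
 proof -
  have "(LBINT t. f t) = \<i> * (LBINT t. line 1 t ^ 2 * ?w t) + \<i> * of_real x * (LBINT t. line 1 t ^ 0 * ?w t)" unfolding f_def
   by (subst Bochner_Integration.integral_add) (auto intro!: integrable_mult_right integrable_moment simp del: power_0)
  moreover have "airym 2 x = - (LBINT t. line 1 t ^ 2 * ?w t)" unfolding airym_def power_mult_distrib by simp
  ultimately show ?thesis by (simp add: airym_def)
 qed
 ultimately have "\<i> * airym 2 x = \<i> * (of_real x * airym 0 x)" by (simp add: mult.assoc)
 then show ?thesis by simp
qed

lemma ampl_0: "ampl 0 x y = of_real (exp (- (y^2) / 2)) * airym 0 x"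
proof -
 have "wave 0 x y v = of_real (exp (- (y^2) / 2)) * wave 0 x 0 v" for v
  unfolding wave_def exp_of_real[symmetric] exp_add[symmetric] by (simp add: algebra_simps)
 then have "ampl 0 x y = (LBINT t. of_real (exp (- (y^2) / 2)) * wave 0 x 0 (line 1 t))" unfolding ampl_def ampl_at_def by simp
 then show ?thesis unfolding airym_0 ampl_def ampl_at_def by (simp only: integral_mult_right_zero)
qed

lemma airym_real: "Im (airym 0 x) = 0" "Im (airym 1 x) = 0"
proof -
 have r: "Im (airym 0 x) = 0" for x
 proof -
  have "cnj (airym 0 x) = airym 0 x" unfolding airym_0 by (simp add: cnj_ampl)
  then show ?thesis by (metis cnj.simps(2) equal_neg_zero)
 qed
 show "Im (airym 0 x) = 0" by (rule r)
 have "((%x. Im (airym 0 x)) has_vector_derivative Im (airym (Suc 0) x)) (at x)"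
  by (rule bounded_linear.has_vector_derivative[OF bounded_linear_Im has_derivative_airym])
 then have "((%x. 0 :: real) has_vector_derivative Im (airym (Suc 0) x)) (at x)" unfolding r .
 then show "Im (airym 1 x) = 0"
  using vector_derivative_unique_at[OF _ has_vector_derivative_const, of "0::real" "Im (airym (Suc 0) x)" x] by simp
qed

lemma airym_of_real: "airym 0 x = of_real (Re (airym 0 x))" "airym 1 x = of_real (Re (airym 1 x))"
 using airym_real by (simp_all add: complex_eq_iff)

text \<open>Lowering the contour to height 0 leads to the improper integral; there the real part of
  the wave is an even cosine, so the symmetric range gives twice the half range.\<close>

lemma Airy_eq: "Airy x = Re (airym 0 x) / (2 * pi)"
proof -
 let ?A = "%t. wave 0 x 0 (line 0 t)"
 let ?c = "%t::real. cos (t^3 / 3 + x * t)"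
 have cc: "continuous_on S ?c" for S by (intro continuous_intros) simp
 have w: "wave 0 x 0 (line 0 t) = exp (\<i> * of_real (t^3 / 3 + x * t))" for t unfolding wave_def line_def by (simp add: algebra_simps)
 have "((%T. integral {-T..T} ?A) ---> ampl_at 1 0 x 0) at_top" by (rule contour_limit) simp_all
 then have "((%T. Re (integral {-T..T} ?A)) ---> Re (airym 0 x)) at_top"
  unfolding airym_0 ampl_def by (rule tendsto_Re)
 moreover have "\<forall>\<^sub>F T in at_top. Re (integral {-T..T} ?A) = 2 * integral {0..T} ?c" using eventually_ge_at_top[of 0]
 proof eventually_elim
  case (elim T)
  have wi: "?A integrable_on {-T..T}" by (rule integrable_continuous_real) (rule continuous_on_subset[OF continuous_wave], simp)
  have "Re (integral {-T..T} ?A) = integral {-T..T} (%t. Re (wave 0 x 0 (line 0 t)))"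
   using integral_linear[OF wi bounded_linear_Re] by (simp add: o_def)
  also have "... = integral {-T..T} ?c" by (simp add: w Re_exp)
  also have "... = integral {-T..0} ?c + integral {0..T} ?c"
   using elim by (intro Henstock_Kurzweil_Integration.integral_combine[symmetric] integrable_continuous_real cc) auto
  also have "integral {-T..0} ?c = integral {0..T} (%t. ?c (- t))"
   using Henstock_Kurzweil_Integration.integral_reflect_real[of T 0 "%t. ?c (- t)"] by (simp del: integral_reflect_real)
  also have "(%t. ?c (- t)) = ?c"
  proof
   fix t
   have "(- t)^3 / 3 + x * (- t) = - (t^3 / 3 + x * t)" by (simp add: power3_eq_cube)
   then show "?c (- t) = ?c t" by (simp only: cos_minus)
  qed
  finally show ?case by simp
 qed
 ultimately have "((%T. 2 * integral {0..T} ?c) ---> Re (airym 0 x)) at_top" by (simp add: tendsto_cong)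
 from tendsto_mult_left[OF this, of "1/2"] have "((%T. integral {0..T} ?c) ---> Re (airym 0 x) / 2) at_top" by simp
 then have l: "Lim at_top (%T. integral {0..T} ?c) = Re (airym 0 x) / 2" by (intro tendsto_Lim) simp_all
 show ?thesis unfolding Airy_def l by simp
qed

lemma deriv_Airy: "deriv Airy x = Re (airym 1 x) / (2 * pi)"
proof -
 have "((%x. Re (airym 0 x)) has_vector_derivative Re (airym (Suc 0) x)) (at x)"
  by (rule bounded_linear.has_vector_derivative[OF bounded_linear_Re has_derivative_airym])
 then have "((%x. Re (airym 0 x)) has_real_derivative Re (airym 1 x)) (at x)"
  by (simp add: has_real_derivative_iff_has_vector_derivative)
 from DERIV_cdivide[OF this, of "2 * pi"] have "(Airy has_real_derivative Re (airym 1 x) / (2 * pi)) (at x)" by (simp add: Airy_eq[abs_def])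
 then show ?thesis by (rule DERIV_imp_deriv)
qed

definition airy_gram :: "real => real => complex" where
 "airy_gram x y = (LBINT l. ind {0..} l *\<^sub>R (airym 0 (x + l) * airym 0 (y + l)))"

text \<open>The integrand is the derivative in l of the Wronskian of the two shifted functions,
  divided by y - x: by Airy's equation the second derivatives contribute (y + l) - (x + l), in which
  l cancels. At infinity the Wronskian vanishes.\<close>

lemma airy_gram_off: assumes "x ~= y"
 shows "airy_gram x y = (airym 0 x * airym 1 y - airym 1 x * airym 0 y) / of_real (x - y)"
proof -
 let ?B = "%l. airym 1 (x + l) * airym 1 (y + l) + airym 2 (x + l) * airym 0 (y + l)"
 let ?A = "%l. airym 0 (x + l) * airym 2 (y + l) + airym 1 (x + l) * airym 1 (y + l)"
 define F where "F l = (airym 0 (x + l) * airym 1 (y + l) - airym 1 (x + l) * airym 0 (y + l)) / of_real (y - x)" for l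
 have d: "((%l. airym k (a + l)) has_vector_derivative airym (Suc k) (a + l)) (at l)" for k a l
 proof -
  have "((%l. a + l) has_real_derivative 1) (at l)" by (auto intro!: derivative_eq_intros)
  from vector_diff_chain_at[OF this[unfolded has_real_derivative_iff_has_vector_derivative] has_derivative_airym[of k "a + l"]]
  show ?thesis by (simp add: o_def)
 qed
 have "airy_gram x y = 0 - F 0" unfolding airy_gram_def
 proof (rule half_line_FTC)
  show "integrable lborel (%l. ind {0..} l *\<^sub>R (airym 0 (x + l) * airym 0 (y + l)))"
   using gram_integrable[of 0 x 0 y 0] by (simp add: airym_0)
  have c: "continuous_on UNIV (%l. airym 0 (a + l))" for a
   by (intro continuous_at_imp_continuous_on ballI has_vector_derivative_continuous[OF d])
  show "continuous_on UNIV (%l. airym 0 (x + l) * airym 0 (y + l))" by (intro continuous_on_mult c)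
  show "(F has_vector_derivative airym 0 (x + l) * airym 0 (y + l)) (at l)" for l
  proof -
   have "((%l. airym 0 (x + l) * airym 1 (y + l) - airym 1 (x + l) * airym 0 (y + l)) has_vector_derivative
    (?A l) - (?B l)) (at l)" using d[of 0] d[of 1] by (intro has_vector_derivative_diff has_vector_derivative_mult) (simp_all add: numeral_2_eq_2)
   also have "(?A l) - (?B l) = airym 0 (x + l) * airym 0 (y + l) * of_real (y - x)" unfolding airy_ode by (simp add: algebra_simps)
   finally have "(F has_vector_derivative airym 0 (x + l) * airym 0 (y + l) * of_real (y - x) / of_real (y - x)) (at l)"
    unfolding F_def by (rule has_vector_derivative_divide)
   then show ?thesis using assms by simp
  qed
  show "(F ---> 0) at_top"
  proof -
   have z: "((%l. airym k (a + l)) ---> 0) at_top" for k a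
   proof (rule Lim_null_comparison)
    show "\<forall>\<^sub>F l in at_top. norm (airym k (a + l)) <= exp (real k^2 / 2 + 1/3) * sqrt (2 * pi) * exp (- (a + l))"
     by (intro always_eventually allI norm_airym_le)
    have "((%l::real. exp (- (a + l))) ---> 0) at_top" by real_asymp
    then show "((%l. exp (real k^2 / 2 + 1/3) * sqrt (2 * pi) * exp (- (a + l))) ---> 0) at_top" by (rule tendsto_mult_right_zero)
   qed
   have "(F ---> (0 * 0 - 0 * 0) / of_real (y - x)) at_top" unfolding F_def using assms by (intro tendsto_intros z) simp
   then show ?thesis by simp
  qed
 qed
 also have "0 - F 0 = (airym 0 x * airym 1 y - airym 1 x * airym 0 y) / of_real (x - y)"
  using assms by (simp add: F_def field_simps)
 finally show ?thesis .
qed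

lemma airy_gram_tendsto:
 fixes X Y :: "nat => real" assumes X: "X ----> x" and Y: "Y ----> y"
 shows "(%n. airy_gram (X n) (Y n)) ----> airy_gram x y"
proof -
 let ?E = "%n l. airym 0 (X n + l) * airym 0 (Y n + l)"
 let ?A = "%l. ind {0..} l * exp (- 2 * l)"
 obtain B where B: "!!n. \<bar>X n\<bar> <= B" using convergent_imp_Bseq[OF convergentI[OF X]] by (auto simp: Bseq_def)
 obtain D where D: "!!n. \<bar>Y n\<bar> <= D" using convergent_imp_Bseq[OF convergentI[OF Y]] by (auto simp: Bseq_def)
 define C where "C = exp (real 0^2 / 2 + 1/3) * sqrt (2 * pi)"
 have C0: "0 <= C" by (simp add: C_def)
 have m: "norm (airym 0 (a + l)) <= C * exp b * exp (- l)" if "\<bar>a\<bar> <= b" for a b l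
 proof -
  have "norm (airym 0 (a + l)) <= C * exp (- (a + l))" unfolding C_def by (rule norm_airym_le)
  also have "... <= C * exp (b - l)" using that C0 by (intro mult_left_mono) auto
  also have "exp (b - l) = exp b * exp (- l)" unfolding exp_add[symmetric] by simp
  finally show ?thesis by (simp only: mult.assoc)
 qed
 have mm: "(%l. ind {0..} l *\<^sub>R (airym 0 (a + l) * airym 0 (b + l))) : bmeas lborel" for a b
  unfolding airym_0 by measurable
 show ?thesis unfolding airy_gram_def
 proof (rule integral_dominated_convergence[where w="%l. C * exp B * (C * exp D) * (?A l)", OF mm mm])
  show "integrable lborel (%l. C * exp B * (C * exp D) * (?A l))" by (intro integrable_mult_right int_exp_half) simp
  show "AE l in lborel. (%n. ind {0..} l *\<^sub>R (?E n l)) ----> ind {0..} l *\<^sub>R (airym 0 (x + l) * airym 0 (y + l))"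
   unfolding airym_0 by (intro AE_I2 tendsto_intros ampl_tendsto X Y)
  show "AE l in lborel. norm (ind {0..} l *\<^sub>R (?E n l)) <= C * exp B * (C * exp D) * (?A l)" for n
  proof (rule AE_I2)
   fix l
   have "norm (airym 0 (X n + l)) * norm (airym 0 (Y n + l)) <= (C * exp B * exp (- l)) * (C * exp D * exp (- l))"
    by (intro mult_mono m B D) (auto simp: C0)
   also have "... = C * exp B * (C * exp D) * (exp (- l) * exp (- l))" by (simp only: mult_ac)
   also have "exp (- l) * exp (- l) = exp (- 2 * l)" unfolding exp_add[symmetric] by simp
   finally show "norm (ind {0..} l *\<^sub>R (?E n l)) <= C * exp B * (C * exp D) * (?A l)" by (simp add: indicator_def norm_mult)
  qed
 qed
qed

lemma Airy_quotient_gram: assumes "x ~= y" shows "Airy_quotient (x, y) = Re (airy_gram x y) / (4 * pi^2)"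
proof -
 define a b c d where "a = Re (airym 0 x)" and "b = Re (airym 1 x)" and "c = Re (airym 0 y)" and "d = Re (airym 1 y)"
 have m: "airym 0 x = of_real a" "airym 1 x = of_real b" "airym 0 y = of_real c" "airym 1 y = of_real d"
  unfolding a_def b_def c_def d_def by (rule airym_of_real)+
 have "airy_gram x y = of_real ((a * d - b * c) / (x - y))" unfolding airy_gram_off[OF assms] m by simp
 then have r: "Re (airy_gram x y) = (a * d - b * c) / (x - y)" by simp
 have "x - y ~= 0" using assms by simp
 then show ?thesis unfolding Airy_quotient_def case_prod_conv Airy_eq deriv_Airy r a_def[symmetric] b_def[symmetric] c_def[symmetric] d_def[symmetric]
  by (simp add: power2_eq_square diff_divide_distrib mult_ac)
qed

lemma airy_gram_real: "Im (airy_gram x y) = 0"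
proof -
 have "ind {0..} l *\<^sub>R (airym 0 (x + l) * airym 0 (y + l)) = cor (ind {0..} l * (Re (airym 0 (x + l)) * Re (airym 0 (y + l))))" for l
  using airym_real(1) by (simp add: complex_eq_iff)
 then show ?thesis unfolding airy_gram_def by (simp only: integral_complex_of_real Im_complex_of_real)
qed

text \<open>On the diagonal the kernel is defined as a limit of the quotient along distinct pairs.
  There the quotient equals the Gram integral, which is continuous, so the limit is its value on the
  diagonal.\<close>

lemma Airy_kernel_gram: "Airy_kernel x y = Re (airy_gram x y) / (4 * pi^2)"
proof (cases "x = y")
 case False
 then show ?thesis by (simp add: Airy_kernel_def Airy_quotient_gram)
next
 case True
 let ?F = "at (x, y) within {p :: real \<times> real. fst p ~= snd p}"
 have "(Airy_quotient ---> Re (airy_gram x y) / (4 * pi^2)) ?F" unfolding tendsto_at_iff_sequentially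
 proof (intro allI impI)
  fix p :: "nat => real \<times> real"
  assume p: "ALL i. p i : {p. fst p ~= snd p} - {(x, y)}" and l: "p ----> (x, y)"
  have "(%n. Re (airy_gram (fst (p n)) (snd (p n))) / (4 * pi^2)) ----> Re (airy_gram x y) / (4 * pi^2)"
   using tendsto_fst[OF l] tendsto_snd[OF l] by (intro tendsto_divide tendsto_Re airy_gram_tendsto tendsto_const) auto
  moreover have "Airy_quotient (p n) = Re (airy_gram (fst (p n)) (snd (p n))) / (4 * pi^2)" for n
   using Airy_quotient_gram[of "fst (p n)" "snd (p n)"] p by auto
  ultimately show "(Airy_quotient \<circ> p) ----> Re (airy_gram x y) / (4 * pi^2)" by (simp add: o_def)
 qed
 \<comment> \<open>Without distinct pairs arbitrarily close to the diagonal point the value of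
   \<open>Lim\<close> would not be determined.\<close>
 moreover have "~ trivial_limit ?F" unfolding trivial_limit_within not_not islimpt_approachable
 proof (intro allI impI)
  fix e :: real assume e: "e > 0"
  show "EX q:{p. fst p ~= snd p}. q ~= (x, y) & dist q (x, y) < e"
   by (rule bexI[of _ "(x + e / 2, y)"]) (use e True in \<open>auto simp: dist_Pair_Pair dist_norm\<close>)
 qed
 ultimately show ?thesis using True by (simp add: Airy_kernel_def tendsto_Lim)
qed

text \<open>Each amplitude carries 2 pi times an Airy function and half of the Gaussian; the
  remaining constant 4 pi^2 \<open>kconst\<close> is pi^(-1/2).\<close>

theorem gramk_Airy: "gramk 0 = M_Airy"
proof (intro ext)
 let ?A = "%z w. exp (- ((snd z)^2) / 2) * exp (- ((snd w)^2) / 2)"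
 fix z w :: plane
 have "gramk 0 z w = of_real kconst * (LBINT l. of_real (?A z w) * (ind {0..} l *\<^sub>R (airym 0 (fst z + l) * airym 0 (fst w + l))))"
  unfolding gramk_def ampl_0 by (simp add: mult_ac)
 also have "... = of_real kconst * (of_real (?A z w) * airy_gram (fst z) (fst w))" unfolding airy_gram_def integral_mult_right_zero ..
 also have "airy_gram (fst z) (fst w) = of_real (4 * pi^2 * Airy_kernel (fst z) (fst w))"
  using airy_gram_real[of "fst z" "fst w"] by (simp add: Airy_kernel_gram complex_eq_iff)
 also have "of_real kconst * (of_real (?A z w) * of_real (4 * pi^2 * Airy_kernel (fst z) (fst w))) =
  cor ((kconst * (4 * pi^2)) * (?A z w) * Airy_kernel (fst z) (fst w))" unfolding of_real_mult[symmetric] by (simp only: mult_ac)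
 also have "kconst * (4 * pi^2) = pi powr (-1/2)"
 proof -
  have "pi powr (-1/2) * pi powr (5/2) = pi^2" unfolding powr_add[symmetric] by simp
  then have "4 * pi powr (5/2) * pi powr (-1/2) = 4 * pi^2" by (simp add: mult.commute)
  moreover have "pi powr (5/2) > 0" by simp
  ultimately show ?thesis unfolding kconst_def by (simp add: field_simps)
 qed
 also have "exp (- ((snd z)^2) / 2) * exp (- ((snd w)^2) / 2) = exp (- (1/2) * ((snd z)^2 + (snd w)^2))"
  unfolding exp_add[symmetric] by (simp add: field_simps)
 finally show "gramk 0 z w = M_Airy z w" unfolding M_Airy_def case_prod_beta .
qed

theorem theorem2p3:
  fixes \<delta>\<^sub>1 \<delta>\<^sub>2 :: real
  assumes "\<delta>\<^sub>1 > 0" and "\<delta>\<^sub>2 > 0"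
  shows
    "(\<forall>\<sigma>\<ge>0. \<forall>\<zeta>\<^sub>1 \<zeta>\<^sub>2.
        integrable (lborel \<Otimes>\<^sub>M lborel)
          (\<lambda>(s, t). M_integrand \<sigma> \<zeta>\<^sub>1 \<zeta>\<^sub>2 (line \<delta>\<^sub>2 t) (line \<delta>\<^sub>1 s)) \<and>
        (\<forall>d\<^sub>1>0. \<forall>d\<^sub>2>0. M_kernel d\<^sub>1 d\<^sub>2 \<sigma> \<zeta>\<^sub>1 \<zeta>\<^sub>2 = M_kernel \<delta>\<^sub>1 \<delta>\<^sub>2 \<sigma> \<zeta>\<^sub>1 \<zeta>\<^sub>2)) \<and>
     (\<forall>\<sigma>\<ge>0. \<exists>(P :: plane set measure) Z. determinantal P Z (M_kernel \<delta>\<^sub>1 \<delta>\<^sub>2 \<sigma>)) \<and>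
     (\<forall>(P :: real \<Rightarrow> 'a measure) Z.
        (\<forall>\<sigma>\<ge>0. determinantal (P \<sigma>) (Z \<sigma>) (M_kernel \<delta>\<^sub>1 \<delta>\<^sub>2 \<sigma>)) \<longrightarrow>
          determinantal (P 0) (Z 0) M_Airy \<and>
          (\<forall>(Q :: 'b measure) Z_A. determinantal Q Z_A M_Airy \<longrightarrow> same_law (P 0) (Z 0) Q Z_A) \<and>
          (\<forall>(Q :: 'c measure) Z_P. poisson_process Q Z_P pint \<longrightarrow>
             converges_weakly P (\<lambda>\<sigma> \<omega>. rescale \<sigma> (Z \<sigma> \<omega>)) at_top Q Z_P) \<and>
          (\<forall>\<sigma>\<ge>0.
             has_last_particle (P \<sigma>) (Z \<sigma>) \<and>
             (\<forall>t. of_real (last_particle_cdf (P \<sigma>) (Z \<sigma>) t)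
                    = fredholm_det (right_of t) (M_kernel \<delta>\<^sub>1 \<delta>\<^sub>2 \<sigma>) \<and>
                  (\<forall>r. set_integrable (lborel_pow r) ({..<r} \<rightarrow>\<^sub>E right_of t)
                         (kernel_det (M_kernel \<delta>\<^sub>1 \<delta>\<^sub>2 \<sigma>) r)) \<and>
                  fredholm_term (right_of t) (M_kernel \<delta>\<^sub>1 \<delta>\<^sub>2 \<sigma>)
                    sums of_real (last_particle_cdf (P \<sigma>) (Z \<sigma>) t))) \<and>
          (\<forall>t. ((\<lambda>\<sigma>. last_particle_cdf (P \<sigma>) (Z \<sigma>) (c_shift \<sigma> + a_scale \<sigma> * t))
                  \<longlongrightarrow> gumbel_cdf t) at_top))"
proof -
 \<comment> \<open>The Gram form contains no contour heights, so this identity proves independence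
   of the heights and reduces all claims to \<open>gramk\<close>.\<close>
 have K: "M_kernel \<delta>\<^sub>1 \<delta>\<^sub>2 = gramk" by (intro ext M_kernel_gram(2) assms)
 note G = psd_gram gram_loc
 note H = G right_of_borel gram_right_of
 note R = G gram_right_of skern_diag skern_off skern_dominated
 show ?thesis unfolding K
 proof (intro conjI allI impI, goal_cases)
  case (1 s x y)
  then show ?case using assms by (simp add: M_kernel_gram)
 next
  case (2 s x y a b)
  then show ?case by (simp add: M_kernel_gram)
 next
  case (3 s)
  then show ?case using janossy_kernel.determinantal_point_law[OF janossy_kernel_gram] by blast
 next
  case (4 P Z)
  then show ?case by (metis gramk_Airy order_refl)
 next
  case (5 P Z Q Y)
  then have "determinantal (P 0) (Z 0) M_Airy" by (metis gramk_Airy order_refl)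
  then show ?case by (rule determinantal_same_law[OF _ 5(2)])
    (use psd_gram[of 0] gram_loc[of _ 0] in \<open>auto simp: gramk_Airy\<close>)
 next
  case (6 P Z Q Y)
  then show ?case by (intro rescaled_poisson[OF _ R]) auto
 next
  case (7 P Z s)
  then show ?case unfolding has_last_particle_def by (intro exI nn_integral_npts[OF _ H]) auto
 next
  case (8 P Z s t)
  then show ?case unfolding fredholm_det_def last_particle_cdf_def by (intro sums_unique void_probability[OF _ H]) auto
 next
  case (9 P Z s t r)
  then show ?case by (intro set_integrable_kernel_det[OF _ H]) auto
 next
  case (10 P Z s t)
  then show ?case unfolding last_particle_cdf_def by (intro void_probability[OF _ H]) auto
 next
  case (11 P Z t)
  then show ?case by (intro rescaled_last_particle[OF _ R]) auto
 qed
qed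

end
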